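(* Let $L_+$, $L_-$ and $L_0$ be three long w-links which are identical except in a neighborhood of a crossing, where $L_+$ has a positive crossing, $L_-$ has a negative crossing, and $L_0$ has the oriented smoothing of the crossing. Then $$\Delta_{L_+}(t)-\Delta_{L_-}(t)=(t^{-1/2}-t^{1/2})\,\Delta_{L_0}(t).$$
   Context: W-tangles. A w-tangle diagram labelled by a finite set $Y$ is a finite collection of oriented arcs (no closed components), bijectively labelled by $Y$, drawn in the plane with finitely many transverse double points, each virtual, positive or negative, up to planar isotopy, the position of endpoints being immaterial. A w-tangle is an equivalence class modulo R2, R3, the purely virtual moves VR1–VR3, the mixed moves M (arcs having only virtual crossings may be moved across real crossings), and OC (two consecutive overpasses of an arc may be exchanged); R1 is not imposed. Operations: $m^{x,y}_z$ connects the head of strand $x$ to the tail of strand $y$ (creating only virtual crossings) and calls the result $z$; $e_x$ adds a crossingless strand $x$; $\sqcup$ is disjoint union; $\sigma^x_z$ relabels. $R_{i,j}^{\pm}$ is the two-strand w-tangle with one real crossing of sign $\pm$ with strand $i$ over strand $j$. Every w-tangle is obtained from a disjoint union of crossings and trivial strands by stitching. A long w-link is the analogous object (same moves) with exactly one open component and any number of closed components. $\Gamma$-calculus. An element labelled by $Y$ is a pair $(\omega,M)$ with $\omega\in\mathbb{Q}(t_i:i\in Y)$ and $M$ a $Y\times Y$ matrix over this field (rows $y_i$, columns $x_j$) with $M|_{t_i\to1}=I$. Operations: $e_a$ sends $(\omega,M)$ to $(\omega,(1)\oplus M)$; $(\omega_1,M_1)\sqcup(\omega_2,M_2)=(\omega_1\omega_2,M_1\oplus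 M_2)$; $\sigma^a_b$ renames $x_a,y_a,t_a$ to $x_b,y_b,t_b$; and, if the entries in rows $y_a,y_b,y_S$ and columns $x_a,x_b,x_S$ are $\left(\begin{smallmatrix}\alpha&\beta&\theta\\ \gamma&\delta&\epsilon\\ \phi&\psi&\Xi\end{smallmatrix}\right)$, then $m^{a,b}_c$ produces scalar $(1-\gamma)\omega$ and matrix (rows $y_c,y_S$, columns $x_c,x_S$) $\begin{pmatrix}\beta+\frac{\alpha\delta}{1-\gamma}&\theta+\frac{\alpha\epsilon}{1-\gamma}\\ \psi+\frac{\delta\phi}{1-\gamma}&\Xi+\frac{\phi\epsilon}{1-\gamma}\end{pmatrix}$, with $t_a,t_b\to t_c$ substituted everywhere. The invariant $\varphi$ of w-tangles is the map compatible with all these operations determined by: $\varphi(R_{a,b}^{\pm})$ has scalar part $1$ and matrix part (rows $y_a,y_b$, columns $x_a,x_b$) $\begin{pmatrix}1&1-t_a^{\pm1}\\0&t_a^{\pm1}\end{pmatrix}$. For a long w-link $L$ with closed components labelled $\mathbf{c}=(c_1,\dots,c_n)$, choose a w-tangle $T$ from which $L$ is obtained by closing the strands $c_1,\dots,c_n$ trivially (creating only virtual crossings). Let $\omega$ be the scalar part of $\varphi(T)$ and $\alpha$ the submatrix of the matrix part with rows $y_{\mathbf{c}}$ and columns $x_{\mathbf{c}}$; then $\omega_L:=\omega\det(I-\alpha)$ depends only on $L$. $\omega_L(t)$ denotes $\omega_L$ with all variables $t_i$ set to $t$. Define $\Delta_L(t)=t^{-w(L)/2}\,\omega_L(t)$,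 where $w(L)=\sum_{\text{real crossings}}\pm1$ is the writhe ($+1$ for a positive, $-1$ for a negative crossing). *)

theory Defs
  imports
    Complex_Main
    "HOL-Library.Poly_Mapping"
    "HOL-Computational_Algebra.Fraction_Field"
    "HOL-Computational_Algebra.Polynomial"
    "HOL-Combinatorics.Transposition"
    "Jordan_Normal_Form.Determinant"
begin

section \<open>Diagrams\<close>

datatype crossing_kind = Virtual | Positive | Negative

text \<open>
  A planar isotopy class of diagrams is recorded by the sequence of double points met by each
  component, following its orientation. The two passages through a double point \<open>c\<close> are
  \<open>(c, True)\<close> and \<open>(c, False)\<close>, named so that the directions of
  \<open>(c, True)\<close> and \<open>(c, False)\<close>, in this order, form a positively oriented
  basis of the plane. This fixes the cyclic order of the four half-edges at every double point.
  The over strand is then determined by the sign: it is \<open>(c, True)\<close> at a positive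
  crossing and \<open>(c, False)\<close> at a negative one. The word of a closed component
  starts at an arbitrary base point.
\<close>

type_synonym passage = "nat \<times> bool"

record diagram =
  arcs :: "nat \<rightharpoonup> passage list"
  loops :: "nat \<rightharpoonup> passage list"
  kinds :: "nat \<rightharpoonup> crossing_kind"

definition passages :: "diagram \<Rightarrow> nat \<Rightarrow> passage list" where
  "passages D k = (case arcs D k of Some w \<Rightarrow> w
                   | None \<Rightarrow> (case loops D k of Some w \<Rightarrow> w | None \<Rightarrow> []))"

definition components :: "diagram \<Rightarrow> nat set" where
  "components D = dom (arcs D) \<union> dom (loops D)"

definition well_formed :: "diagram \<Rightarrow> bool" where
  "well_formed D \<longleftrightarrow>
     finite (components D) \<and> dom (arcs D) \<inter> dom (loops D) = {} \<and> finite (dom (kinds D)) \<and>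
     (\<forall>k\<in>components D. distinct (passages D k)) \<and>
     (\<forall>k\<in>components D. \<forall>l\<in>components D. k \<noteq> l \<longrightarrow>
        set (passages D k) \<inter> set (passages D l) = {}) \<and>
     (\<Union>k\<in>components D. set (passages D k)) = dom (kinds D) \<times> UNIV"

text \<open>
  \<open>D\<close> is drawn in the plane by regular \<open>C\<^sup>1\<close> curves \<open>\<gamma> k\<close> with velocities
  \<open>\<gamma>' k\<close>; \<open>\<tau>\<close> gives the time of each passage. The curves meet exactly at the
  prescribed double points, transversally and with the prescribed local orientation
  (\<open>Im (cnj u * v)\<close> is the determinant of \<open>u, v\<close>). Triple points are excluded because
  the times along one component are strictly increasing.
\<close>

definition drawn_by ::
  "diagram \<Rightarrow> (nat \<Rightarrow> real \<Rightarrow> complex) \<Rightarrow> (nat \<Rightarrow> real \<Rightarrow> complex) \<Rightarrow> (passage \<Rightarrow> real) \<Rightarrow> bool" where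
  "drawn_by D \<gamma> \<gamma>' \<tau> \<longleftrightarrow>
     (\<forall>k\<in>components D. continuous_on {0..1} (\<gamma>' k) \<and>
        (\<forall>s\<in>{0..1}. (\<gamma> k has_vector_derivative \<gamma>' k s) (at s within {0..1}) \<and> \<gamma>' k s \<noteq> 0)) \<and>
     (\<forall>k\<in>dom (loops D). \<gamma> k 0 = \<gamma> k 1 \<and> \<gamma>' k 0 = \<gamma>' k 1) \<and>
     (\<forall>k\<in>components D. sorted_wrt (<) (map \<tau> (passages D k)) \<and>
        \<tau> ` set (passages D k) \<subseteq> {0<..<1}) \<and>
     (\<forall>k\<in>components D. \<forall>l\<in>components D. \<forall>s\<in>{0..1}. \<forall>t\<in>{0..1}. (k, s) \<noteq> (l, t) \<longrightarrow>
        (\<gamma> k s = \<gamma> l t \<longleftrightarrow>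
           k = l \<and> k \<in> dom (loops D) \<and> {s, t} = {0, 1} \<or>
           (\<exists>c b. (c, b) \<in> set (passages D k) \<and> (c, \<not> b) \<in> set (passages D l) \<and>
                  \<tau> (c, b) = s \<and> \<tau> (c, \<not> b) = t))) \<and>
     (\<forall>k\<in>components D. \<forall>l\<in>components D. \<forall>c.
        (c, True) \<in> set (passages D k) \<and> (c, False) \<in> set (passages D l) \<longrightarrow>
        Im (cnj (\<gamma>' k (\<tau> (c, True))) * \<gamma>' l (\<tau> (c, False))) > 0)"

definition diagrams :: "diagram set" where
  "diagrams = {D. well_formed D \<and> (\<exists>\<gamma> \<gamma>' \<tau>. drawn_by D \<gamma> \<gamma>' \<tau>)}"

definition tangle_diagrams :: "nat set \<Rightarrow> diagram set" where
  "tangle_diagrams Y = {D \<in> diagrams. dom (arcs D) = Y \<and> loops D = Map.empty}"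

definition long_link_diagrams :: "diagram set" where
  "long_link_diagrams = {D \<in> diagrams. card (dom (arcs D)) = 1}"


section \<open>Moves\<close>

definition map_words :: "(passage list \<Rightarrow> passage list) \<Rightarrow> diagram \<Rightarrow> diagram" where
  "map_words f D = D\<lparr>arcs := map_option f \<circ> arcs D, loops := map_option f \<circ> loops D\<rparr>"

definition erase_word :: "nat set \<Rightarrow> passage list \<Rightarrow> passage list" where
  "erase_word V = filter (\<lambda>p. fst p \<notin> V)"

definition erase :: "nat set \<Rightarrow> diagram \<Rightarrow> diagram" where
  "erase V D = (map_words (erase_word V) D)\<lparr>kinds := kinds D |` (- V)\<rparr>"

definition rename_crossings :: "(nat \<Rightarrow> nat) \<Rightarrow> diagram \<Rightarrow> diagram" where
  "rename_crossings \<pi> D = (map_words (map (map_prod \<pi> id)) D)\<lparr>kinds := kinds D \<circ> inv_into UNIV \<pi>\<rparr>"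

text \<open>Every passage occurs only once, so exchanging two neighbours on a component is the same as
  transposing their names.\<close>

definition exchange :: "passage \<Rightarrow> passage \<Rightarrow> diagram \<Rightarrow> diagram" where
  "exchange x y = map_words (map (Transposition.transpose x y))"

definition next_on :: "diagram \<Rightarrow> passage \<Rightarrow> passage \<Rightarrow> bool" where
  "next_on D x y \<longleftrightarrow>
     (\<exists>k\<in>components D. \<exists>u v. passages D k = u @ [x, y] @ v) \<or>
     (\<exists>k u. loops D k = Some ([y] @ u @ [x]))"

definition edge :: "diagram \<Rightarrow> bool \<Rightarrow> passage \<Rightarrow> passage \<Rightarrow> bool" where
  "edge D \<sigma> x y = (if \<sigma> then next_on D x y else next_on D y x)"

definition passes_over :: "diagram \<Rightarrow> passage \<Rightarrow> bool" where
  "passes_over D x \<longleftrightarrow> kinds D (fst x) = Some (if snd x then Positive else Negative)"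

definition is_virtual :: "diagram \<Rightarrow> nat \<Rightarrow> bool" where
  "is_virtual D c \<longleftrightarrow> kinds D c = Some Virtual"

definition is_real :: "diagram \<Rightarrow> nat \<Rightarrow> bool" where
  "is_real D c \<longleftrightarrow> kinds D c \<in> {Some Positive, Some Negative}"

text \<open>
  Two strands bounding a bigon with corners \<open>p\<close> and \<open>q\<close>; the first runs from \<open>p\<close> to
  \<open>q\<close>. The local orientations at the two corners are opposite.
\<close>

definition bigon :: "diagram \<Rightarrow> nat \<Rightarrow> nat \<Rightarrow> bool" where
  "bigon D p q \<longleftrightarrow> p \<noteq> q \<and>
     (\<exists>a \<sigma>. next_on D (p, a) (q, \<not> a) \<and> edge D \<sigma> (p, \<not> a) (q, a))"

text \<open>
  Three strands bounding a triangular face: strands 1 and 2 cross at \<open>p\<close>, strands 2 and 3 at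
  \<open>q\<close>, strands 3 and 1 at \<open>r\<close>. The passage of strand 1 at \<open>p\<close> is \<open>(p, a)\<close>, that of strand 2
  at \<open>q\<close> is \<open>(q, b)\<close>, that of strand 3 at \<open>r\<close> is \<open>(r, d)\<close>. The \<open>\<sigma>\<close>s tell whether the strands
  agree with the direction \<open>p \<rightarrow> q \<rightarrow> r \<rightarrow> p\<close>. That direction runs counterclockwise (\<open>\<tau>\<close>) or
  clockwise (\<open>\<not> \<tau>\<close>) around the face, so it turns the same way at each corner; this is
  the condition relating \<open>a, b, d\<close> to the \<open>\<sigma>\<close>s. Sliding one strand across the crossing of the
  others exchanges the two passages on each of the three edges.
\<close>

definition triangle :: "diagram \<Rightarrow> passage \<Rightarrow> passage \<Rightarrow> passage \<Rightarrow> bool" where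
  "triangle D x y z \<longleftrightarrow>
     (case (x, y, z) of ((p, a), (q, b), (r, d)) \<Rightarrow> distinct [p, q, r] \<and>
        (\<exists>\<sigma>\<^sub>1 \<sigma>\<^sub>2 \<sigma>\<^sub>3 \<tau>.
           edge D \<sigma>\<^sub>1 (r, \<not> d) (p, a) \<and> edge D \<sigma>\<^sub>2 (p, \<not> a) (q, b) \<and> edge D \<sigma>\<^sub>3 (q, \<not> b) (r, d) \<and>
           (a \<longleftrightarrow> ((\<sigma>\<^sub>1 = \<sigma>\<^sub>2) = \<tau>)) \<and> (b \<longleftrightarrow> ((\<sigma>\<^sub>2 = \<sigma>\<^sub>3) = \<tau>)) \<and> (d \<longleftrightarrow> ((\<sigma>\<^sub>3 = \<sigma>\<^sub>1) = \<tau>))))"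

definition slide :: "passage \<Rightarrow> passage \<Rightarrow> passage \<Rightarrow> diagram \<Rightarrow> diagram" where
  "slide x y z D =
     (case (x, y, z) of ((p, a), (q, b), (r, d)) \<Rightarrow>
        exchange (r, \<not> d) (p, a) (exchange (p, \<not> a) (q, b) (exchange (q, \<not> b) (r, d) D)))"

text \<open>
  The rules \<open>rename\<close> and \<open>base_point\<close> only change the encoding, and \<open>endpoint\<close> expresses that
  the position of endpoints is immaterial: an endpoint may be pulled across a strand it crosses
  virtually. In \<open>OC\<close>, strand 1 passes over strands 2 and 3, which cross virtually; in \<open>M\<close>,
  strand 1 meets the other two virtually; in \<open>R3\<close>, strand 1 is on top and strand 3 at the bottom.
\<close>

inductive move :: "diagram \<Rightarrow> diagram \<Rightarrow> bool" where
  rename: "bij \<pi> \<Longrightarrow> move D (rename_crossings \<pi> D)"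
| base_point: "loops D k = Some w \<Longrightarrow> move D (D\<lparr>loops := (loops D)(k \<mapsto> rotate1 w)\<rparr>)"
| endpoint: "arcs D k = Some w \<Longrightarrow> w = [(c, b)] @ v \<or> w = v @ [(c, b)] \<Longrightarrow> is_virtual D c \<Longrightarrow>
    move D (erase {c} D)"
| VR1: "next_on D (c, b) (c, \<not> b) \<Longrightarrow> is_virtual D c \<Longrightarrow> move D (erase {c} D)"
| VR2: "bigon D p q \<Longrightarrow> is_virtual D p \<Longrightarrow> is_virtual D q \<Longrightarrow> move D (erase {p, q} D)"
| VR3: "triangle D (p, a) (q, b) (r, d) \<Longrightarrow>
    is_virtual D p \<Longrightarrow> is_virtual D q \<Longrightarrow> is_virtual D r \<Longrightarrow>
    move D (slide (p, a) (q, b) (r, d) D)"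
| M: "triangle D (p, a) (q, b) (r, d) \<Longrightarrow>
    is_virtual D p \<Longrightarrow> is_real D q \<Longrightarrow> is_virtual D r \<Longrightarrow>
    move D (slide (p, a) (q, b) (r, d) D)"
| OC: "triangle D (p, a) (q, b) (r, d) \<Longrightarrow>
    passes_over D (p, a) \<Longrightarrow> is_virtual D q \<Longrightarrow> passes_over D (r, \<not> d) \<Longrightarrow>
    move D (slide (p, a) (q, b) (r, d) D)"
| R2: "bigon D p q \<Longrightarrow> {kinds D p, kinds D q} = {Some Positive, Some Negative} \<Longrightarrow>
    move D (erase {p, q} D)"
| R3: "triangle D (p, a) (q, b) (r, d) \<Longrightarrow>
    passes_over D (p, a) \<Longrightarrow> passes_over D (q, b) \<Longrightarrow> passes_over D (r, \<not> d) \<Longrightarrow>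
    move D (slide (p, a) (q, b) (r, d) D)"

definition diagram_equiv :: "(diagram \<times> diagram) set" where
  "diagram_equiv = {(D, D'). D \<in> diagrams \<and> D' \<in> diagrams \<and>
     equivclp (\<lambda>A B. A \<in> diagrams \<and> B \<in> diagrams \<and> move A B) D D'}"

definition w_class :: "diagram \<Rightarrow> diagram set" where
  "w_class D = diagram_equiv `` {D}"

definition w_tangles :: "nat set \<Rightarrow> diagram set set" where
  "w_tangles Y = tangle_diagrams Y // diagram_equiv"

definition long_w_links :: "diagram set set" where
  "long_w_links = long_link_diagrams // diagram_equiv"


section \<open>Operations on tangles\<close>

definition add_strand :: "nat \<Rightarrow> diagram \<Rightarrow> diagram" where
  "add_strand x D = D\<lparr>arcs := (arcs D)(x \<mapsto> [])\<rparr>"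

definition disjoint_union :: "diagram \<Rightarrow> diagram \<Rightarrow> diagram" where
  "disjoint_union D E =
     \<lparr>arcs = arcs D ++ arcs E, loops = loops D ++ loops E, kinds = kinds D ++ kinds E\<rparr>"

definition relabel :: "nat \<Rightarrow> nat \<Rightarrow> diagram \<Rightarrow> diagram" where
  "relabel x z D = D\<lparr>arcs := ((arcs D)(x := None))(z := arcs D x)\<rparr>"

definition crossing_diagram :: "crossing_kind \<Rightarrow> nat \<Rightarrow> nat \<Rightarrow> nat \<Rightarrow> diagram" where
  "crossing_diagram s c i j =
     \<lparr>arcs = [i \<mapsto> [(c, s = Positive)], j \<mapsto> [(c, s \<noteq> Positive)]], loops = Map.empty, kinds = [c \<mapsto> s]\<rparr>"

text \<open>
  \<open>D'\<close> arises from \<open>D\<close> by joining the head of \<open>x\<close> to the tail of \<open>y\<close> along a path whose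
  passages are \<open>h\<close>. Its crossings \<open>V\<close>, including those of the path with itself, are all virtual,
  and removing the path and \<open>V\<close> from \<open>D'\<close> gives back \<open>D\<close>.
\<close>

definition stitches_to :: "nat \<Rightarrow> nat \<Rightarrow> nat \<Rightarrow> diagram \<Rightarrow> diagram \<Rightarrow> bool" where
  "stitches_to x y z D D' \<longleftrightarrow> x \<noteq> y \<and> {x, y} \<inter> (dom (arcs D') - {z}) = {} \<and>
     (\<exists>u h v V. arcs D' z = Some (u @ h @ v) \<and> V = fst ` set h \<and> (\<forall>c\<in>V. is_virtual D' c) \<and>
        D = (erase V D')\<lparr>arcs := (arcs (erase V D'))
               (z := None, x \<mapsto> erase_word V u, y \<mapsto> erase_word V v)\<rparr>)"

text \<open>\<open>D'\<close> arises from the tangle \<open>D\<close> by closing the strands that are loops of \<open>D'\<close>, the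
  closing path of \<open>k\<close> having passages \<open>h k\<close>.\<close>

definition closes_to :: "diagram \<Rightarrow> diagram \<Rightarrow> bool" where
  "closes_to D D' \<longleftrightarrow>
     (\<exists>u h V. (\<forall>k\<in>dom (loops D'). loops D' k = Some (u k @ h k)) \<and>
        V = (\<Union>k\<in>dom (loops D'). fst ` set (h k)) \<and> (\<forall>c\<in>V. is_virtual D' c) \<and>
        D = (erase V D')\<lparr>
              arcs := arcs (erase V D') ++
                (\<lambda>k. if k \<in> dom (loops D') then Some (erase_word V (u k)) else None),
              loops := Map.empty\<rparr>)"


section \<open>Rational functions\<close>

instance fract :: ("{idom, ring_char_0}") field_char_0
proof
  show "inj (of_nat :: nat \<Rightarrow> 'a fract)"
    by (rule injI) (simp add: Fraction_Field.of_nat_fract eq_fract)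
qed

type_synonym polys = "(nat \<Rightarrow>\<^sub>0 nat) \<Rightarrow>\<^sub>0 rat"
type_synonym ratfun = "polys fract"

definition tvar :: "nat \<Rightarrow> ratfun" where
  "tvar i = Fraction_Field.Fract (Poly_Mapping.single (Poly_Mapping.single i 1) 1) 1"

definition poly_vars :: "polys \<Rightarrow> nat set" where
  "poly_vars p = (\<Union>m\<in>Poly_Mapping.keys p. Poly_Mapping.keys m)"

definition ratfuns :: "nat set \<Rightarrow> ratfun set" where
  "ratfuns Y = {Fraction_Field.Fract p q | p q. q \<noteq> 0 \<and> poly_vars p \<subseteq> Y \<and> poly_vars q \<subseteq> Y}"

definition poly_value :: "(nat \<Rightarrow> 'a::field_char_0) \<Rightarrow> polys \<Rightarrow> 'a" where
  "poly_value v p = (\<Sum>m\<in>Poly_Mapping.keys p.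
     of_rat (Poly_Mapping.lookup p m) * (\<Prod>i\<in>Poly_Mapping.keys m. v i ^ Poly_Mapping.lookup m i))"

text \<open>Substituting \<open>v i\<close> for \<open>t\<^sub>i\<close> is a partial operation on rational functions.\<close>

definition specializes_to :: "(nat \<Rightarrow> 'a::field_char_0) \<Rightarrow> ratfun \<Rightarrow> 'a \<Rightarrow> bool" where
  "specializes_to v f y \<longleftrightarrow>
     (\<exists>p q. f = Fraction_Field.Fract p q \<and> poly_value v q \<noteq> 0 \<and> y = poly_value v p / poly_value v q)"

definition specialize :: "(nat \<Rightarrow> 'a::field_char_0) \<Rightarrow> ratfun \<Rightarrow> 'a" where
  "specialize v f = (THE y. specializes_to v f y)"


section \<open>\<open>\<Gamma>\<close>-calculus\<close>

text \<open>In \<open>(\<omega>, M)\<close>, \<open>M i j\<close> is the entry in row \<open>y\<^sub>i\<close> and column \<open>x\<^sub>j\<close>; entries outside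
  \<open>Y \<times> Y\<close> are set to 0.\<close>

type_synonym gamma = "ratfun \<times> (nat \<Rightarrow> nat \<Rightarrow> ratfun)"

definition gamma_elements :: "nat set \<Rightarrow> gamma set" where
  "gamma_elements Y = {(\<omega>, M). \<omega> \<in> ratfuns Y \<and>
     (\<forall>i j. i \<in> Y \<and> j \<in> Y \<longrightarrow> M i j \<in> ratfuns Y \<and>
              specializes_to (\<lambda>_. 1 :: rat) (M i j) (if i = j then 1 else 0)) \<and>
     (\<forall>i j. i \<notin> Y \<or> j \<notin> Y \<longrightarrow> M i j = 0)}"

definition gamma_strand :: "nat \<Rightarrow> gamma \<Rightarrow> gamma" where
  "gamma_strand a = (\<lambda>(\<omega>, M). (\<omega>, \<lambda>i j. if i = a \<and> j = a then 1 else M i j))"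

definition gamma_union :: "gamma \<Rightarrow> gamma \<Rightarrow> gamma" where
  "gamma_union = (\<lambda>(\<omega>, M) (\<omega>', M'). (\<omega> * \<omega>', \<lambda>i j. M i j + M' i j))"

definition gamma_relabel :: "nat \<Rightarrow> nat \<Rightarrow> gamma \<Rightarrow> gamma" where
  "gamma_relabel a b = (\<lambda>(\<omega>, M).
     let subst = specialize (\<lambda>i. tvar (if i = a then b else i)) in
       (subst \<omega>, \<lambda>i j. subst (M (Transposition.transpose a b i) (Transposition.transpose a b j))))"

definition gamma_stitch :: "nat \<Rightarrow> nat \<Rightarrow> nat \<Rightarrow> gamma \<Rightarrow> gamma" where
  "gamma_stitch a b c = (\<lambda>(\<omega>, M).
     let \<alpha> = M a a; \<beta> = M a b; \<gamma> = M b a; \<delta> = M b b;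
         \<theta> = M a; \<epsilon> = M b; \<phi> = (\<lambda>i. M i a); \<psi> = (\<lambda>i. M i b);
         subst = specialize (\<lambda>i. tvar (if i = a \<or> i = b then c else i))
     in (subst ((1 - \<gamma>) * \<omega>),
         \<lambda>i j. subst (
           if i = c \<and> j = c then \<beta> + \<alpha> * \<delta> / (1 - \<gamma>)
           else if i \<in> {a, b} - {c} \<or> j \<in> {a, b} - {c} then 0
           else if i = c then \<theta> j + \<alpha> * \<epsilon> j / (1 - \<gamma>)
           else if j = c then \<psi> i + \<delta> * \<phi> i / (1 - \<gamma>)
           else M i j + \<phi> i * \<epsilon> j / (1 - \<gamma>))))"

definition gamma_crossing :: "crossing_kind \<Rightarrow> nat \<Rightarrow> nat \<Rightarrow> gamma" where
  "gamma_crossing s a b =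
     (let T = (if s = Positive then tvar a else inverse (tvar a)) in
       (1, \<lambda>i j. if i = a \<and> j = a then 1 else if i = a \<and> j = b then 1 - T
                 else if i = b \<and> j = b then T else 0))"

locale gamma_invariant =
  fixes f :: "diagram set \<Rightarrow> gamma"
  assumes elements: "T \<in> w_tangles Y \<Longrightarrow> f T \<in> gamma_elements Y"
    and crossing: "s \<in> {Positive, Negative} \<Longrightarrow> i \<noteq> j \<Longrightarrow>
      crossing_diagram s c i j \<in> tangle_diagrams {i, j} \<Longrightarrow>
      f (w_class (crossing_diagram s c i j)) = gamma_crossing s i j"
    and strand: "D \<in> tangle_diagrams Y \<Longrightarrow> x \<notin> Y \<Longrightarrow>
      add_strand x D \<in> tangle_diagrams (insert x Y) \<Longrightarrow>
      f (w_class (add_strand x D)) = gamma_strand x (f (w_class D))"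
    and union: "D \<in> tangle_diagrams Y \<Longrightarrow> E \<in> tangle_diagrams Z \<Longrightarrow> Y \<inter> Z = {} \<Longrightarrow>
      dom (kinds D) \<inter> dom (kinds E) = {} \<Longrightarrow>
      disjoint_union D E \<in> tangle_diagrams (Y \<union> Z) \<Longrightarrow>
      f (w_class (disjoint_union D E)) = gamma_union (f (w_class D)) (f (w_class E))"
    and relabel: "D \<in> tangle_diagrams Y \<Longrightarrow> x \<in> Y \<Longrightarrow> z \<notin> Y - {x} \<Longrightarrow>
      f (w_class (relabel x z D)) = gamma_relabel x z (f (w_class D))"
    and stitch: "D \<in> tangle_diagrams Y \<Longrightarrow> D' \<in> tangle_diagrams Y' \<Longrightarrow> stitches_to x y z D D' \<Longrightarrow>
      f (w_class D') = gamma_stitch x y z (f (w_class D))"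

text \<open>The values on w-tangles are determined by the conditions, those on other sets of
  diagrams are arbitrary.\<close>

definition phi :: "diagram set \<Rightarrow> gamma" where
  "phi = (SOME f. gamma_invariant f)"


section \<open>Long w-links\<close>

definition submatrix_on :: "nat list \<Rightarrow> (nat \<Rightarrow> nat \<Rightarrow> ratfun) \<Rightarrow> ratfun mat" where
  "submatrix_on cs M = mat (length cs) (length cs) (\<lambda>(i, j). M (cs ! i) (cs ! j))"

definition closed_value :: "nat list \<Rightarrow> gamma \<Rightarrow> ratfun" where
  "closed_value cs = (\<lambda>(\<omega>, M). \<omega> * det (1\<^sub>m (length cs) - submatrix_on cs M))"

definition link_omega :: "diagram set \<Rightarrow> ratfun" where
  "link_omega L = (THE w. \<exists>D\<in>diagrams. \<exists>D'\<in>L. closes_to D D' \<and>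
     w = closed_value (sorted_list_of_set (dom (loops D'))) (phi (w_class D)))"

definition crossing_sign :: "crossing_kind \<Rightarrow> int" where
  "crossing_sign s = (case s of Virtual \<Rightarrow> 0 | Positive \<Rightarrow> 1 | Negative \<Rightarrow> -1)"

definition diagram_writhe :: "diagram \<Rightarrow> int" where
  "diagram_writhe D = (\<Sum>c\<in>dom (kinds D). crossing_sign (the (kinds D c)))"

definition writhe :: "diagram set \<Rightarrow> int" where
  "writhe L = (THE n. \<forall>D\<in>L. diagram_writhe D = n)"

text \<open>One-variable values live in the rational functions in \<open>t\<^bsup>1/2\<^esup>\<close>.\<close>

definition sqrt_t :: "rat poly fract" where
  "sqrt_t = Fraction_Field.Fract [:0, 1:] 1"

definition link_omega_t :: "diagram set \<Rightarrow> rat poly fract" where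
  "link_omega_t L = specialize (\<lambda>_. sqrt_t ^ 2) (link_omega L)"

definition Delta :: "diagram set \<Rightarrow> rat poly fract" where
  "Delta L = sqrt_t powi (- writhe L) * link_omega_t L"

text \<open>
  \<open>smoothing c D D\<^sub>0\<close>: \<open>D\<^sub>0\<close> is the oriented smoothing of \<open>D\<close> at \<open>c\<close>, for diagrams with one
  open component. Each incoming strand continues along the outgoing part of the other one, so a
  component meeting \<open>c\<close> twice splits and two components merge. The labels of the new
  components are arbitrary unused ones; a loop is based at \<open>c\<close>.
\<close>

inductive smoothing :: "nat \<Rightarrow> diagram \<Rightarrow> diagram \<Rightarrow> bool" for c :: nat and D :: diagram where
  split_arc:
    "arcs D k = Some (u @ [(c, b)] @ v @ [(c, \<not> b)] @ w) \<Longrightarrow>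
     y \<noteq> z \<Longrightarrow> {y, z} \<inter> (components D - {k}) = {} \<Longrightarrow>
     smoothing c D \<lparr>arcs = ((arcs D)(k := None))(y \<mapsto> u @ w), loops = (loops D)(z \<mapsto> v),
                    kinds = (kinds D)(c := None)\<rparr>"
| split_loop:
    "loops D k = Some ([(c, b)] @ u @ [(c, \<not> b)] @ v) \<Longrightarrow>
     y \<noteq> z \<Longrightarrow> {y, z} \<inter> (components D - {k}) = {} \<Longrightarrow>
     smoothing c D \<lparr>arcs = arcs D, loops = ((loops D)(k := None))(y \<mapsto> u, z \<mapsto> v),
                    kinds = (kinds D)(c := None)\<rparr>"
| merge_arc:
    "arcs D k = Some (u @ [(c, b)] @ v) \<Longrightarrow> loops D l = Some ([(c, \<not> b)] @ w) \<Longrightarrow>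
     z \<notin> components D - {k, l} \<Longrightarrow>
     smoothing c D \<lparr>arcs = ((arcs D)(k := None))(z \<mapsto> u @ w @ v), loops = (loops D)(l := None),
                    kinds = (kinds D)(c := None)\<rparr>"
| merge_loops:
    "loops D k = Some ([(c, b)] @ u) \<Longrightarrow> loops D l = Some ([(c, \<not> b)] @ v) \<Longrightarrow> k \<noteq> l \<Longrightarrow>
     z \<notin> components D - {k, l} \<Longrightarrow>
     smoothing c D \<lparr>arcs = arcs D, loops = ((loops D)(k := None, l := None))(z \<mapsto> u @ v),
                    kinds = (kinds D)(c := None)\<rparr>"

text \<open>The same drawing with another sign at \<open>c\<close> is the crossing change: the sign determines
  which strand is on top.\<close>

definition skein_triple :: "nat \<Rightarrow> diagram \<Rightarrow> diagram \<Rightarrow> diagram \<Rightarrow> bool" where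
  "skein_triple c D\<^sub>p D\<^sub>m D\<^sub>0 \<longleftrightarrow>
     kinds D\<^sub>p c = Some Positive \<and> D\<^sub>m = D\<^sub>p\<lparr>kinds := (kinds D\<^sub>p)(c \<mapsto> Negative)\<rparr> \<and>
     smoothing c D\<^sub>p D\<^sub>0"

end

theory Submission
  imports Defs
begin

text \<open>
  The polynomial is a determinant, and the skein relation is linear algebra in two of its rows.

  A diagram defines a walk against the orientation, whose states are the passages through double
  points and one further state at the beginning of each component. A state steps to its predecessor;
  only at the lower passage of a real crossing of sign \<open>\<plusminus>\<close> does the walk choose: it stays on its
  component with weight \<open>T\<close> and jumps to the upper passage with weight \<open>1 - T\<close>, where \<open>T\<close> is
  \<open>t\<^bsup>\<plusminus>1\<^esup>\<close> for the variable \<open>t\<close> of the upper strand. Beginnings of loops are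
  preceded by their ends, and the walk stops at beginnings of arcs. Let \<open>link_det\<close> be the
  determinant of the identity minus the matrix of weights of single steps.

  This determinant is unchanged by all moves (\<open>link_det_move\<close>): row operations remove virtual
  passages, cancel the two lower passages of an R2 bigon, and exchange neighbouring passages of a
  triangle. For a tangle, let \<open>\<omega>\<close> be its value and let \<open>M\<close> collect the total
  weights of walks from the end of one arc to the beginning of another. By Cramer's rule
  \<open>1 - M\<^sub>k\<^sub>l\<close> is the quotient by \<open>\<omega>\<close> of the determinant of the walk that
  continues from the beginning of \<open>k\<close> at the end of \<open>l\<close>. Hence every
  determinant obtained by connecting ends to beginnings is expressed by \<open>\<omega>\<close> and minors of \<open>M\<close>
  (\<open>link_det_closing\<close>). This yields the stitching formula of \<open>\<Gamma>\<close>-calculus, so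
  \<open>(\<omega>, M)\<close> is an invariant in the sense of the definition of \<open>phi\<close>. It is the only one, because
  a drawing can be cut into single crossings and strands (\<open>agree\<close>). Therefore
  \<open>phi_w_class\<close> computes \<open>phi\<close>, and the same formula for closing strands turns the
  normalized closure \<open>\<omega> det (I - \<alpha>)\<close> of a long w-link into the
  determinant of any of its diagrams (\<open>link_omega_eq\<close>).

  With all variables equal to \<open>t\<close>, the three determinants in the skein relation differ in the two
  rows of the crossing only: \<open>a - p, b - t q - (1 - t) a\<close> for the positive crossing,
  \<open>a - t\<^bsup>-1\<^esup> p - (1 - t\<^bsup>-1\<^esup>) b, b - q\<close> for the negative one and
  \<open>a - q, b - p\<close> for the smoothing, where \<open>a, b\<close> are the unit vectors of the two passages
  and \<open>p, q\<close> those of their predecessors. Bilinearity and antisymmetry in these two rows give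
  \<open>\<omega>\<^sub>+ - t \<omega>\<^sub>- = (1 - t) \<omega>\<^sub>0\<close> (\<open>walk_det_skein\<close>), and the writhe
  normalization makes this symmetric.
\<close>

section \<open>Determinants over finite index sets\<close>

text \<open>
  Determinants of matrices indexed by a set, so that states can be removed and renamed freely.
\<close>

definition det_on :: "'a set \<Rightarrow> ('a \<Rightarrow> 'a \<Rightarrow> 'f) \<Rightarrow> 'f::comm_ring_1" where
  "det_on S A = (\<Sum>p | p permutes S. of_int (sign p) * (\<Prod>i\<in>S. A i (p i)))"

lemma det_on_cong:
  assumes "\<And>i j. i \<in> S \<Longrightarrow> j \<in> S \<Longrightarrow> A i j = B i j"
  shows "det_on S A = det_on S B"
  unfolding det_on_def
  by (intro sum.cong prod.cong arg_cong2[where f="(*)"] refl assms) (auto simp: permutes_in_image)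

lemma det_on_reindex:
  assumes f: "bij_betw f S S'" and fin: "finite S"
  shows "det_on S' A = det_on S (\<lambda>i j. A (f i) (f j))"
proof -
  have inj: "inj_on f S" and im: "f ` S = S'" using f by (auto simp: bij_betw_def)
  have "bij_betw (map_permutation S f) {p. p permutes S} {p. p permutes S'}"
  proof (rule bij_betwI[where g = "map_permutation S' (inv_into S f)"])
    show "map_permutation S f \<in> {p. p permutes S} \<rightarrow> {p. p permutes S'}"
      using map_permutation_permutes[OF f] by auto
    show "map_permutation S' (inv_into S f) \<in> {p. p permutes S'} \<rightarrow> {p. p permutes S}"
      using map_permutation_permutes[OF bij_betw_inv_into[OF f]] by auto
    show "map_permutation S' (inv_into S f) (map_permutation S f p) = p" if "p \<in> {p. p permutes S}" for p
      using map_permutation_compose_inv[OF f, of p "inv_into S f"] that inj by auto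
    show "map_permutation S f (map_permutation S' (inv_into S f) p) = p" if "p \<in> {p. p permutes S'}" for p
      using map_permutation_compose_inv[OF bij_betw_inv_into[OF f], of p f] that im
      by (auto simp: f_inv_into_f)
  qed
  then have "det_on S' A = (\<Sum>p | p permutes S. of_int (sign (map_permutation S f p)) *
       (\<Prod>i\<in>S'. A i (map_permutation S f p i)))"
    unfolding det_on_def by (intro sum.reindex_bij_betw[symmetric])
  also have "\<dots> = (\<Sum>p | p permutes S. of_int (sign p) * (\<Prod>i\<in>S. A (f i) (f (p i))))"
  proof (rule sum.cong)
    fix p assume "p \<in> {p. p permutes S}"
    then have p: "p permutes S" by simp
    have "sign (map_permutation S f p) = sign p"
      using sign_map_permutation[OF inj p fin] .
    moreover have "(\<Prod>i\<in>S'. A i (map_permutation S f p i)) = (\<Prod>i\<in>S. A (f i) (map_permutation S f p (f i)))"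
      using prod.reindex_bij_betw[OF f, of "\<lambda>i. A i (map_permutation S f p i)"] by simp
    moreover have "\<dots> = (\<Prod>i\<in>S. A (f i) (f (p i)))"
      using inj by (intro prod.cong) (auto simp: map_permutation_apply)
    ultimately show "of_int (sign (map_permutation S f p)) * (\<Prod>i\<in>S'. A i (map_permutation S f p i)) =
      of_int (sign p) * (\<Prod>i\<in>S. A (f i) (f (p i)))" by simp
  qed auto
  finally show ?thesis unfolding det_on_def .
qed

lemma det_on_eq_det:
  assumes "bij_betw f {0..<n} S"
  shows "det_on S A = det (mat n n (\<lambda>(i, j). A (f i) (f j)))"
proof -
  have "det_on S A = det_on {0..<n} (\<lambda>i j. A (f i) (f j))"
    using det_on_reindex[OF assms] by simp
  also have "\<dots> = det (mat n n (\<lambda>(i, j). A (f i) (f j)))"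
    unfolding det_on_def det_def
    by (auto intro!: sum.cong prod.cong dest: permutes_in_image[of _ _ i for i])
  finally show ?thesis .
qed

lemma det_on_unit:
  assumes fin: "finite S" and x: "x \<in> S" "A x x = 1"
    and z: "(\<forall>j\<in>S-{x}. A x j = 0) \<or> (\<forall>i\<in>S-{x}. A i x = 0)"
  shows "det_on S A = det_on (S - {x}) A"
proof -
  have "{p. p permutes S - {x}} \<subseteq> {p. p permutes S}"
    by (auto intro: permutes_subset)
  moreover have "of_int (sign p) * (\<Prod>i\<in>S. A i (p i)) = 0"
    if p: "p permutes S" "\<not> p permutes S - {x}" for p
  proof -
    have px: "p x \<noteq> x" using p permutes_superset[of p S "S - {x}"] x by auto
    obtain y where y: "y \<in> S" "p y = x" using p(1) x(1)
      by (metis permutes_image image_iff)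
    have "\<exists>i\<in>S. A i (p i) = 0"
      using z
    proof
      assume "\<forall>j\<in>S-{x}. A x j = 0"
      then show ?thesis using px x(1) permutes_in_image[OF p(1)] by blast
    next
      assume "\<forall>i\<in>S-{x}. A i x = 0"
      then show ?thesis using px y by force
    qed
    then have "(\<Prod>i\<in>S. A i (p i)) = 0" using fin by (intro prod_zero) auto
    then show ?thesis by simp
  qed
  ultimately have "det_on S A = (\<Sum>p | p permutes S - {x}. of_int (sign p) * (\<Prod>i\<in>S. A i (p i)))"
    unfolding det_on_def using finite_permutations[OF fin]
    by (intro sum.mono_neutral_right) auto
  also have "\<dots> = det_on (S - {x}) A"
    unfolding det_on_def
  proof (intro sum.cong refl)
    fix p assume "p \<in> {p. p permutes S - {x}}"
    then have "p x = x" by (auto simp: permutes_def)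
    then show "of_int (sign p) * (\<Prod>i\<in>S. A i (p i)) = of_int (sign p) * (\<Prod>i\<in>S - {x}. A i (p i))"
      using prod.remove[OF fin x(1), of "\<lambda>i. A i (p i)"] x(2) by simp
  qed
  finally show ?thesis .
qed

lemma det_on_row_linear:
  assumes "finite S" "i \<in> S"
  shows "det_on S (A(i := \<lambda>j. u j + c * v j)) = det_on S (A(i := u)) + c * det_on S (A(i := v))"
proof -
  have *: "(\<Prod>k\<in>S. (A(i := w)) k (p k)) = w (p i) * (\<Prod>k\<in>S-{i}. A k (p k))" for w and p :: "'a \<Rightarrow> 'a"
    using prod.remove[OF assms, of "\<lambda>k. (A(i := w)) k (p k)"] by (auto intro!: prod.cong)
  show ?thesis
    unfolding det_on_def *
    by (simp add: algebra_simps sum.distrib sum_distrib_left)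
qed

lemma ex_enumeration: "finite S \<Longrightarrow> \<exists>f. bij_betw f {0..<card S} S"
  by (rule ex_bij_betw_nat_finite)

lemma det_on_identical_rows:
  assumes fin: "finite S" and ij: "i \<in> S" "j \<in> S" "i \<noteq> j" and eq: "\<And>k. k \<in> S \<Longrightarrow> A i k = A j k"
  shows "det_on S A = 0"
proof -
  obtain f where f: "bij_betw f {0..<card S} S" using ex_enumeration[OF fin] by blast
  then have im: "f ` {0..<card S} = S" by (simp add: bij_betw_def)
  have "i \<in> f ` {0..<card S}" "j \<in> f ` {0..<card S}" using im ij by simp_all
  then obtain a b where ab: "a < card S" "b < card S" "f a = i" "f b = j" by auto
  have fS: "m < card S \<Longrightarrow> f m \<in> S" for m using im by auto
  have "A (f a) (f m) = A (f b) (f m)" if "m < card S" for m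
    using eq[OF fS[OF that]] ab by simp
  then have r: "row (mat (card S) (card S) (\<lambda>(i, j). A (f i) (f j))) a = row (mat (card S) (card S) (\<lambda>(i, j). A (f i) (f j))) b"
    using ab(1,2) by (intro eq_vecI) simp_all
  have "a \<noteq> b" using ab(3,4) ij(3) by blast
  then have "det (mat (card S) (card S) (\<lambda>(i, j). A (f i) (f j))) = 0"
    using det_identical_rows[OF mat_carrier _ ab(1,2) r] by blast
  then show ?thesis using det_on_eq_det[OF f] by metis
qed

lemma det_on_row_add:
  assumes "finite S" "i \<in> S" "k \<in> S" "i \<noteq> k"
  shows "det_on S (A(i := \<lambda>j. A i j + c * A k j)) = det_on S A"
  using det_on_row_linear[OF assms(1,2), of A "A i" c "A k"]
    det_on_identical_rows[OF assms, of "A(i := A k)"] assms(4)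
  by simp

lemma det_on_mult:
  assumes fin: "finite S"
  shows "det_on S (\<lambda>i j. \<Sum>k\<in>S. A i k * B k j) = det_on S A * det_on S B"
proof -
  obtain f where f: "bij_betw f {0..<card S} S" using ex_enumeration[OF fin] by blast
  let ?m = "\<lambda>A. mat (card S) (card S) (\<lambda>(i, j). A (f i) (f j))"
  have "?m A * ?m B = ?m (\<lambda>i j. \<Sum>k\<in>S. A i k * B k j)"
    by (rule eq_matI) (auto simp: scalar_prod_def sum.reindex_bij_betw[OF f, symmetric])
  then show ?thesis
    using det_mult[of "?m A" "card S" "?m B"] by (simp add: det_on_eq_det[OF f])
qed

lemma det_on_transpose:
  assumes fin: "finite S"
  shows "det_on S (\<lambda>i j. A j i) = det_on S A"
proof -
  obtain f where f: "bij_betw f {0..<card S} S" using ex_enumeration[OF fin] by blast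
  let ?m = "\<lambda>A. mat (card S) (card S) (\<lambda>(i, j). A (f i) (f j))"
  have "transpose_mat (?m A) = ?m (\<lambda>i j. A j i)" by (rule eq_matI) auto
  then show ?thesis
    using det_transpose[of "?m A" "card S"] by (simp add: det_on_eq_det[OF f])
qed

lemma det_on_block:
  fixes A :: "'a \<Rightarrow> 'a \<Rightarrow> 'f::idom"
  assumes fin: "finite S" "finite T" and disj: "S \<inter> T = {}" and z: "\<And>i j. i \<in> T \<Longrightarrow> j \<in> S \<Longrightarrow> A i j = 0"
  shows "det_on (S \<union> T) A = det_on S A * det_on T A"
proof -
  let ?n = "card S" and ?m = "card T"
  obtain f where f: "bij_betw f {0..<?n} S" using ex_enumeration[OF fin(1)] by blast
  obtain g where g: "bij_betw g {0..<?m} T" using ex_enumeration[OF fin(2)] by blast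
  define h where "h i = (if i < ?n then f i else g (i - ?n))" for i
  have "bij_betw h {0..<?n} S"
    using f by (subst bij_betw_cong[of _ h f]) (auto simp: h_def)
  moreover have "bij_betw h {?n..<?n+?m} T"
  proof -
    have "bij_betw (\<lambda>i. i - ?n) {?n..<?n+?m} {0..<?m}"
      by (rule bij_betwI[where g = "\<lambda>i. i + ?n"]) auto
    then have "bij_betw (g \<circ> (\<lambda>i. i - ?n)) {?n..<?n+?m} T" using g by (rule bij_betw_trans)
    then show ?thesis by (subst bij_betw_cong[of _ h "g \<circ> (\<lambda>i. i - ?n)"]) (auto simp: h_def)
  qed
  ultimately have "bij_betw h ({0..<?n} \<union> {?n..<?n+?m}) (S \<union> T)"
    by (rule bij_betw_combine) (use disj in auto)
  moreover have "{0..<?n} \<union> {?n..<?n+?m} = {0..<?n+?m}" by auto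
  ultimately have h: "bij_betw h {0..<?n+?m} (S \<union> T)" by simp
  let ?A1 = "mat ?n ?n (\<lambda>(i, j). A (f i) (f j))" and ?A2 = "mat ?n ?m (\<lambda>(i, j). A (f i) (g j))"
    and ?A4 = "mat ?m ?m (\<lambda>(i, j). A (g i) (g j))"
  have fS: "i < ?n \<Longrightarrow> f i \<in> S" for i using f by (auto simp: bij_betw_def)
  have gT: "i < ?m \<Longrightarrow> g i \<in> T" for i using g by (auto simp: bij_betw_def)
  have "mat (?n+?m) (?n+?m) (\<lambda>(i, j). A (h i) (h j)) = four_block_mat ?A1 ?A2 (0\<^sub>m ?m ?n) ?A4"
    by (rule eq_matI) (auto simp: h_def z fS gT)
  then show ?thesis
    using det_four_block_mat_lower_left_zero[of ?A1 ?n ?A2 ?m "0\<^sub>m ?m ?n" ?A4]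
    by (simp add: det_on_eq_det[OF f] det_on_eq_det[OF g] det_on_eq_det[OF h])
qed

text \<open>Cramer's rule, read for rows: the coefficients of a vector in the basis formed by the rows.\<close>

lemma row_expansion:
  fixes R :: "'a \<Rightarrow> 'a \<Rightarrow> 'f::field"
  assumes fin: "finite S" and nz: "det_on S R \<noteq> 0" and j: "j \<in> S"
  shows "x j = (\<Sum>i\<in>S. det_on S (R(i := x)) / det_on S R * R i j)"
proof -
  obtain f where f: "bij_betw f {0..<card S} S" using ex_enumeration[OF fin] by blast
  define n where "n = card S"
  note f = f[folded n_def]
  let ?m = "\<lambda>A. mat n n (\<lambda>(i, j). A (f i) (f j))"
  have fS: "i < n \<Longrightarrow> f i \<in> S" for i using f by (auto simp: bij_betw_def)
  have "det (?m R) \<noteq> 0" using nz det_on_eq_det[OF f] by metis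
  then obtain B where B: "B \<in> carrier_mat n n" "B * ?m R = 1\<^sub>m n"
    using det_non_zero_imp_unit[of "?m R" n] by (auto simp: Units_def ring_mat_def)
  define g where "g = inv_into {0..<n} f"
  have gf: "i < n \<Longrightarrow> g (f i) = i" for i using f by (auto simp: g_def bij_betw_def)
  have fg: "i \<in> S \<Longrightarrow> f (g i) = i" "i \<in> S \<Longrightarrow> g i < n" for i
    using f by (auto simp: g_def bij_betw_def f_inv_into_f)
  have BR: "(\<Sum>k\<in>S. B $$ (g i, g k) * R k j) = of_bool (i = j)" if "i \<in> S" "j \<in> S" for i j
  proof -
    have "(\<Sum>k\<in>S. B $$ (g i, g k) * R k j) = (B * ?m R) $$ (g i, g j)"
      using that B(1) fg
      by (auto simp: scalar_prod_def sum.reindex_bij_betw[OF f, symmetric] gf intro!: sum.cong)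
    also have "\<dots> = of_bool (i = j)" unfolding B(2) using that fg by (auto) (metis fg(1))
    finally show ?thesis .
  qed
  define c where "c k = (\<Sum>i\<in>S. x i * B $$ (g i, g k))" for k
  have xc: "x j = (\<Sum>k\<in>S. c k * R k j)" if "j \<in> S" for j
  proof -
    have "(\<Sum>k\<in>S. c k * R k j) = (\<Sum>i\<in>S. x i * (\<Sum>k\<in>S. B $$ (g i, g k) * R k j))"
      unfolding c_def sum_distrib_right sum_distrib_left
      by (subst sum.swap) (simp add: mult.assoc)
    also have "\<dots> = (\<Sum>i\<in>S. x i * of_bool (i = j))"
      by (intro sum.cong refl) (simp add: BR that)
    also have "\<dots> = x j" using that fin by (simp add: of_bool_def if_distrib cong: if_cong)
    finally show ?thesis by simp
  qed
  have "det_on S (R(i := x)) = c i * det_on S R" if i: "i \<in> S" for i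
  proof -
    have *: "det_on S (R(i := \<lambda>j. \<Sum>k\<in>F. c k * R k j)) = (if i \<in> F then c i * det_on S R else 0)"
      if "finite F" "F \<subseteq> S" for F
      using that
    proof induction
      case empty
      have "det_on S (R(i := \<lambda>j. 0)) = 0"
        using det_on_row_linear[OF fin i, of R "\<lambda>_. 0" "-1" "\<lambda>_. 0"] by (simp del: fun_upd_apply)
      then show ?case by (simp del: fun_upd_apply)
    next
      case (insert k F)
      have "(\<lambda>j. \<Sum>k\<in>insert k F. c k * R k j) = (\<lambda>j. (\<Sum>k\<in>F. c k * R k j) + c k * R k j)"
        using insert by (auto simp: add.commute)
      then have "det_on S (R(i := \<lambda>j. \<Sum>k\<in>insert k F. c k * R k j)) =
         (if i \<in> F then c i * det_on S R else 0) + c k * det_on S (R(i := R k))"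
        using det_on_row_linear[OF fin i, of R "\<lambda>j. \<Sum>k\<in>F. c k * R k j" "c k" "R k"] insert
        by (simp del: fun_upd_apply)
      moreover have "det_on S (R(i := R k)) = 0" if "i \<noteq> k"
        using that insert i by (intro det_on_identical_rows[OF fin, of i k]) auto
      ultimately show ?case using insert.hyps by (cases "i = k") (auto simp del: fun_upd_apply)
    qed
    have "det_on S (R(i := x)) = det_on S (R(i := \<lambda>j. \<Sum>k\<in>S. c k * R k j))"
      by (rule det_on_cong) (auto simp: xc)
    then show ?thesis using *[OF fin] i by simp
  qed
  then show ?thesis using xc[OF j] nz by simp
qed

text \<open>Replacing several rows of an invertible matrix multiplies its determinant by the determinant
  of the coefficients of the new rows in the basis of the old ones.\<close>

lemma det_on_replace_rows:
  fixes R :: "'a \<Rightarrow> 'a \<Rightarrow> 'f::field"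
  assumes fin: "finite S" and C: "C \<subseteq> S" and nz: "det_on S R \<noteq> 0"
  shows "det_on S (\<lambda>i. if i \<in> C then x i else R i) =
     det_on S R * det_on C (\<lambda>i j. det_on S (R(j := x i)) / det_on S R)"
proof -
  define H where "H i j = (if i \<in> C then det_on S (R(j := x i)) / det_on S R else of_bool (i = j))" for i j
  have "det_on S (\<lambda>i. if i \<in> C then x i else R i) = det_on S (\<lambda>i j. \<Sum>k\<in>S. H i k * R k j)"
  proof (rule det_on_cong)
    fix i j assume "i \<in> S" "j \<in> S"
    then show "(if i \<in> C then x i else R i) j = (\<Sum>k\<in>S. H i k * R k j)"
      using row_expansion[OF fin nz, of j "x i"] fin
      by (auto simp: H_def of_bool_def if_distrib[of "\<lambda>t. t * _"] cong: if_cong)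
  qed
  also have "\<dots> = det_on S H * det_on S R" by (rule det_on_mult[OF fin])
  also have "det_on S H = det_on C H"
  proof -
    have "F \<subseteq> S - C \<Longrightarrow> det_on S H = det_on (S - F) H" if "finite F" for F
      using that
    proof induction
      case (insert y F)
      have "det_on (S - F) H = det_on (S - F - {y}) H"
        by (rule det_on_unit) (use insert fin in \<open>auto simp: H_def\<close>)
      then show ?case using insert Diff_insert[of S y F] by simp
    qed simp
    from this[of "S - C"] show ?thesis using fin C by (simp add: double_diff)
  qed
  also have "det_on C H = det_on C (\<lambda>i j. det_on S (R(j := x i)) / det_on S R)"
    by (rule det_on_cong) (auto simp: H_def)
  finally show ?thesis by simp
qed

section \<open>Random walks along a wiring\<close>

text \<open>
  Row \<open>s\<close> of the identity minus the transition matrix. \<open>A j s\<close> means that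
  \<open>j\<close> precedes \<open>s\<close>, and \<open>und s = Some (T, v)\<close> that
  \<open>s\<close> passes under \<open>v\<close> with weight \<open>T\<close>; a state without
  predecessor is absorbing.
\<close>

definition walk_row :: "('a \<Rightarrow> 'a \<Rightarrow> bool) \<Rightarrow> ('a \<Rightarrow> ('f \<times> 'a) option) \<Rightarrow> 'a \<Rightarrow> 'a \<Rightarrow> 'f::comm_ring_1" where
  "walk_row A und s j = of_bool (s = j) -
     (case und s of None \<Rightarrow> of_bool (A j s)
      | Some (T, v) \<Rightarrow> T * of_bool (A j s) + (1 - T) * of_bool (v = j))"

definition walk_det :: "'a set \<Rightarrow> ('a \<Rightarrow> 'a \<Rightarrow> bool) \<Rightarrow> ('a \<Rightarrow> ('f \<times> 'a) option) \<Rightarrow> 'f::comm_ring_1" where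
  "walk_det S A und = det_on S (walk_row A und)"

definition wiring :: "('a \<Rightarrow> 'a \<Rightarrow> bool) \<Rightarrow> bool" where
  "wiring A \<longleftrightarrow> (\<forall>a b c. A a c \<longrightarrow> A b c \<longrightarrow> a = b) \<and> (\<forall>a b c. A a b \<longrightarrow> A a c \<longrightarrow> b = c)"

lemma wiring_pred: "wiring A \<Longrightarrow> A a c \<Longrightarrow> A b c \<longleftrightarrow> b = a"
  and wiring_succ: "wiring A \<Longrightarrow> A a b \<Longrightarrow> A a c \<longleftrightarrow> c = b"
  by (auto simp: wiring_def)

lemma walk_det_cong:
  assumes "\<And>j s. j \<in> S \<Longrightarrow> s \<in> S \<Longrightarrow> A j s \<longleftrightarrow> B j s" "\<And>s. s \<in> S \<Longrightarrow> und s = und' s"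
  shows "walk_det S A und = walk_det S B und'"
  unfolding walk_det_def walk_row_def by (intro det_on_cong) (simp add: assms)

lemma walk_det_reindex:
  assumes f: "bij_betw f S S'" and fin: "finite S"
    and A: "\<And>j s. j \<in> S \<Longrightarrow> s \<in> S \<Longrightarrow> A' (f j) (f s) \<longleftrightarrow> A j s"
    and und: "\<And>s. s \<in> S \<Longrightarrow> und' (f s) = map_option (map_prod id f) (und s)"
    and ran: "\<And>s T v. s \<in> S \<Longrightarrow> und s = Some (T, v) \<Longrightarrow> v \<in> S"
  shows "walk_det S' A' und' = walk_det S A und"
proof -
  have inj: "f i = f j \<longleftrightarrow> i = j" if "i \<in> S" "j \<in> S" for i j
    using f that by (auto simp: bij_betw_def inj_on_def)
  show ?thesis
    unfolding walk_det_def det_on_reindex[OF f fin]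
    by (rule det_on_cong) (auto simp: walk_row_def A und inj ran split: option.splits)
qed

definition bypass :: "'a \<Rightarrow> ('a \<Rightarrow> 'a \<Rightarrow> bool) \<Rightarrow> 'a \<Rightarrow> 'a \<Rightarrow> bool" where
  "bypass x A j s \<longleftrightarrow> j \<noteq> x \<and> s \<noteq> x \<and> (A j s \<or> A j x \<and> A x s)"

lemma wiring_bypass: "wiring A \<Longrightarrow> wiring (bypass x A)"
  unfolding wiring_def bypass_def by blast

definition unreferenced :: "'a set \<Rightarrow> ('a \<Rightarrow> ('f \<times> 'a) option) \<Rightarrow> 'a \<Rightarrow> bool" where
  "unreferenced S und x \<longleftrightarrow> (\<forall>s\<in>S. \<forall>T. und s \<noteq> Some (T, x))"

text \<open>
  Adding a multiple of row \<open>x\<close> to the row of the successor of \<open>x\<close> clears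
  the column of \<open>x\<close>. This removes virtual passages and joins components.
\<close>

lemma walk_det_bypass:
  assumes fin: "finite S" and x: "x \<in> S" "und x = None" "\<not> A x x" and w: "wiring A"
    and unref: "unreferenced S und x"
  shows "walk_det S A und = walk_det (S - {x}) (bypass x A) und"
proof (cases "\<exists>s\<in>S. A x s")
  case False
  have "walk_det S A und = det_on (S - {x}) (walk_row A und)"
    unfolding walk_det_def using False unref
    by (intro det_on_unit[OF fin x(1)])
       (auto simp: walk_row_def x unreferenced_def split: option.splits)
  also have "\<dots> = walk_det (S - {x}) (bypass x A) und"
    unfolding walk_det_def using False
    by (intro det_on_cong) (auto simp: walk_row_def bypass_def split: option.splits)
  finally show ?thesis .
next
  case True
  then obtain y where y: "y \<in> S" "A x y" by blast
  have xy: "x \<noteq> y" using x y by auto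
  let ?R = "walk_row A und"
  define R where "R = ?R(y := \<lambda>j. ?R y j + (- ?R y x) * ?R x j)"
  have rx: "?R x x = 1" by (simp add: walk_row_def x)
  have "walk_det S A und = det_on S R"
    unfolding walk_det_def R_def using det_on_row_add[OF fin y(1) x(1), of ?R "- ?R y x"] xy by simp
  also have "\<dots> = det_on (S - {x}) R"
    by (intro det_on_unit[OF fin x(1)])
       (use xy unref in \<open>auto simp: R_def rx walk_row_def wiring_succ[OF w y(2)] x unreferenced_def split: option.splits\<close>)
  also have "\<dots> = walk_det (S - {x}) (bypass x A) und"
    unfolding walk_det_def
  proof (rule det_on_cong)
    fix i j assume ij: "i \<in> S - {x}" "j \<in> S - {x}"
    then show "R i j = walk_row (bypass x A) und i j"
      using unref y(1) xy
      by (cases "i = y")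
         (auto simp: R_def walk_row_def bypass_def x wiring_succ[OF w y(2)] wiring_pred[OF w y(2)]
            unreferenced_def split: option.splits)
  qed
  finally show ?thesis .
qed

text \<open>A step onto a state that is left with certainty may be replaced by the step after it.\<close>

definition redirect :: "'a \<Rightarrow> 'a \<Rightarrow> ('a \<Rightarrow> ('f \<times> 'a) option) \<Rightarrow> 'a \<Rightarrow> ('f \<times> 'a) option" where
  "redirect x y und s = map_option (map_prod id (\<lambda>v. if v = x then y else v)) (und s)"

lemma walk_det_redirect:
  assumes fin: "finite S" and x: "x \<in> S" "und x = None" and w: "wiring A" and y: "A y x"
  shows "walk_det S A (redirect x y und) = walk_det S A und"
proof -
  have *: "walk_det S A (\<lambda>s. if s \<in> F then redirect x y und s else und s) = walk_det S A und"
    if "finite F" "F \<subseteq> S" for F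
    using that
  proof induction
    case (insert s F)
    let ?u = "\<lambda>F s. if s \<in> F then redirect x y und s else und s"
    show ?case
    proof (cases "\<exists>T. und s = Some (T, x)")
      case False
      then have "?u (insert s F) = ?u F"
        by (cases "und s") (auto simp: redirect_def fun_eq_iff)
      then show ?thesis using insert by simp
    next
      case True
      then obtain T where T: "und s = Some (T, x)" by blast
      have sx: "s \<noteq> x" using T x by auto
      let ?R = "walk_row A (?u F)"
      have "walk_det S A (?u (insert s F)) = det_on S (?R(s := \<lambda>j. ?R s j + (1 - T) * ?R x j))"
        unfolding walk_det_def
        by (intro det_on_cong)
           (use insert x in \<open>auto simp: walk_row_def T redirect_def wiring_pred[OF w y] algebra_simps\<close>)
      also have "\<dots> = walk_det S A (?u F)"
        unfolding walk_det_def by (intro det_on_row_add) (use fin insert x sx in auto)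
      finally show ?thesis using insert by simp
    qed
  qed simp
  have "walk_det S A (redirect x y und) = walk_det S A (\<lambda>s. if s \<in> S then redirect x y und s else und s)"
    by (rule walk_det_cong) auto
  then show ?thesis using *[OF fin] by simp
qed

definition swap_states :: "'a \<Rightarrow> 'a \<Rightarrow> ('a \<Rightarrow> 'a \<Rightarrow> bool) \<Rightarrow> 'a \<Rightarrow> 'a \<Rightarrow> bool" where
  "swap_states x y A j s \<longleftrightarrow> A (Transposition.transpose x y j) (Transposition.transpose x y s)"

lemma wiring_swap_states: "wiring A \<Longrightarrow> wiring (swap_states x y A)"
  unfolding wiring_def swap_states_def by (metis transpose_involutory)

lemma swap_states_commute: "swap_states x y A = swap_states y x A"
  by (simp add: swap_states_def fun_eq_iff transpose_commute)

lemma swap_states_swap_states [simp]: "swap_states x y (swap_states x y A) = A"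
  by (simp add: swap_states_def fun_eq_iff)

lemma bypass_swap_states:
  assumes w: "wiring A" and xy: "x \<noteq> y" "A x y \<or> A y x"
  shows "bypass x (swap_states x y A) = bypass x A"
proof -
  have *: "bypass x (swap_states x y A) j s \<longleftrightarrow> bypass x A j s" for j s
    using xy(2)
  proof
    assume a: "A x y"
    have "\<not> A x x" "\<not> A y y" using a xy w by (auto simp: wiring_def)
    then show ?thesis using xy(1)
      by (auto simp: bypass_def swap_states_def transpose_def wiring_succ[OF w a] wiring_pred[OF w a])
  next
    assume a: "A y x"
    have "\<not> A x x" "\<not> A y y" using a xy w by (auto simp: wiring_def)
    then show ?thesis using xy(1)
      by (auto simp: bypass_def swap_states_def transpose_def wiring_succ[OF w a] wiring_pred[OF w a])
  qed
  then show ?thesis by blast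
qed

lemma walk_det_swap_virtual:
  assumes fin: "finite S" and x: "x \<in> S" "und x = None" "unreferenced S und x"
    and w: "wiring A" and xy: "x \<noteq> y" "A x y \<or> A y x"
  shows "walk_det S (swap_states x y A) und = walk_det S A und"
proof -
  have n: "\<not> A x x" "\<not> A y y" using xy w by (auto simp: wiring_def)
  then have "\<not> swap_states x y A x x" by (simp add: swap_states_def)
  then show ?thesis
    using walk_det_bypass[OF fin x(1,2) _ wiring_swap_states[OF w] x(3)]
      walk_det_bypass[OF fin x(1,2) n(1) w x(3)] bypass_swap_states[OF w xy] by metis
qed

text \<open>
  Two neighbouring states without a choice have the same distribution after one more step, so
  exchanging them only redirects references along the strand. This is the content of OC.
\<close>

lemma walk_det_swap_over:
  assumes fin: "finite S" and x: "x \<in> S" "und x = None" and y: "y \<in> S" "und y = None"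
    and w: "wiring A" and xy: "x \<noteq> y" "A x y" and i: "A i x"
  shows "walk_det S (swap_states x y A) und = walk_det S A und"
proof (cases "i = y")
  case True
  then have "swap_states x y A = A"
    using xy i w by (auto simp: swap_states_def transpose_def fun_eq_iff wiring_def)
  then show ?thesis by simp
next
  case False
  have ix: "i \<noteq> x" using i xy w by (auto simp: wiring_def)
  let ?B = "swap_states x y A"
  define u where "u = redirect x i (redirect y x und)"
  have u': "u = redirect y i (redirect x y und)"
    using ix False by (auto simp: u_def redirect_def fun_eq_iff option.map_comp comp_def map_prod_def split_beta
      intro!: option.map_cong0)
  have "walk_det S A und = walk_det S A u"
    unfolding u_def using w i xy(2) x y
    by (simp add: walk_det_redirect[OF fin] redirect_def)
  moreover have "walk_det S ?B und = walk_det S ?B u"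
  proof -
    have "?B y x" "?B i y" using xy i ix False by (simp_all add: swap_states_def)
    then show ?thesis
      unfolding u' using wiring_swap_states[OF w] x y
      by (simp add: walk_det_redirect[OF fin] redirect_def)
  qed
  moreover have "walk_det S ?B u = walk_det S A u"
    by (rule walk_det_swap_virtual[OF fin x(1) _ _ w xy(1)])
       (use x xy ix in \<open>auto simp: u_def redirect_def unreferenced_def\<close>)
  ultimately show ?thesis by simp
qed

text \<open>Eliminating \<open>x\<close>, which only row \<open>y\<close> refers to.\<close>

lemma det_on_eliminate_pair:
  assumes fin: "finite S" and xy: "x \<in> S" "y \<in> S" "x \<noteq> y" and p: "p \<in> S - {x, y}"
    and same: "\<And>i. i \<in> S - {x, y} \<Longrightarrow> R i = R' i"
    and col: "\<And>i. i \<in> S - {x, y} \<Longrightarrow> R i x = 0"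
    and diag: "R x x = 1" "R' x x = 1"
    and eq: "\<And>j. j \<in> S - {x} \<Longrightarrow> R' y j - R' y x * R' x j = R y j - R y x * R x j + c * R p j"
  shows "det_on S R = det_on S R'"
proof -
  define Q where "Q R = R(y := \<lambda>j. R y j + (- R y x) * R x j)" for R :: "'a \<Rightarrow> 'a \<Rightarrow> 'b"
  have Q: "det_on S R = det_on (S - {x}) (Q R)" if "\<And>i. i \<in> S - {x, y} \<Longrightarrow> R i x = 0" "R x x = 1" for R
  proof -
    have "det_on S R = det_on S (Q R)"
      unfolding Q_def using det_on_row_add[OF fin xy(2,1), of R "- R y x"] xy(3) by simp
    also have "\<dots> = det_on (S - {x}) (Q R)"
      by (rule det_on_unit[OF fin xy(1)]) (use that xy in \<open>auto simp: Q_def\<close>)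
    finally show ?thesis .
  qed
  have "det_on (S - {x}) (Q R') = det_on (S - {x}) ((Q R)(y := \<lambda>j. Q R y j + c * Q R p j))"
  proof (rule det_on_cong)
    fix i j assume ij: "i \<in> S - {x}" "j \<in> S - {x}"
    show "Q R' i j = ((Q R)(y := \<lambda>j. Q R y j + c * Q R p j)) i j"
    proof (cases "i = y")
      case True
      then show ?thesis using eq[OF ij(2)] p by (simp add: Q_def)
    next
      case False
      then show ?thesis using same[of i] ij by (simp add: Q_def)
    qed
  qed
  also have "\<dots> = det_on (S - {x}) (Q R)"
    by (rule det_on_row_add) (use fin xy p in auto)
  finally show ?thesis using Q[of R] Q[of R'] col diag same by simp
qed

text \<open>
  The two lower passages in succession jump to the upper strand with total weight \<open>T' (1 - T)
  + (1 - T') = 1 - T T' = 0\<close>, so the walk runs straight through: this is R2. The condition on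
  \<open>v\<close> and \<open>v'\<close> says that the upper passages are neighbours.
\<close>

lemma walk_det_cancel_bigon:
  assumes fin: "finite S" and xy: "x \<in> S" "y \<in> S" "x \<noteq> y" "A x y" and w: "wiring A"
    and und: "und x = Some (T, v)" "und y = Some (T', v')" "T * T' = 1"
    and v: "v \<in> S" "v' \<in> S" "und v = None" "und v' = None" "A v v' \<or> A v' v"
    and unref: "unreferenced S und x"
  shows "walk_det S A und = walk_det S A (und(x := None, y := None))"
proof -
  have nx: "\<not> A x x" using xy w by (auto simp: wiring_def)
  have core: "walk_det S A u = walk_det S A (u(x := None, y := None))"
    if u: "u x = Some (T, o')" "u y = Some (T', o')" "o' \<in> S - {x, y}" and unref: "unreferenced S u x" for u o'
    unfolding walk_det_def
  proof (rule det_on_eliminate_pair[OF fin xy(1,2,3) u(3), where c=0])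
    show "walk_row A u i = walk_row A (u(x := None, y := None)) i" if "i \<in> S - {x, y}" for i
      using that by (auto simp: walk_row_def fun_eq_iff)
    show "walk_row A u i x = 0" if "i \<in> S - {x, y}" for i
      using that unref by (auto simp: walk_row_def wiring_succ[OF w xy(4)] unreferenced_def split: option.splits)
    show "walk_row A u x x = 1" "walk_row A (u(x := None, y := None)) x x = 1"
      using nx u by (auto simp: walk_row_def)
    fix j assume j: "j \<in> S - {x}"
    have 1: "walk_row A u y j - walk_row A u y x * walk_row A u x j =
      of_bool (y = j) - (T * T') * of_bool (A j x) - (1 - T * T') * of_bool (o' = j)"
      using j xy u unref by (auto simp: walk_row_def wiring_pred[OF w xy(4)] algebra_simps)
    show "walk_row A (u(x := None, y := None)) y j - walk_row A (u(x := None, y := None)) y x * walk_row A (u(x := None, y := None)) x j =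
      walk_row A u y j - walk_row A u y x * walk_row A u x j + 0 * walk_row A u o' j"
      unfolding 1 und(3) using j xy by (auto simp: walk_row_def wiring_pred[OF w xy(4)])
  qed
  have vx: "v \<noteq> x" "v \<noteq> y" "v' \<noteq> x" "v' \<noteq> y" using und v by auto
  from v(5) show ?thesis
  proof
    assume a: "A v v'"
    let ?u = "redirect v' v und"
    have "walk_det S A und = walk_det S A ?u"
      using walk_det_redirect[where und=und, OF fin v(2,4) w a] by simp
    also have "\<dots> = walk_det S A (?u(x := None, y := None))"
      by (rule core[of _ v]) (use und v vx unref in \<open>auto simp: redirect_def unreferenced_def\<close>)
    also have "?u(x := None, y := None) = redirect v' v (und(x := None, y := None))"
      by (auto simp: redirect_def fun_eq_iff)
    also have "walk_det S A \<dots> = walk_det S A (und(x := None, y := None))"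
      by (rule walk_det_redirect[OF fin v(2) _ w a]) (use v vx in auto)
    finally show ?thesis .
  next
    assume a: "A v' v"
    let ?u = "redirect v v' und"
    have "walk_det S A und = walk_det S A ?u"
      using walk_det_redirect[where und=und, OF fin v(1,3) w a] by simp
    also have "\<dots> = walk_det S A (?u(x := None, y := None))"
      by (rule core[of _ v']) (use und v vx unref in \<open>auto simp: redirect_def unreferenced_def\<close>)
    also have "?u(x := None, y := None) = redirect v v' (und(x := None, y := None))"
      by (auto simp: redirect_def fun_eq_iff)
    also have "walk_det S A \<dots> = walk_det S A (und(x := None, y := None))"
      by (rule walk_det_redirect[OF fin v(1) _ w a]) (use v vx in auto)
    finally show ?thesis .
  qed
qed

text \<open>
  Both rows of the crossing are combinations of the same four vectors, and the determinant is
  bilinear and alternating in this pair of rows.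
\<close>

lemma walk_det_skein:
  fixes T :: "'f::field"
  assumes fin: "finite S" and xy: "x \<in> S" "y \<in> S" "x \<noteq> y"
    and und: "und x = None" "und y = None" and T: "T \<noteq> 0"
  shows "walk_det S A (und(y := Some (T, x))) - T * walk_det S A (und(x := Some (inverse T, y))) =
     (1 - T) * walk_det S (\<lambda>j s. A j (Transposition.transpose x y s)) und"
proof -
  define W where "W u v = det_on S ((walk_row A und)(x := u, y := v))" for u v
  have L1: "W (\<lambda>j. u j + c * u' j) v = W u v + c * W u' v" for u u' v c
    unfolding W_def
    using det_on_row_linear[OF fin xy(1), of "(walk_row A und)(y := v)" u c u'] xy(3)
    by (simp add: fun_upd_twist)
  have L2: "W v (\<lambda>j. u j + c * u' j) = W v u + c * W v u'" for u u' v c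
    unfolding W_def using det_on_row_linear[OF fin xy(2), of "(walk_row A und)(x := v)" u c u'] by simp
  have alt0: "W u u = 0" for u
    unfolding W_def by (rule det_on_identical_rows[OF fin xy]) (use xy in auto)
  have alt: "W u v = - W v u" for u v
    using alt0[of "\<lambda>j. u j + 1 * v j"] unfolding L1 L2 by (simp add: alt0 add_eq_0_iff)
  define a where "a j = (of_bool (x = j) :: 'f)" for j
  define b where "b j = (of_bool (y = j) :: 'f)" for j
  define p where "p j = (of_bool (A j x) :: 'f)" for j
  define q where "q j = (of_bool (A j y) :: 'f)" for j
  have 1: "walk_det S A (und(y := Some (T, x))) =
      W (\<lambda>j. a j + (-1) * p j) (\<lambda>j. (b j + (- T) * q j) + (T - 1) * a j)"
    unfolding walk_det_def W_def
    by (rule det_on_cong) (use xy und in \<open>auto simp: walk_row_def a_def b_def p_def q_def algebra_simps\<close>)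
  have 2: "walk_det S A (und(x := Some (inverse T, y))) =
      W (\<lambda>j. (a j + (- inverse T) * p j) + (inverse T - 1) * b j) (\<lambda>j. b j + (-1) * q j)"
    unfolding walk_det_def W_def
    by (rule det_on_cong) (use xy und in \<open>auto simp: walk_row_def a_def b_def p_def q_def algebra_simps\<close>)
  have 3: "walk_det S (\<lambda>j s. A j (Transposition.transpose x y s)) und =
      W (\<lambda>j. a j + (-1) * q j) (\<lambda>j. b j + (-1) * p j)"
    unfolding walk_det_def W_def
    by (rule det_on_cong) (use xy und in \<open>auto simp: walk_row_def a_def b_def p_def q_def transpose_def\<close>)
  have e: "T * (inverse T * z) = z" for z using T by (simp add: mult.assoc[symmetric])
  show ?thesis
    unfolding 1 2 3 L1 L2 alt0 alt[of b a] alt[of p a] alt[of q a] alt[of p b] alt[of q b] alt[of q p]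
    by (simp add: algebra_simps e)
qed

text \<open>
  Passing under \<open>v\<close> sends \<open>s\<close> to \<open>T s + (1 - T) v\<close>, and such
  affine maps satisfy the self-distributive law. So the order in which a strand passes under
  \<open>v\<close> and under \<open>m\<close> may be exchanged if \<open>m\<close> is replaced by
  the state on the other side of the lower passage \<open>p\<close> of its own strand under
  \<open>v\<close>.
\<close>

lemma walk_det_exchange_unders:
  assumes fin: "finite S" and pqr: "p \<in> S" "q \<in> S" "r \<in> S" "p \<noteq> q" "p \<noteq> r" "q \<noteq> r"
    and w: "wiring A" and A: "A q r" "A u p" and v: "v \<in> S" "v \<noteq> q" "v \<noteq> r" and uS: "u \<in> S"
    and und: "und p = Some (T, v)" "und r = Some (T', v)"
    and unref: "unreferenced (S - {q}) und q" "unreferenced (S - {q}) und r"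
    and m: "(m = p \<and> m' = Transposition.transpose q r u \<and> T * T' = 1) \<or> (m = u \<and> m' = p \<and> T = T')"
  shows "walk_det S (swap_states q r A) (und(q := Some (s, m'))) = walk_det S A (und(q := Some (s, m)))"
proof -
  define t where "t = Transposition.transpose q r"
  have tt [simp]: "t (t i) = i" for i by (simp add: t_def)
  have tq: "t q = r" "t r = q" and tn: "i \<noteq> q \<Longrightarrow> i \<noteq> r \<Longrightarrow> t i = i" for i by (auto simp: t_def transpose_def)
  have uq: "u \<noteq> q" using A pqr w by (auto simp: wiring_def)
  have nq: "\<not> A q q" using A pqr w by (auto simp: wiring_def)
  have bij: "bij_betw t S S"
    by (rule bij_betwI[of t _ _ t]) (use pqr in \<open>auto simp: t_def transpose_def\<close>)
  define h where "h \<longleftrightarrow> m = u \<and> m' = p \<and> T = T'"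
  have h': "m = p \<and> m' = t u \<and> T * T' = 1" if "\<not> h" using m that by (auto simp: h_def t_def)
  define n where "n = (if h then p else u)"
  have n: "t m' = n" "n \<noteq> q" using h' pqr uq tn by (auto simp: n_def h_def)
  have mq: "m \<noteq> q" using m pqr uq by auto
  have "walk_det S (swap_states q r A) (und(q := Some (s, m'))) = walk_det S A (und(q := Some (T', v), r := Some (s, n)))"
    unfolding walk_det_def
  proof (subst det_on_reindex[OF bij fin], rule det_on_cong)
    fix i j assume ij: "i \<in> S" "j \<in> S"
    have eq: "t i = t j \<longleftrightarrow> i = j" "r = t j \<longleftrightarrow> q = j" "q = t j \<longleftrightarrow> r = j" for i j
      by (metis tt, (metis tt tq)+)
    consider "i = q" | "i = r" | "i \<noteq> q" "i \<noteq> r" by blast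
    then show "walk_row (swap_states q r A) (und(q := Some (s, m'))) (t i) (t j) =
       walk_row A (und(q := Some (T', v), r := Some (s, n))) i j"
    proof cases
      case 1
      have "v = t j \<longleftrightarrow> v = j" using v by (metis tn tt)
      then show ?thesis using 1 pqr und by (simp add: walk_row_def swap_states_def eq tq t_def[symmetric])
    next
      case 2
      have "m' = t j \<longleftrightarrow> n = j" using n by (metis tt)
      then show ?thesis using 2 pqr und by (simp add: walk_row_def swap_states_def eq tq t_def[symmetric])
    next
      case 3
      have "und i = Some (T'', o') \<Longrightarrow> o' = t j \<longleftrightarrow> o' = j" for T'' o'
        using unref 3 ij tn[of o'] unfolding unreferenced_def by (metis Diff_iff singletonD tt)
      moreover have "t i = i" "i = t j \<longleftrightarrow> i = j" using 3 tn[of i] by (simp, metis tt)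
      ultimately show ?thesis using 3 pqr und
        by (auto simp add: walk_row_def swap_states_def t_def[symmetric] split: option.splits)
    qed
  qed
  also have "\<dots> = walk_det S A (und(q := Some (s, m)))"
    unfolding walk_det_def
  proof (rule det_on_eliminate_pair[OF fin pqr(2,3,6), where p=p and c="if h then 1 - s else (s - 1) * T'"])
    show "p \<in> S - {q, r}" using pqr by simp
    fix i assume i: "i \<in> S - {q, r}"
    show "walk_row A (und(q := Some (T', v), r := Some (s, n))) i = walk_row A (und(q := Some (s, m))) i"
      using i by (auto simp: walk_row_def fun_eq_iff)
    show "walk_row A (und(q := Some (T', v), r := Some (s, n))) i q = 0"
      using i unref by (auto simp: walk_row_def wiring_succ[OF w A(1)] unreferenced_def split: option.splits)
  next
    show "walk_row A (und(q := Some (T', v), r := Some (s, n))) q q = 1" "walk_row A (und(q := Some (s, m))) q q = 1"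
      using nq v pqr mq by (auto simp: walk_row_def)
  next
    fix j assume j: "j \<in> S - {q}"
    show "walk_row A (und(q := Some (s, m))) r j - walk_row A (und(q := Some (s, m))) r q * walk_row A (und(q := Some (s, m))) q j =
      walk_row A (und(q := Some (T', v), r := Some (s, n))) r j -
      walk_row A (und(q := Some (T', v), r := Some (s, n))) r q * walk_row A (und(q := Some (T', v), r := Some (s, n))) q j +
      (if h then 1 - s else (s - 1) * T') * walk_row A (und(q := Some (T', v), r := Some (s, n))) p j"
    proof -
      have Ajr: "\<not> A j r" using j wiring_pred[OF w A(1), of j] by auto
      have rows: "walk_row A (und(q := Some (s, m))) r j = of_bool (r = j) - (1 - T') * of_bool (v = j)"
        "walk_row A (und(q := Some (s, m))) r q = - T'"
        "walk_row A (und(q := Some (s, m))) q j = - s * of_bool (A j q) - (1 - s) * of_bool (m = j)"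
        "walk_row A (und(q := Some (T', v), r := Some (s, n))) r j = of_bool (r = j) - (1 - s) * of_bool (n = j)"
        "walk_row A (und(q := Some (T', v), r := Some (s, n))) r q = - s"
        "walk_row A (und(q := Some (T', v), r := Some (s, n))) q j = - T' * of_bool (A j q) - (1 - T') * of_bool (v = j)"
        "walk_row A (und(q := Some (T', v), r := Some (s, n))) p j = of_bool (p = j) - T * of_bool (u = j) - (1 - T) * of_bool (v = j)"
        using j pqr und v A(1) n Ajr wiring_pred[OF w A(2), of j] by (auto simp: walk_row_def)
      show ?thesis
      proof (cases h)
        case True
        then show ?thesis unfolding rows by (simp add: n_def h_def algebra_simps)
      next
        case False
        then have e: "T * (T' * z) = z" "T' * (T * z) = z" for z
          using h' by (metis mult.assoc mult.commute mult_1)+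
        show ?thesis unfolding rows using False h'[OF False] by (simp add: n_def algebra_simps e)
      qed
    qed
  qed
  finally show ?thesis .
qed

text \<open>
  The move R3: the bottom strand meets \<open>q\<close> and \<open>r\<close>, the middle strand
  meets \<open>p\<close> and \<open>v\<close>, and \<open>p\<close> and \<open>r\<close> both pass
  under the top strand, represented by a single state \<open>x\<close>.
\<close>

lemma walk_det_slide:
  assumes fin: "finite S" and S: "{p, v, q, r, x} \<subseteq> S" and dist: "distinct [p, v, q, r]" "x \<notin> {v, q, r}"
    and w: "wiring A" and A: "A q r" and pred: "\<exists>u\<in>S. A u p" "\<exists>u\<in>S. A u v"
    and und: "und p = Some (T, x)" "und v = None" "und q = Some (s, v)" "und r = Some (T', x)"
    and unref: "unreferenced S und p" "unreferenced S und q" "unreferenced S und r" "unreferenced (S - {q}) und v"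
    and rel: "A p v \<and> T * T' = 1 \<or> A v p \<and> T = T'"
  shows "walk_det S (swap_states p v (swap_states q r A)) und = walk_det S A und"
proof -
  let ?C = "swap_states q r A" and ?B = "bypass v A"
  let ?A' = "swap_states p v ?C"
  have C: "?C p v \<longleftrightarrow> A p v" "?C v p \<longleftrightarrow> A v p" using dist by (auto simp: swap_states_def transpose_def)
  have B': "bypass v ?A' = swap_states q r ?B"
  proof -
    have "bypass v ?A' = bypass v ?C"
      using bypass_swap_states[OF wiring_swap_states[OF w], of v p q r] rel dist C
      by (auto simp: swap_states_commute)
    also have "\<dots> = swap_states q r ?B"
      using dist by (auto simp: bypass_def swap_states_def transpose_def fun_eq_iff)
    finally show ?thesis .
  qed
  have nv: "\<not> A v v" using rel dist w by (auto simp: wiring_def)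
  have nv': "\<not> ?A' v v" using rel dist w by (auto simp: wiring_def swap_states_def transpose_def)
  have wB: "wiring ?B" using wiring_bypass[OF w] .
  have w': "wiring ?A'" using w by (intro wiring_swap_states)
  have vS: "v \<in> S" using S by simp
  have elim: "walk_det S X und = walk_det (S - {v}) (bypass v X) (und(q := Some (s, y)))"
    if X: "wiring X" "\<not> X v v" "X y v" for X y
  proof -
    have yv: "y \<noteq> v" using X by auto
    have "walk_det S X und = walk_det S X (redirect v y und)"
      using walk_det_redirect[where und=und, OF fin vS und(2) X(1,3)] by simp
    also have "\<dots> = walk_det (S - {v}) (bypass v X) (redirect v y und)"
      by (rule walk_det_bypass[OF fin vS _ X(2,1)]) (use und yv in \<open>auto simp: redirect_def unreferenced_def\<close>)
    also have "\<dots> = walk_det (S - {v}) (bypass v X) (und(q := Some (s, y)))"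
    proof (rule walk_det_cong)
      fix i assume "i \<in> S - {v}"
      then show "redirect v y und i = (und(q := Some (s, y))) i"
        using und unref(4) by (cases "und i") (auto simp: redirect_def unreferenced_def)
    qed simp
    finally show ?thesis .
  qed
  have step: "walk_det (S - {v}) (swap_states q r ?B) (und(q := Some (s, m'))) = walk_det (S - {v}) ?B (und(q := Some (s, m)))"
    if u: "u \<in> S - {v}" "?B u p" and m: "(m = p \<and> m' = Transposition.transpose q r u \<and> T * T' = 1) \<or> (m = u \<and> m' = p \<and> T = T')"
    for u m m'
    by (rule walk_det_exchange_unders[where p=p and u=u and v=x and T=T and T'=T'])
       (use fin S dist wB A u und unref m in \<open>auto simp: bypass_def unreferenced_def\<close>)
  from rel show ?thesis
  proof
    assume h: "A p v \<and> T * T' = 1"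
    obtain u where u: "u \<in> S" "A u p" using pred by blast
    define u' where "u' = (if u = v then p else u)"
    have np: "u \<noteq> p" using h u w dist by (auto simp: wiring_def)
    have nq: "u \<noteq> q" using u A w dist by (auto simp: wiring_def)
    have Bu: "?B u' p" using h u dist by (auto simp: u'_def bypass_def)
    have "?A' (Transposition.transpose q r u') v"
      using h u dist np nq by (auto simp: u'_def swap_states_def transpose_def)
    from elim[OF w' nv' this] elim[OF w nv, of p] step[of u' p] Bu h u S dist
    show ?thesis unfolding B' by (auto simp: u'_def)
  next
    assume h: "A v p \<and> T = T'"
    obtain u where u: "u \<in> S" "A u v" using pred by blast
    have nv2: "u \<noteq> v" using nv u by auto
    have Bu: "?B u p" using h u nv2 dist by (auto simp: bypass_def)
    have "?A' p v"
      using h u dist by (auto simp: swap_states_def transpose_def)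
    from elim[OF w' nv' this] elim[OF w nv u(2)] step[of u u p] Bu h u S dist nv2
    show ?thesis unfolding B' by auto
  qed
qed

section \<open>Chains of states\<close>

fun adjacent :: "'a list \<Rightarrow> 'a \<Rightarrow> 'a \<Rightarrow> bool" where
  "adjacent (x # y # zs) a b \<longleftrightarrow> a = x \<and> b = y \<or> adjacent (y # zs) a b"
| "adjacent _ a b \<longleftrightarrow> False"

lemma adjacent_Cons: "adjacent (x # xs) a b \<longleftrightarrow> xs \<noteq> [] \<and> a = x \<and> b = hd xs \<or> adjacent xs a b"
  by (cases xs) auto

lemma adjacent_append:
  "adjacent (xs @ ys) a b \<longleftrightarrow>
     adjacent xs a b \<or> adjacent ys a b \<or> xs \<noteq> [] \<and> ys \<noteq> [] \<and> a = last xs \<and> b = hd ys"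
  by (induction xs) (auto simp: adjacent_Cons hd_append)

lemma in_set_tlD: "a \<in> set (tl xs) \<Longrightarrow> a \<in> set xs"
  by (cases xs) auto

lemma adjacent_set: "adjacent xs a b \<Longrightarrow> a \<in> set xs \<and> b \<in> set (tl xs)"
  by (induction xs) (auto simp: adjacent_Cons neq_Nil_conv intro: list.set_sel)

lemma adjacent_unique:
  assumes "distinct xs"
  shows "adjacent xs a c \<Longrightarrow> adjacent xs b c \<Longrightarrow> a = b" "adjacent xs a b \<Longrightarrow> adjacent xs a c \<Longrightarrow> b = c"
    "\<not> adjacent xs (last xs) c"
  using assms
  by (induction xs) (auto simp: adjacent_Cons neq_Nil_conv dest: adjacent_set split: if_splits)

lemma adjacent_map: "inj_on f (set xs) \<Longrightarrow> a \<in> set xs \<Longrightarrow> b \<in> set xs \<Longrightarrow>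
    adjacent (map f xs) (f a) (f b) \<longleftrightarrow> adjacent xs a b"
proof (induction xs)
  case (Cons x xs)
  show ?case
  proof (cases "a \<in> set xs \<and> b \<in> set xs")
    case True
    with Cons show ?thesis by (cases xs) (auto simp: adjacent_Cons inj_on_def)
  next
    case False
    have "\<not> adjacent (map f xs) (f a) (f b)"
    proof
      assume "adjacent (map f xs) (f a) (f b)"
      then have "f a \<in> f ` set xs" "f b \<in> f ` set xs" using adjacent_set[of "map f xs" "f a" "f b"] in_set_tlD[of "f b" "map f xs"] by auto
      then show False using False Cons.prems by (auto simp: inj_on_def)
    qed
    moreover have "\<not> adjacent xs a b" using False adjacent_set[of xs a b] by (auto dest: in_set_tlD)
    ultimately show ?thesis using Cons.prems by (cases xs) (auto simp: inj_on_def)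
  qed
qed simp

definition chain_states :: "'a set \<Rightarrow> ('a \<Rightarrow> 'a list) \<Rightarrow> 'a set" where
  "chain_states K W = (\<Union>k\<in>K. set (k # W k))"

text \<open>
  Chains stand for components: \<open>k\<close> is the head and \<open>W k\<close> the word
  following it. The head of \<open>k\<close> is preceded by the end of the chain \<open>cl
  k\<close>, if any.
\<close>

definition chain_wiring :: "'a set \<Rightarrow> ('a \<Rightarrow> 'a list) \<Rightarrow> ('a \<Rightarrow> 'a option) \<Rightarrow> 'a \<Rightarrow> 'a \<Rightarrow> bool" where
  "chain_wiring K W cl a b \<longleftrightarrow> (\<exists>k\<in>K. adjacent (k # W k) a b) \<or>
     b \<in> K \<and> (\<exists>l\<in>K. cl b = Some l \<and> a = last (l # W l))"

definition chain_system :: "'a set \<Rightarrow> ('a \<Rightarrow> 'a list) \<Rightarrow> ('a \<Rightarrow> 'a option) \<Rightarrow> bool" where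
  "chain_system K W cl \<longleftrightarrow> finite K \<and> (\<forall>k\<in>K. distinct (k # W k)) \<and>
     (\<forall>k\<in>K. \<forall>l\<in>K. k \<noteq> l \<longrightarrow> set (k # W k) \<inter> set (l # W l) = {}) \<and>
     (\<forall>k\<in>K. \<forall>l\<in>K. cl k = cl l \<longrightarrow> cl k \<noteq> None \<longrightarrow> k = l)"

definition chain_det :: "'a set \<Rightarrow> ('a \<Rightarrow> 'a list) \<Rightarrow> ('a \<Rightarrow> 'a option) \<Rightarrow> ('a \<Rightarrow> ('f \<times> 'a) option) \<Rightarrow> 'f::comm_ring_1" where
  "chain_det K W cl und = walk_det (chain_states K W) (chain_wiring K W cl) und"

lemma chain_system_cong:
  assumes "\<And>k. k \<in> K \<Longrightarrow> W k = W' k"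
  shows "chain_system K W cl \<longleftrightarrow> chain_system K W' cl"
  unfolding chain_system_def by (intro conj_cong refl ball_cong) (simp_all add: assms)

lemma chain_wiring_states:
  assumes "chain_wiring K W cl a b"
  shows "a \<in> chain_states K W \<and> b \<in> chain_states K W"
proof -
  have "last (l # W l) \<in> set (l # W l)" for l by (rule last_in_set) simp
  moreover have "a \<in> set (k # W k) \<and> b \<in> set (k # W k)" if "adjacent (k # W k) a b" for k
    using adjacent_set[OF that] by auto
  moreover have "b \<in> set (b # W b)" by simp
  ultimately show ?thesis
    using assms unfolding chain_wiring_def chain_states_def by blast
qed

lemma finite_chain_states: "chain_system K W cl \<Longrightarrow> finite (chain_states K W)"
  by (auto simp: chain_system_def chain_states_def)

lemma wiring_chain:
  assumes sys: "chain_system K W cl"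
  shows "wiring (chain_wiring K W cl)"
proof -
  have d: "distinct (k # W k)" if "k \<in> K" for k using sys that by (auto simp: chain_system_def)
  have same: "k = l" if "k \<in> K" "l \<in> K" "x \<in> set (k # W k)" "x \<in> set (l # W l)" for k l x
    using sys that unfolding chain_system_def by blast
  have st: "a \<in> set (k # W k)" "b \<in> set (k # W k)" "b \<in> set (W k)" if "adjacent (k # W k) a b" for k a b
    using adjacent_set[OF that] by auto
  have nohead: "\<not> adjacent (k # W k) a b" if "k \<in> K" "b \<in> K" for k a b
    using d[OF that(1)] same[OF that, of b] st[of k a b] by auto
  have ls: "last (l # W l) \<in> set (l # W l)" for l by (rule last_in_set) simp
  have nolast: "\<not> adjacent (k # W k) (last (l # W l)) b" if "k \<in> K" "l \<in> K" for k l b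
    using adjacent_unique(3)[OF d[OF that(1)]] same[OF that _ ls] st[of k "last (l # W l)" b] by metis
  show ?thesis
    unfolding wiring_def
  proof (intro conjI allI impI)
    fix a b c assume 1: "chain_wiring K W cl a c" and 2: "chain_wiring K W cl b c"
    show "a = b"
    proof (cases "c \<in> K")
      case True
      then show ?thesis using 1 2 nohead unfolding chain_wiring_def by auto
    next
      case False
      then obtain k l where "k \<in> K" "l \<in> K" "adjacent (k # W k) a c" "adjacent (l # W l) b c"
        using 1 2 unfolding chain_wiring_def by auto
      then show ?thesis using same[of k l c] st adjacent_unique(1)[OF d] by metis
    qed
  next
    fix a b c assume 1: "chain_wiring K W cl a b" and 2: "chain_wiring K W cl a c"
    consider k where "k \<in> K" "adjacent (k # W k) a b" | l where "l \<in> K" "b \<in> K" "cl b = Some l" "a = last (l # W l)"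
      using 1 unfolding chain_wiring_def by blast
    then show "b = c"
    proof cases
      case 1
      then have "\<exists>l\<in>K. adjacent (l # W l) a c" using 2 nolast unfolding chain_wiring_def by blast
      then show ?thesis using 1 same st adjacent_unique(2)[OF d] by metis
    next
      case l: 2
      then obtain l' where l': "l' \<in> K" "c \<in> K" "cl c = Some l'" "a = last (l' # W l')"
        using 2 nolast unfolding chain_wiring_def by blast
      then have "l = l'" using same[OF l(1) l'(1)] ls l(4) by metis
      then show ?thesis using sys l l' unfolding chain_system_def by (metis option.distinct(1))
    qed
  qed
qed

lemma chain_det_cong:
  assumes "\<And>k. k \<in> K \<Longrightarrow> W k = W' k" "\<And>k. k \<in> K \<Longrightarrow> cl k = cl' k"
    "\<And>s. s \<in> chain_states K W \<Longrightarrow> und s = und' s"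
  shows "chain_det K W cl und = chain_det K W' cl' und'"
proof -
  have "chain_states K W' = chain_states K W" "chain_wiring K W' cl' = chain_wiring K W cl"
    using assms(1,2) by (auto simp: chain_states_def chain_wiring_def fun_eq_iff)
  then show ?thesis unfolding chain_det_def using assms(3) by (auto intro: walk_det_cong)
qed

lemma chain_det_rename:
  assumes sys: "chain_system K W cl" and f: "inj_on f (chain_states K W)"
    and K': "K' = f ` K" and W': "\<And>k. k \<in> K \<Longrightarrow> W' (f k) = map f (W k)"
    and cl: "\<And>k. k \<in> K \<Longrightarrow> cl' (f k) = map_option f (cl k)" and ran: "\<And>k l. k \<in> K \<Longrightarrow> cl k = Some l \<Longrightarrow> l \<in> K"
    and und: "\<And>s. s \<in> chain_states K W \<Longrightarrow> und' (f s) = map_option (map_prod id f) (und s)"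
    and ran': "\<And>s T v. s \<in> chain_states K W \<Longrightarrow> und s = Some (T, v) \<Longrightarrow> v \<in> chain_states K W"
  shows "chain_det K' W' cl' und' = chain_det K W cl und"
proof -
  have S: "chain_states K' W' = f ` chain_states K W"
    unfolding chain_states_def K' using W' by auto
  have KS: "k \<in> K \<Longrightarrow> k \<in> chain_states K W" for k by (auto simp: chain_states_def)
  have WS: "k \<in> K \<Longrightarrow> set (k # W k) \<subseteq> chain_states K W" for k by (auto simp: chain_states_def)
  have inj: "f a = f b \<longleftrightarrow> a = b" if "a \<in> chain_states K W" "b \<in> chain_states K W" for a b
    using f that by (auto simp: inj_on_def)
  have adj: "adjacent (f k # W' (f k)) (f a) (f b) \<longleftrightarrow> adjacent (k # W k) a b"
    if "k \<in> K" "a \<in> chain_states K W" "b \<in> chain_states K W" for k a b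
  proof (cases "a \<in> set (k # W k) \<and> b \<in> set (k # W k)")
    case True
    then show ?thesis
      using adjacent_map[of f "k # W k" a b] inj_on_subset[OF f WS[OF that(1)]] W'[OF that(1)] by auto
  next
    case False
    have im: "f y \<notin> f ` set (k # W k)" if "y \<in> chain_states K W" "y \<notin> set (k # W k)" for y
      using that inj WS[OF \<open>k \<in> K\<close>] by (metis image_iff subsetD)
    have "\<not> adjacent (map f (k # W k)) (f a) (f b)"
    proof
      assume "adjacent (map f (k # W k)) (f a) (f b)"
      then have "f a \<in> f ` set (k # W k)" "f b \<in> f ` set (k # W k)"
        using adjacent_set[of "map f (k # W k)" "f a" "f b"] by auto
      then show False using im[of a] im[of b] that False by blast
    qed
    moreover have "\<not> adjacent (k # W k) a b"
      using False adjacent_set[of "k # W k" a b] by auto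
    ultimately show ?thesis using W'[OF that(1)] by simp
  qed
  have last: "last (f l # W' (f l)) = f (last (l # W l))" if "l \<in> K" for l
    using W'[OF that] by (simp add: last_map)
  have lastS: "last (l # W l) \<in> chain_states K W" if "l \<in> K" for l
    using WS[OF that] last_in_set[of "l # W l"] by blast
  show ?thesis
    unfolding chain_det_def
  proof (rule walk_det_reindex[of f])
    show "bij_betw f (chain_states K W) (chain_states K' W')" using f S by (simp add: bij_betw_def)
    show "finite (chain_states K W)" by (rule finite_chain_states[OF sys])
    fix j s assume js: "j \<in> chain_states K W" "s \<in> chain_states K W"
    have h1: "(\<exists>k\<in>K'. adjacent (k # W' k) (f j) (f s)) \<longleftrightarrow> (\<exists>k\<in>K. adjacent (k # W k) j s)"
      unfolding K' using adj js by auto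
    have h2: "f s \<in> K' \<longleftrightarrow> s \<in> K" unfolding K' using inj js KS by (metis image_iff)
    have h3: "(\<exists>l\<in>K'. cl' (f s) = Some l \<and> f j = last (l # W' l)) \<longleftrightarrow>
       (\<exists>l\<in>K. cl s = Some l \<and> j = last (l # W l))" if "s \<in> K"
    proof -
      have "cl' (f s) = Some (f l) \<longleftrightarrow> cl s = Some l" if "l \<in> K" for l
        using cl[OF \<open>s \<in> K\<close>] inj KS[OF that] KS ran[OF \<open>s \<in> K\<close>] by (cases "cl s") auto
      moreover have "f j = last (f l # W' (f l)) \<longleftrightarrow> j = last (l # W l)" if "l \<in> K" for l
        unfolding last[OF that] by (rule inj[OF js(1) lastS[OF that]])
      ultimately show ?thesis unfolding K' bex_simps(7) by (intro bex_cong) simp_all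
    qed
    show "chain_wiring K' W' cl' (f j) (f s) \<longleftrightarrow> chain_wiring K W cl j s"
      unfolding chain_wiring_def h1 h2 using h3 by blast
  qed (use und ran' in auto)
qed

text \<open>
  If the end of \<open>x\<close> precedes the head \<open>y\<close>, the chain of \<open>y\<close>
  can be read as a continuation of that of \<open>x\<close>, with the same wiring.
\<close>

lemma chain_join:
  assumes sys: "chain_system K W cl" and xy: "x \<in> K" "y \<in> K" "x \<noteq> y" "cl y = Some x"
  defines "K' \<equiv> K - {y}" and "W' \<equiv> W(x := W x @ [y] @ W y)"
    and "cl' \<equiv> (\<lambda>k. if cl k = Some y then Some x else cl k)"
  shows "chain_system K' W' cl'" and "chain_states K' W' = chain_states K W"
    and "chain_wiring K' W' cl' = chain_wiring K W cl"
    and "chain_det K' W' cl' und = chain_det K W cl und"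
proof -
  have uniq: "k \<in> K \<Longrightarrow> cl k = Some x \<longleftrightarrow> k = y" for k
    using sys xy unfolding chain_system_def by (metis option.distinct(1))
  have d: "distinct (k # W k)" if "k \<in> K" for k using sys that by (auto simp: chain_system_def)
  have disj: "set (k # W k) \<inter> set (l # W l) = {}" if "k \<in> K" "l \<in> K" "k \<noteq> l" for k l
    using sys that unfolding chain_system_def by blast
  have S: "set (k # W' k) = (if k = x then set (x # W x) \<union> set (y # W y) else set (k # W k))" for k
    by (auto simp: W'_def)
  show "chain_system K' W' cl'"
    unfolding chain_system_def
  proof (intro conjI ballI impI)
    show "finite K'" using sys by (simp add: chain_system_def K'_def)
    show "distinct (k # W' k)" if "k \<in> K'" for k
      using that d[of k] d[OF xy(1)] d[OF xy(2)] disj[OF xy(1-3)] xy by (auto simp: K'_def W'_def)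
    show "set (k # W' k) \<inter> set (l # W' l) = {}" if "k \<in> K'" "l \<in> K'" "k \<noteq> l" for k l
      unfolding S using that disj[of k l] disj[of x l] disj[of y l] disj[of k x] disj[of k y] xy
      unfolding K'_def by (simp split: if_split) blast
    show "k = l" if "k \<in> K'" "l \<in> K'" "cl' k = cl' l" "cl' k \<noteq> None" for k l
    proof -
      have inj: "cl k = cl l \<Longrightarrow> cl k \<noteq> None \<Longrightarrow> k = l" using sys that unfolding chain_system_def K'_def by blast
      have "cl k \<noteq> Some x" "cl l \<noteq> Some x" using uniq that unfolding K'_def by auto
      then show ?thesis using that(3,4) inj unfolding cl'_def by (auto split: if_splits)
    qed
  qed
  show st: "chain_states K' W' = chain_states K W"
    unfolding chain_states_def S K'_def using xy by auto
  have "chain_wiring K' W' cl' a b \<longleftrightarrow> chain_wiring K W cl a b" for a b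
  proof -
    have 1: "(\<exists>k\<in>K'. adjacent (k # W' k) a b) \<longleftrightarrow>
      (\<exists>k\<in>K. adjacent (k # W k) a b) \<or> b = y \<and> a = last (x # W x)"
    proof -
      have "adjacent (x # W' x) a b \<longleftrightarrow> adjacent (x # W x) a b \<or> adjacent (y # W y) a b \<or> b = y \<and> a = last (x # W x)"
        using adjacent_append[of "x # W x" "y # W y" a b] by (auto simp: W'_def)
      moreover have "W' k = W k" if "k \<noteq> x" for k using that by (simp add: W'_def)
      ultimately show ?thesis using xy unfolding K'_def by (metis Diff_iff singletonD)
    qed
    have 2: "(b \<in> K' \<and> (\<exists>l\<in>K'. cl' b = Some l \<and> a = last (l # W' l))) \<longleftrightarrow>
       b \<in> K \<and> b \<noteq> y \<and> (\<exists>l\<in>K. cl b = Some l \<and> a = last (l # W l))"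
    proof (cases "b \<in> K \<and> b \<noteq> y")
      case True
      then have nx: "cl b \<noteq> Some x" using uniq by auto
      have "(\<exists>l\<in>K'. cl' b = Some l \<and> a = last (l # W' l)) \<longleftrightarrow> (\<exists>l\<in>K. cl b = Some l \<and> a = last (l # W l))"
      proof (cases "cl b = Some y")
        case True
        have "last (x # W' x) = last (y # W y)" by (simp add: W'_def)
        then show ?thesis using True xy unfolding cl'_def K'_def by auto
      next
        case False
        then show ?thesis using nx xy unfolding cl'_def K'_def W'_def by auto
      qed
      then show ?thesis using True unfolding K'_def by blast
    qed (auto simp: K'_def)
    have 3: "(\<exists>l\<in>K. cl y = Some l \<and> a = last (l # W l)) \<longleftrightarrow> a = last (x # W x)" using xy by auto
    show ?thesis unfolding chain_wiring_def 1 2 using 3 xy(2) by blast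
  qed
  then show w: "chain_wiring K' W' cl' = chain_wiring K W cl" by blast
  show "chain_det K' W' cl' und = chain_det K W cl und"
    unfolding chain_det_def st w ..
qed

text \<open>
  The reverse of joining: any inner state of a chain may be declared a head.
\<close>

lemma chain_unjoin:
  assumes sys: "chain_system K W cl" and k: "k \<in> K" "W k = u @ y # w"
    and ran: "\<And>l m. l \<in> K \<Longrightarrow> cl l = Some m \<Longrightarrow> m \<in> K"
  defines "K' \<equiv> insert y K" and "W' \<equiv> W(k := u, y := w)"
    and "cl' \<equiv> (\<lambda>l. if l = y then Some k else if cl l = Some k then Some y else cl l)"
  shows "chain_system K' W' cl'" "chain_states K' W' = chain_states K W"
    "chain_wiring K' W' cl' = chain_wiring K W cl" "y \<notin> K" "\<And>l m. l \<in> K' \<Longrightarrow> cl' l = Some m \<Longrightarrow> m \<in> K'"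
proof -
  have sK: "finite K" "\<And>k. k \<in> K \<Longrightarrow> distinct (k # W k)"
    "\<And>k l. k \<in> K \<Longrightarrow> l \<in> K \<Longrightarrow> k \<noteq> l \<Longrightarrow> set (k # W k) \<inter> set (l # W l) = {}"
    "\<And>k l. k \<in> K \<Longrightarrow> l \<in> K \<Longrightarrow> cl k = cl l \<Longrightarrow> cl k \<noteq> None \<Longrightarrow> k = l"
    using sys unfolding chain_system_def by blast+
  have d: "distinct (k # u @ y # w)" using sK(2)[OF k(1)] k(2) by simp
  have yk: "k \<noteq> y" using d by auto
  show yK: "y \<notin> K"
  proof
    assume "y \<in> K"
    then have "set (k # W k) \<inter> set (y # W y) = {}" using sK(3)[OF k(1)] yk by blast
    then show False using k(2) by simp
  qed
  show ran': "m \<in> K'" if "l \<in> K'" "cl' l = Some m" for l m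
    using that ran k(1) unfolding K'_def cl'_def by (auto split: if_splits)
  have Wk: "W' k = u" "W' y = w" and Wl: "l \<in> K - {k} \<Longrightarrow> W' l = W l" for l
    using yk yK unfolding W'_def by auto
  have V: "set (k # W' k) \<union> set (y # W' y) = set (k # W k)" "set (k # W' k) \<inter> set (y # W' y) = {}"
    "distinct (k # W' k)" "distinct (y # W' y)"
    using d unfolding Wk k(2) by auto
  have Vl: "set (l # W' l) \<inter> set (k # W' k) = {}" "set (l # W' l) \<inter> set (y # W' y) = {}" if "l \<in> K - {k}" for l
  proof -
    have "set (l # W l) \<inter> set (k # W k) = {}" using sK(3) k(1) that by blast
    then show "set (l # W' l) \<inter> set (k # W' k) = {}" "set (l # W' l) \<inter> set (y # W' y) = {}"
      unfolding Wl[OF that] V(1)[symmetric] by blast+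
  qed
  show sys': "chain_system K' W' cl'"
    unfolding chain_system_def
  proof (intro conjI ballI impI)
    show "finite K'" using sK(1) by (simp add: K'_def)
    show "distinct (l # W' l)" if "l \<in> K'" for l
      using that V(3,4) sK(2)[of l] Wl[of l] unfolding K'_def by (cases "l = k"; cases "l = y") auto
    show "set (l # W' l) \<inter> set (m # W' m) = {}" if "l \<in> K'" "m \<in> K'" "l \<noteq> m" for l m
    proof -
      have "l \<in> {k, y} \<or> l \<in> K - {k}" "m \<in> {k, y} \<or> m \<in> K - {k}" using that unfolding K'_def by auto
      then consider "l \<in> {k, y}" "m \<in> {k, y}" | "l \<in> K - {k}" "m \<in> {k, y}" | "l \<in> {k, y}" "m \<in> K - {k}"
        | "l \<in> K - {k}" "m \<in> K - {k}" by blast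
      then show ?thesis
      proof cases
        case 1
        then show ?thesis using V(2) that(3) by (auto simp del: set_simps)
      next
        case 2
        then show ?thesis using Vl[OF 2(1)] by (auto simp del: set_simps)
      next
        case 3
        then show ?thesis using Vl[OF 3(2)] by (auto simp del: set_simps)
      next
        case 4
        then show ?thesis unfolding Wl[OF 4(1)] Wl[OF 4(2)] using sK(3) that(3) by blast
      qed
    qed
    show "l = m" if h: "l \<in> K'" "m \<in> K'" "cl' l = cl' m" "cl' l \<noteq> None" for l m
    proof -
      have n: "cl i \<noteq> Some y" if "i \<in> K" for i using ran[OF that] yK by blast
      have lk: "cl' l = Some k \<longleftrightarrow> l = y" if "l \<in> K'" for l using yk by (auto simp: cl'_def)
      show ?thesis
      proof (cases "l = y \<or> m = y")
        case True
        then show ?thesis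
        proof
          assume l: "l = y"
          have "cl' m = Some k" using trans[OF h(3)[symmetric] iffD2[OF lk[OF h(1)] l]] .
          with lk[OF h(2)] have "m = y" by (rule iffD1)
          show ?thesis by (rule trans[OF l \<open>m = y\<close>[symmetric]])
        next
          assume m: "m = y"
          have "cl' l = Some k" using trans[OF h(3) iffD2[OF lk[OF h(2)] m]] .
          with lk[OF h(1)] have "l = y" by (rule iffD1)
          show ?thesis by (rule trans[OF \<open>l = y\<close> m[symmetric]])
        qed
      next
        case False
        then have "l \<in> K" "m \<in> K" using h unfolding K'_def by auto
        then have "cl l = cl m" "cl l \<noteq> None" using h(3,4) False n[of l] n[of m] unfolding cl'_def by (auto split: if_splits)
        then show ?thesis using sK(4) \<open>l \<in> K\<close> \<open>m \<in> K\<close> by blast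
      qed
    qed
  qed
  have in': "k \<in> K'" "y \<in> K'" "k \<noteq> y" "cl' y = Some k" using k yk by (auto simp: K'_def cl'_def)
  note j = chain_join[OF sys' in']
  have Kd: "K' - {y} = K" using yK by (simp add: K'_def)
  have Wd: "(W'(k := W' k @ [y] @ W' y)) l = W l" if "l \<in> K" for l
    using that Wl[of l] Wk k(2) by (cases "l = k") auto
  have cd: "(if cl' l = Some y then Some k else cl' l) = cl l" if "l \<in> K" for l
    using that yK ran[OF that] by (auto simp: cl'_def)
  show "chain_states K' W' = chain_states K W"
    using j(2) unfolding Kd chain_states_def using Wd by simp
  have "chain_wiring K (W'(k := W' k @ [y] @ W' y)) (\<lambda>l. if cl' l = Some y then Some k else cl' l) = chain_wiring K W cl"
    using Wd cd by (intro ext) (simp add: chain_wiring_def cong: bex_cong conj_cong)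
  then show "chain_wiring K' W' cl' = chain_wiring K W cl" using j(3) unfolding Kd by simp
qed

lemma chain_system_filter:
  "chain_system K W cl \<Longrightarrow> chain_system K (\<lambda>k. filter P (W k)) cl"
  unfolding chain_system_def by fastforce

text \<open>
  A state which is not a lower passage and which nobody jumps to is bypassed.
\<close>

lemma chain_det_filter_one:
  assumes sys: "chain_system K W cl" and x: "und x = None" "unreferenced (chain_states K W) und x" "x \<notin> K"
  shows "chain_det K (\<lambda>k. filter (\<lambda>s. s \<noteq> x) (W k)) cl und = chain_det K W cl und"
proof (cases "\<exists>k\<in>K. x \<in> set (W k)")
  case False
  then have "filter (\<lambda>s. s \<noteq> x) (W k) = W k" if "k \<in> K" for k using that by (auto intro: filter_True)
  then show ?thesis by (intro chain_det_cong) auto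
next
  case True
  then obtain k u v where k: "k \<in> K" "W k = u @ [x] @ v" by (metis append_Cons append_Nil split_list)
  let ?W = "\<lambda>k. filter (\<lambda>s. s \<noteq> x) (W k)"
  have d: "distinct (k # W k)" if "k \<in> K" for k using sys that by (auto simp: chain_system_def)
  have kd: "x \<notin> set u" "x \<notin> set v" "k \<noteq> x" using d[OF k(1)] k(2) by auto
  have same: "k = l" if "l \<in> K" "x \<in> set (l # W l)" for l
    using sys that k unfolding chain_system_def by (metis IntI empty_iff append_Cons in_set_conv_decomp set_ConsD list.set_intros(2))
  have "filter (\<lambda>s. s \<noteq> x) u = u" "filter (\<lambda>s. s \<noteq> x) v = v"
    using kd by (auto intro!: filter_True)
  then have Wk: "?W k = u @ v" unfolding k(2) by simp
  have Wl: "?W l = W l" if "l \<in> K" "l \<noteq> k" for l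
    using same[of l] that by (intro filter_True) auto
  have st: "chain_states K ?W = chain_states K W - {x}"
    using x(3) by (auto simp: chain_states_def)
  let ?A = "chain_wiring K W cl"
  have lastk: "last (k # ?W k) = (if v = [] then last (k # u) else last v)" "last (k # W k) = (if v = [] then x else last v)"
    by (subst Wk, simp) (simp add: k(2))
  have nl: "\<not> adjacent (l # W l) a b" if "l \<in> K" "l \<noteq> k" "a = x \<or> b = x" for l a b
    using same[of l] adjacent_set[of "l # W l" a b] that by auto
  have nv: "\<not> adjacent u a b" "\<not> adjacent v a b" "\<not> adjacent (k # u) a b" if "a = x \<or> b = x" for a b
    using adjacent_set[of u a b] adjacent_set[of v a b] adjacent_set[of "k # u" a b] kd that by (auto dest: in_set_tlD)
  have Wks: "adjacent (k # W k) a b \<longleftrightarrow> adjacent (k # u) a b \<or> adjacent v a b \<or>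
      a = last (k # u) \<and> b = x \<or> v \<noteq> [] \<and> a = x \<and> b = hd v" for a b
    unfolding k(2) using adjacent_append[of "k # u" "x # v" a b] adjacent_append[of "[x]" v a b] by auto
  have split: "(\<exists>l\<in>K. P l) \<longleftrightarrow> P k \<or> (\<exists>l\<in>K-{k}. P l)" for P :: "_ \<Rightarrow> bool" using k(1) by auto
  have jx: "?A j x \<longleftrightarrow> j = last (k # u)" for j
    unfolding chain_wiring_def split Wks using nl nv x(3) kd by auto
have lu: "last (k # u) \<noteq> x" using kd last_in_set[of "k # u"] by auto
  have nAx: "\<not> ?A x x" unfolding jx using lu by auto
  have "chain_wiring K ?W cl j s \<longleftrightarrow> bypass x ?A j s" for j s
  proof -
    have Wks': "adjacent (k # ?W k) a b \<longleftrightarrow> adjacent (k # u) a b \<or> adjacent v a b \<or>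
        v \<noteq> [] \<and> a = last (k # u) \<and> b = hd v" for a b
      unfolding Wk using adjacent_append[of "k # u" v a b] by auto
    have lastx: "last (l # W l) \<noteq> x" if "l \<in> K" "l \<noteq> k" for l
      using same[OF that(1)] that last_in_set[of "l # W l"] by auto
    have hv: "v \<noteq> [] \<Longrightarrow> hd v \<noteq> x" "v \<noteq> [] \<Longrightarrow> last v \<noteq> x" using kd hd_in_set[of v] last_in_set[of v] by auto
    have xs: "?A x s \<longleftrightarrow> (if v = [] then s \<in> K \<and> cl s = Some k else s = hd v)"
    proof -
      have n1: "\<not> adjacent (k # u) x s" by (rule nv(3)) simp
      have n2: "\<not> adjacent v x s" by (rule nv(2)) simp
      have n3: "\<not> (\<exists>l\<in>K-{k}. adjacent (l # W l) x s)" using nl by blast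
      have n4: "\<not> (\<exists>l\<in>K-{k}. cl s = Some l \<and> x = last (l # W l))" using lastx by (auto simp del: last.simps)
      have n5: "x \<noteq> last (k # u)" "v \<noteq> [] \<Longrightarrow> x \<noteq> last v" using lu hv(2) by (auto simp del: last.simps)
      note n = n1 n2 n3 n4 n5
      show ?thesis unfolding chain_wiring_def split Wks lastk
        using n by (cases "v = []") (simp_all del: last.simps, blast+)
    qed
    have Kx: "(\<exists>l\<in>K-{k}. adjacent (l # ?W l) j s) \<longleftrightarrow> (\<exists>l\<in>K-{k}. adjacent (l # W l) j s)"
      using Wl by auto
    have Kl: "(\<exists>l\<in>K-{k}. cl s = Some l \<and> j = last (l # ?W l)) \<longleftrightarrow> (\<exists>l\<in>K-{k}. cl s = Some l \<and> j = last (l # W l))"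
      using Wl by auto
    have jn: "chain_wiring K ?W cl j s \<Longrightarrow> j \<noteq> x \<and> s \<noteq> x"
      using chain_wiring_states[of K ?W cl j s] unfolding st by simp
    show ?thesis
    proof (cases "j \<noteq> x \<and> s \<noteq> x")
      case False
      then show ?thesis using jn by (auto simp: bypass_def)
    next
      case True
      have "?A j s \<longleftrightarrow> (adjacent (k # u) j s \<or> adjacent v j s) \<or> (\<exists>l\<in>K-{k}. adjacent (l # W l) j s) \<or>
         s \<in> K \<and> (v \<noteq> [] \<and> cl s = Some k \<and> j = last v \<or> (\<exists>l\<in>K-{k}. cl s = Some l \<and> j = last (l # W l)))"
        unfolding chain_wiring_def split Wks lastk using True by (cases "v = []") (simp_all del: last.simps)
      moreover have "chain_wiring K ?W cl j s \<longleftrightarrow> (adjacent (k # u) j s \<or> adjacent v j s \<or> v \<noteq> [] \<and> j = last (k # u) \<and> s = hd v) \<or>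
         (\<exists>l\<in>K-{k}. adjacent (l # W l) j s) \<or>
         s \<in> K \<and> (cl s = Some k \<and> j = (if v = [] then last (k # u) else last v) \<or> (\<exists>l\<in>K-{k}. cl s = Some l \<and> j = last (l # W l)))"
        unfolding chain_wiring_def split Wks' Kx Kl lastk by blast
      ultimately show ?thesis unfolding bypass_def jx xs using True
        by (cases "v = []") (simp_all del: last.simps, blast+)
    qed
  qed
  then have w: "chain_wiring K ?W cl = bypass x ?A" by blast
  have "x \<in> set (W k)" using k by simp
  then have "x \<in> chain_states K W" using k(1) by (auto simp: chain_states_def)
  then show ?thesis
    unfolding chain_det_def w st
    using walk_det_bypass[OF finite_chain_states[OF sys] _ x(1) nAx wiring_chain[OF sys] x(2)] by simp
qed

lemma chain_det_filter:
  assumes sys: "chain_system K W cl"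
    and V: "finite V" "\<And>x. x \<in> V \<Longrightarrow> und x = None \<and> unreferenced (chain_states K W) und x \<and> x \<notin> K"
  shows "chain_det K (\<lambda>k. filter (\<lambda>s. s \<notin> V) (W k)) cl und = chain_det K W cl und"
  using V
proof (induction V)
  case (insert x V)
  let ?W = "\<lambda>k. filter (\<lambda>s. s \<notin> V) (W k)"
  have "chain_states K ?W \<subseteq> chain_states K W" by (auto simp: chain_states_def)
  then have "unreferenced (chain_states K ?W) und x"
    using insert.prems[of x] unfolding unreferenced_def by blast
  then have "chain_det K (\<lambda>k. filter (\<lambda>s. s \<noteq> x) (?W k)) cl und = chain_det K ?W cl und"
    using insert.prems[of x] by (intro chain_det_filter_one chain_system_filter sys) auto
  moreover have "filter (\<lambda>s. s \<noteq> x) (?W k) = filter (\<lambda>s. s \<notin> insert x V) (W k)" for k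
    by (auto intro: filter_cong)
  ultimately show ?case using insert by simp
qed simp

text \<open>
  Joining two chains and bypassing the former head between them: the effect of stitching.
\<close>

lemma chain_det_merge:
  assumes sys: "chain_system K W cl" and xy: "x \<in> K" "y \<in> K" "x \<noteq> y" "cl y = Some x"
    and y: "und y = None" "unreferenced (chain_states K W) und y"
  shows "chain_det (K - {y}) (W(x := W x @ W y)) (\<lambda>k. if cl k = Some y then Some x else cl k) und = chain_det K W cl und"
    and "chain_system (K - {y}) (W(x := W x @ W y)) (\<lambda>k. if cl k = Some y then Some x else cl k)"
    and "chain_states (K - {y}) (W(x := W x @ W y)) = chain_states K W - {y}"
proof -
  note j = chain_join[OF sys xy]
  let ?W = "W(x := W x @ [y] @ W y)"
  have d: "distinct (x # W x)" "distinct (y # W y)" "set (x # W x) \<inter> set (y # W y) = {}"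
    using sys xy unfolding chain_system_def by blast+
  have ny: "y \<notin> set (W k)" if "k \<in> K - {y}" for k
    using sys xy that unfolding chain_system_def by (metis Diff_iff IntI empty_iff list.set_intros(1,2) singletonI)
  have f: "filter (\<lambda>s. s \<noteq> y) (?W k) = (W(x := W x @ W y)) k" if "k \<in> K - {y}" for k
  proof -
    have "filter (\<lambda>s. s \<noteq> y) xs = xs" if "y \<notin> set xs" for xs using that by (intro filter_True) auto
    then show ?thesis using ny[OF that] d xy by auto
  qed
  show "chain_det (K - {y}) (W(x := W x @ W y)) (\<lambda>k. if cl k = Some y then Some x else cl k) und = chain_det K W cl und"
  proof -
    have "chain_det (K - {y}) (W(x := W x @ W y)) (\<lambda>k. if cl k = Some y then Some x else cl k) und =
      chain_det (K - {y}) (\<lambda>k. filter (\<lambda>s. s \<noteq> y) (?W k)) (\<lambda>k. if cl k = Some y then Some x else cl k) und"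
      by (rule chain_det_cong) (use f in auto)
    also have "\<dots> = chain_det K W cl und"
      using chain_det_filter_one[where und=und and x=y, OF j(1)] y unfolding j(2,4) by simp
    finally show ?thesis .
  qed
  have "chain_system (K - {y}) (\<lambda>k. filter (\<lambda>s. s \<noteq> y) (?W k)) (\<lambda>k. if cl k = Some y then Some x else cl k)"
    by (rule chain_system_filter[OF j(1)])
  then show "chain_system (K - {y}) (W(x := W x @ W y)) (\<lambda>k. if cl k = Some y then Some x else cl k)"
    by (rule chain_system_cong[THEN iffD1, rotated]) (use f in auto)
  show "chain_states (K - {y}) (W(x := W x @ W y)) = chain_states K W - {y}"
  proof -
    have "chain_states (K - {y}) (W(x := W x @ W y)) = chain_states (K - {y}) (\<lambda>k. filter (\<lambda>s. s \<noteq> y) (?W k))"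
      unfolding chain_states_def using f by simp
    also have "\<dots> = chain_states (K - {y}) ?W - {y}" by (auto simp: chain_states_def)
    finally show ?thesis using j(2) by simp
  qed
qed

text \<open>
  Cutting a loop once more after its base point gives two chains, each continuing the other; merging
  them in the opposite order moves the base point.
\<close>

lemma chain_det_rotate:
  assumes sys: "chain_system K W cl" and k: "k \<in> K" "cl k = Some k" "W k = a # w"
    and ran: "\<And>l m. l \<in> K \<Longrightarrow> cl l = Some m \<Longrightarrow> m \<in> K"
    and y: "und k = None" "unreferenced (chain_states K W) und k"
  shows "chain_det K (W(k := w @ [a])) cl und = chain_det K W cl und"
proof -
  define W' where "W' = W(k := w @ [a])"
  let ?K = "insert a K" and ?cl = "\<lambda>l. if l = a then Some k else if cl l = Some k then Some a else cl l"
  have S: "set (l # W' l) = set (l # W l)" "distinct (l # W' l) \<longleftrightarrow> distinct (l # W l)" for l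
    using k(3) by (auto simp: W'_def)
  have sys': "chain_system K W' cl" using sys unfolding chain_system_def S .
  have st: "chain_states K W' = chain_states K W" unfolding chain_states_def S ..
  have "distinct (k # W k)" using sys k(1) unfolding chain_system_def by blast
  then have ka: "a \<noteq> k" using k(3) by auto
  have Wk: "W k = [] @ a # w" "W' k = w @ a # []" using k(3) by (simp_all add: W'_def)
  have ins: "a \<in> ?K" "k \<in> ?K" "?cl k = Some a" using k ka by auto
  let ?V = "W(k := [], a := w)" and ?V' = "W'(k := w, a := [])"
  have u: "chain_system ?K ?V ?cl" "chain_states ?K ?V = chain_states K W"
      "chain_wiring ?K ?V ?cl = chain_wiring K W cl"
    and u': "chain_system ?K ?V' ?cl" "chain_states ?K ?V' = chain_states K W'"
      "chain_wiring ?K ?V' ?cl = chain_wiring K W' cl"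
    by (rule chain_unjoin[OF sys k(1) Wk(1)] chain_unjoin[OF sys' k(1) Wk(2)], rule ran, assumption+)+
  have "chain_det K W cl und = chain_det ?K ?V ?cl und" unfolding chain_det_def u(2,3) ..
  also have "\<dots> = chain_det (?K - {k}) (?V(a := ?V a @ ?V k)) (\<lambda>l. if ?cl l = Some k then Some a else ?cl l) und"
    by (rule chain_det_merge(1)[where und=und, OF u(1) ins(1,2) ka ins(3) y(1), symmetric]) (unfold u(2), fact y(2))
  also have "\<dots> = chain_det (?K - {k}) (?V'(a := ?V' a @ ?V' k)) (\<lambda>l. if ?cl l = Some k then Some a else ?cl l) und"
    by (rule chain_det_cong) (use ka in \<open>auto simp: W'_def\<close>)
  also have "\<dots> = chain_det ?K ?V' ?cl und"
    by (rule chain_det_merge(1)[where und=und, OF u'(1) ins(1,2) ka ins(3) y(1)]) (unfold u'(2) st, fact y(2))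
  also have "\<dots> = chain_det K W' cl und" unfolding chain_det_def u'(2,3) ..
  finally show ?thesis unfolding W'_def ..
qed

section \<open>The determinant of a diagram\<close>

text \<open>
  Bypassing several states at once is well-behaved if no two of them are neighbours.
\<close>

definition bypass_set :: "'a set \<Rightarrow> ('a \<Rightarrow> 'a \<Rightarrow> bool) \<Rightarrow> 'a \<Rightarrow> 'a \<Rightarrow> bool" where
  "bypass_set L A j s \<longleftrightarrow> j \<notin> L \<and> s \<notin> L \<and> (A j s \<or> (\<exists>k\<in>L. A j k \<and> A k s))"

lemma walk_det_bypass_set:
  assumes fin: "finite S" and w: "wiring A" and "finite L" "L \<subseteq> S"
    and L: "\<And>k. k \<in> L \<Longrightarrow> und k = None \<and> unreferenced S und k" and nadj: "\<And>k l. k \<in> L \<Longrightarrow> l \<in> L \<Longrightarrow> \<not> A k l"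
  shows "walk_det (S - L) (bypass_set L A) und = walk_det S A und \<and> wiring (bypass_set L A)"
  using assms(3-)
proof (induction L)
  case empty
  have "bypass_set {} A = A" by (auto simp: bypass_set_def fun_eq_iff)
  then show ?case using w by simp
next
  case (insert x L)
  have IH: "walk_det (S - L) (bypass_set L A) und = walk_det S A und" "wiring (bypass_set L A)"
    using insert by auto
  have "\<not> bypass_set L A x x" using insert.prems(3) by (auto simp: bypass_set_def)
  moreover have "unreferenced (S - L) und x" using insert.prems(2)[of x] by (auto simp: unreferenced_def)
  ultimately have "walk_det (S - L) (bypass_set L A) und = walk_det (S - L - {x}) (bypass x (bypass_set L A)) und"
    using insert fin IH by (intro walk_det_bypass) auto
  moreover have "bypass x (bypass_set L A) j s \<longleftrightarrow> bypass_set (insert x L) A j s" for j s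
    using insert.prems(3) insert.hyps unfolding bypass_def bypass_set_def by blast
  then have "bypass x (bypass_set L A) = bypass_set (insert x L) A" by blast
  moreover have "S - L - {x} = S - insert x L" by auto
  ultimately show ?case using IH wiring_bypass[OF IH(2)] by metis
qed

lemma bypass_set_swap_states:
  assumes "x \<notin> L" "y \<notin> L"
  shows "bypass_set L (swap_states x y A) = swap_states x y (bypass_set L A)"
proof -
  have "Transposition.transpose x y k = k" if "k \<in> L" for k using that assms by (auto simp: transpose_def)
  then have "bypass_set L (swap_states x y A) j s \<longleftrightarrow> swap_states x y (bypass_set L A) j s" for j s
    using assms unfolding bypass_set_def swap_states_def by (auto simp: transpose_def)
  then show ?thesis by blast
qed

text \<open>
  The reverse directions of the bottom strand, obtained by undoing the move.
\<close>

lemma walk_det_slide':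
  assumes fin: "finite S" and S: "{p, v, q, r, x} \<subseteq> S" and dist: "distinct [p, v, q, r]" "x \<notin> {v, q, r}"
    and w: "wiring A" and pred: "\<exists>u\<in>S. A u p" "\<exists>u\<in>S. A u v"
    and und: "und p = Some (T, x)" "und v = None" "und q = Some (s, v)" "und r = Some (T', x)"
    and unref: "unreferenced S und p" "unreferenced S und q" "unreferenced S und r" "unreferenced (S - {q}) und v"
    and rel: "A q r \<and> A p v \<and> T * T' = 1 \<or> A q r \<and> A v p \<and> T = T' \<or>
      A r q \<and> A v p \<and> T * T' = 1 \<or> A r q \<and> A p v \<and> T = T'"
  shows "walk_det S (swap_states p v (swap_states q r A)) und = walk_det S A und"
proof (cases "A q r \<and> (A p v \<and> T * T' = 1 \<or> A v p \<and> T = T')")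
  case True
  then show ?thesis
    by (intro walk_det_slide[OF fin S dist w _ pred und unref]) auto
next
  case False
  let ?B = "swap_states p v (swap_states q r A)"
  have B: "?B a b \<longleftrightarrow> A (Transposition.transpose q r (Transposition.transpose p v a)) (Transposition.transpose q r (Transposition.transpose p v b))"
    for a b by (simp add: swap_states_def)
  have undo: "swap_states p v (swap_states q r ?B) = A"
  proof -
    have c: "Transposition.transpose q r (Transposition.transpose p v a) = Transposition.transpose p v (Transposition.transpose q r a)" for a
      using dist by (auto simp: transpose_def)
    then show ?thesis by (simp add: swap_states_def fun_eq_iff c[symmetric])
  qed
  have t: "Transposition.transpose q r (Transposition.transpose p v p) = v" "Transposition.transpose q r (Transposition.transpose p v v) = p"
     "Transposition.transpose q r (Transposition.transpose p v q) = r" "Transposition.transpose q r (Transposition.transpose p v r) = q"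
    using dist by (auto simp: transpose_def)
  have pr: "\<exists>u\<in>S. ?B u b" if u: "u \<in> S" "A u (Transposition.transpose q r (Transposition.transpose p v b))" for u b
  proof (rule bexI)
    show "?B (Transposition.transpose p v (Transposition.transpose q r u)) b" using u by (simp add: B)
    show "Transposition.transpose p v (Transposition.transpose q r u) \<in> S" using u S by (auto simp: transpose_def)
  qed
  have wB: "wiring ?B" by (intro wiring_swap_states w)
  have qr: "?B q r" unfolding B t using False rel by blast
  have "walk_det S (swap_states p v (swap_states q r ?B)) und = walk_det S ?B und"
  proof (rule walk_det_slide[OF fin S dist wB qr _ _ und unref])
    show "\<exists>u\<in>S. ?B u p" "\<exists>u\<in>S. ?B u v" using pred pr[of _ p] pr[of _ v] unfolding t by blast+
    have "?B p v \<longleftrightarrow> A v p" "?B v p \<longleftrightarrow> A p v" unfolding B t by simp_all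
    then show "?B p v \<and> T * T' = 1 \<or> ?B v p \<and> T = T'" using rel False by blast
  qed
  then show ?thesis unfolding undo by simp
qed

type_synonym state = "nat + passage"

definition comp_of :: "diagram \<Rightarrow> passage \<Rightarrow> nat" where
  "comp_of D p = (THE k. k \<in> components D \<and> p \<in> set (passages D k))"

text \<open>
  The value at the lower passage of a crossing: the weight of staying and the upper passage. The
  lower passage is \<open>(c, True)\<close> exactly at negative crossings, hence the inverse.
\<close>

fun under :: "diagram \<Rightarrow> (nat \<Rightarrow> 'f::field) \<Rightarrow> state \<Rightarrow> ('f \<times> state) option" where
  "under D v (Inl k) = None"
| "under D v (Inr (c, b)) = (if passes_over D (c, \<not> b)
     then Some (if b then inverse (v (comp_of D (c, \<not> b))) else v (comp_of D (c, \<not> b)), Inr (c, \<not> b))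
     else None)"

fun words :: "diagram \<Rightarrow> state \<Rightarrow> state list" where
  "words D (Inl k) = map Inr (passages D k)"
| "words D (Inr p) = []"

abbreviation heads :: "diagram \<Rightarrow> state set" where
  "heads D \<equiv> Inl ` components D"

fun closing :: "diagram \<Rightarrow> (nat \<Rightarrow> nat option) \<Rightarrow> state \<Rightarrow> state option" where
  "closing D cl (Inl k) = (if k \<in> dom (loops D) then Some (Inl k) else map_option Inl (cl k))"
| "closing D cl (Inr p) = None"

text \<open>
  The partial map \<open>cl\<close> prescribes additional connections: \<open>cl k = Some l\<close>
  lets the walk go on from the beginning of the arc \<open>k\<close> to the end of \<open>l\<close>.
\<close>

definition link_det :: "diagram \<Rightarrow> (nat \<Rightarrow> nat option) \<Rightarrow> (nat \<Rightarrow> 'f) \<Rightarrow> 'f::field" where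
  "link_det D cl v = chain_det (heads D) (words D) (closing D cl) (under D v)"

definition closes_arcs :: "diagram \<Rightarrow> (nat \<Rightarrow> nat option) \<Rightarrow> bool" where
  "closes_arcs D cl \<longleftrightarrow> (\<forall>k\<in>dom (arcs D). \<forall>m. cl k = Some m \<longrightarrow> m \<in> dom (arcs D)) \<and>
     (\<forall>k\<in>dom (arcs D). \<forall>l\<in>dom (arcs D). cl k = cl l \<longrightarrow> cl k \<noteq> None \<longrightarrow> k = l)"

lemma passes_over_not: "passes_over D (c, b) \<Longrightarrow> \<not> passes_over D (c, \<not> b)"
  by (auto simp: passes_over_def split: if_splits)

lemma under_ref: "under D v s = Some (T, x) \<Longrightarrow> \<exists>c b. s = Inr (c, b) \<and> x = Inr (c, \<not> b) \<and> passes_over D (c, \<not> b)"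
  by (cases "(D, v, s)" rule: under.cases) (auto split: if_splits)

context
  fixes D :: diagram
  assumes wf: "well_formed D"
begin

lemma wfD:
  "finite (components D)" "finite (dom (kinds D))" "k \<in> components D \<Longrightarrow> distinct (passages D k)"
  "k \<in> components D \<Longrightarrow> l \<in> components D \<Longrightarrow> p \<in> set (passages D k) \<Longrightarrow> p \<in> set (passages D l) \<Longrightarrow> k = l"
  "dom (arcs D) \<inter> dom (loops D) = {}"
  using wf unfolding well_formed_def by blast+

lemma passage_iff: "(\<exists>k\<in>components D. p \<in> set (passages D k)) \<longleftrightarrow> fst p \<in> dom (kinds D)"
proof -
  have "(\<Union>k\<in>components D. set (passages D k)) = dom (kinds D) \<times> UNIV" using wf by (simp add: well_formed_def)
  then have "p \<in> (\<Union>k\<in>components D. set (passages D k)) \<longleftrightarrow> p \<in> dom (kinds D) \<times> UNIV" by simp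
  then show ?thesis by (auto simp: mem_Times_iff)
qed

lemma comp_of_eq: "k \<in> components D \<Longrightarrow> p \<in> set (passages D k) \<Longrightarrow> comp_of D p = k"
  unfolding comp_of_def using wfD(4) by blast

lemma link_states: "chain_states (heads D) (words D) = Inl ` components D \<union> Inr ` (dom (kinds D) \<times> UNIV)"
proof -
  have "chain_states (heads D) (words D) = Inl ` components D \<union> Inr ` (\<Union>k\<in>components D. set (passages D k))"
    by (auto simp: chain_states_def)
  then show ?thesis using wf by (simp add: well_formed_def)
qed

lemma link_system:
  assumes cl: "closes_arcs D cl"
  shows "chain_system (heads D) (words D) (closing D cl)"
  unfolding chain_system_def
proof (intro conjI ballI impI)
  show "finite (heads D)" using wfD by simp
  show "distinct (k # words D k)" if "k \<in> heads D" for k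
    using that wfD by (auto simp: distinct_map)
  show "set (k # words D k) \<inter> set (l # words D l) = {}" if "k \<in> heads D" "l \<in> heads D" "k \<noteq> l" for k l
    using that wfD(4) by auto
  show "k = l" if kl: "k \<in> heads D" "l \<in> heads D" "closing D cl k = closing D cl l" "closing D cl k \<noteq> None" for k l
  proof -
    obtain a b where ab: "k = Inl a" "l = Inl b" "a \<in> components D" "b \<in> components D" using kl by auto
    have arc: "c \<in> dom (arcs D)" if "c \<in> components D" "c \<notin> dom (loops D)" for c
      using that by (auto simp: components_def)
    note clD = cl[unfolded closes_arcs_def, THEN conjunct1, rule_format] cl[unfolded closes_arcs_def, THEN conjunct2, rule_format]
    have ca: "m \<notin> dom (loops D)" if "c \<in> components D" "c \<notin> dom (loops D)" "cl c = Some m" for c m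
      using clD(1)[OF arc[OF that(1,2)] that(3)] wfD(5) by auto
    have inj: "c = d" if "c \<in> components D" "c \<notin> dom (loops D)" "d \<in> components D" "d \<notin> dom (loops D)"
        "cl c = cl d" "cl c \<noteq> None" for c d
      using clD(2)[OF arc[OF that(1,2)] arc[OF that(3,4)] that(5,6)] .
    have m: "map_option Inl x = map_option Inl y \<Longrightarrow> x = y" for x y :: "nat option"
      by (cases x; cases y) auto
    consider "a \<in> dom (loops D)" "b \<in> dom (loops D)" | "a \<in> dom (loops D)" "b \<notin> dom (loops D)"
      | "a \<notin> dom (loops D)" "b \<in> dom (loops D)" | "a \<notin> dom (loops D)" "b \<notin> dom (loops D)" by blast
    then show ?thesis
    proof cases
      case 2
      then have "cl b = Some a" using kl(3) ab by (cases "cl b") auto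
      then show ?thesis using ca[OF ab(4) 2(2)] 2 by blast
    next
      case 3
      then have "cl a = Some b" using kl(3) ab by (cases "cl a") auto
      then show ?thesis using ca[OF ab(3) 3(1)] 3 by blast
    next
      case 4
      then have "cl a = cl b" "cl a \<noteq> None" using kl(3,4) ab m by auto
      then show ?thesis using inj[OF ab(3) 4(1) ab(4) 4(2)] ab by simp
    qed (use kl(3) ab in auto)
  qed
qed

lemma unreferenced_virtual:
  assumes "\<not> passes_over D (c, b)"
  shows "unreferenced S (under D v) (Inr (c, b))"
  unfolding unreferenced_def using assms under_ref[of D v] by fastforce

lemma unreferenced_head: "unreferenced S (under D v) (Inl k)"
  unfolding unreferenced_def using under_ref[of D v] by fastforce

text \<open>
  Virtual passages neither are lower passages nor are jumped to, so they can be bypassed. This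
  covers VR1, VR2 and the endpoint move.
\<close>

lemma link_det_erase:
  assumes V: "finite V" "\<And>c. c \<in> V \<Longrightarrow> is_virtual D c" and cl: "closes_arcs D cl"
  shows "link_det (erase V D) cl v = link_det D cl v"
proof -
  have comps: "components (erase V D) = components D" and lp: "dom (loops (erase V D)) = dom (loops D)"
    by (auto simp: erase_def map_words_def components_def)
  have w: "passages (erase V D) k = filter (\<lambda>p. fst p \<notin> V) (passages D k)" for k
    by (auto simp: erase_def map_words_def passages_def erase_word_def split: option.splits)
  have W: "words (erase V D) k = filter (\<lambda>s. s \<notin> Inr ` (V \<times> UNIV)) (words D k)" if "k \<in> heads D" for k
    using that by (auto simp: w filter_map comp_def intro!: arg_cong[where f="map Inr"] filter_cong)
  have co: "comp_of (erase V D) p = comp_of D p" if "fst p \<notin> V" for p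
    unfolding comp_of_def comps w using that by simp
  have po: "passes_over (erase V D) p = (fst p \<notin> V \<and> passes_over D p)" for p
    by (auto simp: passes_over_def erase_def restrict_map_def)
  have nv: "\<not> passes_over D (c, b)" if "c \<in> V" for c b
    using V(2)[OF that] by (auto simp: passes_over_def is_virtual_def)
  have un: "under (erase V D) v s = under D v s" for s
    by (cases "(D, v, s)" rule: under.cases) (auto simp: po co nv)
  have "closing (erase V D) cl = closing D cl"
    by (rule ext, rule closing.induct[where P="\<lambda>_ cl s. closing (erase V D) cl s = closing D cl s"]) (auto simp: lp)
  then have "link_det (erase V D) cl v = chain_det (heads D) (\<lambda>k. filter (\<lambda>s. s \<notin> Inr ` (V \<times> UNIV)) (words D k)) (closing D cl) (under D v)"
    unfolding link_det_def comps using W un by (intro chain_det_cong) auto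
  also have "\<dots> = link_det D cl v"
    unfolding link_det_def
    by (rule chain_det_filter[OF link_system[OF cl]])
       (use V nv in \<open>auto intro: unreferenced_virtual\<close>)
  finally show ?thesis .
qed

text \<open>Eliminating the base points of the loops makes neighbours on a loop adjacent across the base point.\<close>

definition base_points :: "state set" where
  "base_points = {Inl k |k. \<exists>w. loops D k = Some w \<and> w \<noteq> []}"

definition cyclic_wiring :: "(nat \<Rightarrow> nat option) \<Rightarrow> state \<Rightarrow> state \<Rightarrow> bool" where
  "cyclic_wiring cl = bypass_set base_points (chain_wiring (heads D) (words D) (closing D cl))"

definition cyclic_states :: "state set" where
  "cyclic_states = chain_states (heads D) (words D) - base_points"

lemma passages_loop: "loops D k = Some w \<Longrightarrow> passages D k = w"
  using wfD(5) by (auto simp: passages_def split: option.splits)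

lemma base_points_subset: "base_points \<subseteq> heads D"
  by (auto simp: base_points_def components_def)

lemma base_point_not_adjacent:
  assumes "x \<in> base_points" "y \<in> base_points"
  shows "\<not> chain_wiring (heads D) (words D) (closing D cl) x y"
proof
  assume "chain_wiring (heads D) (words D) (closing D cl) x y"
  moreover obtain k l w z where k: "x = Inl k" "y = Inl l" "loops D k = Some w" "w \<noteq> []" "loops D l = Some z" "z \<noteq> []"
    using assms by (auto simp: base_points_def)
  moreover have "\<not> adjacent (Inl m # map Inr ps) a (Inl l)" for m and ps :: "passage list" and a
    using adjacent_set[of "Inl m # map Inr ps" a "Inl l"] by auto
  ultimately obtain m where m: "m \<in> components D" "Inl k = last (Inl m # words D (Inl m))"
    by (auto simp: chain_wiring_def simp del: last.simps)
  then have "passages D m = []" "m = k" by (auto simp: last_map split: if_splits)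
  then show False using passages_loop k by simp
qed

lemma cyclic_wiring_swap:
  assumes X: "X = chain_wiring (heads D) (words D) (closing D cl) \<or>
     X = swap_states (Inr x1) (Inr y1) (swap_states (Inr x2) (Inr y2) (swap_states (Inr x3) (Inr y3)
       (chain_wiring (heads D) (words D) (closing D cl))))"
    and cl: "closes_arcs D cl"
  shows "walk_det (chain_states (heads D) (words D)) X (under D v) = walk_det cyclic_states (bypass_set base_points X) (under D v)"
    and "wiring (bypass_set base_points X)"
proof -
  have w: "wiring X"
    using X wiring_chain[OF link_system[OF cl]] by (auto intro: wiring_swap_states)
  have nadj: "\<not> X k l" if "k \<in> base_points" "l \<in> base_points" for k l
  proof -
    have t: "Transposition.transpose (Inr x) (Inr y) k = k" "Transposition.transpose (Inr x) (Inr y) l = l" for x y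
      using that by (auto simp: base_points_def)
    show ?thesis using X base_point_not_adjacent[OF that] by (elim disjE) (simp_all add: swap_states_def t)
  qed
  have fin: "finite (chain_states (heads D) (words D))" by (rule finite_chain_states[OF link_system[OF cl]])
  have sub: "base_points \<subseteq> chain_states (heads D) (words D)"
    using base_points_subset by (auto simp: link_states)
  have "walk_det (chain_states (heads D) (words D) - base_points) (bypass_set base_points X) (under D v) =
      walk_det (chain_states (heads D) (words D)) X (under D v) \<and> wiring (bypass_set base_points X)"
    using fin sub finite_subset[OF sub fin] nadj w
    by (intro walk_det_bypass_set) (auto simp: base_points_def intro: unreferenced_head)
  then show "walk_det (chain_states (heads D) (words D)) X (under D v) = walk_det cyclic_states (bypass_set base_points X) (under D v)"
    "wiring (bypass_set base_points X)"
    unfolding cyclic_states_def by auto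
qed

lemma next_on_same: 
  assumes "next_on D x y"
  shows "\<exists>k\<in>components D. x \<in> set (passages D k) \<and> y \<in> set (passages D k)"
  using assms unfolding next_on_def
proof (elim disjE exE bexE)
  fix k u assume "loops D k = Some ([y] @ u @ [x])"
  then show ?thesis using passages_loop[of k] by (intro bexI[of _ k]) (auto simp: components_def)
qed force

lemma next_on_cyclic:
  assumes n: "next_on D x y" and cl: "closes_arcs D cl"
  shows "cyclic_wiring cl (Inr x) (Inr y)"
  using n unfolding next_on_def
proof
  assume "\<exists>k\<in>components D. \<exists>u v. passages D k = u @ [x, y] @ v"
  then obtain k u v where k: "k \<in> components D" "passages D k = u @ [x, y] @ v" by blast
  then have "adjacent (Inl k # words D (Inl k)) (Inr x) (Inr y)" by (auto simp: adjacent_Cons adjacent_append)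
  then have "chain_wiring (heads D) (words D) (closing D cl) (Inr x) (Inr y)"
    using k by (auto simp: chain_wiring_def simp del: words.simps)
  then show ?thesis by (auto simp: cyclic_wiring_def bypass_set_def base_points_def)
next
  assume "\<exists>k u. loops D k = Some ([y] @ u @ [x])"
  then obtain k u where k: "loops D k = Some ([y] @ u @ [x])" by blast
  have kc: "k \<in> components D" "Inl k \<in> base_points" using k by (auto simp: components_def base_points_def)
  have w: "words D (Inl k) = Inr y # map Inr u @ [Inr x]" using passages_loop[OF k] by simp
  have "chain_wiring (heads D) (words D) (closing D cl) (Inr x) (Inl k)"
    using k kc w by (auto simp: chain_wiring_def simp del: words.simps)
  moreover have "adjacent (Inl k # words D (Inl k)) (Inl k) (Inr y)" unfolding w by simp
  then have "chain_wiring (heads D) (words D) (closing D cl) (Inl k) (Inr y)"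
    using kc by (auto simp: chain_wiring_def simp del: words.simps)
  ultimately show ?thesis using kc by (auto simp: cyclic_wiring_def bypass_set_def base_points_def)
qed

lemma cyclic_pred:
  assumes p: "fst p \<in> dom (kinds D)" and cl: "closes_arcs D cl"
  shows "\<exists>s\<in>cyclic_states. cyclic_wiring cl s (Inr p)"
proof -
  let ?A = "chain_wiring (heads D) (words D) (closing D cl)"
  obtain k u z where k: "k \<in> components D" "passages D k = u @ [p] @ z"
    using p passage_iff[of p] by (metis append_Cons append_Nil split_list)
  define s where "s = last (Inl k # map Inr u)"
  have "adjacent (Inl k # words D (Inl k)) s (Inr p)"
    using adjacent_append[of "Inl k # map Inr u" "Inr p # map Inr z" s "Inr p"] k(2) by (simp add: s_def)
  then have A: "?A s (Inr p)" using k by (auto simp: chain_wiring_def simp del: words.simps)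
  have pn: "Inr p \<notin> base_points" by (auto simp: base_points_def)
  show ?thesis
  proof (cases "s \<in> base_points")
    case False
    then show ?thesis using A pn chain_wiring_states[OF A]
      by (intro bexI[of _ s]) (auto simp: cyclic_wiring_def bypass_set_def cyclic_states_def)
  next
    case True
    then obtain l w where l: "s = Inl l" "loops D l = Some w" "w \<noteq> []" by (auto simp: base_points_def)
    have "?A (Inr (last w)) (Inl l)"
      using l passages_loop[OF l(2)] by (auto simp: chain_wiring_def components_def last_map)
    then show ?thesis using A pn True l chain_wiring_states[of "heads D" "words D" "closing D cl" "Inr (last w)"]
      by (intro bexI[of _ "Inr (last w)"]) (auto simp: cyclic_wiring_def bypass_set_def cyclic_states_def base_points_def)
  qed
qed

end

section \<open>Invariance under the moves\<close>

lemma adjacent_map_inj: "inj f \<Longrightarrow> adjacent (map f xs) (f a) (f b) \<longleftrightarrow> adjacent xs a b"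
  by (induction xs a b rule: adjacent.induct) (auto simp: inj_eq)

lemma well_formed_cong:
  assumes "dom (arcs E) = dom (arcs D)" "dom (loops E) = dom (loops D)" "dom (kinds E) = dom (kinds D)"
    "passages E = passages D"
  shows "well_formed E \<longleftrightarrow> well_formed D"
  unfolding well_formed_def components_def assms ..

lemma closes_arcs_cong: "arcs E = arcs D \<Longrightarrow> closes_arcs E cl \<longleftrightarrow> closes_arcs D cl"
  by (simp only: closes_arcs_def)

lemma closing_heads:
  assumes cl: "closes_arcs D cl" and k: "k \<in> heads D" "closing D cl k = Some l"
  shows "l \<in> heads D"
proof -
  obtain a where a: "k = Inl a" "a \<in> components D" using k by blast
  show ?thesis
  proof (cases "a \<in> dom (loops D)")
    case True
    then have "l = k" using k(2) a by simp
    then show ?thesis using k(1) by simp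
  next
    case False
    then obtain m where m: "cl a = Some m" "l = Inl m" using k(2) a by auto
    have "a \<in> dom (arcs D)" using False a by (simp only: components_def Un_iff simp_thms)
    then have "m \<in> dom (arcs D)" using cl m(1) unfolding closes_arcs_def by blast
    then show ?thesis unfolding m(2) components_def by blast
  qed
qed

text \<open>
  Exchanging the names of two passages of the same component does not change the component of any
  passage, so the weights stay the same.
\<close>

definition balanced :: "diagram \<Rightarrow> passage \<Rightarrow> passage \<Rightarrow> bool" where
  "balanced D x y \<longleftrightarrow> (\<forall>k\<in>components D. x \<in> set (passages D k) \<longleftrightarrow> y \<in> set (passages D k))"

lemma exchange_simps:
  "components (exchange x y D) = components D" "dom (loops (exchange x y D)) = dom (loops D)"
  "kinds (exchange x y D) = kinds D"
  "passages (exchange x y D) k = map (Transposition.transpose x y) (passages D k)"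
  by (auto simp: exchange_def map_words_def components_def passages_def split: option.splits)

lemma exchange_set:
  assumes "balanced D x y" "k \<in> components D"
  shows "set (passages (exchange x y D) k) = set (passages D k)"
  using assms by (auto simp: exchange_simps balanced_def transpose_def image_iff split: if_splits)

lemma under_cong:
  assumes "components D' = components D" "kinds D' = kinds D"
    "\<And>k. k \<in> components D \<Longrightarrow> set (passages D' k) = set (passages D k)"
  shows "under D' v = under D v"
proof
  fix s
  have "comp_of D' p = comp_of D p" for p
    unfolding comp_of_def using assms by (intro arg_cong[where f=The] ext) auto
  then show "under D' v s = under D v s"
    using assms by (cases "(D, v, s)" rule: under.cases) (auto simp: passes_over_def)
qed

lemma closing_cong: "dom (loops D') = dom (loops D) \<Longrightarrow> closing D' cl s = closing D cl s"
  by (cases "(D, cl, s)" rule: closing.cases) auto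

lemma exchange_chain:
  assumes bal: "balanced D x y"
  shows "chain_states (heads (exchange x y D)) (words (exchange x y D)) = chain_states (heads D) (words D)"
    and "chain_wiring (heads (exchange x y D)) (words (exchange x y D)) (closing (exchange x y D) cl) =
      swap_states (Inr x) (Inr y) (chain_wiring (heads D) (words D) (closing D cl))"
    and "under (exchange x y D) v = under D v"
proof -
  let ?D = "exchange x y D" and ?t = "Transposition.transpose (Inr x :: state) (Inr y)"
  have W: "words ?D k = map ?t (words D k)" for k
    by (cases k) (auto simp: exchange_simps transpose_def)
  have S: "set (words ?D k) = set (words D k)" if "k \<in> heads D" for k
    using that exchange_set[OF bal] by auto
  have t: "?t (Inl k) = Inl k" for k by (simp add: transpose_def)
  have inj: "inj ?t" by simp
  have cl: "closing ?D cl s = closing D cl s" for s by (rule closing_cong) (simp add: exchange_simps)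
  show "chain_states (heads ?D) (words ?D) = chain_states (heads D) (words D)"
    unfolding chain_states_def exchange_simps using S by auto
  have "chain_wiring (heads ?D) (words ?D) (closing ?D cl) (?t j) (?t s) \<longleftrightarrow>
      chain_wiring (heads D) (words D) (closing D cl) j s" for j s
  proof -
    have a: "adjacent (k # words ?D k) (?t j) (?t s) \<longleftrightarrow> adjacent (k # words D k) j s" if "k \<in> heads D" for k
      using adjacent_map_inj[OF inj, of "k # words D k" j s] that by (auto simp: W t)
    have l: "last (l # words ?D l) = ?t (last (l # words D l))" if "l \<in> heads D" for l
      using that by (auto simp: W t last_map)
    have h: "?t s \<in> heads D \<longleftrightarrow> s \<in> heads D" by (auto simp: transpose_def)
    have hs: "?t s = s" if "s \<in> heads D" using that t by auto
    have e: "?t a = ?t b \<longleftrightarrow> a = b" for a b using inj by (simp add: inj_eq)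
    have q: "(\<exists>l\<in>heads D. closing D cl (?t s) = Some l \<and> ?t j = last (l # words ?D l)) \<longleftrightarrow>
      (\<exists>l\<in>heads D. closing D cl s = Some l \<and> j = last (l # words D l))" if "s \<in> heads D"
      unfolding hs[OF that] by (intro bex_cong refl) (simp only: l e)
    show ?thesis
      unfolding chain_wiring_def exchange_simps cl h using a q by blast
  qed
  from this[of "?t _" "?t _"] show "chain_wiring (heads ?D) (words ?D) (closing ?D cl) =
      swap_states (Inr x) (Inr y) (chain_wiring (heads D) (words D) (closing D cl))"
    by (auto simp: fun_eq_iff swap_states_def)
  show "under ?D v = under D v"
    by (rule under_cong) (use exchange_set[OF bal] in \<open>auto simp: exchange_simps(1-3)\<close>)
qed

lemma balanced_exchange: "balanced D x y \<Longrightarrow> balanced D z w \<Longrightarrow> balanced (exchange x y D) z w"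
  using exchange_set unfolding balanced_def exchange_simps(1) by metis

lemma unreferenced_redirect:
  "unreferenced S und z \<Longrightarrow> z \<noteq> y \<Longrightarrow> unreferenced S (redirect x y und) z"
  by (auto simp: unreferenced_def redirect_def)

context
  fixes D :: diagram and cl :: "nat \<Rightarrow> nat option" and v :: "nat \<Rightarrow> 'f::field"
  assumes wf: "well_formed D" and cl: "closes_arcs D cl"
begin

lemma cyclic_facts:
  "finite (cyclic_states D)" "wiring (cyclic_wiring D cl)"
  "link_det D cl v = walk_det (cyclic_states D) (cyclic_wiring D cl) (under D v)"
  "fst p \<in> dom (kinds D) \<Longrightarrow> Inr p \<in> cyclic_states D"
proof -
  show "finite (cyclic_states D)"
    unfolding cyclic_states_def[OF wf] using finite_chain_states[OF link_system[OF wf cl]] by simp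
  show "wiring (cyclic_wiring D cl)" "link_det D cl v = walk_det (cyclic_states D) (cyclic_wiring D cl) (under D v)"
    using cyclic_wiring_swap[OF wf disjI1[OF refl] cl]
    by (simp_all add: cyclic_wiring_def[OF wf] link_det_def chain_det_def)
  show "fst p \<in> dom (kinds D) \<Longrightarrow> Inr p \<in> cyclic_states D"
    by (auto simp: cyclic_states_def[OF wf] link_states[OF wf] base_points_def[OF wf] mem_Times_iff image_iff intro!: bexI[of _ p])
qed

lemma next_on_balanced: "next_on D x y \<Longrightarrow> balanced D x y"
  using next_on_same[OF wf] wfD(4)[OF wf] unfolding balanced_def by metis

lemma edge_facts:
  assumes "edge D \<sigma> x y"
  shows "(if \<sigma> then cyclic_wiring D cl (Inr x) (Inr y) else cyclic_wiring D cl (Inr y) (Inr x))"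
    "balanced D x y" "comp_of D x = comp_of D y" "fst x \<in> dom (kinds D)" "fst y \<in> dom (kinds D)"
proof -
  have n: "next_on D x y \<or> next_on D y x" using assms by (auto simp: edge_def split: if_splits)
  show "(if \<sigma> then cyclic_wiring D cl (Inr x) (Inr y) else cyclic_wiring D cl (Inr y) (Inr x))"
    using assms next_on_cyclic[OF wf _ cl] by (auto simp: edge_def split: if_splits)
  show "balanced D x y" using n next_on_balanced unfolding balanced_def by metis
  obtain k where k: "k \<in> components D" "x \<in> set (passages D k)" "y \<in> set (passages D k)"
    using n next_on_same[OF wf] by metis
  show "comp_of D x = comp_of D y" using comp_of_eq[OF wf k(1,2)] comp_of_eq[OF wf k(1,3)] by simp
  show "fst x \<in> dom (kinds D)" "fst y \<in> dom (kinds D)" using passage_iff[OF wf] k by blast+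
qed

lemma link_det_three_exchanges:
  assumes "balanced D x1 y1" "balanced D x2 y2" "balanced D x3 y3"
  shows "link_det (exchange x1 y1 (exchange x2 y2 (exchange x3 y3 D))) cl v =
    walk_det (cyclic_states D) (swap_states (Inr x1) (Inr y1) (swap_states (Inr x2) (Inr y2)
       (swap_states (Inr x3) (Inr y3) (cyclic_wiring D cl)))) (under D v)"
proof -
  let ?D3 = "exchange x3 y3 D" and ?D2 = "exchange x2 y2 (exchange x3 y3 D)"
  have b: "balanced ?D3 x2 y2" "balanced ?D2 x1 y1"
    using assms balanced_exchange by blast+
  have n: "Inr x \<notin> base_points D" for x by (auto simp: base_points_def[OF wf])
  show ?thesis
    unfolding link_det_def chain_det_def exchange_chain[OF b(2)] exchange_chain[OF b(1)] exchange_chain[OF assms(3)]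
      cyclic_wiring_swap(1)[OF wf disjI2[OF refl] cl]
    by (simp add: bypass_set_swap_states[OF n n] cyclic_wiring_def[OF wf])
qed

text \<open>
  With base points bypassed, a slide is a product of three exchanges of neighbouring states. In VR3
  and M each exchange involves a virtual passage; in OC the exchange of the two upper passages is
  harmless as well; R3 needs the interplay of all three edges.
\<close>

lemma link_det_slide:
  assumes tri: "triangle D (p, a) (q, b) (r, d)" and v: "\<And>k. v k \<noteq> 0"
    and kinds: "is_virtual D p \<and> is_virtual D r \<or>
       passes_over D (p, a) \<and> is_virtual D q \<and> passes_over D (r, \<not> d) \<or>
       passes_over D (p, a) \<and> passes_over D (q, b) \<and> passes_over D (r, \<not> d)"
  shows "link_det (slide (p, a) (q, b) (r, d) D) cl v = link_det D cl v"
proof -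
  let ?S = "cyclic_states D" and ?A = "cyclic_wiring D cl" and ?u = "under D v"
  define P1 P2 Q1 Q2 R1 R2 :: state where
    "P1 = Inr (p, a)" and "P2 = Inr (p, \<not> a)" and "Q1 = Inr (q, b)" and "Q2 = Inr (q, \<not> b)"
    and "R1 = Inr (r, d)" and "R2 = Inr (r, \<not> d)"
  note defs = P1_def P2_def Q1_def Q2_def R1_def R2_def
  obtain \<sigma>1 \<sigma>2 \<sigma>3 \<tau> where dist: "distinct [p, q, r]"
    and e: "edge D \<sigma>1 (r, \<not> d) (p, a)" "edge D \<sigma>2 (p, \<not> a) (q, b)" "edge D \<sigma>3 (q, \<not> b) (r, d)"
    and or: "a \<longleftrightarrow> ((\<sigma>1 = \<sigma>2) = \<tau>)" "b \<longleftrightarrow> ((\<sigma>2 = \<sigma>3) = \<tau>)" "d \<longleftrightarrow> ((\<sigma>3 = \<sigma>1) = \<tau>)"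
    using tri unfolding triangle_def prod.case by blast
  note f1 = edge_facts[OF e(1)] and f2 = edge_facts[OF e(2)] and f3 = edge_facts[OF e(3)]
  have S: "P1 \<in> ?S" "P2 \<in> ?S" "Q1 \<in> ?S" "Q2 \<in> ?S" "R1 \<in> ?S" "R2 \<in> ?S"
    unfolding defs using f1 f2 f3 by (auto intro!: cyclic_facts(4))
  have D6: "distinct [P1, P2, Q1, Q2, R1, R2]" using dist by (auto simp: defs)
  have A1: "?A R2 P1 \<or> ?A P1 R2" and A2: "if \<sigma>2 then ?A P2 Q1 else ?A Q1 P2"
    and A3: "if \<sigma>3 then ?A Q2 R1 else ?A R1 Q2"
    using f1(1) f2(1) f3(1) by (auto simp: defs split: if_splits)
  have pred: "\<exists>s\<in>?S. ?A s P1" "\<exists>s\<in>?S. ?A s P2" "\<exists>s\<in>?S. ?A s Q1" "\<exists>s\<in>?S. ?A s R2"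
    unfolding defs using f1 f2 f3 by (auto intro!: cyclic_pred[OF wf _ cl])
  let ?A3 = "swap_states Q2 R1 ?A"
  let ?A2 = "swap_states P2 Q1 ?A3"
  let ?A1 = "swap_states R2 P1 ?A2"
  have fin: "finite ?S" and w: "wiring ?A" using cyclic_facts by blast+
  have w3: "wiring ?A3" and w2: "wiring ?A2" using w by (intro wiring_swap_states; simp)+
  have A32: "if \<sigma>2 then ?A3 P2 Q1 else ?A3 Q1 P2" using A2 D6 by (auto simp: swap_states_def transpose_def)
  have A21: "?A2 R2 P1 \<longleftrightarrow> ?A R2 P1" "?A2 P1 R2 \<longleftrightarrow> ?A P1 R2"
    using D6 by (auto simp: swap_states_def transpose_def)
  have pred2: "\<exists>s. ?A2 s P1" "\<exists>s. ?A2 s R2"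
  proof -
    have "\<exists>s. ?A2 s x" if h: "\<exists>s\<in>?S. ?A s x" "x \<notin> {P2, Q1, Q2, R1}" for x
    proof -
      obtain s where "?A s x" using h by blast
      then have "?A2 (Transposition.transpose P2 Q1 (Transposition.transpose Q2 R1 s)) x"
        using h(2) by (simp add: swap_states_def)
      then show ?thesis by blast
    qed
    then show "\<exists>s. ?A2 s P1" "\<exists>s. ?A2 s R2" using pred D6 by auto
  qed
  have None: "?u (Inr (c, e)) = None" if "is_virtual D c \<or> passes_over D (c, e)" for c e
    using that passes_over_not[of D c e] by (auto simp: is_virtual_def passes_over_def)
  have unref: "unreferenced T ?u (Inr (c, e))" if "is_virtual D c \<or> passes_over D (c, \<not> e)" for T c e
    using that passes_over_not[of D c "\<not> e"] by (intro unreferenced_virtual[OF wf]) (auto simp: is_virtual_def passes_over_def)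
  have over: "walk_det ?S ?A1 ?u = walk_det ?S ?A2 ?u" if "passes_over D (p, a)" "passes_over D (r, \<not> d)"
  proof -
    have n: "?u P1 = None" "?u R2 = None" unfolding defs using that by (auto simp del: under.simps intro!: None)
    show ?thesis
    proof (cases "?A R2 P1")
      case True
      then show ?thesis
        using walk_det_swap_over[where und="?u", OF fin S(6) n(2) S(1) n(1) w2] A21 pred2 D6 by auto
    next
      case False
      then show ?thesis
        using walk_det_swap_over[where und="?u", OF fin S(1) n(1) S(6) n(2) w2] A1 A21 pred2 D6
        by (auto simp: swap_states_commute[of R2 P1])
    qed
  qed
  have virt: "walk_det ?S (swap_states x y B) ?u = walk_det ?S B ?u"
    if "x = Inr (c, e)" "is_virtual D c" "x \<in> ?S" "wiring B" "B x y \<or> B y x" "x \<noteq> y" for x y c e B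
    using that by (intro walk_det_swap_virtual[OF fin]) (auto simp del: under.simps simp: None unref)
  have "walk_det ?S ?A1 ?u = walk_det ?S ?A ?u"
    using kinds
  proof (elim disjE conjE)
    assume k: "is_virtual D p" "is_virtual D r"
    have "walk_det ?S ?A1 ?u = walk_det ?S ?A2 ?u"
      by (rule virt[of _ r "\<not> d"]) (use k S w2 A1 A21 D6 in \<open>auto simp: R2_def\<close>)
    also have "\<dots> = walk_det ?S ?A3 ?u"
      by (rule virt[of _ p "\<not> a"]) (use k S w3 A32 D6 in \<open>auto simp: P2_def split: if_splits\<close>)
    also have "\<dots> = walk_det ?S ?A ?u"
      unfolding swap_states_commute[of Q2 R1]
      by (rule virt[of _ r d]) (use k S w A3 D6 in \<open>auto simp: R1_def split: if_splits\<close>)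
    finally show ?thesis .
  next
    assume k: "passes_over D (p, a)" "is_virtual D q" "passes_over D (r, \<not> d)"
    have "walk_det ?S ?A1 ?u = walk_det ?S ?A2 ?u" using over k by simp
    also have "\<dots> = walk_det ?S ?A3 ?u"
      unfolding swap_states_commute[of P2 Q1]
      by (rule virt[of _ q b]) (use k S w3 A32 D6 in \<open>auto simp: Q1_def split: if_splits\<close>)
    also have "\<dots> = walk_det ?S ?A ?u"
      by (rule virt[of _ q "\<not> b"]) (use k S w A3 D6 in \<open>auto simp: Q2_def split: if_splits\<close>)
    finally show ?thesis .
  next
    assume k: "passes_over D (p, a)" "passes_over D (q, b)" "passes_over D (r, \<not> d)"
    define t where "t = v (comp_of D (p, a))"
    have t: "t \<noteq> 0" "v (comp_of D (r, \<not> d)) = t" using v f1(3) by (auto simp: t_def)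
    define X Y where "X = (if ?A R2 P1 then P1 else R2)" and "Y = (if ?A R2 P1 then R2 else P1)"
    have XY: "?A Y X" "?A2 Y X" "X \<in> ?S" "?u X = None" "Y \<in> {P1, R2}" "{X, Y} = {P1, R2}"
      using A1 A21 S None[of p a] None[of r "\<not> d"] k by (auto simp del: under.simps simp: X_def Y_def P1_def[symmetric] R2_def[symmetric])
    let ?w = "redirect X Y ?u"
    have "?u P2 = Some (if a then t else inverse t, P1)" "?u R1 = Some (if d then inverse t else t, R2)"
      "?u Q2 = Some (if b then v (comp_of D (q, b)) else inverse (v (comp_of D (q, b))), Q1)" "?u Q1 = None"
      using k t None[of q b] by (auto simp: defs t_def)
    then have und: "?w P2 = Some (if a then t else inverse t, Y)" "?w R1 = Some (if d then inverse t else t, Y)"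
      "?w Q2 = Some (if b then v (comp_of D (q, b)) else inverse (v (comp_of D (q, b))), Q1)" "?w Q1 = None"
      using XY(6) D6 by (auto simp: redirect_def doubleton_eq_iff)
    have "unreferenced (?S - {Q2}) ?u Q1"
      unfolding unreferenced_def Q1_def Q2_def using under_ref[of D v] by fastforce
    then have ur: "unreferenced ?S ?w P2" "unreferenced ?S ?w Q2" "unreferenced ?S ?w R1" "unreferenced (?S - {Q2}) ?w Q1"
      using XY(5) D6 k by (auto intro!: unreferenced_redirect simp: P2_def Q2_def R1_def intro: unref)
    have "walk_det ?S ?A1 ?u = walk_det ?S ?A2 ?u" using over k by simp
    also have "\<dots> = walk_det ?S ?A2 ?w"
      by (rule walk_det_redirect[where und="?u", OF fin XY(3,4) w2 XY(2), symmetric])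
    also have "\<dots> = walk_det ?S ?A ?w"
    proof (rule walk_det_slide'[OF fin _ _ _ w pred(2,3) und(1,4,3,2) ur])
      show "{P2, Q1, Q2, R1, Y} \<subseteq> ?S" using S XY(5) by auto
      show "distinct [P2, Q1, Q2, R1]" "Y \<notin> {Q1, Q2, R1}" using D6 XY(5) by auto
      have ad: "a = d \<longleftrightarrow> \<sigma>2 = \<sigma>3" using or by (cases \<sigma>1; cases \<sigma>2; cases \<sigma>3; cases \<tau>; simp)
      show "?A Q2 R1 \<and> ?A P2 Q1 \<and> (if a then t else inverse t) * (if d then inverse t else t) = 1 \<or>
        ?A Q2 R1 \<and> ?A Q1 P2 \<and> (if a then t else inverse t) = (if d then inverse t else t) \<or>
        ?A R1 Q2 \<and> ?A Q1 P2 \<and> (if a then t else inverse t) * (if d then inverse t else t) = 1 \<or>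
        ?A R1 Q2 \<and> ?A P2 Q1 \<and> (if a then t else inverse t) = (if d then inverse t else t)"
        using A2 A3 ad t by (cases \<sigma>2; cases \<sigma>3; cases a; cases d) auto
    qed
    also have "\<dots> = walk_det ?S ?A ?u"
      by (rule walk_det_redirect[where und="?u", OF fin XY(3,4) w XY(1)])
    finally show ?thesis .
  qed
  moreover have "link_det (slide (p, a) (q, b) (r, d) D) cl v = walk_det ?S ?A1 ?u"
    unfolding slide_def using link_det_three_exchanges[OF f1(2) f2(2) f3(2)] by (simp add: defs)
  ultimately show ?thesis using cyclic_facts(3) by simp
qed

end

text \<open>
  After cancellation the corners of an R2 bigon may be regarded as virtual, which reduces R2 to VR2.
\<close>

lemma link_det_cancel:
  fixes v :: "nat \<Rightarrow> 'f::field"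
  assumes wf: "well_formed D" and cl: "closes_arcs D cl" and big: "bigon D p q" and kinds: "{kinds D p, kinds D q} = {Some Positive, Some Negative}"
    and v: "\<And>k. v k \<noteq> 0"
  shows "link_det (D\<lparr>kinds := (kinds D)(p \<mapsto> Virtual, q \<mapsto> Virtual)\<rparr>) cl v = link_det D cl v"
proof -
  let ?S = "cyclic_states D" and ?A = "cyclic_wiring D cl" and ?u = "under D v"
  let ?D = "D\<lparr>kinds := (kinds D)(p \<mapsto> Virtual, q \<mapsto> Virtual)\<rparr>"
  obtain a \<sigma> where pq: "p \<noteq> q" "next_on D (p, a) (q, \<not> a)" "edge D \<sigma> (p, \<not> a) (q, a)"
    using big by (auto simp: bigon_def)
  have e1: "edge D True (p, a) (q, \<not> a)" using pq by (simp add: edge_def)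
  note f1 = edge_facts[OF wf cl e1] and f2 = edge_facts[OF wf cl pq(3)]
  define P N where "P = (if kinds D p = Some Positive then p else q)" and "N = (if kinds D p = Some Positive then q else p)"
  have k: "kinds D P = Some Positive" "kinds D N = Some Negative" "P \<noteq> N" "{P, N} = {p, q}"
    using kinds pq(1) by (auto simp: P_def N_def doubleton_eq_iff)
  have adj: "?A (Inr (P, False)) (Inr (N, True)) \<or> ?A (Inr (N, True)) (Inr (P, False))"
    "?A (Inr (P, True)) (Inr (N, False)) \<or> ?A (Inr (N, False)) (Inr (P, True))"
    using f1(1) f2(1) by (cases a; cases \<sigma>; auto simp: P_def N_def)+
  have comp: "comp_of D (P, True) = comp_of D (N, False)"
    using f1(3) f2(3) by (cases a) (auto simp: P_def N_def)
  define t where "t = v (comp_of D (P, True))"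
  have und: "?u (Inr (P, False)) = Some (t, Inr (P, True))" "?u (Inr (N, True)) = Some (inverse t, Inr (N, False))"
    "?u (Inr (P, True)) = None" "?u (Inr (N, False)) = None"
    using k comp by (auto simp: passes_over_def t_def)
  have t: "t * inverse t = 1" "inverse t * t = 1" using v by (auto simp: t_def)
  have S: "Inr (P, x) \<in> ?S" "Inr (N, x) \<in> ?S" for x using k by (auto intro: cyclic_facts(4)[OF wf cl])
  have unref: "unreferenced ?S ?u (Inr (P, False))" "unreferenced ?S ?u (Inr (N, True))"
    using k by (auto intro!: unreferenced_virtual[OF wf] simp: passes_over_def)
  have fin: "finite ?S" and w: "wiring ?A" using cyclic_facts[OF wf cl] by blast+
  have n: "Inr (P, False) \<noteq> Inr (N, True)" "Inr (N, True) \<noteq> Inr (P, False)" using k by auto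
  let ?u' = "?u(Inr (P, False) := None, Inr (N, True) := None)"
  have "walk_det ?S ?A ?u = walk_det ?S ?A ?u'"
    using adj(1)
  proof
    assume "?A (Inr (P, False)) (Inr (N, True))"
    then show ?thesis
      using walk_det_cancel_bigon[where und="?u", OF fin S(1) S(2) n(1) _ w und(1,2) t(1) S(1) S(2) und(3,4) adj(2) unref(1)] by simp
  next
    assume "?A (Inr (N, True)) (Inr (P, False))"
    then show ?thesis
      using walk_det_cancel_bigon[where und="?u", OF fin S(2) S(1) n(2) _ w und(2,1) t(2) S(2) S(1) und(4,3) _ unref(2)] adj(2)
      by (auto simp: fun_upd_twist[OF n(1)])
  qed
  moreover have "link_det ?D cl v = walk_det ?S ?A ?u'"
  proof -
    have [simp]: "components ?D = components D" by (simp add: components_def)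
    have [simp]: "passages ?D = passages D" by (rule ext) (simp add: passages_def split: option.split)
    have "dom ((kinds D)(p \<mapsto> Virtual, q \<mapsto> Virtual)) = dom (kinds D)"
      using f1(4,5) by (simp only: dom_fun_upd fst_conv insert_absorb insert_iff simp_thms option.distinct if_False)
    moreover have "kinds ?D = (kinds D)(p \<mapsto> Virtual, q \<mapsto> Virtual)" by simp
    ultimately have dk: "dom (kinds ?D) = dom (kinds D)" by (simp only:)
    have wf': "well_formed ?D" by (rule well_formed_cong[THEN iffD2, OF _ _ dk _ wf]) simp_all
    have cl': "closes_arcs ?D cl" by (rule closes_arcs_cong[THEN iffD2, OF _ cl]) simp
    have "words ?D s = words D s" for s by (cases s) auto
    then have W: "words ?D = words D" by blast
    have C: "closing ?D cl = closing D cl" by (rule ext, rule closing_cong) simp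
    have B: "base_points ?D = base_points D" by (simp add: base_points_def[OF wf] base_points_def[OF wf'])
    have co: "comp_of ?D x = comp_of D x" for x by (simp add: comp_of_def)
    have po: "passes_over ?D x \<longleftrightarrow> fst x \<notin> {P, N} \<and> passes_over D x" for x
      unfolding k(4) by (auto simp: passes_over_def)
    have "under ?D v s = ?u' s" for s
    proof (cases s)
      case (Inr x)
      obtain c b where x: "x = (c, b)" by fastforce
      have pP: "passes_over D (P, e) \<longleftrightarrow> e" "passes_over D (N, e) \<longleftrightarrow> \<not> e" for e
        by (simp_all add: passes_over_def k)
      show ?thesis
        unfolding Inr x using k(3) by (cases "c = P"; cases "c = N"; cases b) (simp_all add: po co pP)
    qed simp
    then have "under ?D v = ?u'" by blast
    then show ?thesis
      unfolding cyclic_facts(3)[OF wf' cl'] cyclic_states_def[OF wf'] cyclic_states_def[OF wf]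
        cyclic_wiring_def[OF wf'] cyclic_wiring_def[OF wf] W C B by simp
  qed
  ultimately show ?thesis by (simp only: cyclic_facts(3)[OF wf cl])
qed

lemma link_det_rename:
  fixes v :: "nat \<Rightarrow> 'f::field"
  assumes wf: "well_formed D" and cl: "closes_arcs D cl" and \<pi>: "bij \<pi>"
  shows "link_det (rename_crossings \<pi> D) cl v = link_det D cl v"
proof -
  let ?D = "rename_crossings \<pi> D" and ?f = "map_sum id (map_prod \<pi> id) :: state \<Rightarrow> state"
  have comps: "components ?D = components D" and lp: "dom (loops ?D) = dom (loops D)"
    by (auto simp: rename_crossings_def map_words_def components_def)
  have w: "passages ?D k = map (map_prod \<pi> id) (passages D k)" for k
    by (auto simp: rename_crossings_def map_words_def passages_def split: option.splits)
  have kd: "kinds ?D (\<pi> c) = kinds D c" for c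
    using \<pi> by (simp add: rename_crossings_def bij_is_inj)
  have inj: "inj (map_prod \<pi> (id :: bool \<Rightarrow> bool))" using \<pi> by (intro prod.inj_map) (auto simp: bij_is_inj)
  have co: "comp_of ?D (\<pi> c, b) = comp_of D (c, b)" for c b
  proof -
    have "(\<pi> c, b) \<in> map_prod \<pi> id ` X \<longleftrightarrow> (c, b) \<in> X" for X :: "passage set"
      using inj_image_mem_iff[OF inj, of "(c, b)" X] by simp
    then show ?thesis unfolding comp_of_def comps w by simp
  qed
  have ran: "chain_states (heads D) (words D) = Inl ` components D \<union> Inr ` (dom (kinds D) \<times> UNIV)"
    by (rule link_states[OF wf])
  show ?thesis
    unfolding link_det_def
  proof (rule chain_det_rename[where f="?f"])
    show "chain_system (heads D) (words D) (closing D cl)" by (rule link_system[OF wf cl])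
    have "inj ?f" using inj by (auto simp: inj_on_def map_sum_def split: sum.splits)
    then show "inj_on ?f (chain_states (heads D) (words D))" by (rule inj_on_subset) simp
    show "heads ?D = ?f ` heads D" by (simp add: comps image_image)
    show "words ?D (?f k) = map ?f (words D k)" if "k \<in> heads D" for k using that by (auto simp: w)
    show "closing ?D cl (?f k) = map_option ?f (closing D cl k)" if "k \<in> heads D" for k
    proof -
      have "map_option ?f (map_option Inl x) = map_option Inl x" for x by (cases x) auto
      then show ?thesis using that by (auto simp: lp)
    qed
    show "l \<in> heads D" if "k \<in> heads D" "closing D cl k = Some l" for k l
      by (rule closing_heads[OF cl that])
    show "under ?D v (?f s) = map_option (map_prod id ?f) (under D v s)" if "s \<in> chain_states (heads D) (words D)" for s
      by (cases "(D, v, s)" rule: under.cases) (auto simp: passes_over_def kd co)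
    show "x \<in> chain_states (heads D) (words D)" if "s \<in> chain_states (heads D) (words D)" "under D v s = Some (T, x)" for s T x
      using that(1) under_ref[OF that(2)] unfolding ran by auto
  qed
qed

lemma link_det_base_point:
  fixes v :: "nat \<Rightarrow> 'f::field"
  assumes wf: "well_formed D" and cl: "closes_arcs D cl" and k: "loops D k = Some w"
  shows "link_det (D\<lparr>loops := (loops D)(k \<mapsto> rotate1 w)\<rparr>) cl v = link_det D cl v"
proof (cases w)
  case Nil
  then have "D\<lparr>loops := (loops D)(k \<mapsto> rotate1 w)\<rparr> = D" using k by (simp add: fun_upd_idem)
  then show ?thesis by simp
next
  case (Cons a z)
  let ?D = "D\<lparr>loops := (loops D)(k \<mapsto> rotate1 w)\<rparr>"
  have comps: "components ?D = components D" and lp: "dom (loops ?D) = dom (loops D)"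
    using k by (auto simp: components_def)
  have kc: "k \<in> components D" using k by (auto simp: components_def)
  have na: "arcs D k = None" using k wfD(5)[OF wf] by auto
  have w: "passages ?D l = (if l = k then rotate1 w else passages D l)" for l
    using na by (auto simp: passages_def split: option.splits)
  have un: "under ?D v = under D v"
    by (rule under_cong) (auto simp: comps w passages_loop[OF wf k])
  have C: "closing ?D cl s = closing D cl s" for s by (rule closing_cong[OF lp])
  have "words ?D s = ((words D)(Inl k := map Inr z @ [Inr a])) s" for s
  proof (cases s)
    case (Inl l)
    then show ?thesis unfolding Inl words.simps w by (simp add: Cons)
  qed simp
  then have "link_det ?D cl v = chain_det (heads D) ((words D)(Inl k := map Inr z @ [Inr a])) (closing D cl) (under D v)"
    unfolding link_det_def comps un by (intro chain_det_cong) (auto simp: C)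
  also have "\<dots> = link_det D cl v"
    unfolding link_det_def
  proof (rule chain_det_rotate[OF link_system[OF wf cl]])
    show "words D (Inl k) = Inr a # map Inr z" using passages_loop[OF wf k] Cons by simp
    show "m \<in> heads D" if "l \<in> heads D" "closing D cl l = Some m" for l m
      by (rule closing_heads[OF cl that])
  qed (use k kc in \<open>auto intro: unreferenced_head[OF wf]\<close>)
  finally show ?thesis .
qed

theorem link_det_move:
  fixes v :: "nat \<Rightarrow> 'f::field"
  assumes m: "move D E" and wf: "well_formed D" and cl: "closes_arcs D cl" and v: "\<And>k. v k \<noteq> 0"
  shows "link_det E cl v = link_det D cl v"
  using m wf cl
proof cases
  case (rename \<pi>)
  then show ?thesis using link_det_rename[OF wf cl] by simp
next
  case (base_point k w)
  then show ?thesis using link_det_base_point[OF wf cl] by simp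
next
  case (endpoint k w c b z)
  then show ?thesis using link_det_erase[OF wf _ _ cl, of "{c}" v] by simp
next
  case (VR1 c b)
  then show ?thesis using link_det_erase[OF wf _ _ cl, of "{c}" v] by simp
next
  case (VR2 p q)
  then show ?thesis using link_det_erase[OF wf _ _ cl, of "{p, q}" v] by auto
next
  case (R2 p q)
  let ?D = "D\<lparr>kinds := (kinds D)(p \<mapsto> Virtual, q \<mapsto> Virtual)\<rparr>"
  have "p \<in> dom (kinds D)" "q \<in> dom (kinds D)" using R2(3) by (auto simp: doubleton_eq_iff)
  then have d: "dom ((kinds D)(p \<mapsto> Virtual, q \<mapsto> Virtual)) = dom (kinds D)"
    by (simp only: dom_fun_upd insert_absorb insert_iff simp_thms option.distinct if_False)
  have "passages ?D = passages D"
    by (rule ext) (simp add: passages_def split: option.split)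
  have kk: "kinds ?D = (kinds D)(p \<mapsto> Virtual, q \<mapsto> Virtual)" by simp
  have wf': "well_formed ?D"
    by (rule well_formed_cong[THEN iffD2, OF _ _ _ \<open>passages ?D = passages D\<close> wf]) (simp, simp, simp only: kk d)
  have cl': "closes_arcs ?D cl" by (rule closes_arcs_cong[THEN iffD2, OF _ cl]) simp
  have "erase {p, q} D = erase {p, q} ?D"
    by (auto simp: erase_def map_words_def restrict_map_def fun_eq_iff)
  moreover have "link_det (erase {p, q} ?D) cl v = link_det ?D cl v"
    by (rule link_det_erase[OF wf' _ _ cl']) (auto simp: is_virtual_def)
  ultimately show ?thesis using link_det_cancel[OF wf cl R2(2,3) v] unfolding R2(1) by (simp only:)
qed (auto intro!: link_det_slide[OF wf cl _ v])

lemma diagram_writhe_move: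
  assumes m: "move D E" and wf: "well_formed D" and wf': "well_formed E"
  shows "diagram_writhe E = diagram_writhe D"
proof -
  have slide: "kinds (slide x y z D) = kinds D" for x y z
    by (auto simp: slide_def exchange_simps split: prod.splits)
  have erase: "diagram_writhe (erase V D) = diagram_writhe D"
    if V: "V \<subseteq> dom (kinds D)" "(\<Sum>c\<in>V. crossing_sign (the (kinds D c))) = 0" for V
  proof -
    have fin: "finite (dom (kinds D))" by (rule wfD(2)[OF wf])
    have "dom (kinds (erase V D)) = dom (kinds D) - V" by (auto simp: erase_def)
    then have "diagram_writhe (erase V D) = (\<Sum>c\<in>dom (kinds D) - V. crossing_sign (the (kinds D c)))"
      unfolding diagram_writhe_def by (intro sum.cong) (auto simp: erase_def)
    then show ?thesis
      using sum.subset_diff[OF V(1) fin, of "\<lambda>c. crossing_sign (the (kinds D c))"] V(2)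
      by (simp add: diagram_writhe_def)
  qed
  have virt: "c \<in> dom (kinds D)" "crossing_sign (the (kinds D c)) = 0" if "is_virtual D c" for c
    using that by (auto simp: is_virtual_def crossing_sign_def)
  from m show ?thesis
  proof cases
    case (rename \<pi>)
    have inv: "inv_into UNIV \<pi> (\<pi> c) = c" "\<pi> (inv_into UNIV \<pi> c) = c" for c
      using rename(2) by (auto simp: bij_is_inj bij_is_surj surj_f_inv_f)
    have dm: "c \<in> dom (kinds E) \<longleftrightarrow> inv_into UNIV \<pi> c \<in> dom (kinds D)" for c by (auto simp: rename rename_crossings_def)
    show ?thesis
      unfolding diagram_writhe_def
      by (rule sum.reindex_bij_witness[of _ \<pi> "inv_into UNIV \<pi>"])
         (use inv dm in \<open>auto simp: rename rename_crossings_def\<close>)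
  next
    case (R2 p q)
    then have "p \<noteq> q" "p \<in> dom (kinds D)" "q \<in> dom (kinds D)"
      "crossing_sign (the (kinds D p)) + crossing_sign (the (kinds D q)) = 0"
      by (auto simp: bigon_def doubleton_eq_iff crossing_sign_def)
    then show ?thesis unfolding R2(1) by (intro erase) auto
  next
    case (VR2 p q)
    then show ?thesis unfolding VR2(1) by (intro erase) (use virt in \<open>auto simp: bigon_def\<close>)
  next
    case (VR1 c b)
    then show ?thesis unfolding VR1(1) by (intro erase) (use virt in auto)
  next
    case (endpoint k w c b z)
    then show ?thesis unfolding endpoint(1) by (intro erase) (use virt in auto)
  qed (auto simp: slide diagram_writhe_def)
qed

section \<open>Specialization of rational functions\<close>

definition monom_value :: "(nat \<Rightarrow> 'a::field_char_0) \<Rightarrow> (nat \<Rightarrow>\<^sub>0 nat) \<Rightarrow> 'a" where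
  "monom_value v m = (\<Prod>i\<in>Poly_Mapping.keys m. v i ^ Poly_Mapping.lookup m i)"

lemma monom_value_superset:
  "finite S \<Longrightarrow> Poly_Mapping.keys m \<subseteq> S \<Longrightarrow> monom_value v m = (\<Prod>i\<in>S. v i ^ Poly_Mapping.lookup m i)"
  unfolding monom_value_def by (rule prod.mono_neutral_left) (auto simp: in_keys_iff)

lemma monom_value_add: "monom_value v (m + n) = monom_value v m * monom_value v n"
proof -
  let ?S = "Poly_Mapping.keys m \<union> Poly_Mapping.keys n"
  have "monom_value v (m + n) = (\<Prod>i\<in>?S. v i ^ Poly_Mapping.lookup (m + n) i)"
    by (rule monom_value_superset) (auto dest: subsetD[OF Poly_Mapping.keys_add])
  also have "\<dots> = (\<Prod>i\<in>?S. v i ^ Poly_Mapping.lookup m i) * (\<Prod>i\<in>?S. v i ^ Poly_Mapping.lookup n i)"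
    by (simp add: lookup_add power_add prod.distrib)
  also have "\<dots> = monom_value v m * monom_value v n"
    by (simp add: monom_value_superset[of ?S])
  finally show ?thesis .
qed

lemma poly_value_superset:
  "finite S \<Longrightarrow> Poly_Mapping.keys p \<subseteq> S \<Longrightarrow>
     poly_value v p = (\<Sum>m\<in>S. of_rat (Poly_Mapping.lookup p m) * monom_value v m)"
  unfolding poly_value_def monom_value_def[symmetric]
  by (rule sum.mono_neutral_left) (auto simp: in_keys_iff)

lemma poly_value_add: "poly_value v (p + q) = poly_value v p + poly_value v q"
proof -
  let ?S = "Poly_Mapping.keys p \<union> Poly_Mapping.keys q"
  have "poly_value v (p + q) = (\<Sum>m\<in>?S. of_rat (Poly_Mapping.lookup (p + q) m) * monom_value v m)"
    by (rule poly_value_superset) (auto dest: subsetD[OF Poly_Mapping.keys_add])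
  also have "\<dots> = (\<Sum>m\<in>?S. of_rat (Poly_Mapping.lookup p m) * monom_value v m) +
      (\<Sum>m\<in>?S. of_rat (Poly_Mapping.lookup q m) * monom_value v m)"
    by (simp add: lookup_add of_rat_add algebra_simps sum.distrib)
  also have "\<dots> = poly_value v p + poly_value v q"
    by (simp add: poly_value_superset[of ?S])
  finally show ?thesis .
qed

lemma poly_value_single: "poly_value v (Poly_Mapping.single m a) = of_rat a * monom_value v m"
  by (simp add: poly_value_def monom_value_def)

lemma poly_value_zero [simp]: "poly_value v 0 = 0"
  by (simp add: poly_value_def)

lemma poly_value_sum: "poly_value v (\<Sum>i\<in>I. p i) = (\<Sum>i\<in>I. poly_value v (p i))"
  by (induction I rule: infinite_finite_induct) (auto simp: poly_value_add)

lemma poly_as_sum: "p = (\<Sum>m\<in>Poly_Mapping.keys p. Poly_Mapping.single m (Poly_Mapping.lookup p m))"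
proof (rule poly_mapping_eqI)
  fix k
  show "Poly_Mapping.lookup p k = Poly_Mapping.lookup (\<Sum>m\<in>Poly_Mapping.keys p. Poly_Mapping.single m (Poly_Mapping.lookup p m)) k"
    by (simp add: lookup_sum lookup_single when_def in_keys_iff)
qed

lemma poly_value_mult: "poly_value v (p * q) = poly_value v p * poly_value v q"
proof -
  let ?s = "\<lambda>p m. Poly_Mapping.single m (Poly_Mapping.lookup p m)"
  have "p * q = (\<Sum>m\<in>Poly_Mapping.keys p. ?s p m) * (\<Sum>m\<in>Poly_Mapping.keys q. ?s q m)"
    using poly_as_sum[of p] poly_as_sum[of q] by simp
  also have "\<dots> = (\<Sum>m\<in>Poly_Mapping.keys p. \<Sum>n\<in>Poly_Mapping.keys q. ?s p m * ?s q n)"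
    by (rule sum_product)
  also have "poly_value v \<dots> = (\<Sum>m\<in>Poly_Mapping.keys p. \<Sum>n\<in>Poly_Mapping.keys q. poly_value v (?s p m) * poly_value v (?s q n))"
    by (simp add: poly_value_sum poly_value_single mult_single monom_value_add of_rat_mult algebra_simps)
  also have "\<dots> = poly_value v (\<Sum>m\<in>Poly_Mapping.keys p. ?s p m) * poly_value v (\<Sum>n\<in>Poly_Mapping.keys q. ?s q n)"
    by (simp add: poly_value_sum sum_product)
  also have "\<dots> = poly_value v p * poly_value v q"
    using poly_as_sum[of p] poly_as_sum[of q] by simp
  finally show ?thesis .
qed

lemma monom_value_zero [simp]: "monom_value v 0 = 1"
  by (simp add: monom_value_def)

lemma poly_value_one [simp]: "poly_value v 1 = 1"
  using poly_value_single[of v 0 1] by simp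

lemma poly_value_uminus: "poly_value v (- p) = - poly_value v p"
  using poly_value_add[of v p "- p"] by (simp add: add_eq_0_iff)

lemma specializes_to_unique: "specializes_to v f y \<Longrightarrow> specializes_to v f z \<Longrightarrow> y = z"
proof -
  assume "specializes_to v f y" "specializes_to v f z"
  then obtain p q p' q' where f: "f = Fraction_Field.Fract p q" "poly_value v q \<noteq> 0" "y = poly_value v p / poly_value v q"
    "f = Fraction_Field.Fract p' q'" "poly_value v q' \<noteq> 0" "z = poly_value v p' / poly_value v q'"
    unfolding specializes_to_def by blast
  have "q \<noteq> 0" "q' \<noteq> 0" using f by auto
  then have "p * q' = p' * q" using f(1,4) eq_fract(1) by metis
  then have "poly_value v p * poly_value v q' = poly_value v p' * poly_value v q"
    using poly_value_mult by metis
  then show "y = z" unfolding f(3,6) using f(2,5) by (simp add: frac_eq_eq)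
qed

lemma specialize_eq: "specializes_to v f y \<Longrightarrow> specialize v f = y"
  unfolding specialize_def using specializes_to_unique by blast

lemma specializes_to_add: "specializes_to v f y \<Longrightarrow> specializes_to v g z \<Longrightarrow> specializes_to v (f + g) (y + z)"
proof -
  assume "specializes_to v f y" "specializes_to v g z"
  then obtain p q p' q' where f: "f = Fraction_Field.Fract p q" "poly_value v q \<noteq> 0" "y = poly_value v p / poly_value v q"
    "g = Fraction_Field.Fract p' q'" "poly_value v q' \<noteq> 0" "z = poly_value v p' / poly_value v q'"
    unfolding specializes_to_def by blast
  have "q \<noteq> 0" "q' \<noteq> 0" using f by auto
  then have "f + g = Fraction_Field.Fract (p * q' + p' * q) (q * q')" using f by simp
  moreover have "y + z = poly_value v (p * q' + p' * q) / poly_value v (q * q')"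
    using f by (simp add: poly_value_add poly_value_mult field_simps)
  moreover have "poly_value v (q * q') \<noteq> 0" using f by (simp add: poly_value_mult)
  ultimately show ?thesis unfolding specializes_to_def by blast
qed

lemma specializes_to_mult: "specializes_to v f y \<Longrightarrow> specializes_to v g z \<Longrightarrow> specializes_to v (f * g) (y * z)"
proof -
  assume "specializes_to v f y" "specializes_to v g z"
  then obtain p q p' q' where f: "f = Fraction_Field.Fract p q" "poly_value v q \<noteq> 0" "y = poly_value v p / poly_value v q"
    "g = Fraction_Field.Fract p' q'" "poly_value v q' \<noteq> 0" "z = poly_value v p' / poly_value v q'"
    unfolding specializes_to_def by blast
  have "f * g = Fraction_Field.Fract (p * p') (q * q')" using f by simp
  moreover have "y * z = poly_value v (p * p') / poly_value v (q * q')"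
    using f by (simp add: poly_value_mult)
  moreover have "poly_value v (q * q') \<noteq> 0" using f by (simp add: poly_value_mult)
  ultimately show ?thesis unfolding specializes_to_def by blast
qed

lemma specializes_to_inverse: "specializes_to v f y \<Longrightarrow> y \<noteq> 0 \<Longrightarrow> specializes_to v (inverse f) (inverse y)"
proof -
  assume "specializes_to v f y" "y \<noteq> 0"
  then obtain p q where f: "f = Fraction_Field.Fract p q" "poly_value v q \<noteq> 0" "y = poly_value v p / poly_value v q" "poly_value v p \<noteq> 0"
    unfolding specializes_to_def by force
  then have "inverse f = Fraction_Field.Fract q p" by simp
  moreover have "inverse y = poly_value v q / poly_value v p" using f by simp
  ultimately show ?thesis unfolding specializes_to_def using f by blast
qed

lemma specializes_to_poly: "specializes_to v (Fraction_Field.Fract p 1) (poly_value v p)"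
  unfolding specializes_to_def by (rule exI[of _ p], rule exI[of _ 1]) simp

lemma specializes_to_0: "specializes_to v 0 0"
  using specializes_to_poly[of v 0] by (simp add: Zero_fract_def)

lemma specializes_to_1: "specializes_to v 1 1"
  using specializes_to_poly[of v 1] by (simp add: One_fract_def)

lemma specializes_to_tvar: "specializes_to v (tvar i) (v i)"
  using specializes_to_poly[of v "Poly_Mapping.single (Poly_Mapping.single i 1) 1"]
  by (simp add: tvar_def poly_value_single monom_value_def)

lemma specializes_to_uminus: "specializes_to v f y \<Longrightarrow> specializes_to v (- f) (- y)"
proof -
  have "specializes_to v (Fraction_Field.Fract (- 1) 1) (- 1)"
    using specializes_to_poly[of v "- 1"] by (simp add: poly_value_uminus)
  moreover have "Fraction_Field.Fract (- 1) 1 = (- 1 :: ratfun)" by (simp add: One_fract_def)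
  moreover assume "specializes_to v f y"
  ultimately show ?thesis using specializes_to_mult[of v "-1" "-1" f y] by simp
qed

lemma specializes_to_diff: "specializes_to v f y \<Longrightarrow> specializes_to v g z \<Longrightarrow> specializes_to v (f - g) (y - z)"
  using specializes_to_add[of v f y "- g" "- z"] specializes_to_uminus by auto

lemma specializes_to_divide:
  "specializes_to v f y \<Longrightarrow> specializes_to v g z \<Longrightarrow> z \<noteq> 0 \<Longrightarrow> specializes_to v (f / g) (y / z)"
  using specializes_to_mult[of v f y "inverse g" "inverse z"] specializes_to_inverse
  by (auto simp: divide_inverse)

lemma specializes_to_sum: "(\<And>i. i \<in> I \<Longrightarrow> specializes_to v (f i) (g i)) \<Longrightarrow> specializes_to v (sum f I) (sum g I)"
  by (induction I rule: infinite_finite_induct) (auto intro: specializes_to_0 specializes_to_add)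

lemma specializes_to_prod: "(\<And>i. i \<in> I \<Longrightarrow> specializes_to v (f i) (g i)) \<Longrightarrow> specializes_to v (prod f I) (prod g I)"
  by (induction I rule: infinite_finite_induct) (auto intro: specializes_to_1 specializes_to_mult)

lemma specializes_to_det_on:
  assumes "\<And>i j. i \<in> S \<Longrightarrow> j \<in> S \<Longrightarrow> specializes_to v (A i j) (B i j)"
  shows "specializes_to v (det_on S A) (det_on S B)"
  unfolding det_on_def
proof (intro specializes_to_sum specializes_to_mult specializes_to_prod)
  fix p assume "p \<in> {p. p permutes S}"
  then show "specializes_to v (A i (p i)) (B i (p i))" if "i \<in> S" for i
    using that assms by (simp add: permutes_in_image)
  show "specializes_to v (of_int (sign p)) (of_int (sign p))"
    by (cases p rule: sign_cases) (auto intro: specializes_to_1 specializes_to_uminus)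
qed

text \<open>
  The determinant is a polynomial expression in the variables and their inverses, so specialization
  can be carried out entrywise.
\<close>

lemma specializes_to_link_det:
  fixes w :: "nat \<Rightarrow> 'a::field_char_0"
  assumes v: "\<And>k. specializes_to h (v k) (w k)" and w: "\<And>k. w k \<noteq> 0"
  shows "specializes_to h (link_det D cl v) (link_det D cl w)"
  unfolding link_det_def chain_det_def walk_det_def
proof (rule specializes_to_det_on)
  fix s j
  have b: "specializes_to h (of_bool P) (of_bool P)" for P
    by (cases P) (auto intro: specializes_to_0 specializes_to_1)
  let ?A = "chain_wiring (heads D) (words D) (closing D cl)"
  show "specializes_to h (walk_row ?A (under D v) s j) (walk_row ?A (under D w) s j)"
  proof (cases s)
    case (Inl k)
    show ?thesis unfolding Inl walk_row_def under.simps option.case by (intro specializes_to_diff b)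
  next
    case (Inr x)
    obtain c e where x: "x = (c, e)" by fastforce
    define k where "k = comp_of D (c, \<not> e)"
    have t: "specializes_to h (if e then inverse (v k) else v k) (if e then inverse (w k) else w k)"
      using v[of k] specializes_to_inverse[OF v[of k] w[of k]] by simp
    show ?thesis
    proof (cases "passes_over D (c, \<not> e)")
      case True
      show ?thesis
        unfolding Inr x walk_row_def under.simps if_P[OF True] option.case prod.case k_def[symmetric]
        by (intro specializes_to_diff specializes_to_add specializes_to_mult specializes_to_1 b t)
    next
      case False
      show ?thesis
        unfolding Inr x walk_row_def under.simps if_not_P[OF False] option.case by (intro specializes_to_diff b)
    qed
  qed
qed

lemma ratfuns_add: "f \<in> ratfuns Y \<Longrightarrow> g \<in> ratfuns Y \<Longrightarrow> f + g \<in> ratfuns Y"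
  and ratfuns_mult: "f \<in> ratfuns Y \<Longrightarrow> g \<in> ratfuns Y \<Longrightarrow> f * g \<in> ratfuns Y"
proof -
  have pm: "poly_vars (p * q) \<subseteq> Y" if "poly_vars p \<subseteq> Y" "poly_vars q \<subseteq> Y" for p q
  proof
    fix i assume "i \<in> poly_vars (p * q)"
    then obtain m where m: "m \<in> Poly_Mapping.keys (p * q)" "i \<in> Poly_Mapping.keys m" by (auto simp: poly_vars_def)
    then obtain a b where ab: "m = a + b" "a \<in> Poly_Mapping.keys p" "b \<in> Poly_Mapping.keys q"
      using keys_mult[of p q] by blast
    have "i \<in> Poly_Mapping.keys a \<union> Poly_Mapping.keys b" using m(2) Poly_Mapping.keys_add[of a b] ab(1) by blast
    then show "i \<in> Y" using that ab by (auto simp: poly_vars_def)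
  qed
  have pa: "poly_vars (p + q) \<subseteq> Y" if "poly_vars p \<subseteq> Y" "poly_vars q \<subseteq> Y" for p q
    using that Poly_Mapping.keys_add[of p q] unfolding poly_vars_def by blast
  assume "f \<in> ratfuns Y" "g \<in> ratfuns Y"
  then obtain p q p' q' where f: "f = Fraction_Field.Fract p q" "q \<noteq> 0" "g = Fraction_Field.Fract p' q'" "q' \<noteq> 0"
    "poly_vars p \<subseteq> Y" "poly_vars q \<subseteq> Y" "poly_vars p' \<subseteq> Y" "poly_vars q' \<subseteq> Y"
    unfolding ratfuns_def by blast
  have "f + g = Fraction_Field.Fract (p * q' + p' * q) (q * q')" "f * g = Fraction_Field.Fract (p * p') (q * q')"
    using f by simp_all
  moreover have "q * q' \<noteq> 0" using f by simp
  moreover have "poly_vars (p * q' + p' * q) \<subseteq> Y" "poly_vars (p * p') \<subseteq> Y" "poly_vars (q * q') \<subseteq> Y"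
    using f by (auto intro!: pa pm del: subsetI)
  ultimately show "f + g \<in> ratfuns Y" "f * g \<in> ratfuns Y" unfolding ratfuns_def by blast+
qed

lemma ratfuns_poly: "poly_vars p \<subseteq> Y \<Longrightarrow> Fraction_Field.Fract p 1 \<in> ratfuns Y"
  unfolding ratfuns_def mem_Collect_eq by (rule exI[of _ p], rule exI[of _ 1]) (auto simp: poly_vars_def)

lemma ratfuns_0: "0 \<in> ratfuns Y" and ratfuns_1: "1 \<in> ratfuns Y" and ratfuns_minus_1: "- 1 \<in> ratfuns Y"
  using ratfuns_poly[of 0 Y] ratfuns_poly[of 1 Y] ratfuns_poly[of "- 1" Y]
  by (simp_all add: poly_vars_def Zero_fract_def One_fract_def)

lemma ratfuns_uminus: "f \<in> ratfuns Y \<Longrightarrow> - f \<in> ratfuns Y"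
  using ratfuns_mult[OF ratfuns_minus_1, of f Y] by simp

lemma ratfuns_diff: "f \<in> ratfuns Y \<Longrightarrow> g \<in> ratfuns Y \<Longrightarrow> f - g \<in> ratfuns Y"
  using ratfuns_add[of f Y "- g"] ratfuns_uminus by simp

lemma ratfuns_inverse: "f \<in> ratfuns Y \<Longrightarrow> inverse f \<in> ratfuns Y"
proof -
  assume "f \<in> ratfuns Y"
  then obtain p q where f: "f = Fraction_Field.Fract p q" "q \<noteq> 0" "poly_vars p \<subseteq> Y" "poly_vars q \<subseteq> Y"
    unfolding ratfuns_def by blast
  show ?thesis
  proof (cases "p = 0")
    case True
    then have "f = 0" using f by (simp add: fract_collapse)
    then show ?thesis by (simp add: ratfuns_0)
  next
    case False
    then show ?thesis using f unfolding ratfuns_def by auto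
  qed
qed

lemma ratfuns_divide: "f \<in> ratfuns Y \<Longrightarrow> g \<in> ratfuns Y \<Longrightarrow> f / g \<in> ratfuns Y"
  by (simp add: divide_inverse ratfuns_mult ratfuns_inverse)

lemma ratfuns_tvar: "i \<in> Y \<Longrightarrow> tvar i \<in> ratfuns Y"
  unfolding tvar_def by (rule ratfuns_poly) (auto simp: poly_vars_def)

lemma ratfuns_det_on:
  assumes "\<And>i j. i \<in> S \<Longrightarrow> j \<in> S \<Longrightarrow> A i j \<in> ratfuns Y"
  shows "det_on S A \<in> ratfuns Y"
proof -
  have s: "sum f I \<in> ratfuns Y" if "\<And>i. i \<in> I \<Longrightarrow> f i \<in> ratfuns Y" for f and I :: "'b set"
    using that by (induction I rule: infinite_finite_induct) (auto intro: ratfuns_0 ratfuns_add)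
  have p: "prod f I \<in> ratfuns Y" if "\<And>i. i \<in> I \<Longrightarrow> f i \<in> ratfuns Y" for f and I :: "'b set"
    using that by (induction I rule: infinite_finite_induct) (auto intro: ratfuns_1 ratfuns_mult)
  have sg: "of_int (sign p) \<in> ratfuns Y" for p :: "'a \<Rightarrow> 'a"
    by (cases p rule: sign_cases) (auto intro: ratfuns_1 ratfuns_minus_1)
  show ?thesis unfolding det_on_def
    by (intro s ratfuns_mult sg p) (use assms in \<open>auto simp: permutes_in_image\<close>)
qed

lemma tvar_nonzero: "tvar i \<noteq> 0"
proof
  assume "tvar i = 0"
  then have "specializes_to (\<lambda>_. 1 :: rat) (0 :: ratfun) 1" using specializes_to_tvar[of "\<lambda>_. 1 :: rat" i] by simp
  then show False using specializes_to_unique[OF _ specializes_to_0, of "\<lambda>_. 1 :: rat"] by fastforce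
qed

lemma ratfuns_link_det:
  assumes wf: "well_formed D"
  shows "link_det D cl tvar \<in> ratfuns (components D)"
  unfolding link_det_def chain_det_def walk_det_def
proof (rule ratfuns_det_on)
  fix s j assume s: "s \<in> chain_states (heads D) (words D)"
  let ?A = "chain_wiring (heads D) (words D) (closing D cl)"
  have b: "of_bool P \<in> ratfuns Y" for P Y by (cases P) (auto intro: ratfuns_0 ratfuns_1)
  show "walk_row ?A (under D tvar) s j \<in> ratfuns (components D)"
  proof (cases s)
    case (Inl k)
    show ?thesis unfolding Inl walk_row_def under.simps option.case by (intro ratfuns_diff b)
  next
    case (Inr x)
    obtain c e where x: "x = (c, e)" by fastforce
    define k where "k = comp_of D (c, \<not> e)"
    have "(c, e) \<in> dom (kinds D) \<times> UNIV" using s unfolding link_states[OF wf] Inr x by auto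
    then obtain l where "l \<in> components D" "(c, \<not> e) \<in> set (passages D l)"
      using passage_iff[OF wf, of "(c, \<not> e)"] by auto
    then have "k \<in> components D" using comp_of_eq[OF wf] by (simp add: k_def)
    then have t: "(if e then inverse (tvar k) else tvar k) \<in> ratfuns (components D)"
      by (auto intro: ratfuns_inverse ratfuns_tvar)
    show ?thesis
    proof (cases "passes_over D (c, \<not> e)")
      case True
      show ?thesis
        unfolding Inr x walk_row_def under.simps if_P[OF True] option.case prod.case k_def[symmetric]
        by (intro ratfuns_diff ratfuns_add ratfuns_mult ratfuns_1 b t)
    next
      case False
      show ?thesis
        unfolding Inr x walk_row_def under.simps if_not_P[OF False] option.case by (intro ratfuns_diff b)
    qed
  qed
qed

section \<open>The determinants of a tangle in \<open>\<Gamma>\<close>-calculus\<close>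

lemma det_on_zero_row:
  assumes "finite S" "i \<in> S" "\<And>j. j \<in> S \<Longrightarrow> A i j = 0"
  shows "det_on S A = 0"
proof -
  have "det_on S A = det_on S (A(i := \<lambda>j. 0))"
    by (rule det_on_cong) (use assms in auto)
  also have "\<dots> = 0" using det_on_row_linear[OF assms(1,2), of A "\<lambda>_. 0" "-1" "\<lambda>_. 0"] by (simp del: fun_upd_apply)
  finally show ?thesis .
qed

lemma det_on_identity: "finite S \<Longrightarrow> det_on S (\<lambda>i j. of_bool (i = j)) = 1"
proof (induction S rule: finite_induct)
  case empty
  then show ?case by (simp add: det_on_def)
next
  case (insert x S)
  have "det_on (insert x S) (\<lambda>i j. of_bool (i = j) :: 'b) = det_on (insert x S - {x}) (\<lambda>i j. of_bool (i = j))"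
    by (rule det_on_unit) (use insert in auto)
  then show ?case using insert by simp
qed

lemma det_on_pair:
  assumes "a \<noteq> b"
  shows "det_on {a, b} A = A a a * A b b - A a b * A b a"
proof -
  have "{p. p permutes {a, b}} = {id, Transposition.transpose a b}"
    by (auto simp: permutes_doubleton_iff)
  moreover have "id \<noteq> Transposition.transpose a b"
    using assms by (metis id_apply transpose_apply_first)
  ultimately show ?thesis
    using assms by (simp add: det_on_def sign_swap_id algebra_simps)
qed

abbreviation no_closing :: "nat \<Rightarrow> nat option" where
  "no_closing \<equiv> Map.empty"

text \<open>
  By Cramer's rule, entry \<open>(k, l)\<close> is the total weight of walks from the end of
  \<open>l\<close> to the beginning of \<open>k\<close>.
\<close>

definition tangle_matrix :: "diagram \<Rightarrow> (nat \<Rightarrow> 'f) \<Rightarrow> nat \<Rightarrow> nat \<Rightarrow> 'f::field" where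
  "tangle_matrix D v k l = (if k \<in> dom (arcs D) \<and> l \<in> dom (arcs D)
     then 1 - link_det D [k \<mapsto> l] v / link_det D no_closing v else 0)"

definition tangle_gamma :: "diagram \<Rightarrow> gamma" where
  "tangle_gamma D = (link_det D no_closing tvar, tangle_matrix D tvar)"

lemma closes_arcs_empty: "closes_arcs D no_closing"
  by (simp add: closes_arcs_def)

lemma closes_arcs_single: "l \<in> dom (arcs D) \<Longrightarrow> closes_arcs D [k \<mapsto> l]"
  by (auto simp: closes_arcs_def split: if_splits)

lemma chain_det_no_states:
  assumes fin: "finite K"
  shows "chain_det K (\<lambda>_. []) (\<lambda>_. None) (\<lambda>_. None) = (1 :: 'f::comm_ring_1)"
    and "k \<in> K \<Longrightarrow> l \<in> K \<Longrightarrow> chain_det K (\<lambda>_. []) [k \<mapsto> l] (\<lambda>_. None) = (of_bool (k \<noteq> l) :: 'f)"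
proof -
  have S: "chain_states K (\<lambda>_. []) = K" by (auto simp: chain_states_def)
  have "det_on K (walk_row (chain_wiring K (\<lambda>_. []) (\<lambda>_. None)) (\<lambda>_. None)) = det_on K (\<lambda>i j. of_bool (i = j) :: 'f)"
    by (rule det_on_cong) (simp add: walk_row_def chain_wiring_def)
  then show "chain_det K (\<lambda>_. []) (\<lambda>_. None) (\<lambda>_. None) = (1 :: 'f)"
    unfolding chain_det_def walk_det_def S using det_on_identity[OF fin] by simp
  assume kl: "k \<in> K" "l \<in> K"
  let ?A = "walk_row (chain_wiring K (\<lambda>_. []) [k \<mapsto> l]) (\<lambda>_. None) :: _ \<Rightarrow> _ \<Rightarrow> 'f"
  show "chain_det K (\<lambda>_. []) [k \<mapsto> l] (\<lambda>_. None) = (of_bool (k \<noteq> l) :: 'f)"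
  proof (cases "k = l")
    case True
    have "det_on K ?A = 0"
      by (rule det_on_zero_row[OF fin kl(1)]) (use kl True in \<open>auto simp: walk_row_def chain_wiring_def\<close>)
    then show ?thesis unfolding chain_det_def walk_det_def S using True by simp
  next
    case False
    let ?I = "\<lambda>i j. of_bool (i = j) :: 'f"
    have "det_on K ?A = det_on K (?I(k := \<lambda>j. ?I k j + (-1) * ?I l j))"
      by (rule det_on_cong) (use kl False in \<open>auto simp: walk_row_def chain_wiring_def\<close>)
    also have "\<dots> = 1" using det_on_row_add[OF fin kl False, of ?I "-1"] det_on_identity[OF fin, where 'b='f] by simp
    finally show ?thesis unfolding chain_det_def walk_det_def S using False by simp
  qed
qed

locale tangle =
  fixes D :: diagram and Y :: "nat set"
  assumes wf: "well_formed D" and no_loops: "loops D = Map.empty" and Y: "dom (arcs D) = Y"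
begin

lemma comps: "components D = Y"
  using no_loops Y by (simp add: components_def)

lemma fin_Y: "finite Y"
  using wfD(1)[OF wf] comps by simp

lemma closing_tangle: "closing D cl = (\<lambda>s. case s of Inl k \<Rightarrow> map_option Inl (cl k) | Inr p \<Rightarrow> None)"
  by (rule ext, rename_tac s, case_tac s) (auto simp: no_loops)

text \<open>At \<open>t = 1\<close> the walk ignores the crossings.\<close>

lemma link_det_unit_weights:
  assumes v: "\<And>s T x. s \<in> chain_states (heads D) (words D) \<Longrightarrow> under D v s = Some (T, x) \<Longrightarrow> T = (1 :: 'f::field)"
    and cl: "closes_arcs D cl"
  shows "link_det D cl v = chain_det (Inl ` Y) (\<lambda>_. []) (closing D cl) (\<lambda>_. None)"
proof -
  let ?S = "chain_states (heads D) (words D)"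
  have "link_det D cl v = chain_det (heads D) (words D) (closing D cl) (\<lambda>_. None)"
    unfolding link_det_def chain_det_def walk_det_def
    by (rule det_on_cong) (use v in \<open>fastforce simp: walk_row_def split: option.splits\<close>)
  also have "\<dots> = chain_det (heads D) (\<lambda>k. filter (\<lambda>s. s \<notin> Inr ` (dom (kinds D) \<times> UNIV)) (words D k)) (closing D cl) (\<lambda>_. None)"
    by (rule chain_det_filter[OF link_system[OF wf cl], symmetric])
       (use wfD(2)[OF wf] in \<open>auto simp: unreferenced_def\<close>)
  also have "\<dots> = chain_det (Inl ` Y) (\<lambda>_. []) (closing D cl) (\<lambda>_. None)"
    unfolding comps
  proof (rule chain_det_cong)
    fix k assume "k \<in> (Inl ` Y :: state set)"
    then have "set (words D k) \<subseteq> Inr ` (dom (kinds D) \<times> UNIV)"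
      using link_states[OF wf] unfolding chain_states_def comps by fastforce
    then show "filter (\<lambda>s. s \<notin> Inr ` (dom (kinds D) \<times> UNIV)) (words D k) = []"
      by (auto simp: filter_empty_conv)
  qed auto
  finally show ?thesis .
qed

lemma unit_weight_values:
  assumes v: "\<And>s T x. s \<in> chain_states (heads D) (words D) \<Longrightarrow> under D v s = Some (T, x) \<Longrightarrow> T = (1 :: 'f::field)"
  shows "link_det D no_closing v = 1" "k \<in> Y \<Longrightarrow> l \<in> Y \<Longrightarrow> link_det D [k \<mapsto> l] v = of_bool (k \<noteq> l)"
proof -
  have f: "finite (Inl ` Y :: state set)" using fin_Y by simp
  have "closing D no_closing = (\<lambda>_. None)"
    unfolding closing_tangle by (rule ext) (simp split: sum.split)
  then show "link_det D no_closing v = 1"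
    by (subst link_det_unit_weights[OF _ closes_arcs_empty]) (use v chain_det_no_states(1)[OF f] in auto)
  assume kl: "k \<in> Y" "l \<in> Y"
  have c: "closing D [k \<mapsto> l] = [Inl k \<mapsto> Inl l]"
    unfolding closing_tangle by (rule ext) (auto split: sum.split)
  have "link_det D [k \<mapsto> l] v = chain_det (Inl ` Y :: state set) (\<lambda>_. []) [Inl k \<mapsto> Inl l] (\<lambda>_. None)"
    unfolding c[symmetric]
    by (rule link_det_unit_weights[OF _ closes_arcs_single]) (use v kl Y in auto)
  also have "\<dots> = of_bool (Inl k \<noteq> (Inl l :: state))"
    by (rule chain_det_no_states(2)[OF f]) (use kl in auto)
  finally show "link_det D [k \<mapsto> l] v = of_bool (k \<noteq> l)" by simp
qed

lemma unit_weights_1: "under D (\<lambda>_. 1) s = Some (T, x) \<Longrightarrow> T = (1 :: 'f::field)"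
  by (cases "(D, \<lambda>_::nat. 1::'f, s)" rule: under.cases) (auto split: if_splits)

lemma link_det_at_1:
  "link_det D no_closing (\<lambda>_. 1 :: 'f::field) = 1"
  "k \<in> Y \<Longrightarrow> l \<in> Y \<Longrightarrow> link_det D [k \<mapsto> l] (\<lambda>_. 1 :: 'f) = of_bool (k \<noteq> l)"
  by (rule unit_weight_values, rule unit_weights_1, assumption, (assumption+)?)+

text \<open>
  The value is 1 at \<open>t = 1\<close>.
\<close>

lemma link_det_nonzero:
  assumes v: "\<And>k. \<exists>i. v k = tvar i"
  shows "link_det D no_closing v \<noteq> 0"
proof
  assume z: "link_det D no_closing v = 0"
  have "specializes_to (\<lambda>_. 1 :: rat) (v k) 1" for k
    using v[of k] specializes_to_tvar[of "\<lambda>_. 1 :: rat"] by auto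
  then have "specializes_to (\<lambda>_. 1 :: rat) (link_det D no_closing v) (link_det D no_closing (\<lambda>_. 1))"
    by (rule specializes_to_link_det) simp
  then have "specializes_to (\<lambda>_. 1 :: rat) 0 1" using z unfolding link_det_at_1(1) by simp
  then show False using specializes_to_unique[OF _ specializes_to_0, of "\<lambda>_. 1 :: rat"] by fastforce
qed

lemma tangle_gamma_element: "tangle_gamma D \<in> gamma_elements Y"
proof -
  have w: "link_det D cl tvar \<in> ratfuns Y" for cl using ratfuns_link_det[OF wf] comps by simp
  have nz: "link_det D no_closing tvar \<noteq> 0" by (rule link_det_nonzero) auto
  have sp: "specializes_to (\<lambda>_. 1 :: rat) (link_det D cl tvar) (link_det D cl (\<lambda>_. 1))" for cl
    by (rule specializes_to_link_det) (auto intro: specializes_to_tvar)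
  have "specializes_to (\<lambda>_. 1 :: rat) (tangle_matrix D tvar i j) (if i = j then 1 else 0)" if "i \<in> Y" "j \<in> Y" for i j
  proof -
    have "specializes_to (\<lambda>_. 1 :: rat) (1 - link_det D [i \<mapsto> j] tvar / link_det D no_closing tvar)
      (1 - link_det D [i \<mapsto> j] (\<lambda>_. 1) / link_det D no_closing (\<lambda>_. 1))"
      by (intro specializes_to_diff specializes_to_1 specializes_to_divide sp)
         (simp add: link_det_at_1(1))
    then show ?thesis
      unfolding link_det_at_1(1) link_det_at_1(2)[OF that] using that
      by (cases "i = j") (simp_all add: tangle_matrix_def Y)
  qed
  moreover have "tangle_matrix D tvar i j \<in> ratfuns Y" if "i \<in> Y" "j \<in> Y" for i j
    using that Y w by (auto simp: tangle_matrix_def intro!: ratfuns_diff ratfuns_1 ratfuns_divide)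
  ultimately show ?thesis
    using w Y by (auto simp: gamma_elements_def tangle_gamma_def tangle_matrix_def)
qed

lemma head_row:
  assumes k: "k \<in> Y" and cl: "closes_arcs D cl"
  shows "walk_row (chain_wiring (heads D) (words D) (closing D cl)) (under D v) (Inl k) j =
    of_bool (Inl k = j) - (case cl k of None \<Rightarrow> 0 | Some l \<Rightarrow> of_bool (j = last (Inl l # words D (Inl l))))"
proof -
  have n: "\<not> adjacent (Inl m # words D (Inl m)) j (Inl k)" for m
    using adjacent_set[of "Inl m # words D (Inl m)" j "Inl k"] by auto
  have "cl k = Some l \<Longrightarrow> l \<in> Y" for l using cl k Y unfolding closes_arcs_def by blast
  then have "chain_wiring (heads D) (words D) (closing D cl) j (Inl k) \<longleftrightarrow>
      (\<exists>l. cl k = Some l \<and> j = last (Inl l # words D (Inl l)))"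
    using k n unfolding chain_wiring_def comps closing_tangle by (auto simp del: last.simps words.simps)
  then show ?thesis by (auto simp: walk_row_def simp del: last.simps words.simps split: option.split)
qed

lemma inner_row:
  "walk_row (chain_wiring (heads D) (words D) (closing D cl)) (under D v) (Inr p) j =
   walk_row (chain_wiring (heads D) (words D) (closing D cl')) (under D v) (Inr p) j"
  unfolding walk_row_def chain_wiring_def by (auto split: option.splits)

text \<open>
  Connecting beginnings to ends changes exactly the rows of these beginnings, by unit vectors at the
  ends; replacing rows multiplies the determinant by a minor of coefficients.
\<close>

lemma link_det_closing:
  fixes v :: "nat \<Rightarrow> 'f::field"
  assumes nz: "link_det D no_closing v \<noteq> 0" and C: "C \<subseteq> Y" "\<And>k. k \<in> C \<Longrightarrow> f k \<in> Y" "inj_on f C"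
  shows "link_det D (\<lambda>k. if k \<in> C then Some (f k) else None) v =
     link_det D no_closing v * det_on C (\<lambda>i j. of_bool (i = j) - tangle_matrix D v j (f i))"
proof -
  let ?cl = "\<lambda>k. if k \<in> C then Some (f k) else None"
  let ?S = "chain_states (heads D) (words D)"
  let ?R = "walk_row (chain_wiring (heads D) (words D) (closing D no_closing)) (under D v)"
  define x where "x i l j = (of_bool (Inl i = j) :: 'f) + (-1) * of_bool (j = last (Inl l # words D (Inl l)))" for i l j
  have cl: "closes_arcs D ?cl" using C Y by (auto simp: closes_arcs_def inj_on_def)
  have fin: "finite ?S" by (rule finite_chain_states[OF link_system[OF wf cl]])
  have YS: "i \<in> Y \<Longrightarrow> Inl i \<in> ?S" for i using link_states[OF wf] comps by auto
  have R0: "?R (Inl i) = (\<lambda>j. of_bool (Inl i = j))" if "i \<in> Y" for i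
    by (rule ext) (simp add: head_row[OF that closes_arcs_empty])
  have om: "link_det D no_closing v = det_on ?S ?R" by (simp add: link_det_def chain_det_def walk_det_def)
  have S: "s \<in> ?S \<Longrightarrow> (\<exists>k\<in>Y. s = Inl k) \<or> (\<exists>p. s = Inr p)" for s using link_states[OF wf] comps by auto
  have row: "walk_row (chain_wiring (heads D) (words D) (closing D c)) (under D v) s j =
     (case s of Inl k \<Rightarrow> (case c k of None \<Rightarrow> ?R s j | Some l \<Rightarrow> x k l j) | Inr p \<Rightarrow> ?R s j)"
    if "s \<in> ?S" "closes_arcs D c" for s j c
    using S[OF that(1)]
  proof (elim disjE bexE exE)
    fix k assume "k \<in> Y" "s = Inl k"
    then show ?thesis using head_row[OF _ that(2), of k v j] R0[of k] by (auto simp: x_def split: option.split)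
  next
    fix p assume s: "s = Inr p"
    show ?thesis unfolding s sum.case by (rule inner_row)
  qed
  have one: "det_on ?S (?R(Inl k := x k l)) = link_det D [k \<mapsto> l] v" if "k \<in> Y" "l \<in> Y" for k l
    unfolding link_det_def chain_det_def walk_det_def
  proof (rule det_on_cong)
    fix s j assume s: "s \<in> ?S"
    have "closes_arcs D [k \<mapsto> l]" using closes_arcs_single that Y by blast
    from row[OF s this, of j] show "(?R(Inl k := x k l)) s j =
       walk_row (chain_wiring (heads D) (words D) (closing D [k \<mapsto> l])) (under D v) s j"
      by (auto split: sum.split)
  qed
  have entry: "det_on ?S (?R(Inl j := x i (f i))) / det_on ?S ?R = of_bool (i = j) - tangle_matrix D v j (f i)"
    if ij: "i \<in> C" "j \<in> C" for i j
  proof -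
    let ?e = "\<lambda>s. of_bool (s = last (Inl (f i) # words D (Inl (f i)))) :: 'f"
    have jY: "j \<in> Y" "f i \<in> Y" "i \<in> Y" using ij C by auto
    have lin: "det_on ?S (?R(Inl j := x k (f i))) =
        det_on ?S (?R(Inl j := \<lambda>s. of_bool (Inl k = s))) + (-1) * det_on ?S (?R(Inl j := ?e))" for k
      unfolding x_def by (rule det_on_row_linear[OF fin YS[OF jY(1)]])
    have dj: "det_on ?S (?R(Inl j := \<lambda>s. of_bool (Inl j = s))) = det_on ?S ?R"
      by (rule det_on_cong) (simp add: R0[OF jY(1)])
    have di: "det_on ?S (?R(Inl j := \<lambda>s. of_bool (Inl i = s))) = 0" if "i \<noteq> j"
      by (rule det_on_identical_rows[OF fin YS[OF jY(1)] YS[OF jY(3)]]) (use that in \<open>auto simp: R0[OF jY(3)]\<close>)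
    have "link_det D [j \<mapsto> f i] v = det_on ?S ?R - det_on ?S (?R(Inl j := ?e))"
      using lin[of j] dj one[OF jY(1,2)] by simp
    then have e: "det_on ?S (?R(Inl j := ?e)) / det_on ?S ?R = tangle_matrix D v j (f i)"
      using nz jY Y unfolding tangle_matrix_def om by (simp add: field_simps)
    have "det_on ?S (?R(Inl j := x i (f i))) = of_bool (i = j) * det_on ?S ?R - det_on ?S (?R(Inl j := ?e))"
      using lin[of i] dj di by (cases "i = j") auto
    then show ?thesis using nz unfolding om e[symmetric] by (simp add: diff_divide_distrib)
  qed
  let ?xx = "\<lambda>s. case s of Inl i \<Rightarrow> x i (f i) | Inr p \<Rightarrow> (\<lambda>_. 0)"
  have "link_det D ?cl v = det_on ?S (\<lambda>s. if s \<in> Inl ` C then ?xx s else ?R s)"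
    unfolding link_det_def chain_det_def walk_det_def
  proof (rule det_on_cong)
    fix s j assume s: "s \<in> ?S"
    from row[OF s cl, of j] show "walk_row (chain_wiring (heads D) (words D) (closing D ?cl)) (under D v) s j =
       (if s \<in> Inl ` C then ?xx s else ?R s) j"
      by (auto split: sum.splits)
  qed
  also have "\<dots> = det_on ?S ?R * det_on (Inl ` C) (\<lambda>i j. det_on ?S (?R(j := ?xx i)) / det_on ?S ?R)"
    by (rule det_on_replace_rows[OF fin]) (use C YS nz om in auto)
  also have "det_on (Inl ` C) (\<lambda>i j. det_on ?S (?R(j := ?xx i)) / det_on ?S ?R) =
      det_on C (\<lambda>i j. det_on ?S (?R(Inl j := x i (f i))) / det_on ?S ?R)"
  proof (subst det_on_reindex[where f=Inl and S=C])
    show "bij_betw Inl C (Inl ` C)" by (simp add: bij_betw_def)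
    show "finite C" using C fin_Y finite_subset by blast
  qed simp
  also have "\<dots> = det_on C (\<lambda>i j. of_bool (i = j) - tangle_matrix D v j (f i))"
    by (rule det_on_cong) (rule entry)
  finally show ?thesis unfolding om .
qed

text \<open>
  Closing trivially is connecting each strand to itself, so the general formula specializes to
  \<open>\<omega> det (I - \<alpha>)\<close>.
\<close>

lemma link_det_closed_value:
  assumes cs: "distinct cs" "set cs \<subseteq> Y"
  shows "link_det D (\<lambda>k. if k \<in> set cs then Some k else None) tvar = closed_value cs (tangle_gamma D)"
proof -
  have nz: "link_det D no_closing tvar \<noteq> 0" by (rule link_det_nonzero) auto
  let ?M = "tangle_matrix D tvar"
  have "bij_betw ((!) cs) {0..<length cs} (set cs)"
    using cs(1) bij_betw_nth[of cs "{..<length cs}" "set cs"] by (simp add: lessThan_atLeast0)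
  then have "det_on (set cs) (\<lambda>i j. of_bool (i = j) - ?M i j) =
      det (mat (length cs) (length cs) (\<lambda>(i, j). of_bool (cs ! i = cs ! j) - ?M (cs ! i) (cs ! j)))"
    by (rule det_on_eq_det)
  also have "mat (length cs) (length cs) (\<lambda>(i, j). of_bool (cs ! i = cs ! j) - ?M (cs ! i) (cs ! j)) =
      1\<^sub>m (length cs) - submatrix_on cs ?M"
    by (rule eq_matI) (use cs(1) in \<open>auto simp: submatrix_on_def nth_eq_iff_index_eq\<close>)
  finally have "det_on (set cs) (\<lambda>i j. of_bool (i = j) - ?M i j) = det (1\<^sub>m (length cs) - submatrix_on cs ?M)" .
  moreover have "det_on (set cs) (\<lambda>i j. of_bool (i = j) - ?M j i) = det_on (set cs) (\<lambda>i j. of_bool (i = j) - ?M i j)"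
    using det_on_transpose[of "set cs" "\<lambda>i j. of_bool (i = j) - ?M i j"] by (simp add: eq_commute)
  moreover have "link_det D (\<lambda>k. if k \<in> set cs then Some k else None) tvar =
      link_det D no_closing tvar * det_on (set cs) (\<lambda>i j. of_bool (i = j) - ?M j i)"
    by (rule link_det_closing[OF nz cs(2)]) (use cs(2) in auto)
  ultimately show ?thesis by (simp add: closed_value_def tangle_gamma_def)
qed

end

section \<open>Tangle operations\<close>

text \<open>
  No step leads from the second part to the first, so the matrix is block triangular.
\<close>

lemma chain_det_union:
  fixes und :: "'a \<Rightarrow> ('f::idom \<times> 'a) option"
  assumes sys: "chain_system (K \<union> L) W cl" and disj: "K \<inter> L = {}"
    and ref: "\<And>s T x. s \<in> chain_states K W \<Longrightarrow> und s = Some (T, x) \<Longrightarrow> x \<in> chain_states K W"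
      "\<And>s T x. s \<in> chain_states L W \<Longrightarrow> und s = Some (T, x) \<Longrightarrow> x \<in> chain_states L W"
    and cl: "\<And>k l. k \<in> L \<Longrightarrow> cl k = Some l \<Longrightarrow> l \<notin> K"
  shows "chain_det (K \<union> L) W cl und = chain_det K W cl und * chain_det L W cl und"
proof -
  let ?S = "chain_states K W" and ?T = "chain_states L W"
  have st: "chain_states (K \<union> L) W = ?S \<union> ?T" by (auto simp: chain_states_def)
  have fin: "finite ?S" "finite ?T" using finite_chain_states[OF sys] unfolding st by auto
  have ST: "?S \<inter> ?T = {}"
  proof -
    have "set (k # W k) \<inter> set (l # W l) = {}" if "k \<in> K" "l \<in> L" for k l
    proof -
      have "k \<in> K \<union> L" "l \<in> K \<union> L" "k \<noteq> l" using that disj by auto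
      then show ?thesis using sys unfolding chain_system_def by blast
    qed
    then show ?thesis unfolding chain_states_def by blast
  qed
  have memK: "k \<in> K \<Longrightarrow> set (k # W k) \<subseteq> ?S" and memL: "k \<in> L \<Longrightarrow> set (k # W k) \<subseteq> ?T" for k
    by (auto simp: chain_states_def)
  have last: "last (k # W k) \<in> set (k # W k)" for k by (rule last_in_set) simp
  have adj: "adjacent (k # W k) j s \<Longrightarrow> j \<in> set (k # W k) \<and> s \<in> set (k # W k)" for k j s
    using adjacent_set[of "k # W k" j s] by auto
  have heads: "k \<in> K \<Longrightarrow> k \<in> ?S" "k \<in> L \<Longrightarrow> k \<in> ?T" for k by (auto simp: chain_states_def)
  have wK: "chain_wiring (K \<union> L) W cl j s \<longleftrightarrow> chain_wiring K W cl j s" if js: "j \<in> ?S" "s \<in> ?S" for j s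
  proof -
    have "\<not> adjacent (k # W k) j s" if "k \<in> L" for k using adj[of k j s] memL[OF that] js ST by blast
    moreover have "j \<noteq> last (l # W l)" if "l \<in> L" for l using last[of l] memL[OF that] js ST by blast
    moreover have "s \<notin> L" using heads js ST by blast
    ultimately show ?thesis unfolding chain_wiring_def by blast
  qed
  have wL: "chain_wiring (K \<union> L) W cl j s \<longleftrightarrow> chain_wiring L W cl j s" if js: "j \<in> ?T" "s \<in> ?T" for j s
  proof -
    have "\<not> adjacent (k # W k) j s" if "k \<in> K" for k using adj[of k j s] memK[OF that] js ST by blast
    moreover have "j \<noteq> last (l # W l)" if "l \<in> K" for l using last[of l] memK[OF that] js ST by blast
    moreover have "s \<notin> K" using heads js ST by blast
    ultimately show ?thesis unfolding chain_wiring_def by blast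
  qed
  have w0: "\<not> chain_wiring (K \<union> L) W cl j s" if js: "j \<in> ?S" "s \<in> ?T" for j s
  proof -
    have "\<not> adjacent (k # W k) j s" if "k \<in> K \<union> L" for k
      using adj[of k j s] that memK[of k] memL[of k] js ST by blast
    moreover have "j \<noteq> last (l # W l)" if "l \<in> L" for l using last[of l] memL[OF that] js ST by blast
    moreover have "s \<notin> K" using heads js ST by blast
    ultimately show ?thesis unfolding chain_wiring_def using cl by blast
  qed
  have "det_on (?S \<union> ?T) (walk_row (chain_wiring (K \<union> L) W cl) und) =
     det_on ?S (walk_row (chain_wiring (K \<union> L) W cl) und) * det_on ?T (walk_row (chain_wiring (K \<union> L) W cl) und)"
  proof (rule det_on_block[OF fin ST])
    fix i j assume ij: "i \<in> ?T" "j \<in> ?S"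
    then have "i \<noteq> j" using ST by blast
    moreover have "x \<noteq> j" if "und i = Some (T, x)" for T x using ref(2)[OF ij(1) that] ij ST by blast
    ultimately show "walk_row (chain_wiring (K \<union> L) W cl) und i j = 0"
      using w0[OF ij(2,1)] by (auto simp: walk_row_def split: option.split)
  qed
  moreover have "det_on ?S (walk_row (chain_wiring (K \<union> L) W cl) und) = det_on ?S (walk_row (chain_wiring K W cl) und)"
    by (rule det_on_cong) (simp add: walk_row_def wK)
  moreover have "det_on ?T (walk_row (chain_wiring (K \<union> L) W cl) und) = det_on ?T (walk_row (chain_wiring L W cl) und)"
    by (rule det_on_cong) (simp add: walk_row_def wL)
  ultimately show ?thesis unfolding chain_det_def walk_det_def st by simp
qed

lemma well_formed_erase:
  assumes wf: "well_formed D"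
  shows "well_formed (erase V D)"
proof -
  have comps: "components (erase V D) = components D" and da: "dom (arcs (erase V D)) = dom (arcs D)"
    and dl: "dom (loops (erase V D)) = dom (loops D)" and dk: "dom (kinds (erase V D)) = dom (kinds D) - V"
    by (auto simp: erase_def map_words_def components_def)
  have p: "passages (erase V D) k = filter (\<lambda>p. fst p \<notin> V) (passages D k)" for k
    by (auto simp: erase_def map_words_def passages_def erase_word_def split: option.splits)
  have "(\<Union>k\<in>components D. set (filter (\<lambda>p. fst p \<notin> V) (passages D k))) =
      (\<Union>k\<in>components D. set (passages D k)) \<inter> {p. fst p \<notin> V}" by auto
  also have "\<dots> = (dom (kinds D) - V) \<times> UNIV"
    using wf by (auto simp: well_formed_def)
  finally have U: "(\<Union>k\<in>components D. set (filter (\<lambda>p. fst p \<notin> V) (passages D k))) = (dom (kinds D) - V) \<times> UNIV" .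
  have "set (filter (\<lambda>p. fst p \<notin> V) (passages D k)) \<inter> set (filter (\<lambda>p. fst p \<notin> V) (passages D l)) = {}"
    if "k \<in> components D" "l \<in> components D" "k \<noteq> l" for k l
  proof -
    have "set (passages D k) \<inter> set (passages D l) = {}" using wf that unfolding well_formed_def by blast
    then show ?thesis by auto
  qed
  then show ?thesis
    unfolding well_formed_def comps da dl dk p U using wfD[OF wf] by simp
qed

lemma tangle_diagramD: "D \<in> tangle_diagrams Y \<Longrightarrow> tangle D Y"
  by (auto simp: tangle_diagrams_def diagrams_def tangle_def)

context tangle
begin

lemma states: "chain_states (heads D) (words D) = Inl ` Y \<union> Inr ` (dom (kinds D) \<times> UNIV)"
  using link_states[OF wf] comps by simp

lemma passage_on_arc: "fst p \<in> dom (kinds D) \<Longrightarrow> \<exists>k\<in>Y. p \<in> set (passages D k)"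
  using passage_iff[OF wf] comps by simp

lemma comp_of_arc: "k \<in> Y \<Longrightarrow> p \<in> set (passages D k) \<Longrightarrow> comp_of D p = k"
  using comp_of_eq[OF wf] comps by simp

lemma under_states: "under D v s = Some (T, x) \<Longrightarrow> x \<in> chain_states (heads D) (words D)"
  using under_ref[of D v s T x] unfolding states by (auto simp: passes_over_def)

end

lemma under_relabel:
  assumes "kinds E = kinds D" "\<And>p. fst p \<in> dom (kinds D) \<Longrightarrow> comp_of E p = g (comp_of D p)"
  shows "under E v (Inr p) = under D (v \<circ> g) (Inr p)"
proof -
  obtain c b where p: "p = (c, b)" by fastforce
  have "passes_over E (c, \<not> b) \<longleftrightarrow> passes_over D (c, \<not> b)" by (simp add: passes_over_def assms(1))
  moreover have "comp_of E (c, \<not> b) = g (comp_of D (c, \<not> b))" if "passes_over D (c, \<not> b)"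
    using that by (intro assms(2)) (auto simp: passes_over_def)
  ultimately show ?thesis unfolding p by (cases b) simp_all
qed

lemma link_det_of_chains:
  fixes v :: "nat \<Rightarrow> 'f::field"
  assumes E: "tangle E Z" and g: "inj_on g Y" "Z = g ` Y"
    and sys: "chain_system (Inl ` Y) W c0" and W: "\<And>k. k \<in> Y \<Longrightarrow> W (Inl k) = map Inr (passages E (g k))"
    and c: "\<And>k. k \<in> Y \<Longrightarrow> c0 (Inl k) = map_option Inl (c k)" "\<And>k l. k \<in> Y \<Longrightarrow> c k = Some l \<Longrightarrow> l \<in> Y"
    and cl: "\<And>k. k \<in> Y \<Longrightarrow> cl (g k) = map_option g (c k)"
    and und: "\<And>k. und (Inl k) = None" "\<And>p. fst p \<in> dom (kinds E) \<Longrightarrow> und (Inr p) = under E v (Inr p)"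
  shows "link_det E cl v = chain_det (Inl ` Y) W c0 und"
proof -
  interpret E: tangle E Z by fact
  let ?f = "map_sum g id :: state \<Rightarrow> state"
  have "chain_states (Inl ` Y) W = Inl ` Y \<union> Inr ` (\<Union>k\<in>Z. set (passages E k))"
    unfolding chain_states_def g(2) using W by auto
  also have "(\<Union>k\<in>Z. set (passages E k)) = dom (kinds E) \<times> UNIV"
    using E.wf E.comps by (simp add: well_formed_def)
  finally have st: "chain_states (Inl ` Y) W = Inl ` Y \<union> Inr ` (dom (kinds E) \<times> UNIV)" .
  show ?thesis
    unfolding link_det_def
  proof (rule chain_det_rename[where f="?f"])
    show "chain_system (Inl ` Y) W c0" by fact
    show "inj_on ?f (chain_states (Inl ` Y) W)"
    proof (rule inj_onI)
      fix a b assume ab: "a \<in> chain_states (Inl ` Y) W" "b \<in> chain_states (Inl ` Y) W" "?f a = ?f b"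
      show "a = b"
      proof (cases a; cases b)
        fix k l assume kl: "a = Inl k" "b = Inl l"
        then have "k \<in> Y" "l \<in> Y" using ab unfolding st by auto
        then show ?thesis using ab(3) kl inj_onD[OF g(1)] by simp
      qed (use ab(3) in simp_all)
    qed
    show "heads E = ?f ` (Inl ` Y)" unfolding E.comps g(2) by (simp add: image_image)
    show "words E (?f k) = map ?f (W k)" if "k \<in> Inl ` Y" for k using that W by auto
    show "closing E cl (?f k) = map_option ?f (c0 k)" if "k \<in> Inl ` Y" for k
      using that c cl by (auto simp: E.closing_tangle option.map_comp comp_def)
    show "l \<in> Inl ` Y" if "k \<in> Inl ` Y" "c0 k = Some l" for k l
      using that c by auto
    have fst: "fst p \<in> dom (kinds E)" if "Inr p \<in> chain_states (Inl ` Y) W" for p using that unfolding st by auto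
    show "under E v (?f s) = map_option (map_prod id ?f) (und s)" if s: "s \<in> chain_states (Inl ` Y) W" for s
    proof (cases s)
      case (Inl k)
      then show ?thesis using und(1) by simp
    next
      case (Inr p)
      have "map_option (map_prod id ?f) (under E v (Inr p)) = under E v (Inr p)"
        by (cases p) auto
      then show ?thesis using und(2)[OF fst] s Inr by simp
    qed
    show "x \<in> chain_states (Inl ` Y) W" if s: "s \<in> chain_states (Inl ` Y) W" "und s = Some (T, x)" for s T x
    proof (cases s)
      case (Inr p)
      then have "under E v (Inr p) = Some (T, x)" using s und(2)[OF fst] by simp
      then show ?thesis unfolding st using under_ref[of E v "Inr p" T x] by (auto simp: passes_over_def)
    qed (use s und in simp)
  qed
qed

lemma link_det_relabel:
  fixes v :: "nat \<Rightarrow> 'f::field"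
  assumes D: "tangle D Y" and E: "tangle (relabel x z D) Z" and x: "x \<in> Y" "z \<notin> Y - {x}"
    and c: "closes_arcs D c" "\<And>k. k \<in> Y \<Longrightarrow> cl (if k = x then z else k) = map_option (\<lambda>k. if k = x then z else k) (c k)"
  shows "link_det (relabel x z D) cl v = link_det D c (\<lambda>k. v (if k = x then z else k))"
proof -
  interpret D: tangle D Y by fact
  interpret E: tangle "relabel x z D" Z by fact
  let ?g = "\<lambda>k. if k = x then z else k"
  have Z: "Z = ?g ` Y" using x D.Y unfolding E.Y[symmetric] by (auto simp: relabel_def split: if_splits)
  have p: "passages (relabel x z D) (?g k) = passages D k" if "k \<in> Y" for k
    using that x D.no_loops D.Y by (auto simp: passages_def relabel_def split: option.splits)
  have comp: "comp_of (relabel x z D) q = ?g (comp_of D q)" if q: "fst q \<in> dom (kinds D)" for q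
  proof -
    obtain k where k: "k \<in> Y" "q \<in> set (passages D k)" using D.passage_on_arc[OF q] by blast
    then have "?g k \<in> Z" "q \<in> set (passages (relabel x z D) (?g k))" using p Z by auto
    then show ?thesis using E.comp_of_arc D.comp_of_arc[OF k] by metis
  qed
  have k: "kinds (relabel x z D) = kinds D" by (simp add: relabel_def)
  have "link_det (relabel x z D) cl v = chain_det (Inl ` Y) (words D) (closing D c) (under D (v \<circ> ?g))"
  proof (rule link_det_of_chains[OF E _ Z])
    show "inj_on ?g Y" using x by (auto simp: inj_on_def)
    show "chain_system (Inl ` Y) (words D) (closing D c)" using link_system[OF D.wf c(1)] D.comps by simp
    show "l \<in> Y" if "k \<in> Y" "c k = Some l" for k l using c(1) that D.Y unfolding closes_arcs_def by blast
    show "under D (v \<circ> ?g) (Inr q) = under (relabel x z D) v (Inr q)" for q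
      using under_relabel[OF k comp] by metis
    show "closing D c (Inl k) = map_option Inl (c k)" for k by (simp add: D.closing_tangle)
  qed (use p c(2) in auto)
  then show ?thesis by (simp add: link_det_def D.comps comp_def)
qed

text \<open>
  Stitching the head of \<open>x\<close> to the tail of \<open>y\<close> means that the beginning of
  \<open>y\<close> is preceded by the end of \<open>x\<close>; the crossings of the connecting path
  are virtual and can be erased.
\<close>

lemma link_det_stitch:
  fixes v :: "nat \<Rightarrow> 'f::field"
  assumes D: "tangle D Y" and E: "tangle D' Z" and st: "stitches_to x y z D D'" and cl: "closes_arcs D' cl"
  defines "g \<equiv> \<lambda>k. if k = x \<or> k = y then z else k"
  defines "c \<equiv> \<lambda>k. if k = y then Some x else map_option (\<lambda>l. if l = z then y else l) (cl (if k = x then z else k))"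
  shows "link_det D' cl v = link_det D c (v \<circ> g)"
    and "Y = (Z - {z}) \<union> {x, y}" "x \<noteq> y" "z \<in> Z" "{x, y} \<inter> (Z - {z}) = {}"
proof -
  interpret D: tangle D Y by fact
  interpret D': tangle D' Z by fact
  obtain u h w V where xy: "x \<noteq> y" "{x, y} \<inter> (dom (arcs D') - {z}) = {}"
    and az: "arcs D' z = Some (u @ h @ w)" and V: "V = fst ` set h" "\<forall>c\<in>V. is_virtual D' c"
    and Deq: "D = (erase V D')\<lparr>arcs := (arcs (erase V D'))(z := None, x \<mapsto> erase_word V u, y \<mapsto> erase_word V w)\<rparr>"
    using st unfolding stitches_to_def by blast
  define E where "E = erase V D'"
  have aE: "arcs E = map_option (erase_word V) \<circ> arcs D'" and lE: "loops E = Map.empty" and kE: "kinds E = kinds D' |` (- V)"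
    by (auto simp: E_def erase_def map_words_def D'.no_loops fun_eq_iff)
  have eh: "erase_word V h = []" by (auto simp: erase_word_def V(1) filter_empty_conv)
  have Ez: "arcs E z = Some (erase_word V u @ erase_word V w)"
    using az eh by (simp add: aE erase_word_def)
  show Y: "Y = (Z - {z}) \<union> {x, y}" and xy': "x \<noteq> y" and zZ: "z \<in> Z" and fresh: "{x, y} \<inter> (Z - {z}) = {}"
    using xy az D'.Y by (auto simp: D.Y[symmetric] Deq E_def[symmetric] aE split: if_splits)
  have kD: "kinds D = kinds E" by (simp add: Deq E_def)
  have aD: "arcs D = (arcs E)(z := None, x \<mapsto> erase_word V u, y \<mapsto> erase_word V w)" by (simp add: Deq E_def)
  have pE: "passages E k = erase_word V (passages D' k)" for k
    using D'.no_loops lE by (auto simp: passages_def aE erase_word_def split: option.split)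
  have pD: "passages D k = (if k = x then erase_word V u else if k = y then erase_word V w else passages E k)" if "k \<in> Y" for k
    using that fresh Y xy' D.no_loops lE by (auto simp: passages_def aD split: option.splits)
  have pEz: "passages E z = erase_word V u @ erase_word V w" using Ez by (simp add: passages_def)
  have wfE: "well_formed E" unfolding E_def by (rule well_formed_erase[OF D'.wf])
  have tE: "tangle E Z"
    using wfE lE D'.Y by unfold_locales (auto simp: aE)
  interpret E: tangle E Z by fact
  have gY: "g ` (Y - {y}) = Z" "inj_on g (Y - {y})"
    using Y xy' zZ fresh by (auto simp: g_def inj_on_def)
  have setp: "set (passages D k) \<subseteq> set (passages E (g k))" if "k \<in> Y" for k
    using that pD[OF that] pEz by (auto simp: g_def)
  have gZ: "g k \<in> Z" if "k \<in> Y" for k using that Y zZ by (auto simp: g_def)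
  have comp: "comp_of E q = g (comp_of D q)" if q: "fst q \<in> dom (kinds D)" for q
  proof -
    obtain k where k: "k \<in> Y" "q \<in> set (passages D k)" using D.passage_on_arc[OF q] by blast
    then have "g k \<in> Z" "q \<in> set (passages E (g k))" using setp gZ by blast+
    then show ?thesis using E.comp_of_arc D.comp_of_arc[OF k] by metis
  qed
  have clZ: "l \<in> Z" if "k \<in> Z" "cl k = Some l" for k l
    using cl that D'.Y unfolding closes_arcs_def by blast
  have clinj: "k = l" if "k \<in> Z" "l \<in> Z" "cl k = cl l" "cl k \<noteq> None" for k l
    using cl that D'.Y unfolding closes_arcs_def by blast
  have ck: "cl (if k = x then z else k) = cl (g k)" if "k \<in> Y - {y}" for k using that by (auto simp: g_def)
  have cY: "l \<in> Y" "l \<noteq> x \<or> k = y" if "k \<in> Y" "c k = Some l" for k l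
  proof -
    have *: "l \<in> Y \<and> l \<noteq> x" if ky: "k \<noteq> y"
    proof -
      have kk: "k \<in> Y - {y}" using \<open>k \<in> Y\<close> ky by simp
      obtain m where m: "cl (g k) = Some m" "l = (if m = z then y else m)"
        using \<open>c k = Some l\<close> ky ck[OF kk] by (auto simp: c_def)
      have "m \<in> Z" using clZ[OF gZ m(1)] kk by simp
      then show ?thesis using m(2) Y fresh xy' by auto
    qed
    show "l \<in> Y" "l \<noteq> x \<or> k = y" using * Y \<open>c k = Some l\<close> by (auto simp: c_def split: if_splits)
  qed
  have c: "closes_arcs D c"
    unfolding closes_arcs_def D.Y
  proof (intro conjI ballI allI impI)
    show "m \<in> Y" if "k \<in> Y" "c k = Some m" for k m by (rule cY(1)[OF that])
    show "k = l" if kl: "k \<in> Y" "l \<in> Y" "c k = c l" "c k \<noteq> None" for k l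
    proof -
      obtain m where m: "c k = Some m" "c l = Some m" using kl by auto
      show ?thesis
      proof (cases "k = y \<or> l = y")
        case True
        then have "m = x" using m by (auto simp: c_def)
        then show ?thesis using cY(2)[OF kl(1) m(1)] cY(2)[OF kl(2) m(2)] by simp
      next
        case False
        then obtain a b where ab: "cl (g k) = Some a" "cl (g l) = Some b" "m = (if a = z then y else a)" "m = (if b = z then y else b)"
          using m ck[of k] ck[of l] kl by (auto simp: c_def)
        have kZ: "g k \<in> Z" "g l \<in> Z" using gZ kl by auto
        have "a \<in> Z" "b \<in> Z" using clZ kZ ab by blast+
        then have "a = b" using ab fresh by (auto split: if_splits)
        then have "g k = g l" using clinj[OF kZ] ab by simp
        then show ?thesis using gY(2) kl False by (auto simp: inj_on_def)
      qed
    qed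
  qed
  have sysD: "chain_system (heads D) (words D) (closing D c)" by (rule link_system[OF D.wf c])
  have hx: "Inl x \<in> heads D" "Inl y \<in> heads D" "Inl x \<noteq> (Inl y :: state)" "closing D c (Inl y) = Some (Inl x)"
    using Y xy' D.comps by (auto simp: D.closing_tangle c_def)
  note merge = chain_det_merge[where und="under D (v \<circ> g)", OF sysD hx _ unreferenced_head[OF D.wf]]
  have hd: "heads D - {Inl y} = Inl ` (Y - {y})" using D.comps by auto
  have "link_det D' cl v = link_det E cl v"
    unfolding E_def using V by (intro link_det_erase[OF D'.wf _ _ cl, symmetric]) auto
  also have "\<dots> = chain_det (Inl ` (Y - {y})) ((words D)(Inl x := words D (Inl x) @ words D (Inl y)))
      (\<lambda>k. if closing D c k = Some (Inl y) then Some (Inl x) else closing D c k) (under D (v \<circ> g))"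
  proof (rule link_det_of_chains[OF tE gY(2) gY(1)[symmetric], where c="\<lambda>k. if c k = Some y then Some x else c k"])
    show "chain_system (Inl ` (Y - {y})) ((words D)(Inl x := words D (Inl x) @ words D (Inl y)))
      (\<lambda>k. if closing D c k = Some (Inl y) then Some (Inl x) else closing D c k)"
      using merge(2) unfolding hd by simp
    show "((words D)(Inl x := words D (Inl x) @ words D (Inl y))) (Inl k) = map Inr (passages E (g k))" if "k \<in> Y - {y}" for k
      using that pD[of k] pD[of x] pD[of y] Y xy' pEz by (auto simp: g_def)
    show "(if closing D c (Inl k) = Some (Inl y) then Some (Inl x) else closing D c (Inl k)) =
      map_option Inl (if c k = Some y then Some x else c k)" for k
      by (auto simp: D.closing_tangle)
    show "l \<in> Y - {y}" if "k \<in> Y - {y}" "(if c k = Some y then Some x else c k) = Some l" for k l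
      using that cY(1)[of k l] Y xy' by (auto split: if_splits)
    show "cl (g k) = map_option g (if c k = Some y then Some x else c k)" if k: "k \<in> Y - {y}" for k
    proof (cases "cl (g k)")
      case None
      then show ?thesis using k ck[OF k] by (simp add: c_def)
    next
      case (Some m)
      have "m \<in> Z" using clZ[OF gZ Some] k by simp
      then have "m = z \<or> m \<noteq> x \<and> m \<noteq> y" using fresh by auto
      then show ?thesis using Some k ck[OF k] xy' by (auto simp: c_def g_def)
    qed
    show "under D (v \<circ> g) (Inr q) = under E v (Inr q)" for q
      using under_relabel[OF kD[symmetric] comp] by metis
  qed simp
  also have "\<dots> = link_det D c (v \<circ> g)"
    using merge(1) unfolding hd link_det_def by simp
  finally show "link_det D' cl v = link_det D c (v \<circ> g)" .
qed

lemma link_det_union: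
  fixes v :: "nat \<Rightarrow> 'f::field"
  assumes D: "tangle D Y" and E: "tangle E Z" and U: "tangle (disjoint_union D E) (Y \<union> Z)"
    and disj: "Y \<inter> Z = {}" "dom (kinds D) \<inter> dom (kinds E) = {}"
    and cl: "closes_arcs (disjoint_union D E) cl" "(\<forall>k\<in>Z. \<forall>l. cl k = Some l \<longrightarrow> l \<in> Z) \<or> (\<forall>k\<in>Y. \<forall>l. cl k = Some l \<longrightarrow> l \<in> Y)"
  shows "link_det (disjoint_union D E) cl v =
    link_det D (\<lambda>k. if cl k \<in> Some ` Y then cl k else None) v * link_det E (\<lambda>k. if cl k \<in> Some ` Z then cl k else None) v"
proof -
  let ?U = "disjoint_union D E"
  interpret D: tangle D Y by fact
  interpret E: tangle E Z by fact
  interpret U: tangle ?U "Y \<union> Z" by fact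
  have pD: "passages ?U k = passages D k" if "k \<in> Y" for k
    using that disj D.Y E.Y by (auto simp: passages_def disjoint_union_def D.no_loops E.no_loops map_add_def split: option.splits)
  have pE: "passages ?U k = passages E k" if "k \<in> Z" for k
    using that disj D.Y E.Y by (auto simp: passages_def disjoint_union_def D.no_loops E.no_loops map_add_def split: option.splits)
  have kD: "kinds ?U k = kinds D k" if "k \<in> dom (kinds D)" for k
    using that disj by (auto simp: disjoint_union_def map_add_def split: option.splits)
  have kE: "kinds ?U k = kinds E k" if "k \<in> dom (kinds E)" for k
    using that disj by (auto simp: disjoint_union_def map_add_def split: option.splits)
  have cD: "comp_of ?U q = comp_of D q" if q: "fst q \<in> dom (kinds D)" for q
  proof -
    obtain k where k: "k \<in> Y" "q \<in> set (passages D k)" using D.passage_on_arc[OF q] by blast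
    show ?thesis using D.comp_of_arc[OF k] U.comp_of_arc[of k q] k pD[OF k(1)] by simp
  qed
  have cE: "comp_of ?U q = comp_of E q" if q: "fst q \<in> dom (kinds E)" for q
  proof -
    obtain k where k: "k \<in> Z" "q \<in> set (passages E k)" using E.passage_on_arc[OF q] by blast
    show ?thesis using E.comp_of_arc[OF k] U.comp_of_arc[of k q] k pE[OF k(1)] by simp
  qed
  have uD: "under ?U v s = under D v s" if "s \<in> chain_states (heads D) (words D)" for s
  proof (cases s)
    case (Inr q)
    obtain c b where q: "q = (c, b)" by fastforce
    have "c \<in> dom (kinds D)" using that unfolding D.states Inr q by auto
    then show ?thesis using kD[of c] cD[of "(c, \<not> b)"] unfolding Inr q by (cases b) (simp_all add: passes_over_def)
  qed simp
  have uE: "under ?U v s = under E v s" if "s \<in> chain_states (heads E) (words E)" for s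
  proof (cases s)
    case (Inr q)
    obtain c b where q: "q = (c, b)" by fastforce
    have "c \<in> dom (kinds E)" using that unfolding E.states Inr q by auto
    then show ?thesis using kE[of c] cE[of "(c, \<not> b)"] unfolding Inr q by (cases b) (simp_all add: passes_over_def)
  qed simp
  have sD: "chain_states (Inl ` Y) (words ?U) = chain_states (heads D) (words D)"
    unfolding chain_states_def D.comps using pD by simp
  have sE: "chain_states (Inl ` Z) (words ?U) = chain_states (heads E) (words E)"
    unfolding chain_states_def E.comps using pE by simp
  have sys: "chain_system (Inl ` Y \<union> Inl ` Z) (words ?U) (closing ?U cl)"
    using link_system[OF U.wf cl(1)] U.comps by (simp add: image_Un)
  have ref: "x \<in> chain_states (Inl ` Y) (words ?U)" if "s \<in> chain_states (Inl ` Y) (words ?U)" "under ?U v s = Some (T, x)" for s T x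
    using that uD[of s] D.under_states[of v s T x] unfolding sD by simp
  have ref': "x \<in> chain_states (Inl ` Z) (words ?U)" if "s \<in> chain_states (Inl ` Z) (words ?U)" "under ?U v s = Some (T, x)" for s T x
    using that uE[of s] E.under_states[of v s T x] unfolding sE by simp
  have nYZ: "k \<notin> Z" if "k \<in> Y" for k using disj that by auto
  have dj: "Inl ` Y \<inter> (Inl ` Z :: state set) = {}" using disj by auto
  have "chain_det (Inl ` Y \<union> Inl ` Z) (words ?U) (closing ?U cl) (under ?U v) =
     chain_det (Inl ` Y) (words ?U) (closing ?U cl) (under ?U v) * chain_det (Inl ` Z) (words ?U) (closing ?U cl) (under ?U v)"
    using cl(2)
  proof
    assume a: "\<forall>k\<in>Z. \<forall>l. cl k = Some l \<longrightarrow> l \<in> Z"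
    show ?thesis
      by (rule chain_det_union[OF sys dj]) (use ref ref' a disj in \<open>(auto simp: U.closing_tangle)\<close>)
  next
    assume a: "\<forall>k\<in>Y. \<forall>l. cl k = Some l \<longrightarrow> l \<in> Y"
    have "chain_det (Inl ` Z \<union> Inl ` Y) (words ?U) (closing ?U cl) (under ?U v) =
       chain_det (Inl ` Z) (words ?U) (closing ?U cl) (under ?U v) * chain_det (Inl ` Y) (words ?U) (closing ?U cl) (under ?U v)"
      by (rule chain_det_union) (use sys dj ref ref' a nYZ in \<open>(auto simp: U.closing_tangle Un_commute)\<close>)
    then show ?thesis by (simp add: Un_commute mult.commute)
  qed
  moreover have "chain_det (Inl ` Y) (words ?U) (closing ?U cl) (under ?U v) =
      link_det D (\<lambda>k. if cl k \<in> Some ` Y then cl k else None) v"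
    unfolding link_det_def chain_det_def sD
  proof (rule walk_det_cong)
    show "chain_wiring (Inl ` Y) (words ?U) (closing ?U cl) j s \<longleftrightarrow>
      chain_wiring (heads D) (words D) (closing D (\<lambda>k. if cl k \<in> Some ` Y then cl k else None)) j s" for j s
    proof -
      have W: "words ?U k = words D k" if "k \<in> Inl ` Y" for k using pD that by auto
      have c: "closing ?U cl s = Some l \<longleftrightarrow> closing D (\<lambda>k. if cl k \<in> Some ` Y then cl k else None) s = Some l"
        if "l \<in> Inl ` Y" for l
        using that by (cases s) (auto simp: U.closing_tangle D.closing_tangle)
      show ?thesis
        unfolding chain_wiring_def D.comps
        by (intro arg_cong2[where f="(\<or>)"] arg_cong2[where f="(\<and>)"] bex_cong refl) (simp_all only: W c)
    qed
  qed (rule uD)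
  moreover have "chain_det (Inl ` Z) (words ?U) (closing ?U cl) (under ?U v) =
      link_det E (\<lambda>k. if cl k \<in> Some ` Z then cl k else None) v"
    unfolding link_det_def chain_det_def sE
  proof (rule walk_det_cong)
    show "chain_wiring (Inl ` Z) (words ?U) (closing ?U cl) j s \<longleftrightarrow>
      chain_wiring (heads E) (words E) (closing E (\<lambda>k. if cl k \<in> Some ` Z then cl k else None)) j s" for j s
    proof -
      have W: "words ?U k = words E k" if "k \<in> Inl ` Z" for k using pE that by auto
      have c: "closing ?U cl s = Some l \<longleftrightarrow> closing E (\<lambda>k. if cl k \<in> Some ` Z then cl k else None) s = Some l"
        if "l \<in> Inl ` Z" for l
        using that by (cases s) (auto simp: U.closing_tangle E.closing_tangle)
      show ?thesis
        unfolding chain_wiring_def E.comps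
        by (intro arg_cong2[where f="(\<or>)"] arg_cong2[where f="(\<and>)"] bex_cong refl) (simp_all only: W c)
    qed
  qed (rule uE)
  ultimately show ?thesis unfolding link_det_def U.comps by (simp add: image_Un link_det_def)
qed

section \<open>Compatibility with the operations of \<open>\<Gamma>\<close>-calculus\<close>

lemma link_det_closing_cong:
  assumes "\<And>k. k \<in> components D \<Longrightarrow> cl k = cl' k"
  shows "link_det D cl v = link_det D cl' v"
  unfolding link_det_def by (rule chain_det_cong) (use assms in auto)

lemma tangle_matrix_eq:
  assumes "tangle D Y" "i \<in> Y" "j \<in> Y"
  shows "tangle_matrix D v i j = 1 - link_det D [i \<mapsto> j] v / link_det D no_closing v"
  using assms by (simp add: tangle_matrix_def tangle.Y)

lemma tangle_matrix_outside:
  assumes "tangle D Y" "i \<notin> Y \<or> j \<notin> Y"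
  shows "tangle_matrix D v i j = 0"
  using assms tangle.Y[OF assms(1)] by (auto simp: tangle_matrix_def)

lemma tangle_gamma_union:
  assumes D: "tangle D Y" and E: "tangle E Z" and U: "tangle (disjoint_union D E) (Y \<union> Z)"
    and disj: "Y \<inter> Z = {}" "dom (kinds D) \<inter> dom (kinds E) = {}"
  shows "tangle_gamma (disjoint_union D E) = gamma_union (tangle_gamma D) (tangle_gamma E)"
proof -
  interpret D: tangle D Y by fact
  interpret E: tangle E Z by fact
  interpret U: tangle "disjoint_union D E" "Y \<union> Z" by fact
  have nz: "link_det D no_closing tvar \<noteq> 0" "link_det E no_closing tvar \<noteq> 0"
    using D.link_det_nonzero[of tvar] E.link_det_nonzero[of tvar] by auto
  note union = link_det_union[OF D E U disj]
  have om: "link_det (disjoint_union D E) no_closing tvar = link_det D no_closing tvar * link_det E no_closing tvar"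
    using union[OF closes_arcs_empty, of tvar] by (simp add: image_iff)
  have single: "link_det (disjoint_union D E) [k \<mapsto> l] tvar =
      (if k \<in> Y \<and> l \<in> Y then link_det D [k \<mapsto> l] tvar else link_det D no_closing tvar) *
      (if k \<in> Z \<and> l \<in> Z then link_det E [k \<mapsto> l] tvar else link_det E no_closing tvar)"
    if kl: "k \<in> Y \<union> Z" "l \<in> Y \<union> Z" for k l
  proof -
    have c: "closes_arcs (disjoint_union D E) [k \<mapsto> l]" using kl U.Y by (intro closes_arcs_single) simp
    have r: "(\<forall>m\<in>Z. \<forall>n. [k \<mapsto> l] m = Some n \<longrightarrow> n \<in> Z) \<or> (\<forall>m\<in>Y. \<forall>n. [k \<mapsto> l] m = Some n \<longrightarrow> n \<in> Y)"
      using kl disj by auto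
    have "link_det D (\<lambda>m. if [k \<mapsto> l] m \<in> Some ` Y then [k \<mapsto> l] m else None) tvar =
      (if k \<in> Y \<and> l \<in> Y then link_det D [k \<mapsto> l] tvar else link_det D no_closing tvar)"
      using D.comps by (auto intro!: link_det_closing_cong)
    moreover have "link_det E (\<lambda>m. if [k \<mapsto> l] m \<in> Some ` Z then [k \<mapsto> l] m else None) tvar =
      (if k \<in> Z \<and> l \<in> Z then link_det E [k \<mapsto> l] tvar else link_det E no_closing tvar)"
      using E.comps by (auto intro!: link_det_closing_cong)
    ultimately show ?thesis by (simp only: union[OF c r])
  qed
  have "tangle_matrix (disjoint_union D E) tvar i j = tangle_matrix D tvar i j + tangle_matrix E tvar i j" for i j
  proof (cases "i \<in> Y \<union> Z \<and> j \<in> Y \<union> Z")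
    case True
    consider "i \<in> Y" "j \<in> Y" "i \<notin> Z" | "i \<in> Z" "j \<in> Z" "i \<notin> Y" | "i \<in> Y" "j \<in> Z" "i \<notin> Z" "j \<notin> Y" | "i \<in> Z" "j \<in> Y" "i \<notin> Y" "j \<notin> Z"
      using True disj by blast
    then show ?thesis
    proof cases
      case 1
      then show ?thesis using tangle_matrix_eq[OF U, of i j tvar] single[of i j] om nz
          tangle_matrix_eq[OF D, of i j tvar] tangle_matrix_outside[OF E, of i j tvar] by simp
    next
      case 2
      then show ?thesis using tangle_matrix_eq[OF U, of i j tvar] single[of i j] om nz
          tangle_matrix_eq[OF E, of i j tvar] tangle_matrix_outside[OF D, of i j tvar] by simp
    next
      case 3
      then show ?thesis using tangle_matrix_eq[OF U, of i j tvar] single[of i j] om nz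
          tangle_matrix_outside[OF E, of i j tvar] tangle_matrix_outside[OF D, of i j tvar] by simp
    next
      case 4
      then show ?thesis using tangle_matrix_eq[OF U, of i j tvar] single[of i j] om nz
          tangle_matrix_outside[OF E, of i j tvar] tangle_matrix_outside[OF D, of i j tvar] by simp
    qed
  next
    case False
    then show ?thesis using tangle_matrix_outside[OF U, of i j tvar] tangle_matrix_outside[OF D, of i j tvar]
        tangle_matrix_outside[OF E, of i j tvar] by auto
  qed
  then show ?thesis by (simp add: tangle_gamma_def gamma_union_def om fun_eq_iff)
qed

definition strand_diagram :: "nat \<Rightarrow> diagram" where
  "strand_diagram x = \<lparr>arcs = [x \<mapsto> []], loops = Map.empty, kinds = Map.empty\<rparr>"

lemma tangle_strand: "tangle (strand_diagram x) {x}"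
  by unfold_locales (auto simp: well_formed_def strand_diagram_def components_def passages_def)

lemma add_strand_eq: "add_strand x D = disjoint_union D (strand_diagram x)"
  by (simp add: add_strand_def disjoint_union_def strand_diagram_def)

lemma tangle_gamma_strand:
  assumes D: "tangle D Y" and x: "x \<notin> Y" and A: "tangle (add_strand x D) (insert x Y)"
  shows "tangle_gamma (add_strand x D) = gamma_strand x (tangle_gamma D)"
proof -
  interpret S: tangle "strand_diagram x" "{x}" by (rule tangle_strand)
  have none: "under (strand_diagram x) tvar s = None" for s :: state
    by (cases "(strand_diagram x, tvar, s)" rule: under.cases) (simp_all add: passes_over_def strand_diagram_def)
  have w: "link_det (strand_diagram x) no_closing tvar = 1" "link_det (strand_diagram x) [x \<mapsto> x] tvar = 0"
    using S.unit_weight_values(1)[of tvar] S.unit_weight_values(2)[of tvar x x] none by simp_all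
  have m: "tangle_matrix (strand_diagram x) tvar i j = (if i = x \<and> j = x then 1 else 0)" for i j
    using tangle_matrix_eq[OF tangle_strand, of i x j tvar] tangle_matrix_outside[OF tangle_strand, of i x j tvar] w by auto
  have "tangle_gamma (disjoint_union D (strand_diagram x)) = gamma_union (tangle_gamma D) (tangle_gamma (strand_diagram x))"
    by (rule tangle_gamma_union[OF D tangle_strand])
       (use A x in \<open>simp_all add: add_strand_eq strand_diagram_def\<close>)
  then show ?thesis
    using tangle_matrix_outside[OF D, of x x tvar] x
    by (auto simp: add_strand_eq tangle_gamma_def gamma_union_def gamma_strand_def w m fun_eq_iff)
qed

lemma specialize_link_det:
  fixes h :: "nat \<Rightarrow> 'a::field_char_0"
  assumes "\<And>k. h k \<noteq> 0"
  shows "specializes_to h (link_det D cl tvar) (link_det D cl h)"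
  by (rule specializes_to_link_det[OF specializes_to_tvar assms])

lemma tangle_gamma_relabel:
  assumes D: "tangle D Y" and x: "x \<in> Y" "z \<notin> Y - {x}" and R: "tangle (relabel x z D) Z"
  shows "tangle_gamma (relabel x z D) = gamma_relabel x z (tangle_gamma D)"
proof -
  interpret D: tangle D Y by fact
  interpret R: tangle "relabel x z D" Z by fact
  let ?g = "\<lambda>k. if k = x then z else k" and ?t = "Transposition.transpose x z"
  let ?h = "\<lambda>i. tvar (?g i)"
  have Z: "Z = ?g ` Y" using x D.Y unfolding R.Y[symmetric] by (auto simp: relabel_def split: if_splits)
  have sp: "specializes_to ?h (link_det D cl tvar) (link_det D cl ?h)" for cl
    by (rule specialize_link_det) (simp add: tvar_nonzero)
  have om: "link_det (relabel x z D) no_closing tvar = link_det D no_closing ?h"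
    by (rule link_det_relabel[OF D R x closes_arcs_empty]) simp
  have nz: "link_det D no_closing ?h \<noteq> 0" by (rule D.link_det_nonzero) auto
  have M: "tangle_matrix (relabel x z D) tvar i j = specialize ?h (tangle_matrix D tvar (?t i) (?t j))" for i j
  proof (cases "i \<in> Z \<and> j \<in> Z")
    case True
    have inv: "?t k \<in> Y \<and> ?g (?t k) = k" if kZ: "k \<in> Z" for k
    proof -
      obtain m where m: "m \<in> Y" "k = ?g m" using kZ unfolding Z by blast
      have "?t k = m"
      proof (cases "m = x")
        case False
        then have "m \<noteq> z" using x(2) m(1) by blast
        then show ?thesis using False m(2) by simp
      qed (use m in simp)
      then have "?t k \<in> Y \<and> ?g (?t k) = ?g m" using m(1) by simp
      then show ?thesis unfolding m(2)[symmetric] .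
    qed
    define i' j' where "i' = ?t i" and "j' = ?t j"
    have ij: "i' \<in> Y" "j' \<in> Y" "?g i' = i" "?g j' = j"
      using inv[of i] inv[of j] True unfolding i'_def j'_def by blast+
    have inj: "?g a = ?g b \<longleftrightarrow> a = b" if "a \<in> Y" "b \<in> Y" for a b using that x by auto
    have "link_det (relabel x z D) [i \<mapsto> j] tvar = link_det D [i' \<mapsto> j'] ?h"
    proof (rule link_det_relabel[OF D R x])
      show "closes_arcs D [i' \<mapsto> j']" using ij D.Y by (intro closes_arcs_single) simp
      show "[i \<mapsto> j] (?g k) = map_option ?g ([i' \<mapsto> j'] k)" if "k \<in> Y" for k
        using inj[OF that ij(1)] ij by auto
    qed
    then have "tangle_matrix (relabel x z D) tvar i j = 1 - link_det D [i' \<mapsto> j'] ?h / link_det D no_closing ?h"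
      using tangle_matrix_eq[OF R, of i j tvar] True om by simp
    moreover have "specializes_to ?h (tangle_matrix D tvar i' j') (1 - link_det D [i' \<mapsto> j'] ?h / link_det D no_closing ?h)"
      unfolding tangle_matrix_eq[OF D ij(1,2)]
      by (intro specializes_to_diff specializes_to_1 specializes_to_divide sp nz)
    ultimately show ?thesis unfolding i'_def j'_def by (simp only: specialize_eq)
  next
    case False
    have "?t k \<notin> Y" if "k \<notin> Z" for k
    proof
      assume k: "?t k \<in> Y"
      have "?g (?t k) = k"
      proof (cases "?t k = x")
        case True
        then have "?t (?t k) = ?t x" by simp
          then have "k = z" by simp
        then show ?thesis using True by simp
      next
        case False
        have "?t k \<noteq> z"
        proof
          assume e: "?t k = z"
          have "z \<in> Y - {x}" using k False unfolding e by simp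
          then show False using x(2) by simp
        qed
        then have "?t k = k" using False by (auto simp: transpose_def split: if_splits)
        then show ?thesis using False by simp
      qed
      moreover have "?g (?t k) \<in> ?g ` Y" using k by (rule imageI)
      ultimately have "k \<in> Z" unfolding Z by (simp only:)
      then show False using that by blast
    qed
    then have "?t i \<notin> Y \<or> ?t j \<notin> Y" using False by blast
    then show ?thesis
      using tangle_matrix_outside[OF R, of i j tvar] tangle_matrix_outside[OF D, of "?t i" "?t j" tvar] False
        specialize_eq[OF specializes_to_0, of ?h] by simp
  qed
  show ?thesis
    unfolding tangle_gamma_def gamma_relabel_def Let_def prod.case om
    using specialize_eq[OF sp[of no_closing]] M by auto
qed

text \<open>
  The formulas for \<open>m\<close> are the minors of order one and two in
  \<open>link_det_closing\<close>: the connection of \<open>y\<close> to \<open>x\<close> alone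
  gives \<open>(1 - \<gamma>) \<omega>\<close>, and together with one further connection it gives
  the matrix entries.
\<close>

lemma tangle_gamma_stitch:
  assumes D: "tangle D Y" and D': "tangle D' Z" and st: "stitches_to x y z D D'"
  shows "tangle_gamma D' = gamma_stitch x y z (tangle_gamma D)"
proof -
  interpret D: tangle D Y by fact
  interpret D': tangle D' Z by fact
  let ?g = "\<lambda>k. if k = x \<or> k = y then z else k"
  let ?h = "\<lambda>i. tvar (?g i)"
  note stitch = link_det_stitch[OF D D' st]
  have Y: "Y = (Z - {z}) \<union> {x, y}" and xy: "x \<noteq> y" and zZ: "z \<in> Z" and fresh: "{x, y} \<inter> (Z - {z}) = {}"
    using stitch(2-5)[OF closes_arcs_empty] by auto
  have sp: "specializes_to ?h (link_det D cl tvar) (link_det D cl ?h)" for cl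
    by (rule specialize_link_det) (simp add: tvar_nonzero)
  let ?c = "[y \<mapsto> x]"
  have om': "link_det D' no_closing tvar = link_det D ?c ?h"
  proof -
    have "(\<lambda>k. if k = y then Some x else map_option (\<lambda>l. if l = z then y else l) (no_closing (if k = x then z else k))) = ?c"
      by (rule ext) simp
    from stitch(1)[OF closes_arcs_empty, of tvar, unfolded this comp_def] show ?thesis .
  qed
  have nz': "link_det D ?c ?h \<noteq> 0" using D'.link_det_nonzero[of tvar] om' by auto
  have nz: "link_det D no_closing tvar \<noteq> 0" using D.link_det_nonzero[of tvar] by auto
  have kap: "link_det D ?c tvar \<noteq> 0"
  proof
    assume "link_det D ?c tvar = 0"
    then have "specializes_to ?h 0 (link_det D ?c ?h)" using sp[of ?c] by simp
    then have "link_det D ?c ?h = 0" by (rule specializes_to_unique[OF _ specializes_to_0])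
    then show False using nz' by simp
  qed
  let ?M = "tangle_matrix D tvar" and ?w = "link_det D no_closing tvar"
  have xyY: "x \<in> Y" "y \<in> Y" using Y by auto
  have gam: "1 - ?M y x = link_det D ?c tvar / ?w" using tangle_matrix_eq[OF D xyY(2,1), of tvar] by simp
  have gam0: "1 - ?M y x \<noteq> 0" unfolding gam using kap nz by simp
  have scalar: "specialize ?h ((1 - ?M y x) * ?w) = link_det D' no_closing tvar"
    unfolding gam om' using nz specialize_eq[OF sp[of ?c]] by simp
  define expr where "expr i j = (if i = z \<and> j = z then ?M x y + ?M x x * ?M y y / (1 - ?M y x)
       else if i \<in> {x, y} - {z} \<or> j \<in> {x, y} - {z} then 0
       else if i = z then ?M x j + ?M x x * ?M y j / (1 - ?M y x)
       else if j = z then ?M i y + ?M y y * ?M i x / (1 - ?M y x)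
       else ?M i j + ?M i x * ?M y j / (1 - ?M y x))" for i j
  have entry: "tangle_matrix D' tvar i j = specialize ?h (expr i j)" for i j
  proof (cases "i \<in> Z \<and> j \<in> Z")
    case True
    define i' j' where "i' = (if i = z then x else i)" and "j' = (if j = z then y else j)"
    have i': "i' \<in> Y" "i' \<noteq> y" using True Y fresh xy by (auto simp: i'_def)
    have j': "j' \<in> Y" "j' \<noteq> x" using True Y fresh xy by (auto simp: j'_def)
    have e: "expr i j = ?M i' j' + ?M i' x * ?M y j' / (1 - ?M y x)"
      using True fresh by (auto simp: expr_def i'_def j'_def mult.commute)
    let ?cc = "\<lambda>k. if k \<in> {y, i'} then Some (if k = y then x else j') else None"
    have "link_det D ?cc tvar = ?w * det_on {y, i'} (\<lambda>a b. of_bool (a = b) - ?M b (if a = y then x else j'))"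
      by (rule D.link_det_closing[OF nz]) (use xyY i' j' in \<open>auto simp: inj_on_def\<close>)
    then have cc: "link_det D ?cc tvar = ?w * ((1 - ?M y x) * (1 - ?M i' j') - ?M i' x * ?M y j')"
      using i'(2) by (simp add: det_on_pair)
    have "expr i j = 1 - link_det D ?cc tvar / link_det D ?c tvar"
    proof -
      have k: "link_det D ?c tvar = ?w * (1 - ?M y x)" unfolding gam using nz by simp
      have "link_det D ?cc tvar / link_det D ?c tvar = ((1 - ?M y x) * (1 - ?M i' j') - ?M i' x * ?M y j') / (1 - ?M y x)"
        unfolding cc k using nz by simp
      then show ?thesis unfolding e using gam0 by (simp add: diff_divide_distrib)
    qed
    then have "specializes_to ?h (expr i j) (1 - link_det D ?cc ?h / link_det D ?c ?h)"
      by (simp only:) (intro specializes_to_diff specializes_to_1 specializes_to_divide sp nz')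
    moreover have "link_det D' [i \<mapsto> j] tvar = link_det D ?cc ?h"
    proof -
      have "closes_arcs D' [i \<mapsto> j]" using True D'.Y by (intro closes_arcs_single) simp
      from stitch(1)[OF this, of tvar] show ?thesis
        unfolding comp_def
      proof (elim trans, intro link_det_closing_cong)
        fix k assume "k \<in> components D"
        then have "k \<in> Y" using D.comps by simp
        then show "(if k = y then Some x else map_option (\<lambda>l. if l = z then y else l) ([i \<mapsto> j] (if k = x then z else k))) = ?cc k"
          using True fresh xy Y by (auto simp: i'_def j'_def)
      qed
    qed
    moreover have "tangle_matrix D' tvar i j = 1 - link_det D' [i \<mapsto> j] tvar / link_det D' no_closing tvar"
      using True by (intro tangle_matrix_eq[OF D']) auto
    ultimately show ?thesis unfolding om' by (simp only: specialize_eq)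
  next
    case False
    have "expr i j = 0"
    proof (cases "i \<in> {x, y} - {z} \<or> j \<in> {x, y} - {z}")
      case True
      then show ?thesis by (auto simp: expr_def)
    next
      case h: False
      have "i \<notin> Y \<and> i \<noteq> z \<or> j \<notin> Y \<and> j \<noteq> z" using False h Y zZ by auto
      then show ?thesis using h tangle_matrix_outside[OF D, of i _ tvar] tangle_matrix_outside[OF D, of _ j tvar]
        by (auto simp: expr_def)
    qed
    then show ?thesis using tangle_matrix_outside[OF D', of i j tvar] False specialize_eq[OF specializes_to_0, of ?h] by simp
  qed
  show ?thesis
    unfolding tangle_gamma_def gamma_stitch_def Let_def prod.case scalar
    using entry unfolding expr_def by auto
qed

lemma tangle_gamma_crossing:
  assumes s: "s \<in> {Positive, Negative}" and ij: "i \<noteq> j" and T: "tangle (crossing_diagram s c i j) {i, j}"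
  shows "tangle_gamma (crossing_diagram s c i j) = gamma_crossing s i j"
proof -
  let ?D = "crossing_diagram s c i j"
  interpret tangle ?D "{i, j}" by fact
  define p q where "p = (c, s = Positive)" and "q = (c, s \<noteq> Positive)"
  have pi: "passages ?D i = [p]" and pj: "passages ?D j = [q]"
    using ij by (auto simp: passages_def crossing_diagram_def p_def q_def)
  define t where "t = (if s = Positive then tvar i else inverse (tvar i))"
  have co: "comp_of ?D p = i" by (rule comp_of_arc) (simp_all add: pi)
  have uq: "under ?D tvar (Inr q) = Some (t, Inr p)"
    using s co by (auto simp: q_def p_def passes_over_def crossing_diagram_def t_def)
  have up: "under ?D tvar (Inr p) = None"
    using s by (auto simp: p_def passes_over_def crossing_diagram_def)
  let ?u = "redirect (Inr p) (Inl i) (under ?D tvar)"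
  let ?W = "(\<lambda>_. [])(Inl j := [Inr q]) :: state \<Rightarrow> state list"
  let ?S = "{Inl i, Inl j, Inr q} :: state set"
  have pq: "p \<noteq> q" by (auto simp: p_def q_def)
  have uq': "?u (Inr q) = Some (t, Inl i)" using uq by (simp add: redirect_def)
  have SW: "chain_states {Inl i, Inl j} ?W = ?S" using ij by (auto simp: chain_states_def)
  have reduce: "link_det ?D cl tvar = det_on ?S (walk_row (chain_wiring {Inl i, Inl j} ?W (closing ?D cl)) ?u)"
    if cl: "closes_arcs ?D cl" for cl
  proof -
    have sys: "chain_system (heads ?D) (words ?D) (closing ?D cl)" by (rule link_system[OF wf cl])
    have "adjacent (Inl i # words ?D (Inl i)) (Inl i) (Inr p)" using pi by simp
    then have A: "chain_wiring (heads ?D) (words ?D) (closing ?D cl) (Inl i) (Inr p)"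
      unfolding chain_wiring_def comps by blast
    have pS: "Inr p \<in> chain_states (heads ?D) (words ?D)"
      unfolding states by (auto simp: p_def crossing_diagram_def)
    have st: "chain_states (heads ?D) (words ?D) = {Inl i, Inl j, Inr p, Inr q}"
      unfolding chain_states_def comps using pi pj by auto
    have "link_det ?D cl tvar = chain_det (heads ?D) (words ?D) (closing ?D cl) ?u"
      unfolding link_det_def chain_det_def
      by (rule walk_det_redirect[where und="under ?D tvar", OF finite_chain_states[OF sys] pS up wiring_chain[OF sys] A, symmetric])
    also have "\<dots> = chain_det (heads ?D) (\<lambda>k. filter (\<lambda>s. s \<noteq> Inr p) (words ?D k)) (closing ?D cl) ?u"
      by (rule chain_det_filter_one[OF sys, symmetric])
         (use up in \<open>auto simp: redirect_def unreferenced_def\<close>)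
    also have "\<dots> = chain_det {Inl i, Inl j} ?W (closing ?D cl) ?u"
      unfolding comps image_insert image_empty
      by (rule chain_det_cong) (use pi pj pq ij in auto)
    finally show ?thesis unfolding chain_det_def walk_det_def SW .
  qed
  have rq: "walk_row (chain_wiring {Inl i, Inl j} ?W (closing ?D cl)) ?u (Inr q) x =
      of_bool (x = Inr q) - t * of_bool (x = Inl j) - (1 - t) * of_bool (x = Inl i)" for cl x
    using ij unfolding walk_row_def uq' by (auto simp: chain_wiring_def)
  have rh: "walk_row (chain_wiring {Inl i, Inl j} ?W (closing ?D cl)) ?u (Inl k) x =
      of_bool (x = Inl k) - of_bool (cl k = Some i \<and> x = Inl i) - of_bool (cl k = Some j \<and> x = Inr q)"
    if "k \<in> {i, j}" for cl k x
    using ij that unfolding walk_row_def by (auto simp: redirect_def chain_wiring_def closing_tangle)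
  have fin: "finite ?S" by simp
  have Sq: "?S - {Inr q} = {Inl i, Inl j}" by auto
  have nij: "Inl i \<noteq> (Inl j :: state)" using ij by simp
  have no_q: "link_det ?D cl tvar = det_on {Inl i, Inl j} (walk_row (chain_wiring {Inl i, Inl j} ?W (closing ?D cl)) ?u)"
    if "closes_arcs ?D cl" "cl i \<noteq> Some j" "cl j \<noteq> Some j" for cl
    unfolding reduce[OF that(1)] using that(2,3)
    by (subst det_on_unit[OF fin, of "Inr q"]) (auto simp: rq rh Sq)
  have om: "link_det ?D no_closing tvar = 1"
    unfolding no_q[OF closes_arcs_empty, simplified] det_on_pair[OF nij] using ij by (simp add: rh)
  have to_i: "link_det ?D [k \<mapsto> i] tvar = of_bool (k \<noteq> i)" if k: "k \<in> {i, j}" for k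
  proof -
    have "closes_arcs ?D [k \<mapsto> i]" using Y by (intro closes_arcs_single) simp
    from no_q[OF this] have "link_det ?D [k \<mapsto> i] tvar = det_on {Inl i, Inl j} (walk_row (chain_wiring {Inl i, Inl j} ?W (closing ?D [k \<mapsto> i])) ?u)"
      using ij by auto
    then show ?thesis unfolding det_on_pair[OF nij] using k ij by (auto simp: rh)
  qed
  have to_j: "link_det ?D [k \<mapsto> j] tvar = (if k = i then t else 1 - t)" if k: "k \<in> {i, j}" for k
  proof -
    have c: "closes_arcs ?D [k \<mapsto> j]" using Y by (intro closes_arcs_single) simp
    let ?R = "walk_row (chain_wiring {Inl i, Inl j} ?W (closing ?D [k \<mapsto> j])) ?u"
    let ?Q = "?R(Inl k := \<lambda>x. ?R (Inl k) x + 1 * ?R (Inr q) x)"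
    have "det_on ?S ?R = det_on ?S ?Q" using k by (intro det_on_row_add[symmetric]) auto
    also have "\<dots> = det_on (?S - {Inr q}) ?Q"
      by (rule det_on_unit[OF fin]) (use k ij in \<open>auto simp: rq rh\<close>)
    also have "\<dots> = (if k = i then t else 1 - t)"
      unfolding Sq det_on_pair[OF nij] using k ij by (auto simp: rq rh)
    finally show ?thesis unfolding reduce[OF c] .
  qed
  have "tangle_matrix ?D tvar a b = (if a = i \<and> b = i then 1 else if a = i \<and> b = j then 1 - t
      else if a = j \<and> b = j then t else 0)" for a b
  proof (cases "a \<in> {i, j} \<and> b \<in> {i, j}")
    case True
    then have "tangle_matrix ?D tvar a b = 1 - link_det ?D [a \<mapsto> b] tvar"
      using tangle_matrix_eq[OF T, of a b tvar] om by simp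
    then show ?thesis using True ij to_i[of a] to_j[of a] by auto
  next
    case False
    then show ?thesis using tangle_matrix_outside[OF T] by auto
  qed
  then show ?thesis unfolding tangle_gamma_def gamma_crossing_def Let_def om t_def[symmetric] by (simp add: fun_eq_iff)
qed

section \<open>Cutting a drawing\<close>

text \<open>Restricting each curve to disjoint subintervals of its domain gives a drawing.\<close>

lemma subdrawing:
  assumes dr: "drawn_by D \<gamma> \<gamma>' \<tau>" and wf: "well_formed E" and no_loops: "loops E = Map.empty"
    and src: "\<And>k. k \<in> dom (arcs E) \<Longrightarrow> src k \<in> components D"
    and ab: "\<And>k. k \<in> dom (arcs E) \<Longrightarrow> 0 \<le> \<alpha> k \<and> \<alpha> k < \<beta> k \<and> \<beta> k \<le> 1"
    and cut: "\<And>k. k \<in> dom (arcs E) \<Longrightarrow> src k \<in> dom (loops D) \<Longrightarrow> \<beta> k < 1"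
    and disj: "\<And>k l. k \<in> dom (arcs E) \<Longrightarrow> l \<in> dom (arcs E) \<Longrightarrow> k \<noteq> l \<Longrightarrow> src k = src l \<Longrightarrow> \<beta> k < \<alpha> l \<or> \<beta> l < \<alpha> k"
    and sorted: "\<And>k. k \<in> dom (arcs E) \<Longrightarrow> sorted_wrt (<) (map \<tau> (passages E k))"
    and sub: "\<And>k p. k \<in> dom (arcs E) \<Longrightarrow> p \<in> set (passages E k) \<Longrightarrow>
       p \<in> set (passages D (src k)) \<and> \<alpha> k < \<tau> p \<and> \<tau> p < \<beta> k"
    and complete: "\<And>k l c b. k \<in> dom (arcs E) \<Longrightarrow> l \<in> dom (arcs E) \<Longrightarrow>
       (c, b) \<in> set (passages D (src k)) \<Longrightarrow> \<alpha> k \<le> \<tau> (c, b) \<Longrightarrow> \<tau> (c, b) \<le> \<beta> k \<Longrightarrow>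
       (c, \<not> b) \<in> set (passages D (src l)) \<Longrightarrow> \<alpha> l \<le> \<tau> (c, \<not> b) \<Longrightarrow> \<tau> (c, \<not> b) \<le> \<beta> l \<Longrightarrow>
       (c, b) \<in> set (passages E k)"
  shows "E \<in> diagrams"
proof -
  have comps: "components E = dom (arcs E)" using no_loops by (simp add: components_def)
  define L where "L k s = \<alpha> k + s * (\<beta> k - \<alpha> k)" for k s
  define \<sigma> where "\<sigma> p = (let k = comp_of E p in (\<tau> p - \<alpha> k) / (\<beta> k - \<alpha> k))" for p
  define \<delta> where "\<delta> k s = \<gamma> (src k) (L k s)" for k s
  define \<delta>' where "\<delta>' k s = (\<beta> k - \<alpha> k) *\<^sub>R \<gamma>' (src k) (L k s)" for k s
  have L: "\<alpha> k \<le> L k s \<and> L k s \<le> \<beta> k \<and> L k s \<in> {0..1}" if "k \<in> dom (arcs E)" "s \<in> {0..1}" for k s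
  proof -
    define r where "r = s * (\<beta> k - \<alpha> k)"
    have "0 \<le> r" using ab[OF that(1)] that(2) by (simp add: r_def)
    moreover have "r \<le> 1 * (\<beta> k - \<alpha> k)"
      unfolding r_def by (rule mult_right_mono) (use ab[OF that(1)] that(2) in auto)
    ultimately have "\<alpha> k \<le> L k s" "L k s \<le> \<beta> k" unfolding L_def r_def[symmetric] by simp_all
    then show ?thesis using ab[OF that(1)] unfolding atLeastAtMost_iff by linarith
  qed
  have Linj: "L k s = L k t \<longleftrightarrow> s = t" if "k \<in> dom (arcs E)" for k s t
    using ab[OF that] by (auto simp: L_def)
  have \<sigma>: "\<sigma> p = (\<tau> p - \<alpha> k) / (\<beta> k - \<alpha> k)" if "k \<in> dom (arcs E)" "p \<in> set (passages E k)" for k p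
    unfolding \<sigma>_def Let_def using comp_of_eq[OF wf, of k p] that comps by simp
  have L\<sigma>: "L k s = \<tau> p \<longleftrightarrow> \<sigma> p = s" if "k \<in> dom (arcs E)" "p \<in> set (passages E k)" for k p s
    unfolding \<sigma>[OF that] L_def using ab[OF that(1)] by (auto simp: field_simps)
  note dr' = dr[unfolded drawn_by_def]
  have dr1: "continuous_on {0..1} (\<gamma>' k)" "\<And>s. s \<in> {0..1} \<Longrightarrow> (\<gamma> k has_vector_derivative \<gamma>' k s) (at s within {0..1})"
    "\<And>s. s \<in> {0..1} \<Longrightarrow> \<gamma>' k s \<noteq> 0" if "k \<in> components D" for k
    using dr'[THEN conjunct1, THEN bspec, OF that] by simp_all
  have dr4: "\<gamma> k s = \<gamma> l t \<longleftrightarrow>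
           k = l \<and> k \<in> dom (loops D) \<and> {s, t} = {0, 1} \<or>
           (\<exists>c b. (c, b) \<in> set (passages D k) \<and> (c, \<not> b) \<in> set (passages D l) \<and>
                  \<tau> (c, b) = s \<and> \<tau> (c, \<not> b) = t)"
    if "k \<in> components D" "l \<in> components D" "s \<in> {0..1}" "t \<in> {0..1}" "(k, s) \<noteq> (l, t)" for k l s t
    by (rule dr'[THEN conjunct2, THEN conjunct2, THEN conjunct2, THEN conjunct1, rule_format, OF that])
  have dr5: "Im (cnj (\<gamma>' k (\<tau> (c, True))) * \<gamma>' l (\<tau> (c, False))) > 0"
    if "k \<in> components D" "l \<in> components D" "(c, True) \<in> set (passages D k)" "(c, False) \<in> set (passages D l)" for k l c
    by (rule dr'[THEN conjunct2, THEN conjunct2, THEN conjunct2, THEN conjunct2, rule_format, OF that(1,2) conjI[OF that(3,4)]])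
  have "drawn_by E \<delta> \<delta>' \<sigma>"
    unfolding drawn_by_def comps no_loops
  proof (intro conjI ballI impI allI)
    fix k assume k: "k \<in> dom (arcs E)"
    have im: "L k ` {0..1} \<subseteq> {0..1}" using L[OF k] by auto
    have cL: "continuous_on {0..1} (L k)" unfolding L_def by (intro continuous_intros)
    show "continuous_on {0..1} (\<delta>' k)"
      unfolding \<delta>'_def
      by (intro continuous_intros continuous_on_compose2[OF dr1(1)[OF src[OF k]] cL im])
    fix s :: real assume s: "s \<in> {0..1}"
    have "(L k has_derivative (\<lambda>h. h * (\<beta> k - \<alpha> k))) (at s within {0..1})"
      unfolding L_def by (auto intro!: derivative_eq_intros)
    moreover have "(\<gamma> (src k) has_derivative (\<lambda>h. h *\<^sub>R \<gamma>' (src k) (L k s))) (at (L k s) within L k ` {0..1})"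
      using dr1(2)[OF src[OF k], of "L k s"] L[OF k s] im has_derivative_subset
      unfolding has_vector_derivative_def by blast
    ultimately have "((\<lambda>s. \<gamma> (src k) (L k s)) has_derivative (\<lambda>h. (h * (\<beta> k - \<alpha> k)) *\<^sub>R \<gamma>' (src k) (L k s))) (at s within {0..1})"
      by (rule has_derivative_in_compose)
    then show "(\<delta> k has_vector_derivative \<delta>' k s) (at s within {0..1})"
      unfolding \<delta>_def \<delta>'_def has_vector_derivative_def by simp
    show "\<delta>' k s \<noteq> 0" unfolding \<delta>'_def using dr1(3)[OF src[OF k], of "L k s"] L[OF k s] ab[OF k] by simp
  next
    fix k assume k: "k \<in> dom (arcs E)"
    have "map \<sigma> (passages E k) = map (\<lambda>x. (x - \<alpha> k) / (\<beta> k - \<alpha> k)) (map \<tau> (passages E k))"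
      using \<sigma>[OF k] by simp
    then show "sorted_wrt (<) (map \<sigma> (passages E k))"
      using sorted[OF k] ab[OF k] by (auto simp: sorted_wrt_map divide_strict_right_mono elim!: sorted_wrt_mono_rel[rotated])
    show "\<sigma> ` set (passages E k) \<subseteq> {0<..<1}"
    proof
      fix y assume "y \<in> \<sigma> ` set (passages E k)"
      then obtain p where p: "p \<in> set (passages E k)" "y = \<sigma> p" by blast
      have "0 < (\<tau> p - \<alpha> k) / (\<beta> k - \<alpha> k)" "(\<tau> p - \<alpha> k) / (\<beta> k - \<alpha> k) < 1"
        using sub[OF k p(1)] by (simp_all add: divide_less_eq)
      then show "y \<in> {0<..<1}" unfolding p(2) \<sigma>[OF k p(1)] by simp
    qed
  next
    fix k l and s t :: real assume kl: "k \<in> dom (arcs E)" "l \<in> dom (arcs E)" "s \<in> {0..1}" "t \<in> {0..1}" "(k, s) \<noteq> (l, t)"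
    have ne: "(src k, L k s) \<noteq> (src l, L l t)"
    proof (cases "k = l")
      case True
      then show ?thesis using kl Linj by auto
    next
      case False
      then show ?thesis using disj[OF kl(1,2)] L[OF kl(1,3)] L[OF kl(2,4)] by force
    qed
    have nl: "\<not> (src k = src l \<and> src k \<in> dom (loops D) \<and> {L k s, L l t} = {0, 1})"
    proof
      assume h: "src k = src l \<and> src k \<in> dom (loops D) \<and> {L k s, L l t} = {0, 1}"
      then have "src k = src l" and k: "src k \<in> dom (loops D)" by blast+
      then have l: "src l \<in> dom (loops D)" by (simp only:)
      have "\<beta> k < 1" "\<beta> l < 1" using cut[OF kl(1) k] cut[OF kl(2) l] by blast+
      moreover have "L k s = 1 \<or> L l t = 1" using h by (auto simp: doubleton_eq_iff)
      ultimately show False using L[OF kl(1,3)] L[OF kl(2,4)] by auto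
    qed
    have "\<delta> k s = \<delta> l t \<longleftrightarrow> (\<exists>c b. (c, b) \<in> set (passages D (src k)) \<and> (c, \<not> b) \<in> set (passages D (src l)) \<and>
        \<tau> (c, b) = L k s \<and> \<tau> (c, \<not> b) = L l t)"
      unfolding \<delta>_def using dr4[OF src[OF kl(1)] src[OF kl(2)] _ _ ne] L[OF kl(1,3)] L[OF kl(2,4)] nl by auto
    also have "\<dots> \<longleftrightarrow> (\<exists>c b. (c, b) \<in> set (passages E k) \<and> (c, \<not> b) \<in> set (passages E l) \<and> \<sigma> (c, b) = s \<and> \<sigma> (c, \<not> b) = t)"
    proof (intro ex_cong1 iffI)
      fix c b assume h: "(c, b) \<in> set (passages D (src k)) \<and> (c, \<not> b) \<in> set (passages D (src l)) \<and>
        \<tau> (c, b) = L k s \<and> \<tau> (c, \<not> b) = L l t"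
      have 1: "(c, b) \<in> set (passages E k)"
        by (rule complete[OF kl(1,2)]) (use h L[OF kl(1,3)] L[OF kl(2,4)] in auto)
      have 2: "(c, \<not> b) \<in> set (passages E l)"
        by (rule complete[OF kl(2,1)]) (use h L[OF kl(1,3)] L[OF kl(2,4)] in auto)
      show "(c, b) \<in> set (passages E k) \<and> (c, \<not> b) \<in> set (passages E l) \<and> \<sigma> (c, b) = s \<and> \<sigma> (c, \<not> b) = t"
        using 1 2 h L\<sigma>[OF kl(1) 1] L\<sigma>[OF kl(2) 2] by metis
    next
      fix c b assume h: "(c, b) \<in> set (passages E k) \<and> (c, \<not> b) \<in> set (passages E l) \<and> \<sigma> (c, b) = s \<and> \<sigma> (c, \<not> b) = t"
      then show "(c, b) \<in> set (passages D (src k)) \<and> (c, \<not> b) \<in> set (passages D (src l)) \<and>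
        \<tau> (c, b) = L k s \<and> \<tau> (c, \<not> b) = L l t"
        using sub[OF kl(1)] sub[OF kl(2)] L\<sigma>[OF kl(1)] L\<sigma>[OF kl(2)] by metis
    qed
    finally show "\<delta> k s = \<delta> l t \<longleftrightarrow> k = l \<and> k \<in> dom (\<lambda>x. None :: passage list option) \<and> {s, t} = {0, 1} \<or>
       (\<exists>c b. (c, b) \<in> set (passages E k) \<and> (c, \<not> b) \<in> set (passages E l) \<and> \<sigma> (c, b) = s \<and> \<sigma> (c, \<not> b) = t)"
      by simp
  next
    fix k l c assume kl: "k \<in> dom (arcs E)" "l \<in> dom (arcs E)"
      and c: "(c, True) \<in> set (passages E k) \<and> (c, False) \<in> set (passages E l)"
    have "L k (\<sigma> (c, True)) = \<tau> (c, True)" "L l (\<sigma> (c, False)) = \<tau> (c, False)"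
      using L\<sigma>[OF kl(1)] L\<sigma>[OF kl(2)] c by auto
    moreover have "Im (cnj (\<gamma>' (src k) (\<tau> (c, True))) * \<gamma>' (src l) (\<tau> (c, False))) > 0"
      by (rule dr5[OF src[OF kl(1)] src[OF kl(2)]]) (use sub[OF kl(1)] sub[OF kl(2)] c in auto)
    moreover have "Im (cnj (a *\<^sub>R u) * (b *\<^sub>R w)) = a * b * Im (cnj u * w)" for a b u w
      by (simp add: algebra_simps)
    ultimately show "Im (cnj (\<delta>' k (\<sigma> (c, True))) * \<delta>' l (\<sigma> (c, False))) > 0"
      unfolding \<delta>'_def using ab[OF kl(1)] ab[OF kl(2)] by simp
  qed auto
  then show ?thesis using wf unfolding diagrams_def by blast
qed

text \<open>
  A drawn crossing is what pins down the value of an invariant on the empty tangle.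
\<close>

lemma crossing_drawn: "crossing_diagram Positive 0 0 1 \<in> diagrams"
proof -
  let ?D = "crossing_diagram Positive 0 0 1"
  have comps: "components ?D = {0, 1}" and lp: "loops ?D = Map.empty"
    by (auto simp: components_def crossing_diagram_def)
  have p: "passages ?D 0 = [(0, True)]" "passages ?D 1 = [(0, False)]"
    by (auto simp: passages_def crossing_diagram_def)
  have "well_formed ?D"
    unfolding well_formed_def comps using p by (auto simp: crossing_diagram_def)
  moreover have "drawn_by ?D (\<lambda>k s. if k = 0 then of_real (s - 1 / 2) else \<i> * of_real (s - 1 / 2))
     (\<lambda>k s. if k = 0 then 1 else \<i>) (\<lambda>_. 1 / 2)"
    unfolding drawn_by_def comps lp
  proof (intro conjI)
    show "\<forall>k\<in>{0, 1}. continuous_on {0..1} ((\<lambda>k s. if k = 0 then 1 else \<i>) k) \<and>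
      (\<forall>s\<in>{0..1}. ((\<lambda>k s. if k = 0 then of_real (s - 1 / 2) else \<i> * of_real (s - 1 / 2)) k has_vector_derivative
         (\<lambda>k s. if k = 0 then 1 else \<i>) k s) (at s within {0..1}) \<and> (\<lambda>k s. if k = 0 then 1 else \<i>) k s \<noteq> 0)"
      by (auto simp: has_vector_derivative_def intro!: derivative_eq_intros continuous_intros) 
         (auto simp: scaleR_conv_of_real fun_eq_iff mult.commute)
    show "\<forall>k\<in>{0, 1}. \<forall>l\<in>{0, 1}. \<forall>c. (c, True) \<in> set (passages ?D k) \<and> (c, False) \<in> set (passages ?D l) \<longrightarrow>
      0 < Im (cnj (if k = 0 then 1 else \<i>) * (if l = 0 then 1 else \<i>))"
      using p by auto
    show "\<forall>k\<in>{0, 1}. \<forall>l\<in>{0, 1}. \<forall>s\<in>{0..1}. \<forall>t\<in>{0..1}. (k, s) \<noteq> (l, t) \<longrightarrow>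
       ((if k = 0 then complex_of_real (s - 1 / 2) else \<i> * of_real (s - 1 / 2)) =
        (if l = 0 then of_real (t - 1 / 2) else \<i> * of_real (t - 1 / 2))) =
       (k = l \<and> k \<in> dom Map.empty \<and> {s, t} = {0, 1} \<or>
        (\<exists>c b. (c, b) \<in> set (passages ?D k) \<and> (c, \<not> b) \<in> set (passages ?D l) \<and> 1 / 2 = s \<and> 1 / 2 = t))"
      using p by (auto simp: complex_eq_iff)
  qed (use p in auto)
  ultimately show ?thesis unfolding diagrams_def by blast
qed

section \<open>Existence and uniqueness of the invariant of w-tangles\<close>

lemma well_formed_tangleI:
  assumes "loops E = Map.empty" "finite (dom (arcs E))" "finite (dom (kinds E))"
    "\<And>k. k \<in> dom (arcs E) \<Longrightarrow> distinct (passages E k)"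
    "\<And>k l p. k \<in> dom (arcs E) \<Longrightarrow> l \<in> dom (arcs E) \<Longrightarrow> p \<in> set (passages E k) \<Longrightarrow> p \<in> set (passages E l) \<Longrightarrow> k = l"
    "\<And>p. (\<exists>k\<in>dom (arcs E). p \<in> set (passages E k)) \<longleftrightarrow> fst p \<in> dom (kinds E)"
  shows "well_formed E"
proof -
  have c: "components E = dom (arcs E)" using assms(1) by (simp add: components_def)
  have "(\<Union>k\<in>dom (arcs E). set (passages E k)) = dom (kinds E) \<times> UNIV"
  proof (rule Set.set_eqI)
    fix p show "p \<in> (\<Union>k\<in>dom (arcs E). set (passages E k)) \<longleftrightarrow> p \<in> dom (kinds E) \<times> UNIV"
      using assms(6)[of p] by (simp add: mem_Times_iff)
  qed
  moreover have "set (passages E k) \<inter> set (passages E l) = {}" if "k \<in> dom (arcs E)" "l \<in> dom (arcs E)" "k \<noteq> l" for k l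
    using assms(5)[OF that(1,2)] that(3) by blast
  ultimately show ?thesis unfolding well_formed_def c using assms(1-4) by simp
qed

lemma passages_no_loops: "loops D = Map.empty \<Longrightarrow> passages D k = (case arcs D k of Some w \<Rightarrow> w | None \<Rightarrow> [])"
  by (simp add: passages_def split: option.split)

lemma drawn_times:
  assumes "drawn_by D \<gamma> \<gamma>' \<tau>" "k \<in> components D"
  shows "sorted_wrt (<) (map \<tau> (passages D k))" "p \<in> set (passages D k) \<Longrightarrow> 0 < \<tau> p \<and> \<tau> p < 1"
  using assms(1)[unfolded drawn_by_def, THEN conjunct2, THEN conjunct2, THEN conjunct1, THEN bspec, OF assms(2)] by auto

lemma tangle_diagrams_drawn:
  assumes "D \<in> tangle_diagrams Y"
  obtains \<gamma> \<gamma>' \<tau> where "drawn_by D \<gamma> \<gamma>' \<tau>"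
  using assms unfolding tangle_diagrams_def diagrams_def by blast

text \<open>
  There is room to cut a curve between two consecutive passages.
\<close>

lemma time_between:
  fixes A B :: "real set"
  assumes "finite A" "finite B" "\<And>a b. a \<in> A \<Longrightarrow> b \<in> B \<Longrightarrow> a < b" "A \<subseteq> {0<..<1}" "B \<subseteq> {0<..<1}"
  obtains m where "0 < m" "m < 1" "\<And>a. a \<in> A \<Longrightarrow> a < m" "\<And>b. b \<in> B \<Longrightarrow> m < b"
proof -
  define lo hi where "lo = Max (insert 0 A)" and "hi = Min (insert 1 B)"
  have "lo \<in> insert 0 A" "hi \<in> insert 1 B" unfolding lo_def hi_def using assms(1,2) by (intro Max_in Min_in; simp)+
  then have lh: "lo < hi" using assms(3-5) by auto
  have lo: "0 \<le> lo" "\<And>a. a \<in> A \<Longrightarrow> a \<le> lo" and hi: "hi \<le> 1" "\<And>b. b \<in> B \<Longrightarrow> hi \<le> b"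
    unfolding lo_def hi_def using assms(1,2) by auto
  show thesis
    by (rule that[of "(lo + hi) / 2"]) (use lh lo hi in \<open>force+\<close>)
qed

lemma relabel_diagram:
  assumes D: "D \<in> tangle_diagrams Y" and x: "x \<in> Y" "z \<notin> Y - {x}"
  shows "relabel x z D \<in> tangle_diagrams (insert z (Y - {x}))"
proof -
  interpret tangle D Y by (rule tangle_diagramD[OF D])
  let ?E = "relabel x z D" and ?h = "\<lambda>k. if k = z then x else k"
  have dom: "dom (arcs ?E) = insert z (Y - {x})" using x Y by (auto simp: relabel_def)
  have lp: "loops ?E = Map.empty" by (simp add: relabel_def no_loops)
  have kd: "kinds ?E = kinds D" by (simp add: relabel_def)
  have p: "passages ?E k = passages D (?h k)" if "k \<in> insert z (Y - {x})" for k
  proof (cases "k = z")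
    case True
    then show ?thesis unfolding passages_no_loops[OF lp] passages_no_loops[OF no_loops] by (simp add: relabel_def)
  next
    case False
    then have "k \<noteq> x" using that by blast
    then show ?thesis using False unfolding passages_no_loops[OF lp] passages_no_loops[OF no_loops] by (simp add: relabel_def)
  qed
  have h: "?h k \<in> Y" if "k \<in> insert z (Y - {x})" for k using that x(1) by auto
  have hinj: "k = l" if "k \<in> insert z (Y - {x})" "l \<in> insert z (Y - {x})" "?h k = ?h l" for k l
    using that by (auto split: if_splits)
  have hsurj: "\<exists>k\<in>insert z (Y - {x}). ?h k = m" if "m \<in> Y" for m
  proof (cases "m = x")
    case False
    then have "m \<in> Y - {x}" using that by simp
    then have "m \<noteq> z" using x(2) by metis
    then show ?thesis using \<open>m \<in> Y - {x}\<close> by (intro bexI[of _ m]) simp_all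
  qed (auto intro: bexI[of _ z])
  have wfE: "well_formed ?E"
  proof (rule well_formed_tangleI[OF lp])
    show "distinct (passages ?E k)" if "k \<in> dom (arcs ?E)" for k
      using that h wfD(3)[OF wf] comps unfolding dom by (simp add: p)
    show "k = l" if "k \<in> dom (arcs ?E)" "l \<in> dom (arcs ?E)" "q \<in> set (passages ?E k)" "q \<in> set (passages ?E l)" for k l q
    proof -
      have kl: "k \<in> insert z (Y - {x})" "l \<in> insert z (Y - {x})" using that(1,2) unfolding dom .
      have "?h k = ?h l"
        using wfD(4)[OF wf, of "?h k" "?h l" q] h[OF kl(1)] h[OF kl(2)] that(3,4)
        unfolding comps p[OF kl(1)] p[OF kl(2)] by blast
      then show ?thesis by (rule hinj[OF kl])
    qed
    show "(\<exists>k\<in>dom (arcs ?E). q \<in> set (passages ?E k)) \<longleftrightarrow> fst q \<in> dom (kinds ?E)" for q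
      unfolding dom kd passage_iff[OF wf, symmetric] comps
    proof
      assume "\<exists>k\<in>insert z (Y - {x}). q \<in> set (passages ?E k)"
      then obtain k where k: "k \<in> insert z (Y - {x})" "q \<in> set (passages ?E k)" by blast
      show "\<exists>k\<in>Y. q \<in> set (passages D k)"
        by (rule bexI[OF _ h[OF k(1)]]) (use k p in simp)
    next
      assume "\<exists>k\<in>Y. q \<in> set (passages D k)"
      then obtain m where m: "m \<in> Y" "q \<in> set (passages D m)" by blast
      obtain k where k: "k \<in> insert z (Y - {x})" "?h k = m" using hsurj[OF m(1)] by blast
      show "\<exists>k\<in>insert z (Y - {x}). q \<in> set (passages ?E k)"
        by (rule bexI[OF _ k(1)]) (simp only: p[OF k(1)] k(2) m(2))
    qed
  qed (use dom fin_Y kd wfD(2)[OF wf] in simp_all)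
  obtain \<gamma> \<gamma>' \<tau> where dr: "drawn_by D \<gamma> \<gamma>' \<tau>" using tangle_diagrams_drawn[OF D] .
  have "?E \<in> diagrams"
  proof (rule subdrawing[OF dr wfE lp, where src="?h" and \<alpha>="\<lambda>_. 0" and \<beta>="\<lambda>_. 1"], unfold dom)
    fix k assume k: "k \<in> insert z (Y - {x})"
    show "?h k \<in> components D" using h[OF k] comps by simp
    show "sorted_wrt (<) (map \<tau> (passages ?E k))" using drawn_times(1)[OF dr, of "?h k"] h[OF k] comps p[OF k] by simp
    show "q \<in> set (passages D (?h k)) \<and> 0 < \<tau> q \<and> \<tau> q < 1" if "q \<in> set (passages ?E k)" for q
      using that drawn_times(2)[OF dr, of "?h k" q] h[OF k] comps p[OF k] by simp
    show "(1::real) < 0 \<or> (1::real) < 0" if "l \<in> insert z (Y - {x})" "k \<noteq> l" "?h k = ?h l" for l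
      using hinj[OF k that(1,3)] that(2) by blast
    show "(c, b) \<in> set (passages ?E k)" if "(c, b) \<in> set (passages D (?h k))" for c b
      using that unfolding p[OF k] .
  qed (simp_all add: no_loops)
  then show ?thesis using lp dom by (simp add: tangle_diagrams_def)
qed

text \<open>
  Cutting an arc between two passages and leaving a small gap gives a drawing from which the
  original arises by stitching along a path without crossings.
\<close>

lemma cut_diagram:
  assumes D: "D \<in> tangle_diagrams Y" and z: "arcs D z = Some (u @ w)"
    and xy: "x \<noteq> y" "{x, y} \<inter> (Y - {z}) = {}"
  defines "E \<equiv> D\<lparr>arcs := (arcs D)(z := None, x \<mapsto> u, y \<mapsto> w)\<rparr>"
  shows "E \<in> tangle_diagrams (insert x (insert y (Y - {z})))" "stitches_to x y z E D"
proof -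
  interpret tangle D Y by (rule tangle_diagramD[OF D])
  let ?h = "\<lambda>k. if k = x \<or> k = y then z else k" and ?Z = "insert x (insert y (Y - {z}))"
  have zY: "z \<in> Y" using z Y by auto
  have dom: "dom (arcs E) = ?Z" using xy Y by (auto simp: E_def)
  have lp: "loops E = Map.empty" and kd: "kinds E = kinds D" by (simp_all add: E_def no_loops)
  have pz: "passages D z = u @ w" using z by (simp add: passages_def)
  have dz: "distinct (u @ w)" using wfD(3)[OF wf, of z] zY comps pz by simp
  have px: "passages E x = u" "passages E y = w" using xy by (auto simp: E_def passages_def)
  have pk: "passages E k = passages D k" if "k \<in> Y - {z}" for k
    using that xy Y by (auto simp: E_def passages_def split: option.splits)
  have sub: "set (passages E k) \<subseteq> set (passages D (?h k))" if "k \<in> ?Z" for k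
    using that px pk pz by auto
  have h: "?h k \<in> Y" if "k \<in> ?Z" for k using that zY by auto
  have wfE: "well_formed E"
  proof (rule well_formed_tangleI[OF lp])
    show "distinct (passages E k)" if "k \<in> dom (arcs E)" for k
      using that dz px pk wfD(3)[OF wf, of k] comps unfolding dom by auto
    show "k = l" if kl: "k \<in> dom (arcs E)" "l \<in> dom (arcs E)" "q \<in> set (passages E k)" "q \<in> set (passages E l)" for k l q
    proof -
      have "?h k = ?h l" using wfD(4)[OF wf, of "?h k" "?h l" q] h sub kl comps unfolding dom by blast
      then show ?thesis using kl dz px xy unfolding dom by (auto split: if_splits)
    qed
    show "(\<exists>k\<in>dom (arcs E). q \<in> set (passages E k)) \<longleftrightarrow> fst q \<in> dom (kinds E)" for q
      unfolding dom kd passage_iff[OF wf, symmetric] comps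
    proof
      assume "\<exists>k\<in>?Z. q \<in> set (passages E k)"
      then show "\<exists>k\<in>Y. q \<in> set (passages D k)" using sub h by blast
    next
      assume "\<exists>k\<in>Y. q \<in> set (passages D k)"
      then obtain k where k: "k \<in> Y" "q \<in> set (passages D k)" by blast
      show "\<exists>k\<in>?Z. q \<in> set (passages E k)"
      proof (cases "k = z")
        case True
        then have "q \<in> set (passages E x) \<or> q \<in> set (passages E y)" using k pz px by simp
        then show ?thesis by blast
      next
        case False
        then have "k \<in> ?Z" "q \<in> set (passages E k)" using k pk[of k] by simp_all
        then show ?thesis by blast
      qed
    qed
  qed (use dom fin_Y kd wfD(2)[OF wf] in simp_all)
  obtain \<gamma> \<gamma>' \<tau> where dr: "drawn_by D \<gamma> \<gamma>' \<tau>" using tangle_diagrams_drawn[OF D] .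
  note times = drawn_times[OF dr, unfolded comps]
  have sz: "sorted_wrt (<) (map \<tau> u)" "sorted_wrt (<) (map \<tau> w)" "\<And>a b. a \<in> set u \<Longrightarrow> b \<in> set w \<Longrightarrow> \<tau> a < \<tau> b"
    using times(1)[OF zY] unfolding pz by (auto simp: sorted_wrt_append)
  have tz: "\<And>q. q \<in> set u \<union> set w \<Longrightarrow> 0 < \<tau> q \<and> \<tau> q < 1" using times(2)[OF zY] unfolding pz by simp
  obtain m where m: "0 < m" "m < 1" "\<And>a. a \<in> set u \<Longrightarrow> \<tau> a < m" "\<And>b. b \<in> set w \<Longrightarrow> m < \<tau> b"
    by (rule time_between[of "\<tau> ` set u" "\<tau> ` set w"]) (use sz tz in auto)
  obtain m' where m': "m < m'" "m' < 1" "\<And>b. b \<in> set w \<Longrightarrow> m' < \<tau> b"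
    by (rule time_between[of "{m}" "\<tau> ` set w"]) (use m tz in auto)
  have "E \<in> diagrams"
  proof (rule subdrawing[OF dr wfE lp, where src="?h" and \<alpha>="\<lambda>k. if k = y then m' else 0" and \<beta>="\<lambda>k. if k = x then m else 1"], unfold dom)
    fix k assume k: "k \<in> ?Z"
    show "?h k \<in> components D" using h[OF k] comps by simp
    show "0 \<le> (if k = y then m' else 0) \<and> (if k = y then m' else 0) < (if k = x then m else 1) \<and> (if k = x then m else 1) \<le> 1"
      using m m' xy by auto
    show "sorted_wrt (<) (map \<tau> (passages E k))"
      using k px pk sz times(1)[of k] by auto
    show "q \<in> set (passages D (?h k)) \<and> (if k = y then m' else 0) < \<tau> q \<and> \<tau> q < (if k = x then m else 1)"
      if q: "q \<in> set (passages E k)" for q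
    proof -
      have s: "q \<in> set (passages D (?h k))" using q sub[OF k] by blast
      consider "k = x" | "k = y" | "k \<in> Y - {z}" "k \<noteq> x" "k \<noteq> y" using k by blast
      then show ?thesis
      proof cases
        case 1
        then have "q \<in> set u" using q px by simp
        then show ?thesis using s 1 xy(1) m(3)[of q] tz[of q] by simp
      next
        case 2
        then have "q \<in> set w" using q px by simp
        then show ?thesis using s 2 xy(1) m'(3)[of q] tz[of q] by simp
      next
        case 3
        then show ?thesis using s times(2)[of k q] by simp
      qed
    qed
    show "(if k = x then m else 1) < (if l = y then m' else 0) \<or> (if l = x then m else 1) < (if k = y then m' else 0)"
      if "l \<in> ?Z" "k \<noteq> l" "?h k = ?h l" for l
      using that k m' xy by (auto split: if_splits)
    show "(c, b) \<in> set (passages E k)"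
      if "(c, b) \<in> set (passages D (?h k))" "(if k = y then m' else 0) \<le> \<tau> (c, b)" "\<tau> (c, b) \<le> (if k = x then m else 1)" for c b
    proof -
      consider "k = x" | "k = y" | "k \<in> Y - {z}" "k \<noteq> x" "k \<noteq> y" using k by blast
      then show ?thesis
      proof cases
        case 1
        then have "(c, b) \<in> set u \<union> set w" "\<tau> (c, b) \<le> m" using that pz by auto
        then show ?thesis using 1 px m(4)[of "(c, b)"] by force
      next
        case 2
        then have "(c, b) \<in> set u \<union> set w" "m' \<le> \<tau> (c, b)" using that pz xy by auto
        then show ?thesis using 2 px m(3)[of "(c, b)"] m'(1) by force
      next
        case 3
        then show ?thesis using that pk by auto
      qed
    qed
  qed (use no_loops in simp)
  then show "E \<in> tangle_diagrams ?Z" using lp dom by (simp add: tangle_diagrams_def)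
  have er: "erase {} D = D"
  proof -
    have "filter (\<lambda>p. True) = (id :: passage list \<Rightarrow> passage list)" by (rule ext) simp
    moreover have "kinds D |` UNIV = kinds D" by (simp add: restrict_map_def fun_eq_iff)
    ultimately show ?thesis by (simp add: erase_def map_words_def erase_word_def option.map_id0)
  qed
  show "stitches_to x y z E D"
    unfolding stitches_to_def
  proof (intro conjI exI)
    show "arcs D z = Some (u @ [] @ w)" using z by simp
    show "E = (erase {} D)\<lparr>arcs := (arcs (erase {} D))(z := None, x \<mapsto> erase_word {} u, y \<mapsto> erase_word {} w)\<rparr>"
      unfolding er by (simp add: E_def erase_word_def)
  qed (use xy Y in auto)
qed

lemma subdiagram:
  assumes D: "D \<in> tangle_diagrams Y" and Z: "Z \<subseteq> Y" and C: "C \<subseteq> dom (kinds D)"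
    and closed: "\<And>k p. k \<in> Z \<Longrightarrow> p \<in> set (passages D k) \<Longrightarrow> fst p \<in> C"
      "\<And>k p. k \<in> Y - Z \<Longrightarrow> p \<in> set (passages D k) \<Longrightarrow> fst p \<notin> C"
  shows "\<lparr>arcs = arcs D |` Z, loops = Map.empty, kinds = kinds D |` C\<rparr> \<in> tangle_diagrams Z"
proof -
  interpret tangle D Y by (rule tangle_diagramD[OF D])
  let ?E = "\<lparr>arcs = arcs D |` Z, loops = Map.empty, kinds = kinds D |` C\<rparr> :: diagram"
  have dom: "dom (arcs ?E) = Z" and kd: "dom (kinds ?E) = C" and lp: "loops ?E = Map.empty"
    using Z C Y by auto
  have p: "passages ?E k = passages D k" if "k \<in> Z" for k
    using that unfolding passages_no_loops[OF lp] passages_no_loops[OF no_loops] by simp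
  have wfE: "well_formed ?E"
  proof (rule well_formed_tangleI[OF lp])
    show "distinct (passages ?E k)" if "k \<in> dom (arcs ?E)" for k
      using that wfD(3)[OF wf] comps Z p unfolding dom by auto
    show "k = l" if "k \<in> dom (arcs ?E)" "l \<in> dom (arcs ?E)" "q \<in> set (passages ?E k)" "q \<in> set (passages ?E l)" for k l q
      using that wfD(4)[OF wf, of k l q] comps Z p unfolding dom by auto
    show "(\<exists>k\<in>dom (arcs ?E). q \<in> set (passages ?E k)) \<longleftrightarrow> fst q \<in> dom (kinds ?E)" for q
      unfolding dom kd
    proof
      assume "\<exists>k\<in>Z. q \<in> set (passages ?E k)"
      then obtain k where k: "k \<in> Z" "q \<in> set (passages ?E k)" by blast
      then show "fst q \<in> C" using closed(1)[of k q] unfolding p[OF k(1)] by blast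
    next
      assume q: "fst q \<in> C"
      then obtain k where k: "k \<in> Y" "q \<in> set (passages D k)" using passage_on_arc C by blast
      then have "k \<in> Z" using closed(2) q by blast
      then show "\<exists>k\<in>Z. q \<in> set (passages ?E k)" using k p by auto
    qed
  qed (use dom kd Z fin_Y C wfD(2)[OF wf] in \<open>auto intro: finite_subset\<close>)
  obtain \<gamma> \<gamma>' \<tau> where dr: "drawn_by D \<gamma> \<gamma>' \<tau>" using tangle_diagrams_drawn[OF D] .
  have "?E \<in> diagrams"
  proof (rule subdrawing[OF dr wfE lp, where src="\<lambda>k. k" and \<alpha>="\<lambda>_. 0" and \<beta>="\<lambda>_. 1"], unfold dom)
    fix k assume k: "k \<in> Z"
    then show "k \<in> components D" using Z comps by auto
    then show "sorted_wrt (<) (map \<tau> (passages ?E k))" using drawn_times(1)[OF dr, of k] p[OF k] by simp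
    show "q \<in> set (passages D k) \<and> 0 < \<tau> q \<and> \<tau> q < 1" if "q \<in> set (passages ?E k)" for q
      using that drawn_times(2)[OF dr \<open>k \<in> components D\<close>, of q] p[OF k] by simp
    show "(c, b) \<in> set (passages ?E k)" if "(c, b) \<in> set (passages D k)" for c b
      using that unfolding p[OF k] .
  qed (simp_all add: no_loops)
  then show ?thesis using lp dom by (simp add: tangle_diagrams_def)
qed

text \<open>
  An arc with a single passage is shortened so that it ends before the crossing.
\<close>

lemma erase_endpoint_diagram:
  assumes D: "D \<in> tangle_diagrams Y" and k: "arcs D k = Some [(c, b)]"
  shows "erase {c} D \<in> tangle_diagrams Y"
proof -
  interpret tangle D Y by (rule tangle_diagramD[OF D])
  let ?E = "erase {c} D"
  have dom: "dom (arcs ?E) = Y" and lp: "loops ?E = Map.empty"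
    using Y no_loops by (auto simp: erase_def map_words_def)
  have p: "passages ?E l = filter (\<lambda>p. fst p \<noteq> c) (passages D l)" for l
    using no_loops by (auto simp: erase_def map_words_def passages_def erase_word_def split: option.splits)
  have kY: "k \<in> Y" using k Y by auto
  have pk: "passages D k = [(c, b)]" using k by (simp add: passages_def)
  obtain \<gamma> \<gamma>' \<tau> where dr: "drawn_by D \<gamma> \<gamma>' \<tau>" using tangle_diagrams_drawn[OF D] .
  note times = drawn_times[OF dr, unfolded comps]
  have t: "0 < \<tau> (c, b)" "\<tau> (c, b) < 1" using times(2)[OF kY] pk by auto
  have wfE: "well_formed ?E" by (rule well_formed_erase[OF wf])
  have un: "l = k" if "l \<in> Y" "(c, b) \<in> set (passages D l)" for l
    using wfD(4)[OF wf, of l k "(c, b)"] that kY pk comps by simp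
  have "?E \<in> diagrams"
  proof (rule subdrawing[OF dr wfE lp, where src="\<lambda>k. k" and \<alpha>="\<lambda>_. 0" and \<beta>="\<lambda>l. if l = k then \<tau> (c, b) / 2 else 1"], unfold dom)
    fix l assume l: "l \<in> Y"
    show "l \<in> components D" using l comps by simp
    show "sorted_wrt (<) (map \<tau> (passages ?E l))"
      using times(1)[OF l] unfolding p by (simp add: sorted_wrt_map sorted_wrt_filter)
    show "q \<in> set (passages D l) \<and> 0 < \<tau> q \<and> \<tau> q < (if l = k then \<tau> (c, b) / 2 else 1)" if "q \<in> set (passages ?E l)" for q
      using that times(2)[OF l, of q] pk unfolding p by auto
    show "(d, e) \<in> set (passages ?E l)"
      if m: "m \<in> Y" and h: "(d, e) \<in> set (passages D l)" "\<tau> (d, e) \<le> (if l = k then \<tau> (c, b) / 2 else 1)"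
        "(d, \<not> e) \<in> set (passages D m)" "\<tau> (d, \<not> e) \<le> (if m = k then \<tau> (c, b) / 2 else 1)" for m d e
    proof -
      have "d \<noteq> c"
      proof
        assume d: "d = c"
        show False
        proof (cases "e = b")
          case True
          then have "l = k" using un[OF l] h(1) d by simp
          then show False using h(2) t d True by simp
        next
          case False
          then have "m = k" "(\<not> e) = b" using un[OF m] h(3) d by auto
          then show False using h(4) t d by simp
        qed
      qed
      then show ?thesis using h(1) unfolding p by simp
    qed
    show "0 \<le> (0::real) \<and> 0 < (if l = k then \<tau> (c, b) / 2 else 1) \<and> (if l = k then \<tau> (c, b) / 2 else 1) \<le> 1"
      using t by simp
  qed (simp_all add: no_loops)
  then show ?thesis using lp dom by (simp add: tangle_diagrams_def)
qed

lemma open_loops_diagram: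
  assumes D: "D \<in> diagrams"
  shows "D\<lparr>arcs := arcs D ++ loops D, loops := Map.empty\<rparr> \<in> diagrams"
proof -
  let ?E = "D\<lparr>arcs := arcs D ++ loops D, loops := Map.empty\<rparr>"
  obtain \<gamma> \<gamma>' \<tau> where wf: "well_formed D" and dr: "drawn_by D \<gamma> \<gamma>' \<tau>" using D unfolding diagrams_def by blast
  have dom: "dom (arcs ?E) = components D" and lp: "loops ?E = Map.empty" and kd: "kinds ?E = kinds D"
    by (auto simp: components_def)
  have p: "passages ?E k = passages D k" for k
    using wfD(5)[OF wf] by (auto simp: passages_def map_add_def split: option.splits)
  have wfE: "well_formed ?E"
    by (rule well_formed_tangleI[OF lp], unfold dom kd p)
       (use wfD[OF wf] passage_iff[OF wf] in auto)
  have "\<exists>m. 0 < m \<and> m < 1 \<and> (\<forall>q\<in>set (passages D k). \<tau> q < m)" if k: "k \<in> components D" for k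
  proof -
    obtain m where "0 < m" "m < 1" "\<And>a. a \<in> \<tau> ` set (passages D k) \<Longrightarrow> a < m"
      by (rule time_between[of "\<tau> ` set (passages D k)" "{}"]) (use drawn_times(2)[OF dr k] in auto)
    then show ?thesis by blast
  qed
  then obtain m where m: "\<And>k. k \<in> components D \<Longrightarrow> 0 < m k \<and> m k < 1 \<and> (\<forall>q\<in>set (passages D k). \<tau> q < m k)" by metis
  show ?thesis
  proof (rule subdrawing[OF dr wfE lp, where src="\<lambda>k. k" and \<alpha>="\<lambda>_. 0" and \<beta>="m"], unfold dom)
    fix k assume k: "k \<in> components D"
    show "sorted_wrt (<) (map \<tau> (passages ?E k))" using drawn_times(1)[OF dr k] p by simp
    show "q \<in> set (passages D k) \<and> 0 < \<tau> q \<and> \<tau> q < m k" if "q \<in> set (passages ?E k)" for q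
      using that drawn_times(2)[OF dr k] m[OF k] unfolding p by blast
    show "0 \<le> (0::real) \<and> 0 < m k \<and> m k \<le> 1" "m k < 1" using m[OF k] by auto
    show "(c, b) \<in> set (passages ?E k)" if "(c, b) \<in> set (passages D k)" for c b
      using that unfolding p .
  qed simp_all
qed

lemma equiv_diagram_equiv: "equiv diagrams diagram_equiv"
proof (rule equivI)
  show "diagram_equiv \<subseteq> diagrams \<times> diagrams" by (auto simp: diagram_equiv_def)
  show "refl_on diagrams diagram_equiv" by (auto simp: refl_on_def diagram_equiv_def)
  show "sym diagram_equiv" by (auto simp: sym_def diagram_equiv_def intro: equivclp_sym)
  show "trans diagram_equiv" by (auto simp: trans_def diagram_equiv_def intro: equivclp_trans)
qed

lemma move_doms:
  assumes "move D E"
  shows "dom (arcs E) = dom (arcs D)" "dom (loops E) = dom (loops D)"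
proof -
  have x: "dom (arcs (exchange x y D)) = dom (arcs D)" "dom (loops (exchange x y D)) = dom (loops D)" for x y D
    by (auto simp: exchange_def map_words_def)
  have s: "dom (arcs (slide x y z D)) = dom (arcs D)" "dom (loops (slide x y z D)) = dom (loops D)" for x y z
    by (auto simp: slide_def x split: prod.splits)
  have e: "dom (arcs (erase V D)) = dom (arcs D)" "dom (loops (erase V D)) = dom (loops D)" for V
    by (auto simp: erase_def map_words_def)
  have r: "dom (arcs (rename_crossings \<pi> D)) = dom (arcs D)" "dom (loops (rename_crossings \<pi> D)) = dom (loops D)" for \<pi>
    by (auto simp: rename_crossings_def map_words_def)
  from assms show "dom (arcs E) = dom (arcs D)" "dom (loops E) = dom (loops D)"
    by (cases; simp add: s e r insert_absorb domI)+
qed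

lemma equivclp_invariant:
  assumes "equivclp R a b" and "\<And>a b. R a b \<Longrightarrow> f a = f b"
  shows "f a = f b"
  using assms(1)
proof (induction rule: equivclp_induct)
  case (step b c)
  have "f b = f c" using step.hyps(2) assms(2)[of b c] assms(2)[of c b] by auto
  then show ?case using step.IH by simp
qed simp

lemma diagram_equiv_invariants:
  fixes v :: "nat \<Rightarrow> 'f::field"
  assumes "(D, E) \<in> diagram_equiv"
  shows "dom (arcs E) = dom (arcs D)" "dom (loops E) = dom (loops D)" "diagram_writhe E = diagram_writhe D"
    "closes_arcs D cl \<Longrightarrow> (\<And>k. v k \<noteq> 0) \<Longrightarrow> link_det E cl v = link_det D cl v"
proof -
  \<comment> \<open>The condition on \<open>cl\<close> depends on the labels of the arcs only, which no move changes.\<close>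
  define ok where "ok X \<longleftrightarrow> (\<forall>k\<in>X. \<forall>m. cl k = Some m \<longrightarrow> m \<in> X) \<and>
     (\<forall>k\<in>X. \<forall>l\<in>X. cl k = cl l \<longrightarrow> cl k \<noteq> None \<longrightarrow> k = l) \<and> (\<forall>k. v k \<noteq> 0)" for X
  define f where "f A = (dom (arcs A), dom (loops A), diagram_writhe A, if ok (dom (arcs A)) then link_det A cl v else 0)" for A
  have "f A = f B" if "A \<in> diagrams \<and> B \<in> diagrams \<and> move A B" for A B
  proof -
    have m: "move A B" and w: "well_formed A" "well_formed B" using that by (simp_all add: diagrams_def)
    have l: "link_det B cl v = link_det A cl v" if h: "ok (dom (arcs A))"
    proof (rule link_det_move[OF m w(1)])
      show "closes_arcs A cl" using h unfolding closes_arcs_def ok_def by blast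
      show "v k \<noteq> 0" for k using h unfolding ok_def by blast
    qed
    have i: "(if ok (dom (arcs B)) then link_det B cl v else 0) = (if ok (dom (arcs A)) then link_det A cl v else 0)"
      unfolding move_doms(1)[OF m] by (rule if_cong[OF refl l refl])
    then show ?thesis
      unfolding f_def prod.inject
      by (intro conjI move_doms[OF m, symmetric] diagram_writhe_move[OF m w, symmetric] i[symmetric])
  qed
  note inv = this
  have "equivclp (\<lambda>A B. A \<in> diagrams \<and> B \<in> diagrams \<and> move A B) D E"
    using assms by (simp add: diagram_equiv_def)
  from equivclp_invariant[where f=f, OF this inv] have "f D = f E" .
  note fE = this[symmetric, unfolded f_def prod.inject]
  then have e: "dom (arcs E) = dom (arcs D)" "dom (loops E) = dom (loops D)" "diagram_writhe E = diagram_writhe D"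
    "(if ok (dom (arcs E)) then link_det E cl v else 0) = (if ok (dom (arcs D)) then link_det D cl v else 0)"
    by (blast, blast, blast, elim conjE)
  show "dom (arcs E) = dom (arcs D)" "dom (loops E) = dom (loops D)" "diagram_writhe E = diagram_writhe D"
    by (fact e)+
  assume "closes_arcs D cl" "\<And>k. v k \<noteq> 0"
  then have "ok (dom (arcs D))" unfolding closes_arcs_def ok_def by blast
  then show "link_det E cl v = link_det D cl v" using e(4) unfolding e(1) by (simp only: if_True)
qed

lemma in_w_class: "D \<in> diagrams \<Longrightarrow> D \<in> w_class D"
  unfolding w_class_def using equiv_class_self[OF equiv_diagram_equiv] by blast

lemma w_class_eq: "(D, E) \<in> diagram_equiv \<Longrightarrow> w_class D = w_class E"
  unfolding w_class_def by (rule equiv_class_eq[OF equiv_diagram_equiv])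

lemma tangle_gamma_equiv:
  assumes D: "D \<in> tangle_diagrams Y" and E: "(D, E) \<in> diagram_equiv"
  shows "tangle_gamma E = tangle_gamma D"
proof -
  interpret tangle D Y by (rule tangle_diagramD[OF D])
  have dom: "dom (arcs E) = dom (arcs D)" by (rule diagram_equiv_invariants(1)[OF E])
  have l: "link_det E cl tvar = link_det D cl tvar" if "closes_arcs D cl" for cl
    by (rule diagram_equiv_invariants(4)[OF E that tvar_nonzero])
  have "tangle_matrix E tvar i j = tangle_matrix D tvar i j" for i j
    using l[OF closes_arcs_empty] l[OF closes_arcs_single, of j i] by (auto simp: tangle_matrix_def dom)
  then show ?thesis unfolding tangle_gamma_def using l[OF closes_arcs_empty] by (simp add: fun_eq_iff)
qed

text \<open>
  The choice of a representative is immaterial by \<open>tangle_gamma_equiv\<close>.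
\<close>

definition class_gamma :: "diagram set \<Rightarrow> gamma" where
  "class_gamma T = tangle_gamma (SOME D. D \<in> T)"

lemma class_gamma_w_class:
  assumes D: "D \<in> tangle_diagrams Y"
  shows "class_gamma (w_class D) = tangle_gamma D"
proof -
  have "D \<in> w_class D" using D by (intro in_w_class) (simp add: tangle_diagrams_def)
  then have "(SOME E. E \<in> w_class D) \<in> w_class D" by (rule someI)
  then show ?thesis
    unfolding class_gamma_def by (intro tangle_gamma_equiv[OF D]) (simp add: w_class_def)
qed

theorem gamma_invariant_class_gamma: "gamma_invariant class_gamma"
proof
  fix T Y assume "T \<in> w_tangles Y"
  then obtain D where D: "D \<in> tangle_diagrams Y" "T = w_class D"
    unfolding w_tangles_def w_class_def by (auto elim: quotientE)
  show "class_gamma T \<in> gamma_elements Y"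
    unfolding D(2) class_gamma_w_class[OF D(1)] by (rule tangle.tangle_gamma_element[OF tangle_diagramD[OF D(1)]])
next
  fix s and i j c :: nat assume h: "s \<in> {Positive, Negative}" "i \<noteq> j" "crossing_diagram s c i j \<in> tangle_diagrams {i, j}"
  show "class_gamma (w_class (crossing_diagram s c i j)) = gamma_crossing s i j"
    unfolding class_gamma_w_class[OF h(3)] by (rule tangle_gamma_crossing[OF h(1,2) tangle_diagramD[OF h(3)]])
next
  fix D Y x assume h: "D \<in> tangle_diagrams Y" "x \<notin> Y" "add_strand x D \<in> tangle_diagrams (insert x Y)"
  show "class_gamma (w_class (add_strand x D)) = gamma_strand x (class_gamma (w_class D))"
    unfolding class_gamma_w_class[OF h(3)] class_gamma_w_class[OF h(1)]
    by (rule tangle_gamma_strand[OF tangle_diagramD[OF h(1)] h(2) tangle_diagramD[OF h(3)]])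
next
  fix D Y E Z assume h: "D \<in> tangle_diagrams Y" "E \<in> tangle_diagrams Z" "Y \<inter> Z = {}"
    "dom (kinds D) \<inter> dom (kinds E) = {}" "disjoint_union D E \<in> tangle_diagrams (Y \<union> Z)"
  show "class_gamma (w_class (disjoint_union D E)) = gamma_union (class_gamma (w_class D)) (class_gamma (w_class E))"
    unfolding class_gamma_w_class[OF h(1)] class_gamma_w_class[OF h(2)] class_gamma_w_class[OF h(5)]
    by (rule tangle_gamma_union[OF tangle_diagramD[OF h(1)] tangle_diagramD[OF h(2)] tangle_diagramD[OF h(5)] h(3,4)])
next
  fix D Y x z assume h: "D \<in> tangle_diagrams Y" "x \<in> Y" "z \<notin> Y - {x}"
  note r = relabel_diagram[OF h]
  show "class_gamma (w_class (relabel x z D)) = gamma_relabel x z (class_gamma (w_class D))"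
    unfolding class_gamma_w_class[OF h(1)] class_gamma_w_class[OF r]
    by (rule tangle_gamma_relabel[OF tangle_diagramD[OF h(1)] h(2,3) tangle_diagramD[OF r]])
next
  fix D Y D' Y' x y z assume h: "D \<in> tangle_diagrams Y" "D' \<in> tangle_diagrams Y'" "stitches_to x y z D D'"
  show "class_gamma (w_class D') = gamma_stitch x y z (class_gamma (w_class D))"
    unfolding class_gamma_w_class[OF h(1)] class_gamma_w_class[OF h(2)]
    by (rule tangle_gamma_stitch[OF tangle_diagramD[OF h(1)] tangle_diagramD[OF h(2)] h(3)])
qed

definition empty_diagram :: diagram where
  "empty_diagram = \<lparr>arcs = Map.empty, loops = Map.empty, kinds = Map.empty\<rparr>"

lemma empty_diagram: "empty_diagram \<in> tangle_diagrams {}"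
proof -
  have X: "crossing_diagram Positive 0 0 1 \<in> tangle_diagrams {0, 1}"
    using crossing_drawn by (auto simp: tangle_diagrams_def crossing_diagram_def)
  from subdiagram[OF X, of "{}" "{}"] show ?thesis
    using X by (simp add: empty_diagram_def)
qed

text \<open>
  The empty tangle has no defining rule of its own; its value is read off from its disjoint union
  with a crossing, whose scalar is 1.
\<close>

lemma gamma_invariant_empty:
  assumes "gamma_invariant f"
  shows "f (w_class empty_diagram) = (1, \<lambda>_ _. 0)"
proof -
  interpret gamma_invariant f by fact
  let ?X = "crossing_diagram Positive 0 0 1"
  have X: "?X \<in> tangle_diagrams {0, 1}"
    using crossing_drawn by (auto simp: tangle_diagrams_def crossing_diagram_def)
  have u: "disjoint_union empty_diagram ?X = ?X"
    by (simp add: disjoint_union_def empty_diagram_def crossing_diagram_def)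
  have "f (w_class ?X) = gamma_union (f (w_class empty_diagram)) (f (w_class ?X))"
    using union[OF empty_diagram X] X u by (simp add: empty_diagram_def)
  moreover have "f (w_class ?X) = gamma_crossing Positive 0 1"
    by (rule crossing[OF _ _ X]) simp_all
  ultimately show ?thesis
    by (cases "f (w_class empty_diagram)") (auto simp: gamma_crossing_def gamma_union_def Let_def fun_eq_iff)
qed

context
  fixes f g :: "diagram set \<Rightarrow> gamma"
  assumes f: "gamma_invariant f" and g: "gamma_invariant g"
begin

interpretation f: gamma_invariant f by (rule f)
interpretation g: gamma_invariant g by (rule g)

lemma agree_strands:
  assumes "D \<in> tangle_diagrams Y" "kinds D = Map.empty"
  shows "f (w_class D) = g (w_class D)"
proof -
  have "finite Y" using tangle.fin_Y[OF tangle_diagramD[OF assms(1)]] .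
  then show ?thesis using assms
  proof (induction Y arbitrary: D rule: finite_induct)
    case empty
    then have "D = empty_diagram"
      by (cases D) (simp add: tangle_diagrams_def empty_diagram_def)
    then show ?case using gamma_invariant_empty[OF f] gamma_invariant_empty[OF g] by simp
  next
    case (insert x Y)
    interpret tangle D "insert x Y" by (rule tangle_diagramD[OF insert.prems(1)])
    have nil: "passages D k = []" if "k \<in> insert x Y" for k
    proof -
      have "q \<notin> set (passages D k)" for q
        using passage_iff[OF wf, of q] that comps insert.prems(2) by auto
      then show ?thesis by (cases "passages D k") auto
    qed
    let ?E = "\<lparr>arcs = arcs D |` Y, loops = Map.empty, kinds = kinds D |` {}\<rparr> :: diagram"
    have E: "?E \<in> tangle_diagrams Y"
      by (rule subdiagram[OF insert.prems(1)]) (use nil in auto)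
    have "arcs D x = Some []"
    proof -
      obtain w where w: "arcs D x = Some w" using Y by auto
      then show ?thesis using nil[of x] by (simp add: passages_def)
    qed
    then have "(arcs D |` Y)(x \<mapsto> []) = arcs D"
      using Y by (auto simp: fun_eq_iff restrict_map_def)
    then have D: "D = add_strand x ?E"
      using no_loops insert.prems(2) by (cases D) (simp add: add_strand_def)
    have A: "add_strand x ?E \<in> tangle_diagrams (insert x Y)" using insert.prems(1) unfolding D[symmetric] .
    have "f (w_class (add_strand x ?E)) = gamma_strand x (f (w_class ?E))"
      "g (w_class (add_strand x ?E)) = gamma_strand x (g (w_class ?E))"
      by (rule f.strand[OF E insert.hyps(2) A], rule g.strand[OF E insert.hyps(2) A])
    moreover have "f (w_class ?E) = g (w_class ?E)" by (rule insert.IH[OF E]) simp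
    ultimately show ?case unfolding D[symmetric] by (simp only:)
  qed
qed

text \<open>
  If every arc has at most one passage, a real crossing together with its two arcs is a disjoint
  summand, and a virtual one can be undone by moving an endpoint across it.
\<close>

lemma agree_short_arcs:
  assumes "D \<in> tangle_diagrams Y" "\<And>k. k \<in> Y \<Longrightarrow> length (passages D k) \<le> 1"
  shows "f (w_class D) = g (w_class D)"
  using assms
proof (induction "card (dom (kinds D))" arbitrary: D Y rule: less_induct)
  case less
  interpret tangle D Y by (rule tangle_diagramD[OF less.prems(1)])
  have fin: "finite (dom (kinds D))" by (rule wfD(2)[OF wf])
  have single: "passages D k = [q]" if "k \<in> Y" "q \<in> set (passages D k)" for k q
    using less.prems(2)[OF that(1)] that(2) by (cases "passages D k") auto
  show ?case
  proof (cases "kinds D = Map.empty")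
    case True
    then show ?thesis using agree_strands less.prems(1) by blast
  next
    case False
    then obtain c s where c: "kinds D c = Some s" by (auto simp: fun_eq_iff)
    then have cd: "c \<in> dom (kinds D)" by auto
    obtain i where i: "i \<in> Y" "(c, True) \<in> set (passages D i)" using passage_on_arc[of "(c, True)"] cd by auto
    obtain j where j: "j \<in> Y" "(c, False) \<in> set (passages D j)" using passage_on_arc[of "(c, False)"] cd by auto
    have pi: "passages D i = [(c, True)]" and pj: "passages D j = [(c, False)]" using single i j by blast+
    have arc: "arcs D k = Some (passages D k)" if "k \<in> Y" for k
      using that Y by (auto simp: passages_def)
    have ij: "i \<noteq> j" using pi pj by auto
    have kc: "k = i \<or> k = j" if "k \<in> Y" "(c, b) \<in> set (passages D k)" for k b
      using wfD(4)[OF wf, of k i "(c, b)"] wfD(4)[OF wf, of k j "(c, b)"] i j that comps by (cases b) auto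
    show ?thesis
    proof (cases "s = Virtual")
      case True
      have ai: "arcs D i = Some [(c, True)]" using arc[OF i(1)] pi by simp
      have E: "erase {c} D \<in> tangle_diagrams Y" by (rule erase_endpoint_diagram[OF less.prems(1) ai])
      have m: "move D (erase {c} D)"
        by (rule move.endpoint[OF ai, of c True "[]"]) (use c True in \<open>auto simp: is_virtual_def\<close>)
      have "(D, erase {c} D) \<in> diagram_equiv"
        using m E less.prems(1) unfolding diagram_equiv_def tangle_diagrams_def by auto
      then have w: "w_class D = w_class (erase {c} D)" by (rule w_class_eq)
      have "dom (kinds (erase {c} D)) = dom (kinds D) - {c}" by (auto simp: erase_def)
      then have "card (dom (kinds (erase {c} D))) < card (dom (kinds D))"
        using card_Diff1_less[OF fin cd] by (simp only:)
      moreover have "length (passages (erase {c} D) k) \<le> 1" if "k \<in> Y" for k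
      proof -
        have "passages (erase {c} D) k = filter (\<lambda>p. fst p \<notin> {c}) (passages D k)"
          by (auto simp: erase_def map_words_def passages_def erase_word_def split: option.splits)
        then show ?thesis using less.prems(2)[OF that] length_filter_le[of _ "passages D k"] by (metis le_trans)
      qed
      ultimately have "f (w_class (erase {c} D)) = g (w_class (erase {c} D))" using less.hyps E by blast
      then show ?thesis unfolding w .
    next
      case real: False
      define a b where "a = (if s = Positive then i else j)" and "b = (if s = Positive then j else i)"
      let ?X = "crossing_diagram s c a b"
      let ?E = "\<lparr>arcs = arcs D |` (Y - {i, j}), loops = Map.empty, kinds = kinds D |` (dom (kinds D) - {c})\<rparr> :: diagram"
      have ab: "{a, b} = {i, j}" "a \<noteq> b" using ij by (auto simp: a_def b_def)
      have s: "s \<in> {Positive, Negative}" using real by (cases s) auto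
      have fst_c: "fst q = c \<longleftrightarrow> q = (c, True) \<or> q = (c, False)" for q :: passage by (cases q) auto
      have E: "?E \<in> tangle_diagrams (Y - {i, j})"
      proof (rule subdiagram[OF less.prems(1)])
        show "fst q \<in> dom (kinds D) - {c}" if "k \<in> Y - {i, j}" "q \<in> set (passages D k)" for k q
        proof -
          have "fst q \<noteq> c" using kc[of k "snd q"] that by (cases q) auto
          then show ?thesis using passage_iff[OF wf, of q] comps that by auto
        qed
        show "fst q \<notin> dom (kinds D) - {c}" if "k \<in> Y - (Y - {i, j})" "q \<in> set (passages D k)" for k q
          using that pi pj by auto
      qed auto
      have X: "?X \<in> tangle_diagrams {a, b}"
      proof -
        have "\<lparr>arcs = arcs D |` {i, j}, loops = Map.empty, kinds = kinds D |` {c}\<rparr> \<in> tangle_diagrams {i, j}"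
        proof (rule subdiagram[OF less.prems(1)])
          show "fst q \<in> {c}" if "k \<in> {i, j}" "q \<in> set (passages D k)" for k q using that pi pj by auto
          show "fst q \<notin> {c}" if "k \<in> Y - {i, j}" "q \<in> set (passages D k)" for k q
            using kc[of k "snd q"] that by (cases q) auto
        qed (use i j cd in auto)
        moreover have "\<lparr>arcs = arcs D |` {i, j}, loops = Map.empty, kinds = kinds D |` {c}\<rparr> = ?X"
          using s ij arc[OF i(1)] arc[OF j(1)] pi pj c
          by (auto simp: crossing_diagram_def a_def b_def restrict_map_def fun_eq_iff)
        ultimately show ?thesis using ab by simp
      qed
      have U: "disjoint_union ?X ?E = D"
      proof -
        have "arcs ?X ++ arcs ?E = arcs D"
          using s ij arc[OF i(1)] arc[OF j(1)] pi pj Y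
          by (auto simp: crossing_diagram_def a_def b_def restrict_map_def fun_eq_iff map_add_def split: option.splits)
        moreover have "kinds ?X ++ kinds ?E = kinds D"
          using c by (auto simp: crossing_diagram_def restrict_map_def fun_eq_iff map_add_def split: option.splits)
        moreover have "loops ?X ++ loops ?E = loops D" by (simp add: crossing_diagram_def no_loops)
        ultimately show ?thesis unfolding disjoint_union_def by simp
      qed
      have Yab: "{a, b} \<union> (Y - {i, j}) = Y" using ab i j by auto
      have dj: "{a, b} \<inter> (Y - {i, j}) = {}" "dom (kinds ?X) \<inter> dom (kinds ?E) = {}"
        using ab by (auto simp: crossing_diagram_def)
      have D': "disjoint_union ?X ?E \<in> tangle_diagrams ({a, b} \<union> (Y - {i, j}))" unfolding U Yab by (rule less.prems(1))
      have "f (w_class ?E) = g (w_class ?E)"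
      proof (rule less.hyps[OF _ E])
        have "dom (kinds ?E) = dom (kinds D) - {c}" by auto
        then show "card (dom (kinds ?E)) < card (dom (kinds D))" using card_Diff1_less[OF fin cd] by (simp only:)
        show "length (passages ?E k) \<le> 1" if "k \<in> Y - {i, j}" for k
        proof -
          have k: "k \<in> Y" using that by blast
          have "loops ?E = Map.empty" by simp
          then have "passages ?E k = passages D k"
            unfolding passages_no_loops[OF no_loops] using that by (simp add: passages_no_loops)
          then show ?thesis using less.prems(2)[OF k] by (simp only:)
        qed
      qed
      moreover have "f (w_class ?X) = g (w_class ?X)"
        using f.crossing[OF s ab(2) X] g.crossing[OF s ab(2) X] by simp
      ultimately show ?thesis
        using f.union[OF X E dj D'] g.union[OF X E dj D'] unfolding U by simp
    qed
  qed
qed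

text \<open>
  Induction on the number of cuts needed to leave at most one passage on each arc.
\<close>

lemma agree:
  assumes "D \<in> tangle_diagrams Y"
  shows "f (w_class D) = g (w_class D)"
  using assms
proof (induction "\<Sum>k\<in>Y. length (passages D k) - 1" arbitrary: D Y rule: less_induct)
  case less
  interpret tangle D Y by (rule tangle_diagramD[OF less.prems])
  show ?case
  proof (cases "\<forall>k\<in>Y. length (passages D k) \<le> 1")
    case True
    then show ?thesis using agree_short_arcs[OF less.prems] by blast
  next
    case False
    then obtain z where z: "z \<in> Y" "length (passages D z) \<ge> 2" by force
    then obtain a w where w: "passages D z = [a] @ w" "w \<noteq> []" by (cases "passages D z") force+
    have az: "arcs D z = Some ([a] @ w)" using z Y w by (auto simp: passages_def)
    obtain x where x: "x \<notin> Y" using ex_new_if_finite[OF infinite_UNIV_nat fin_Y] by blast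
    obtain y where y: "y \<notin> insert x Y" using ex_new_if_finite[OF infinite_UNIV_nat, of "insert x Y"] fin_Y by auto
    let ?E = "D\<lparr>arcs := (arcs D)(z := None, x \<mapsto> [a], y \<mapsto> w)\<rparr>" and ?Z = "insert x (insert y (Y - {z}))"
    have xy: "x \<noteq> y" "{x, y} \<inter> (Y - {z}) = {}" using x y by auto
    note cut = cut_diagram[OF less.prems az xy]
    have p: "passages ?E k = (if k = x then [a] else if k = y then w else passages D k)" if "k \<in> ?Z" for k
    proof -
      have "loops ?E = Map.empty" by (simp add: no_loops)
      then have E: "passages ?E k = (case arcs ?E k of Some w \<Rightarrow> w | None \<Rightarrow> [])" by (rule passages_no_loops)
      have "k = x \<or> k = y \<or> k \<noteq> z" using that by blast
      then show ?thesis unfolding E passages_no_loops[OF no_loops] using xy(1) by (elim disjE) simp_all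
    qed
    have "(\<Sum>k\<in>?Z. length (passages ?E k) - 1) = (\<Sum>k\<in>?Z. length (if k = x then [a] else if k = y then w else passages D k) - 1)"
      by (rule sum.cong) (simp_all add: p)
    also have "\<dots> = (length w - 1) + (\<Sum>k\<in>Y - {z}. length (passages D k) - 1)"
    proof -
      have nx: "x \<notin> insert y (Y - {z})" "y \<notin> Y - {z}" "finite (Y - {z})" using x y fin_Y by auto
      have "(\<Sum>k\<in>Y - {z}. length (if k = x then [a] else if k = y then w else passages D k) - 1) = (\<Sum>k\<in>Y - {z}. length (passages D k) - 1)"
        by (rule sum.cong) (use nx in auto)
      then show ?thesis using nx xy(1) by simp
    qed
    also have "\<dots> < (length (passages D z) - 1) + (\<Sum>k\<in>Y - {z}. length (passages D k) - 1)"
      using w by (cases w) auto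
    also have "\<dots> = (\<Sum>k\<in>Y. length (passages D k) - 1)"
      using sum.remove[OF fin_Y z(1), of "\<lambda>k. length (passages D k) - 1"] by simp
    finally have "f (w_class ?E) = g (w_class ?E)" using less.hyps cut(1) by blast
    then show ?thesis
      using f.stitch[OF cut(1) less.prems cut(2)] g.stitch[OF cut(1) less.prems cut(2)] by simp
  qed
qed

end

text \<open>
  Existence and uniqueness make the definite description of \<open>phi\<close> meaningful.
\<close>

theorem phi_w_class:
  assumes "D \<in> tangle_diagrams Y"
  shows "phi (w_class D) = tangle_gamma D"
proof -
  have "gamma_invariant phi" unfolding phi_def by (rule someI[where P=gamma_invariant, OF gamma_invariant_class_gamma])
  then show ?thesis
    using agree[OF _ gamma_invariant_class_gamma assms] class_gamma_w_class[OF assms] by simp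
qed

section \<open>Long w-links\<close>

lemma long_w_linkD:
  assumes "L \<in> long_w_links" "E \<in> L"
  shows "E \<in> diagrams" "F \<in> L \<Longrightarrow> (E, F) \<in> diagram_equiv"
proof -
  obtain D where L: "L = diagram_equiv `` {D}" using assms(1) unfolding long_w_links_def by (auto elim: quotientE)
  then have DE: "(D, E) \<in> diagram_equiv" using assms(2) by simp
  then show "E \<in> diagrams" by (simp add: diagram_equiv_def)
  assume "F \<in> L"
  then have "(D, F) \<in> diagram_equiv" using L by simp
  then show "(E, F) \<in> diagram_equiv"
    using DE equiv_diagram_equiv unfolding equiv_def by (meson symD transD)
qed

text \<open>
  The closing paths have only virtual crossings; once these are erased, opening a loop at the
  closing path only changes whether its end precedes its beginning.
\<close>

lemma closed_value_closes_to:
  assumes D: "D \<in> diagrams" and E: "E \<in> diagrams" and cl: "closes_to D E"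
  shows "closed_value (sorted_list_of_set (dom (loops E))) (phi (w_class D)) = link_det E no_closing tvar"
proof -
  have wfE: "well_formed E" using E by (simp add: diagrams_def)
  obtain u h V where u: "\<And>k. k \<in> dom (loops E) \<Longrightarrow> loops E k = Some (u k @ h k)"
    and V: "V = (\<Union>k\<in>dom (loops E). fst ` set (h k))" "\<forall>c\<in>V. is_virtual E c"
    and Deq: "D = (erase V E)\<lparr>arcs := arcs (erase V E) ++
       (\<lambda>k. if k \<in> dom (loops E) then Some (erase_word V (u k)) else None), loops := Map.empty\<rparr>"
    using cl unfolding closes_to_def by blast
  let ?F = "erase V E"
  have dF: "dom (arcs ?F) = dom (arcs E)" "dom (loops ?F) = dom (loops E)" by (auto simp: erase_def map_words_def)
  have lD: "loops D = Map.empty" and kD: "kinds D = kinds ?F" by (simp_all add: Deq)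
  have dD: "dom (arcs D) = components E" by (auto simp: Deq dF components_def split: if_splits)
  have tD: "D \<in> tangle_diagrams (components E)" using D dD lD by (simp add: tangle_diagrams_def)
  interpret tangle D "components E" by (rule tangle_diagramD[OF tD])
  have cF: "components ?F = components E" using dF by (simp add: components_def)
  have lF: "loops ?F k = Some (erase_word V (u k))" if k: "k \<in> dom (loops E)" for k
  proof -
    have "erase_word V (h k) = []" using V(1) k by (auto simp: erase_word_def filter_empty_conv)
    then show ?thesis using u[OF k] by (simp add: erase_def map_words_def erase_word_def)
  qed
  have p: "passages D k = passages ?F k" if "k \<in> components E" for k
  proof (cases "k \<in> dom (loops E)")
    case True
    then have "k \<notin> dom (arcs E)" using wfD(5)[OF wfE] by blast
    then have "arcs ?F k = None" using dF(1) by blast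
    moreover have "arcs D k = Some (erase_word V (u k))" using True by (simp add: Deq map_add_def)
    ultimately show ?thesis using lF[OF True] by (simp add: passages_def)
  next
    case False
    then have "arcs D k = arcs ?F k" by (simp add: Deq map_add_def)
    moreover have "loops ?F k = None" using False dF(2) by blast
    ultimately show ?thesis using lD by (simp add: passages_def split: option.split)
  qed
  let ?cs = "sorted_list_of_set (dom (loops E))"
  have fin: "finite (dom (loops E))" using wfD(1)[OF wfE] by (simp add: components_def)
  have fV: "finite V" unfolding V(1) using fin by simp
  have un: "under D tvar = under ?F tvar"
    by (rule under_cong) (use p comps cF kD in simp_all)
  have "link_det D (\<lambda>k. if k \<in> set ?cs then Some k else None) tvar = link_det ?F no_closing tvar"
    unfolding link_det_def un comps cF
  proof (rule chain_det_cong)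
    show "words D k = words ?F k" if "k \<in> Inl ` components E" for k using that p by auto
    show "closing D (\<lambda>k. if k \<in> set ?cs then Some k else None) k = closing ?F no_closing k" for k
      unfolding closing_tangle using fin dF(2) by (cases k) simp_all
  qed simp
  also have "\<dots> = link_det E no_closing tvar"
    by (rule link_det_erase[OF wfE fV _ closes_arcs_empty]) (use V in blast)
  finally show ?thesis
    unfolding phi_w_class[OF tD] using link_det_closed_value[of ?cs] fin by (simp add: components_def)
qed

text \<open>
  Cutting every loop at its base point shows that each diagram is a trivial closure.
\<close>

lemma closes_to_open_loops: "closes_to (E\<lparr>arcs := arcs E ++ loops E, loops := Map.empty\<rparr>) E"
  unfolding closes_to_def
proof (intro exI conjI)
  have "filter (\<lambda>p. True) = (id :: passage list \<Rightarrow> passage list)" by (rule ext) simp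
  moreover have "kinds E |` UNIV = kinds E" by (simp add: restrict_map_def fun_eq_iff)
  ultimately have er: "erase {} E = E" by (simp add: erase_def map_words_def erase_word_def option.map_id0)
  show "\<forall>k\<in>dom (loops E). loops E k = Some (the (loops E k) @ [])" by auto
  show "{} = (\<Union>k\<in>dom (loops E). fst ` set ([] :: passage list))" by simp
  have l: "(\<lambda>k. if k \<in> dom (loops E) then Some (erase_word {} (the (loops E k))) else None) = loops E"
  proof
    show "(if k \<in> dom (loops E) then Some (erase_word {} (the (loops E k))) else None) = loops E k" for k
      by (cases "loops E k") (simp_all add: domIff erase_word_def)
  qed
  show "E\<lparr>arcs := arcs E ++ loops E, loops := Map.empty\<rparr> = (erase {} E)\<lparr>arcs := arcs (erase {} E) ++
     (\<lambda>k. if k \<in> dom (loops E) then Some (erase_word {} (the (loops E k))) else None), loops := Map.empty\<rparr>"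
    unfolding er l ..
qed simp

lemma link_omega_eq:
  assumes L: "L \<in> long_w_links" "E \<in> L"
  shows "link_omega L = link_det E no_closing tvar"
  unfolding link_omega_def
proof (rule the_equality)
  have E: "E \<in> diagrams" by (rule long_w_linkD(1)[OF L])
  show "\<exists>D\<in>diagrams. \<exists>D'\<in>L. closes_to D D' \<and>
     link_det E no_closing tvar = closed_value (sorted_list_of_set (dom (loops D'))) (phi (w_class D))"
    using open_loops_diagram[OF E] L(2) closes_to_open_loops[of E]
      closed_value_closes_to[OF open_loops_diagram[OF E] E closes_to_open_loops, symmetric] by blast
  fix w assume "\<exists>D\<in>diagrams. \<exists>D'\<in>L. closes_to D D' \<and>
     w = closed_value (sorted_list_of_set (dom (loops D'))) (phi (w_class D))"
  then obtain D D' where h: "D \<in> diagrams" "D' \<in> L" "closes_to D D'"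
    "w = closed_value (sorted_list_of_set (dom (loops D'))) (phi (w_class D))" by blast
  have "w = link_det D' no_closing tvar"
    unfolding h(4) by (rule closed_value_closes_to[OF h(1) long_w_linkD(1)[OF L(1) h(2)] h(3)])
  moreover have "link_det D' no_closing tvar = link_det E no_closing tvar"
    by (rule diagram_equiv_invariants(4)[OF long_w_linkD(2)[OF L h(2)] closes_arcs_empty tvar_nonzero])
  ultimately show "w = link_det E no_closing tvar" by simp
qed

lemma writhe_eq:
  assumes L: "L \<in> long_w_links" "E \<in> L"
  shows "writhe L = diagram_writhe E"
  unfolding writhe_def
proof (rule the_equality)
  show "\<forall>D\<in>L. diagram_writhe D = diagram_writhe E"
    using diagram_equiv_invariants(3)[OF long_w_linkD(2)[OF L]] by blast
  show "n = diagram_writhe E" if "\<forall>D\<in>L. diagram_writhe D = n" for n using bspec[OF that L(2)] by simp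
qed

lemma sqrt_t_nonzero: "sqrt_t \<noteq> 0"
  by (simp add: sqrt_t_def Zero_fract_def eq_fract)

lemma Delta_eq:
  assumes L: "L \<in> long_w_links" "E \<in> L"
  shows "Delta L = sqrt_t powi (- diagram_writhe E) * link_det E no_closing (\<lambda>_. sqrt_t ^ 2)"
proof -
  have "specialize (\<lambda>_. sqrt_t ^ 2) (link_det E no_closing tvar) = link_det E no_closing (\<lambda>_. sqrt_t ^ 2)"
    by (intro specialize_eq specialize_link_det) (simp add: sqrt_t_nonzero)
  then show ?thesis
    by (simp add: Delta_def link_omega_t_def link_omega_eq[OF L] writhe_eq[OF L])
qed

section \<open>The skein relation\<close>

text \<open>
  Heads have predecessors only through closing, so two heads can exchange their predecessors.
\<close>

lemma chain_swap_heads: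
  assumes sys: "chain_system K W cl" and xy: "x \<in> K" "y \<in> K"
  shows "chain_system K W (cl \<circ> Transposition.transpose x y)"
    "chain_wiring K W (cl \<circ> Transposition.transpose x y) = (\<lambda>j s. chain_wiring K W cl j (Transposition.transpose x y s))"
proof -
  let ?t = "Transposition.transpose x y"
  have tK: "?t k \<in> K \<longleftrightarrow> k \<in> K" for k using xy by (auto simp: transpose_def)
  have inj: "k = l" if "k \<in> K" "l \<in> K" "cl k = cl l" "cl k \<noteq> None" for k l
    using sys that unfolding chain_system_def by blast
  have eq: "k = l" if "k \<in> K" "l \<in> K" "cl (?t k) = cl (?t l)" "cl (?t k) \<noteq> None" for k l
  proof -
    have "?t k = ?t l" using inj[of "?t k" "?t l"] that tK by simp
    then show ?thesis by (metis transpose_involutory)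
  qed
  show "chain_system K W (cl \<circ> ?t)"
    unfolding chain_system_def
  proof (intro conjI ballI impI)
    show "finite K" "\<And>k. k \<in> K \<Longrightarrow> distinct (k # W k)"
      "\<And>k l. k \<in> K \<Longrightarrow> l \<in> K \<Longrightarrow> k \<noteq> l \<Longrightarrow> set (k # W k) \<inter> set (l # W l) = {}"
      using sys unfolding chain_system_def by blast+
    show "k = l" if "k \<in> K" "l \<in> K" "(cl \<circ> ?t) k = (cl \<circ> ?t) l" "(cl \<circ> ?t) k \<noteq> None" for k l
      by (rule eq) (use that in simp_all)
  qed
  have nohead: "\<not> adjacent (k # W k) j h" if "k \<in> K" "h \<in> K" for k j h
  proof
    assume a: "adjacent (k # W k) j h"
    then have h: "h \<in> set (W k)" using adjacent_set[of "k # W k" j h] by simp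
    show False
    proof (cases "k = h")
      case True
      then show False using h sys that unfolding chain_system_def by force
    next
      case False
      then have "set (k # W k) \<inter> set (h # W h) = {}" using sys that unfolding chain_system_def by blast
      then show False using h by auto
    qed
  qed
  have "chain_wiring K W (cl \<circ> ?t) j s \<longleftrightarrow> chain_wiring K W cl j (?t s)" for j s
  proof (cases "s \<in> {x, y}")
    case True
    then have "s \<in> K" "?t s \<in> K" using xy tK by auto
    then show ?thesis using nohead unfolding chain_wiring_def comp_def by blast
  next
    case False
    then have "?t s = s" by auto
    then show ?thesis unfolding chain_wiring_def comp_def by simp
  qed
  then show "chain_wiring K W (cl \<circ> ?t) = (\<lambda>j s. chain_wiring K W cl j (?t s))" by blast
qed

lemma link_det_of_system:
  fixes v :: "nat \<Rightarrow> 'f::field"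
  assumes wf: "well_formed D" and sys: "chain_system K W cl" and g: "inj_on g K" "components D = g ` K"
    and W: "\<And>k. k \<in> K \<Longrightarrow> W k = map Inr (passages D (g k))"
    and cl: "\<And>k. k \<in> K \<Longrightarrow> closing D no_closing (Inl (g k)) = map_option (Inl \<circ> g) (cl k)"
    and ran: "\<And>k l. k \<in> K \<Longrightarrow> cl k = Some l \<Longrightarrow> l \<in> K"
    and und: "\<And>k. k \<in> K \<Longrightarrow> und k = None" "\<And>p. fst p \<in> dom (kinds D) \<Longrightarrow> und (Inr p) = under D v (Inr p)"
    and K: "\<And>p. fst p \<in> dom (kinds D) \<Longrightarrow> Inr p \<notin> K"
  shows "link_det D no_closing v = chain_det K W cl und"
proof -
  let ?f = "\<lambda>s. if s \<in> K then Inl (g s) else s"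
  have "(\<Union>k\<in>K. set (W k)) = Inr ` (\<Union>k\<in>components D. set (passages D k))"
    unfolding g(2) using W by auto
  also have "(\<Union>k\<in>components D. set (passages D k)) = dom (kinds D) \<times> UNIV" using wf by (simp add: well_formed_def)
  finally have u: "(\<Union>k\<in>K. set (W k)) = Inr ` (dom (kinds D) \<times> UNIV)" .
  have "chain_states K W = K \<union> (\<Union>k\<in>K. set (W k))" by (auto simp: chain_states_def)
  then have st: "chain_states K W = K \<union> Inr ` (dom (kinds D) \<times> UNIV)" unfolding u .
  have f_in: "?f (Inr p) = Inr p" if "fst p \<in> dom (kinds D)" for p using K[OF that] by simp
  show ?thesis
    unfolding link_det_def
  proof (rule chain_det_rename[where f="?f"])
    show "chain_system K W cl" by fact
    show "inj_on ?f (chain_states K W)"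
    proof (rule inj_onI)
      fix a b assume ab: "a \<in> chain_states K W" "b \<in> chain_states K W" "?f a = ?f b"
      have o: "\<exists>p. s = Inr p" if "s \<in> chain_states K W" "s \<notin> K" for s using that unfolding st by blast
      show "a = b"
        using ab(3) o[OF ab(1)] o[OF ab(2)] inj_onD[OF g(1)] by (cases "a \<in> K"; cases "b \<in> K") auto
    qed
    show "heads D = ?f ` K" unfolding g(2) by (simp add: image_image cong: image_cong)
    show "words D (?f k) = map ?f (W k)" if "k \<in> K" for k
    proof -
      have "?f (Inr p) = Inr p" if "p \<in> set (passages D (g k))" for p
        using f_in passage_iff[OF wf, of p] that \<open>k \<in> K\<close> g(2) by blast
      then show ?thesis using W[OF that] that by simp
    qed
    show "closing D no_closing (?f k) = map_option ?f (cl k)" if "k \<in> K" for k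
      using cl[OF that] ran[OF that] that by (cases "cl k") auto
    show "l \<in> K" if "k \<in> K" "cl k = Some l" for k l by (rule ran[OF that])
    have p: "\<exists>p. s = Inr p \<and> fst p \<in> dom (kinds D)" if "s \<in> chain_states K W" "s \<notin> K" for s
      using that unfolding st by auto
    have U: "x \<in> Inr ` (dom (kinds D) \<times> UNIV)" if "under D v s = Some (T, x)" for s T x
      using under_ref[OF that] by (auto simp: passes_over_def)
    show "under D v (?f s) = map_option (map_prod id ?f) (und s)" if s: "s \<in> chain_states K W" for s
    proof (cases "s \<in> K")
      case True
      then show ?thesis using und(1) by simp
    next
      case False
      then obtain q where q: "s = Inr q" "fst q \<in> dom (kinds D)" using p[OF s] by blast
      show ?thesis
      proof (cases "under D v (Inr q)")
        case None
        then show ?thesis using False und(2)[OF q(2)] q(1) by simp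
      next
        case (Some a)
        then obtain T r where r: "a = (T, Inr r)" "fst r \<in> dom (kinds D)" using U[of "Inr q"] by (cases a) force
        then show ?thesis using Some False und(2)[OF q(2)] q(1) f_in[OF r(2)] K[OF r(2)] by simp
      qed
    qed
    show "x \<in> chain_states K W" if s: "s \<in> chain_states K W" "und s = Some (T, x)" for s T x
    proof (cases "s \<in> K")
      case True
      then show ?thesis using s und(1) by simp
    next
      case False
      then obtain q where q: "s = Inr q" "fst q \<in> dom (kinds D)" using p[OF s(1)] by blast
      then have "under D v (Inr q) = Some (T, x)" using s(2) und(2) by simp
      then show ?thesis unfolding st using U by blast
    qed
  qed
qed

locale positive_crossing =
  fixes D :: diagram and c :: nat and T :: "'f::field"
  assumes wf: "well_formed D" and positive: "kinds D c = Some Positive" and T: "T \<noteq> 0"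
begin

text \<open>
  Both passages through \<open>c\<close> are treated like virtual ones.
\<close>

definition uncrossed :: "state \<Rightarrow> ('f \<times> state) option" where
  "uncrossed = (under D (\<lambda>_. T))(Inr (c, False) := None)"

abbreviation "crossing_changed \<equiv> D\<lparr>kinds := (kinds D)(c \<mapsto> Negative)\<rparr>"

lemma uncrossed_None [simp]: "uncrossed (Inl k) = None" "uncrossed (Inr (c, b)) = None"
  by (cases b; simp add: uncrossed_def passes_over_def positive)+

lemma uncrossed_unreferenced: 
  "unreferenced S uncrossed (Inl k)" "unreferenced S uncrossed (Inr (c, b))"
proof -
  have "\<exists>d e. x = Inr (d, e) \<and> d \<noteq> c" if "uncrossed s = Some (t, x)" for s t x
  proof -
    have "under D (\<lambda>_. T) s = Some (t, x)" using that by (auto simp: uncrossed_def split: if_splits)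
    then obtain d e where de: "s = Inr (d, e)" "x = Inr (d, \<not> e)" using under_ref by blast
    then have "d \<noteq> c" using that uncrossed_None(2)[of e] by auto
    then show ?thesis using de by blast
  qed
  then show "unreferenced S uncrossed (Inl k)" "unreferenced S uncrossed (Inr (c, b))"
    unfolding unreferenced_def by fast+
qed

lemma link_det_smoothed_wiring:
  assumes st: "chain_states K W = chain_states (heads D) (words D)"
    and w: "chain_wiring K W cl = chain_wiring (heads D) (words D) (closing D no_closing)"
    and sys: "chain_system K W cl" and X: "Inr (c, b) \<in> K" and Y: "Inr (c, \<not> b) \<in> K"
  shows "link_det D no_closing (\<lambda>_. T) - T * link_det crossing_changed no_closing (\<lambda>_. T) =
    (1 - T) * chain_det K W (cl \<circ> Transposition.transpose (Inr (c, b)) (Inr (c, \<not> b))) uncrossed"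
proof -
  let ?x = "Inr (c, True) :: state" and ?y = "Inr (c, False) :: state"
  let ?S = "chain_states K W" and ?A = "chain_wiring K W cl"
  have xy: "?x \<in> K" "?y \<in> K" using X Y by (cases b; simp)+
  \<comment> \<open>Which of the two passages comes first on the component is immaterial from here on.\<close>
  have t: "Transposition.transpose (Inr (c, b)) (Inr (c, \<not> b)) = Transposition.transpose ?x ?y"
    by (cases b) (simp_all add: transpose_commute)
  have up: "under D (\<lambda>_. T) = uncrossed(?y := Some (T, ?x))"
  proof -
    have "under D (\<lambda>_. T) ?y = Some (T, ?x)" by (simp add: passes_over_def positive)
    then show ?thesis unfolding uncrossed_def fun_upd_upd by (rule fun_upd_idem[symmetric])
  qed
  have um: "under crossing_changed (\<lambda>_. T) s = (uncrossed(?x := Some (inverse T, ?y))) s" for s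
  proof (cases "(D, \<lambda>_::nat. T, s)" rule: under.cases)
    case (2 D' v d e)
    then have s: "s = Inr (d, e)" by simp
    show ?thesis
    proof (cases "d = c")
      case True
      then show ?thesis unfolding s by (cases e) (simp_all add: passes_over_def)
    next
      case False
      then show ?thesis unfolding s by (simp add: uncrossed_def passes_over_def)
    qed
  qed (simp add: uncrossed_def)
  have D: "link_det D no_closing (\<lambda>_. T) = walk_det ?S ?A (uncrossed(?y := Some (T, ?x)))"
    unfolding link_det_def chain_det_def up st w ..
  have p: "passages crossing_changed = passages D" "components crossing_changed = components D"
    by (auto simp: passages_def components_def fun_eq_iff split: option.split)
  have wd: "words crossing_changed s = words D s" for s by (cases s) (simp_all add: p)
  have cd: "closing crossing_changed no_closing s = closing D no_closing s" for s by (cases s) simp_all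
  have "link_det crossing_changed no_closing (\<lambda>_. T) =
    chain_det (heads D) (words D) (closing D no_closing) (uncrossed(?x := Some (inverse T, ?y)))"
    unfolding link_det_def p by (rule chain_det_cong) (simp_all only: wd cd um)
  then have Dm: "link_det crossing_changed no_closing (\<lambda>_. T) = walk_det ?S ?A (uncrossed(?x := Some (inverse T, ?y)))"
    unfolding chain_det_def st w .
  have sub: "K \<subseteq> ?S" by (auto simp: chain_states_def)
  have "walk_det ?S ?A (uncrossed(?y := Some (T, ?x))) - T * walk_det ?S ?A (uncrossed(?x := Some (inverse T, ?y))) =
    (1 - T) * walk_det ?S (\<lambda>j s. ?A j (Transposition.transpose ?x ?y s)) uncrossed"
    by (rule walk_det_skein[OF finite_chain_states[OF sys]]) (use sub xy T in auto)
  then show ?thesis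
    unfolding D Dm t chain_det_def chain_swap_heads(2)[OF sys xy] .
qed

lemma under_smoothed:
  assumes "kinds E = (kinds D)(c := None)" "fst p \<in> dom (kinds E)"
  shows "uncrossed (Inr p) = under E (\<lambda>_. T) (Inr p)"
proof -
  obtain d e where p: "p = (d, e)" by fastforce
  then have "d \<noteq> c" using assms by auto
  then show ?thesis using assms(1) by (simp add: p uncrossed_def passes_over_def)
qed

lemma range_closing: "l \<in> heads D \<Longrightarrow> closing D no_closing l = Some m \<Longrightarrow> m \<in> heads D"
  by (auto split: if_splits)

lemma passages_arc: "arcs D k = Some w \<Longrightarrow> passages D k = w"
  by (simp add: passages_def)


text \<open>
  Cutting the components immediately before both passages of \<open>c\<close> turns the passages
  into heads. The smoothing interchanges their predecessors, which is a change of the closing alone.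
\<close>

lemma link_det_cut:
  fixes b :: bool
  defines "X \<equiv> Inr (c, b) :: state" and "Y \<equiv> Inr (c, \<not> b) :: state"
  assumes k: "k \<in> heads D" "words D k = u @ X # w"
    and l: "l \<in> insert X (heads D)" "((words D)(k := u, X := w)) l = u' @ Y # w'"
    and W: "W = (words D)(k := u, X := w, l := u', Y := w')"
    and cl: "cl = (\<lambda>i. if i = X then Some k else if closing D no_closing i = Some k then Some X else closing D no_closing i)"
    and cl': "cl' = (\<lambda>i. if i = Y then Some l else if cl i = Some l then Some Y else cl i) \<circ> Transposition.transpose X Y"
  defines "K \<equiv> insert Y (insert X (heads D))"
  shows "chain_system K W cl'"
    and "link_det D no_closing (\<lambda>_. T) - T * link_det crossing_changed no_closing (\<lambda>_. T) =
      (1 - T) * chain_det K W cl' uncrossed"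
proof -
  have sys: "chain_system (heads D) (words D) (closing D no_closing)"
    by (rule link_system[OF wf closes_arcs_empty])
  note u1 = chain_unjoin[OF sys k range_closing]
  note u2 = chain_unjoin[OF u1(1) l u1(5)]
  have XY: "X \<in> insert Y (insert X (heads D))" "Y \<in> insert Y (insert X (heads D))" by simp_all
  show "chain_system K W cl'"
    unfolding K_def W cl' cl by (rule chain_swap_heads(1)[OF u2(1) XY])
  show "link_det D no_closing (\<lambda>_. T) - T * link_det crossing_changed no_closing (\<lambda>_. T) =
      (1 - T) * chain_det K W cl' uncrossed"
    unfolding K_def W cl' cl
    by (rule link_det_smoothed_wiring[where b=b, folded X_def Y_def, OF _ _ u2(1) XY]) (simp_all only: u2(2,3) u1(2,3))
qed

lemma link_det_smoothed:
  assumes wfE: "well_formed E" and kE: "kinds E = (kinds D)(c := None)" and sys: "chain_system K W cl"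
    and sub: "K \<subseteq> range Inl \<union> range (\<lambda>b. Inr (c, b))"
    and g: "inj_on g K" "components E = g ` K"
    and W: "\<forall>i\<in>K. W i = map Inr (passages E (g i))"
    and cl: "\<forall>i\<in>K. closing E no_closing (Inl (g i)) = map_option (Inl \<circ> g) (cl i)"
    and ran: "\<forall>i\<in>K. \<forall>l. cl i = Some l \<longrightarrow> l \<in> K"
  shows "chain_det K W cl uncrossed = link_det E no_closing (\<lambda>_. T)"
proof (rule link_det_of_system[OF wfE sys g, symmetric])
  show "uncrossed i = None" if "i \<in> K" for i using that sub by auto
  show "Inr p \<notin> K" if "fst p \<in> dom (kinds E)" for p using that sub kE by auto
qed (use W cl ran under_smoothed[OF kE] in blast)+

lemma image_redirect:
  assumes "k \<in> A"
  shows "case_sum (\<lambda>l. if l = k then y else l) h ` Inl ` A = insert y (A - {k})"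
proof -
  have "(\<lambda>l. if l = k then y else l) ` A = insert y (A - {k})"
  proof (intro equalityI subsetI)
    fix x assume "x \<in> insert y (A - {k})"
    then show "x \<in> (\<lambda>l. if l = k then y else l) ` A"
      using assms by (cases "x = y") (auto intro: image_eqI[of _ _ k] image_eqI[of _ _ x])
  qed auto
  then show ?thesis unfolding image_image sum.case .
qed

text \<open>
  In each case the two heads at \<open>c\<close> and the old base points are merged back into chains
  until exactly the components of the smoothing are left. A merged component keeps one of the old
  heads as base point; where a passage of \<open>c\<close> remains as a head, it serves as the base
  point of a new loop.
\<close>

lemma link_det_smoothing:
  assumes sm: "smoothing c D E" and wfE: "well_formed E"
  shows "link_det D no_closing (\<lambda>_. T) - T * link_det crossing_changed no_closing (\<lambda>_. T) =
    (1 - T) * link_det E no_closing (\<lambda>_. T)"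
  using sm
proof cases
  case (split_arc k u b v w y z)
  let ?k = "Inl k :: state" and ?X = "Inr (c, b) :: state" and ?Y = "Inr (c, \<not> b) :: state"
  have k: "k \<in> dom (arcs D)" "k \<notin> dom (loops D)" "k \<in> components D"
    using split_arc(2) wfD(5)[OF wf] by (auto simp: components_def)
  have yz: "y \<notin> components D - {k}" "z \<notin> components D - {k}" "y \<noteq> z" using split_arc(3,4) by blast+
  have Wk: "words D ?k = map Inr u @ ?X # map Inr (v @ (c, \<not> b) # w)"
    using passages_arc[OF split_arc(2)] by simp
  have kK: "?k \<in> heads D" using k by blast
  have W1: "((words D)(?k := map Inr u, ?X := map Inr (v @ (c, \<not> b) # w))) ?X = map Inr v @ ?Y # map Inr w" by simp
  let ?K = "insert ?Y (insert ?X (heads D))"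
  define W where "W = (words D)(?k := map Inr u, ?X := map Inr (v @ (c, \<not> b) # w), ?X := map Inr v, ?Y := map Inr w)"
  define cl where "cl = (\<lambda>i. if i = ?X then Some ?k else if closing D no_closing i = Some ?k then Some ?X else closing D no_closing i)"
  define C where "C = (\<lambda>i. if i = ?Y then Some ?X else if cl i = Some ?X then Some ?Y else cl i) \<circ> Transposition.transpose ?X ?Y"
  note cut = link_det_cut[OF kK Wk insertI1 W1 W_def cl_def C_def]
  have t: "Transposition.transpose ?X ?Y (Inl l) = Inl l" for l by (simp add: transpose_def)
  have Wv: "W ?k = map Inr u" "W ?X = map Inr v" "W ?Y = map Inr w" "l \<noteq> k \<Longrightarrow> W (Inl l) = map Inr (passages D l)" for l
    by (simp_all add: W_def)
  have Cv: "C ?X = Some ?X" "C ?Y = Some ?k" "C ?k = None"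
    "l \<noteq> k \<Longrightarrow> C (Inl l) = (if l \<in> dom (loops D) then Some (Inl l) else None)" for l
    using k(2) by (simp_all add: C_def cl_def t)
  have ne: "?k \<noteq> ?Y" by simp
  have K: "?K - {?Y} = insert ?X (heads D)" by auto
  note m = chain_det_merge[OF cut(1) insertI2[OF insertI2[OF kK]] insertI1 ne Cv(2) uncrossed_None(2) uncrossed_unreferenced(2), unfolded K]
  let ?g = "case_sum (\<lambda>l. if l = k then y else l) (\<lambda>_. z)"
  have cE: "components E = insert z (insert y (components D - {k}))"
    using k by (auto simp: split_arc(1) components_def)
  have lE: "dom (loops E) = insert z (dom (loops D))" by (simp add: split_arc(1))
  have nA: "l \<notin> components D - {k} \<Longrightarrow> l \<noteq> k \<Longrightarrow> arcs D l = None \<and> loops D l = None" for l by (auto simp: components_def)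
  have pE: "passages E y = u @ w" "passages E z = v" "l \<in> components D \<Longrightarrow> l \<noteq> k \<Longrightarrow> passages E l = passages D l" for l
    using yz nA[of z] by (auto simp: split_arc(1) passages_def split: option.split)
  have yl: "y \<notin> dom (loops D)" using yz(1) k(2) by (auto simp: components_def)
  have fin: "chain_det (insert ?X (heads D)) (W(?k := W ?k @ W ?Y)) (\<lambda>i. if C i = Some ?Y then Some ?k else C i) uncrossed
    = link_det E no_closing (\<lambda>_. T)"
  proof (rule link_det_smoothed[OF wfE _ m(2), where g="?g"])
    show "components E = ?g ` insert ?X (heads D)"
      unfolding cE image_insert sum.case image_redirect[OF k(3)] ..
    show "inj_on ?g (insert ?X (heads D))"
      by (rule inj_onI) (use yz in \<open>auto split: if_splits\<close>)
    show "\<forall>i\<in>insert ?X (heads D). (W(?k := W ?k @ W ?Y)) i = map Inr (passages E (?g i))"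
      by (simp add: Wv pE)
    show "\<forall>i\<in>insert ?X (heads D). closing E no_closing (Inl (?g i)) =
        map_option (Inl \<circ> ?g) (if C i = Some ?Y then Some ?k else C i)"
      using k yz yl by (auto simp: Cv lE)
    show "\<forall>i\<in>insert ?X (heads D). \<forall>l. (if C i = Some ?Y then Some ?k else C i) = Some l \<longrightarrow> l \<in> insert ?X (heads D)"
    proof (intro ballI allI impI)
      fix i j assume i: "i \<in> insert ?X (heads D)" and j: "(if C i = Some ?Y then Some ?k else C i) = Some j"
      show "j \<in> insert ?X (heads D)"
      proof (cases "i = ?X")
        case True
        then show ?thesis using j by (simp add: Cv(1))
      next
        case False
        then obtain l where l: "i = Inl l" "l \<in> components D" using i by blast
        then have "j = Inl l" using j by (cases "l = k") (simp_all add: Cv split: if_splits)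
        then show ?thesis using l by simp
      qed
    qed
  qed (auto simp: split_arc(1))
  show ?thesis unfolding cut(2) m(1)[symmetric] fin ..
next
  case (split_loop k b u v y z)
  let ?k = "Inl k :: state" and ?X = "Inr (c, b) :: state" and ?Y = "Inr (c, \<not> b) :: state"
  have k: "k \<in> dom (loops D)" "k \<notin> dom (arcs D)" "k \<in> components D"
    using split_loop(2) wfD(5)[OF wf] by (auto simp: components_def)
  have yz: "y \<notin> components D - {k}" "z \<notin> components D - {k}" "y \<noteq> z" using split_loop(3,4) by blast+
  have Wk: "words D ?k = [] @ ?X # map Inr (u @ (c, \<not> b) # v)"
    using passages_loop[OF wf split_loop(2)] by simp
  have kK: "?k \<in> heads D" using k by blast
  have W1: "((words D)(?k := [], ?X := map Inr (u @ (c, \<not> b) # v))) ?X = map Inr u @ ?Y # map Inr v" by simp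
  let ?K = "insert ?Y (insert ?X (heads D))"
  define W where "W = (words D)(?k := [], ?X := map Inr (u @ (c, \<not> b) # v), ?X := map Inr u, ?Y := map Inr v)"
  define cl where "cl = (\<lambda>i. if i = ?X then Some ?k else if closing D no_closing i = Some ?k then Some ?X else closing D no_closing i)"
  define C where "C = (\<lambda>i. if i = ?Y then Some ?X else if cl i = Some ?X then Some ?Y else cl i) \<circ> Transposition.transpose ?X ?Y"
  note cut = link_det_cut[OF kK Wk insertI1 W1 W_def cl_def C_def]
  have t: "Transposition.transpose ?X ?Y (Inl l) = Inl l" for l by (simp add: transpose_def)
  have Wv: "W ?k = []" "W ?X = map Inr u" "W ?Y = map Inr v" "l \<noteq> k \<Longrightarrow> W (Inl l) = map Inr (passages D l)" for l
    by (simp_all add: W_def)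
  have Cv: "C ?X = Some ?X" "C ?Y = Some ?k" "C ?k = Some ?Y"
    "l \<noteq> k \<Longrightarrow> C (Inl l) = (if l \<in> dom (loops D) then Some (Inl l) else None)" for l
    using k(1) by (simp_all add: C_def cl_def t)
  have ne: "?k \<noteq> ?Y" by simp
  have K: "?K - {?Y} = insert ?X (heads D)" by auto
  note m = chain_det_merge[OF cut(1) insertI2[OF insertI2[OF kK]] insertI1 ne Cv(2) uncrossed_None(2) uncrossed_unreferenced(2), unfolded K]
  let ?g = "case_sum (\<lambda>l. if l = k then z else l) (\<lambda>_. y)"
  have cE: "components E = insert y (insert z (components D - {k}))"
    using k by (auto simp: split_loop(1) components_def)
  have lE: "dom (loops E) = insert y (insert z (dom (loops D) - {k}))" by (auto simp: split_loop(1))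
  have az: "arcs D y = None" "arcs D z = None" using yz(1,2) k(2) by (auto simp: components_def)
  have pE: "passages E y = u" "passages E z = v" "l \<in> components D \<Longrightarrow> l \<noteq> k \<Longrightarrow> passages E l = passages D l" for l
    using yz az by (auto simp: split_loop(1) passages_def split: option.split)
  have fin: "chain_det (insert ?X (heads D)) (W(?k := W ?k @ W ?Y)) (\<lambda>i. if C i = Some ?Y then Some ?k else C i) uncrossed
    = link_det E no_closing (\<lambda>_. T)"
  proof (rule link_det_smoothed[OF wfE _ m(2), where g="?g"])
    show "components E = ?g ` insert ?X (heads D)"
      unfolding cE image_insert sum.case image_redirect[OF k(3)] ..
    show "inj_on ?g (insert ?X (heads D))"
      by (rule inj_onI) (use yz in \<open>auto split: if_splits\<close>)
    show "\<forall>i\<in>insert ?X (heads D). (W(?k := W ?k @ W ?Y)) i = map Inr (passages E (?g i))"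
      by (simp add: Wv pE)
    show "\<forall>i\<in>insert ?X (heads D). closing E no_closing (Inl (?g i)) =
        map_option (Inl \<circ> ?g) (if C i = Some ?Y then Some ?k else C i)"
      using k yz by (auto simp: Cv lE)
    show "\<forall>i\<in>insert ?X (heads D). \<forall>l. (if C i = Some ?Y then Some ?k else C i) = Some l \<longrightarrow> l \<in> insert ?X (heads D)"
    proof (intro ballI allI impI)
      fix i j assume i: "i \<in> insert ?X (heads D)" and j: "(if C i = Some ?Y then Some ?k else C i) = Some j"
      show "j \<in> insert ?X (heads D)"
      proof (cases "i = ?X")
        case True
        then show ?thesis using j by (simp add: Cv(1))
      next
        case False
        then obtain l where l: "i = Inl l" "l \<in> components D" using i by blast
        then have "j = Inl l" using j by (cases "l = k") (simp_all add: Cv split: if_splits)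
        then show ?thesis using l by simp
      qed
    qed
  qed (auto simp: split_loop(1))
  show ?thesis unfolding cut(2) m(1)[symmetric] fin ..
next
  case (merge_arc k u b v l w z)
  let ?k = "Inl k :: state" and ?l = "Inl l :: state" and ?X = "Inr (c, b) :: state" and ?Y = "Inr (c, \<not> b) :: state"
  have k: "k \<in> dom (arcs D)" "k \<notin> dom (loops D)" "k \<in> components D"
    and l: "l \<in> dom (loops D)" "l \<in> components D"
    using merge_arc(2,3) wfD(5)[OF wf] by (auto simp: components_def)
  have kl: "k \<noteq> l" using k l by blast
  have Wk: "words D ?k = map Inr u @ ?X # map Inr v"
    using passages_arc[OF merge_arc(2)] by simp
  have K: "?k \<in> heads D" "?l \<in> heads D" using k l by blast+
  have W1: "((words D)(?k := map Inr u, ?X := map Inr v)) ?l = [] @ ?Y # map Inr w"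
    using kl passages_loop[OF wf merge_arc(3)] by simp
  define W where "W = (words D)(?k := map Inr u, ?X := map Inr v, ?l := [], ?Y := map Inr w)"
  define cl where "cl = (\<lambda>i. if i = ?X then Some ?k else if closing D no_closing i = Some ?k then Some ?X else closing D no_closing i)"
  define C where "C = (\<lambda>i. if i = ?Y then Some ?l else if cl i = Some ?l then Some ?Y else cl i) \<circ> Transposition.transpose ?X ?Y"
  note cut = link_det_cut[OF K(1) Wk insertI2[OF K(2)] W1 W_def cl_def C_def]
  have t: "Transposition.transpose ?X ?Y (Inl i) = Inl i" for i by (simp add: transpose_def)
  have Wv: "W ?k = map Inr u" "W ?X = map Inr v" "W ?l = []" "W ?Y = map Inr w"
    "i \<noteq> k \<Longrightarrow> i \<noteq> l \<Longrightarrow> W (Inl i) = map Inr (passages D i)" for i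
    using kl by (simp_all add: W_def)
  have Cv: "C ?X = Some ?l" "C ?Y = Some ?k" "C ?k = None" "C ?l = Some ?Y"
    "i \<noteq> k \<Longrightarrow> i \<noteq> l \<Longrightarrow> C (Inl i) = (if i \<in> dom (loops D) then Some (Inl i) else None)" for i
    using k(2) l(1) kl by (simp_all add: C_def cl_def t)
  have ne: "?k \<noteq> ?Y" "?k \<noteq> ?l" "?k \<noteq> ?X" using kl by simp_all
  define C1 where "C1 = (\<lambda>i. if C i = Some ?Y then Some ?k else C i)"
  define C2 where "C2 = (\<lambda>i. if C1 i = Some ?l then Some ?k else C1 i)"
  define C3 where "C3 = (\<lambda>i. if C2 i = Some ?X then Some ?k else C2 i)"
  define W1 where "W1 = W(?k := W ?k @ W ?Y)"
  define W2 where "W2 = W1(?k := W1 ?k @ W1 ?l)"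
  define W3 where "W3 = W2(?k := W2 ?k @ W2 ?X)"
  have Ks: "insert ?Y (insert ?X (heads D)) - {?Y} = insert ?X (heads D)"
    "insert ?X (heads D) - {?l} = insert ?X (Inl ` (components D - {l}))"
    "insert ?X (Inl ` (components D - {l})) - {?X} = Inl ` (components D - {l})" by auto
  have K2: "?k \<in> Inl ` (components D - {l})" using k kl by blast
  have c: "C1 ?l = Some ?k" "C2 ?X = Some ?k" by (simp_all add: C1_def C2_def Cv)
  note m1 = chain_det_merge[OF cut(1) insertI2[OF insertI2[OF K(1)]] insertI1 ne(1) Cv(2)
    uncrossed_None(2) uncrossed_unreferenced(2), unfolded Ks(1), folded C1_def W1_def]
  note m2 = chain_det_merge[OF m1(2) insertI2[OF K(1)] insertI2[OF K(2)] ne(2) c(1)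
    uncrossed_None(1) uncrossed_unreferenced(1), unfolded Ks(2), folded C2_def W2_def]
  note m3 = chain_det_merge[OF m2(2) insertI2[OF K2] insertI1 ne(3) c(2)
    uncrossed_None(2) uncrossed_unreferenced(2), unfolded Ks(3), folded C3_def W3_def]
  have Wf: "W3 ?k = map Inr (u @ w @ v)" "i \<noteq> k \<Longrightarrow> i \<noteq> l \<Longrightarrow> W3 (Inl i) = map Inr (passages D i)" for i
    using kl by (simp_all add: W1_def W2_def W3_def Wv)
  have Cf: "C3 ?k = None" "i \<noteq> k \<Longrightarrow> i \<noteq> l \<Longrightarrow> C3 (Inl i) = (if i \<in> dom (loops D) then Some (Inl i) else None)" for i
    by (simp_all add: C1_def C2_def C3_def Cv)
  let ?g = "case_sum (\<lambda>i. if i = k then z else i) (\<lambda>_. z)"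
  have cE: "components E = insert z (components D - {l} - {k})"
    using k l kl wfD(5)[OF wf] by (auto simp: merge_arc(1) components_def)
  have lE: "dom (loops E) = dom (loops D) - {l}" by (auto simp: merge_arc(1))
  have z: "z \<notin> components D - {k, l}" by (rule merge_arc(4))
  have zl: "z \<notin> dom (loops D) - {l}" using z k by (auto simp: components_def)
  have pE: "passages E z = u @ w @ v" "i \<in> components D \<Longrightarrow> i \<noteq> k \<Longrightarrow> i \<noteq> l \<Longrightarrow> passages E i = passages D i" for i
    using z by (auto simp: merge_arc(1) passages_def split: option.split)
  have fin: "chain_det (Inl ` (components D - {l})) W3 C3 uncrossed = link_det E no_closing (\<lambda>_. T)"
  proof (rule link_det_smoothed[OF wfE _ m3(2), where g="?g"])
    show "components E = ?g ` Inl ` (components D - {l})"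
      unfolding cE by (rule image_redirect[symmetric]) (use kl k in simp)
    show "inj_on ?g (Inl ` (components D - {l}))"
      by (rule inj_onI) (use z in \<open>auto split: if_splits\<close>)
    show "\<forall>i\<in>Inl ` (components D - {l}). W3 i = map Inr (passages E (?g i))"
      by (simp add: Wf pE)
    show "\<forall>i\<in>Inl ` (components D - {l}). closing E no_closing (Inl (?g i)) = map_option (Inl \<circ> ?g) (C3 i)"
      using zl by (auto simp: Cf lE)
    have "C3 (Inl i) \<in> {None, Some (Inl i)}" if "i \<noteq> l" for i
      using that by (cases "i = k") (simp_all add: Cf)
    then show "\<forall>i\<in>Inl ` (components D - {l}). \<forall>j. C3 i = Some j \<longrightarrow> j \<in> Inl ` (components D - {l})"
      by fastforce
  qed (auto simp: merge_arc(1))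
  show ?thesis unfolding cut(2) m1(1)[symmetric] m2(1)[symmetric] m3(1)[symmetric] fin ..
next
  case (merge_loops k b u l v z)
  let ?k = "Inl k :: state" and ?l = "Inl l :: state" and ?X = "Inr (c, b) :: state" and ?Y = "Inr (c, \<not> b) :: state"
  have k: "k \<in> dom (loops D)" "k \<in> components D"
    and l: "l \<in> dom (loops D)" "l \<in> components D"
    using merge_loops(2,3) wfD(5)[OF wf] by (auto simp: components_def)
  have kl: "k \<noteq> l" by (rule merge_loops(4))
  have na: "k \<notin> dom (arcs D)" "l \<notin> dom (arcs D)" using k l wfD(5)[OF wf] by blast+
  have Wk: "words D ?k = [] @ ?X # map Inr u"
    using passages_loop[OF wf merge_loops(2)] by simp
  have K: "?k \<in> heads D" "?l \<in> heads D" using k l by blast+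
  have W1: "((words D)(?k := [], ?X := map Inr u)) ?l = [] @ ?Y # map Inr v"
    using kl passages_loop[OF wf merge_loops(3)] by simp
  define W where "W = (words D)(?k := [], ?X := map Inr u, ?l := [], ?Y := map Inr v)"
  define cl where "cl = (\<lambda>i. if i = ?X then Some ?k else if closing D no_closing i = Some ?k then Some ?X else closing D no_closing i)"
  define C where "C = (\<lambda>i. if i = ?Y then Some ?l else if cl i = Some ?l then Some ?Y else cl i) \<circ> Transposition.transpose ?X ?Y"
  note cut = link_det_cut[OF K(1) Wk insertI2[OF K(2)] W1 W_def cl_def C_def]
  have t: "Transposition.transpose ?X ?Y (Inl i) = Inl i" for i by (simp add: transpose_def)
  have Wv: "W ?k = []" "W ?X = map Inr u" "W ?l = []" "W ?Y = map Inr v"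
    "i \<noteq> k \<Longrightarrow> i \<noteq> l \<Longrightarrow> W (Inl i) = map Inr (passages D i)" for i
    using kl by (simp_all add: W_def)
  have Cv: "C ?X = Some ?l" "C ?Y = Some ?k" "C ?k = Some ?X" "C ?l = Some ?Y"
    "i \<noteq> k \<Longrightarrow> i \<noteq> l \<Longrightarrow> C (Inl i) = (if i \<in> dom (loops D) then Some (Inl i) else None)" for i
    using k(1) l(1) kl by (simp_all add: C_def cl_def t)
  have ne: "?k \<noteq> ?Y" "?l \<noteq> ?X" "?l \<noteq> ?k" using kl by simp_all
  define C1 where "C1 = (\<lambda>i. if C i = Some ?Y then Some ?k else C i)"
  define C2 where "C2 = (\<lambda>i. if C1 i = Some ?X then Some ?l else C1 i)"
  define C3 where "C3 = (\<lambda>i. if C2 i = Some ?k then Some ?l else C2 i)"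
  define W1 where "W1 = W(?k := W ?k @ W ?Y)"
  define W2 where "W2 = W1(?l := W1 ?l @ W1 ?X)"
  define W3 where "W3 = W2(?l := W2 ?l @ W2 ?k)"
  have Ks: "insert ?Y (insert ?X (heads D)) - {?Y} = insert ?X (heads D)"
    "insert ?X (heads D) - {?X} = heads D" "heads D - {?k} = Inl ` (components D - {k})" by auto
  have c: "C1 ?X = Some ?l" "C2 ?k = Some ?l" using kl by (simp_all add: C1_def C2_def Cv)
  note m1 = chain_det_merge[OF cut(1) insertI2[OF insertI2[OF K(1)]] insertI1 ne(1) Cv(2)
    uncrossed_None(2) uncrossed_unreferenced(2), unfolded Ks(1), folded C1_def W1_def]
  note m2 = chain_det_merge[OF m1(2) insertI2[OF K(2)] insertI1 ne(2) c(1)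
    uncrossed_None(2) uncrossed_unreferenced(2), unfolded Ks(2), folded C2_def W2_def]
  note m3 = chain_det_merge[OF m2(2) K(2) K(1) ne(3) c(2)
    uncrossed_None(1) uncrossed_unreferenced(1), unfolded Ks(3), folded C3_def W3_def]
  have Wf: "W3 ?l = map Inr (u @ v)" "i \<noteq> k \<Longrightarrow> i \<noteq> l \<Longrightarrow> W3 (Inl i) = map Inr (passages D i)" for i
    using kl by (simp_all add: W1_def W2_def W3_def Wv)
  have Cf: "C3 ?l = Some ?l" "i \<noteq> k \<Longrightarrow> i \<noteq> l \<Longrightarrow> C3 (Inl i) = (if i \<in> dom (loops D) then Some (Inl i) else None)" for i
    using kl by (simp_all add: C1_def C2_def C3_def Cv)
  let ?g = "case_sum (\<lambda>i. if i = l then z else i) (\<lambda>_. z)"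
  have cE: "components E = insert z (components D - {k} - {l})"
    using k l kl wfD(5)[OF wf] by (auto simp: merge_loops(1) components_def)
  have lE: "dom (loops E) = insert z (dom (loops D) - {k, l})" by (auto simp: merge_loops(1))
  have z: "z \<notin> components D - {k, l}" by (rule merge_loops(5))
  have za: "arcs D z = None" using z na by (auto simp: components_def)
  have pE: "passages E z = u @ v" "i \<in> components D \<Longrightarrow> i \<noteq> k \<Longrightarrow> i \<noteq> l \<Longrightarrow> passages E i = passages D i" for i
    using z za by (auto simp: merge_loops(1) passages_def split: option.split)
  have fin: "chain_det (Inl ` (components D - {k})) W3 C3 uncrossed = link_det E no_closing (\<lambda>_. T)"
  proof (rule link_det_smoothed[OF wfE _ m3(2), where g="?g"])
    show "components E = ?g ` Inl ` (components D - {k})"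
      unfolding cE by (rule image_redirect[symmetric]) (use kl l in simp)
    show "inj_on ?g (Inl ` (components D - {k}))"
      by (rule inj_onI) (use z in \<open>auto split: if_splits\<close>)
    show "\<forall>i\<in>Inl ` (components D - {k}). W3 i = map Inr (passages E (?g i))"
      by (simp add: Wf pE)
    show "\<forall>i\<in>Inl ` (components D - {k}). closing E no_closing (Inl (?g i)) = map_option (Inl \<circ> ?g) (C3 i)"
      using z by (auto simp: Cf lE)
    have "C3 (Inl i) \<in> {None, Some (Inl i)}" if "i \<noteq> k" for i
      using that by (cases "i = l") (simp_all add: Cf)
    then show "\<forall>i\<in>Inl ` (components D - {k}). \<forall>j. C3 i = Some j \<longrightarrow> j \<in> Inl ` (components D - {k})"
      by fastforce
  qed (auto simp: merge_loops(1))
  show ?thesis unfolding cut(2) m1(1)[symmetric] m2(1)[symmetric] m3(1)[symmetric] fin ..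
qed

end

lemma smoothing_kinds: "smoothing c D E \<Longrightarrow> kinds E = (kinds D)(c := None)"
  by (cases rule: smoothing.cases) auto

lemma diagram_writhe_crossing:
  assumes "finite (dom (kinds D))" "kinds D c = Some s" "kinds E = (kinds D)(c := None)"
  shows "diagram_writhe D = diagram_writhe E + crossing_sign s"
proof -
  have "diagram_writhe D = crossing_sign s + (\<Sum>d\<in>dom (kinds D) - {c}. crossing_sign (the (kinds D d)))"
    unfolding diagram_writhe_def using assms(1,2) by (subst sum.remove[of _ c]) auto
  moreover have "dom (kinds E) = dom (kinds D) - {c}" using assms(3) by auto
  then have "diagram_writhe E = (\<Sum>d\<in>dom (kinds D) - {c}. crossing_sign (the (kinds D d)))"
    unfolding diagram_writhe_def using assms(3) by simp
  ultimately show ?thesis by simp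
qed

theorem mainTheorem6:
  assumes "L\<^sub>p \<in> long_w_links" and "L\<^sub>m \<in> long_w_links" and "L\<^sub>0 \<in> long_w_links"
    and "D\<^sub>p \<in> L\<^sub>p" and "D\<^sub>m \<in> L\<^sub>m" and "D\<^sub>0 \<in> L\<^sub>0"
    and "skein_triple c D\<^sub>p D\<^sub>m D\<^sub>0"
  shows "Delta L\<^sub>p - Delta L\<^sub>m = (sqrt_t powi (-1) - sqrt_t) * Delta L\<^sub>0"
proof -
  have c: "kinds D\<^sub>p c = Some Positive" "D\<^sub>m = D\<^sub>p\<lparr>kinds := (kinds D\<^sub>p)(c \<mapsto> Negative)\<rparr>" "smoothing c D\<^sub>p D\<^sub>0"
    using assms(7) by (simp_all add: skein_triple_def)
  have w: "well_formed D\<^sub>p" "well_formed D\<^sub>m" "well_formed D\<^sub>0"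
    using long_w_linkD(1)[OF assms(1,4)] long_w_linkD(1)[OF assms(2,5)] long_w_linkD(1)[OF assms(3,6)]
    by (simp_all add: diagrams_def)
  define s where "s = sqrt_t"
  have s: "s \<noteq> 0" unfolding s_def by (rule sqrt_t_nonzero)
  define n where "n = diagram_writhe D\<^sub>0"
  define P M Z where "P = link_det D\<^sub>p no_closing (\<lambda>_. s ^ 2)"
    and "M = link_det D\<^sub>m no_closing (\<lambda>_. s ^ 2)" and "Z = link_det D\<^sub>0 no_closing (\<lambda>_. s ^ 2)"
  interpret positive_crossing D\<^sub>p c "s ^ 2"
    by unfold_locales (use w(1) c(1) s in simp_all)
  have "P - s ^ 2 * M = (1 - s ^ 2) * Z"
    using link_det_smoothing[OF c(3) w(3)] unfolding P_def M_def Z_def c(2) .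
  then have P: "P = (1 - s ^ 2) * Z + s ^ 2 * M" by (simp add: algebra_simps)
  have k: "kinds D\<^sub>0 = (kinds D\<^sub>p)(c := None)" by (rule smoothing_kinds[OF c(3)])
  have km: "kinds D\<^sub>m c = Some Negative" "kinds D\<^sub>0 = (kinds D\<^sub>m)(c := None)" by (simp_all add: c(2) k)
  have np: "diagram_writhe D\<^sub>p = n + 1" and nm: "diagram_writhe D\<^sub>m = n - 1"
    using diagram_writhe_crossing[OF wfD(2)[OF w(1)] c(1) k] diagram_writhe_crossing[OF wfD(2)[OF w(2)] km]
    by (simp_all add: n_def crossing_sign_def)
  have "s powi (- (n + 1)) = s powi (- n) * inverse s" "s powi (- (n - 1)) = s powi (- n) * s"
    using power_int_add[of s "- n" "- 1"] power_int_add[of s "- n" 1] s by (simp_all add: power_int_minus)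
  moreover have "s powi (- n) * inverse s * P - s powi (- n) * s * M = (inverse s - s) * (s powi (- n) * Z)"
    unfolding P using s by (simp add: field_simps power2_eq_square)
  ultimately show ?thesis
    unfolding Delta_eq[OF assms(1,4)] Delta_eq[OF assms(2,5)] Delta_eq[OF assms(3,6)]
    by (simp add: np nm n_def[symmetric] s_def[symmetric] P_def[symmetric] M_def[symmetric] Z_def[symmetric] power_int_minus)
qed

end
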